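(* Consider the equation $$\varphi_{tt}-\mu\varphi_{xx}=\Big(\tfrac12\mathbb H[\phi^2]_{xx}+\phi\,\varphi_{xx}\Big)_x,\qquad \phi=\mathbb H[\varphi],\qquad (\ast)$$ for a real-valued unknown $\varphi=\varphi(t,x)$, $x\in\mathbb T$, with initial conditions $\varphi|_{t=0}=\varphi^{(0)}$, $\partial_t\varphi|_{t=0}=\varphi^{(1)}$. (1) For given $0<\delta<\mu$ there exist $0<R_0\le 1$ and positive constants $C_1,C_2$ such that for all real-valued $\varphi^{(0)}\in H^3(\mathbb T)$, $\varphi^{(1)}\in H^2(\mathbb T)$ with zero spatial mean satisfying $$\|\varphi^{(0)}_x\|_{H^2(\mathbb T)}^2+\|\varphi^{(1)}\|_{H^2(\mathbb T)}^2<R_0^2,\qquad(\ast\ast)$$ and for $$T_0:=C_1\Big\{\|\varphi^{(0)}_x\|^2_{H^2(\mathbb T)}+\|\varphi^{(1)}\|^2_{H^2(\mathbb T)}\Big\}^{-1/2},$$ there exists a unique solution $\varphi\in C([0,T_0);H^3(\mathbb T))\cap C^1([0,T_0);H^2(\mathbb T))$ of the Cauchy problem for $(\ast)$ with initial data $\varphi^{(0)},\varphi^{(1)}$, with zero spatial mean, satisfying $$\mu-2\mathbb H[\varphi]_x\ge\delta\quad\text{on }[0,T_0)\times\mathbb T$$ and the energy estimate $$\|\varphi(t)\|_{H^3(\mathbb T)}^2+\|\varphi_t(t)\|_{H^2(\mathbb T)}^2\le C_2\Big\{\|\varphi^{(0)}\|_{H^3(\mathbb T)}^2+\|\varphi^{(1)}\|_{H^2(\mathbb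 T)}^2\Big\},\qquad\forall\,t\in[0,T_0).$$ (2) If, for an arbitrary real $s\ge 3$, the initial data satisfy $\varphi^{(0)}\in H^s(\mathbb T)$, $\varphi^{(1)}\in H^{s-1}(\mathbb T)$ (real-valued, with zero spatial mean) and $(\ast\ast)$ (with the lower norm $H^2$ and the same $R_0$), then the corresponding solution $\varphi$ of part (1) belongs to $C([0,T_0);H^s(\mathbb T))\cap C^1([0,T_0);H^{s-1}(\mathbb T))$ and satisfies $$\|\varphi(t)\|_{H^s(\mathbb T)}^2+\|\varphi_t(t)\|_{H^{s-1}(\mathbb T)}^2\le C_s\Big\{\|\varphi^{(0)}\|_{H^s(\mathbb T)}^2+\|\varphi^{(1)}\|_{H^{s-1}(\mathbb T)}^2\Big\},\qquad\forall\,t\in[0,T_0),$$ with a suitable constant $C_s>0$ depending only on $\delta,\mu,s$.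
   Context: $\mathbb T=\mathbb R/(2\pi\mathbb Z)$. Fourier coefficients: $\widehat f(k)=\frac1{2\pi}\int_{\mathbb T}f(x)e^{-ikx}dx$, $k\in\mathbb Z$. For $s\in\mathbb R$, $H^s(\mathbb T)$ is the Sobolev space of periodic functions (distributions) with norm $\|f\|_{H^s(\mathbb T)}^2=2\pi\sum_{k\in\mathbb Z}\langle k\rangle^{2s}|\widehat f(k)|^2$, where $\langle k\rangle=(1+|k|^2)^{1/2}$. The discrete Hilbert transform $\mathbb H$ is defined by $\widehat{\mathbb H[f]}(k)=-i\,\mathrm{sgn}(k)\,\widehat f(k)$, with $\mathrm{sgn}(0)=0$. Zero spatial mean of a function $\varphi(t,x)$ means $\int_{\mathbb T}\varphi(t,x)\,dx=0$ for every $t$. Subscripts $t,x$ denote partial derivatives. The equation $(\ast)$ is understood in the sense of distributions. If the initial data both vanish, $T_0$ is read as $+\infty$. *)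

theory Defs
  imports "HOL-Analysis.Analysis"
begin

definition fourier_coeff :: "(real \<Rightarrow> real) \<Rightarrow> int \<Rightarrow> complex" where
  "fourier_coeff f k =
     (LINT x:{0..2*pi}|lborel. complex_of_real (f x) * exp (- (\<i> * of_int k * of_real x))) / (2 * pi)"

definition japanese :: "int \<Rightarrow> real" where
  "japanese k = sqrt (1 + (real_of_int k)\<^sup>2)"

text \<open>
  Functions on the circle are \<open>2\<pi>\<close>-periodic functions on the line. For \<open>s > 1/2\<close> every class in
  \<open>H\<^sup>s\<close> has exactly one continuous representative, and \<open>sobolev s\<close> is the set of the real-valued
  ones. It is the Sobolev space for \<open>s > 1/2\<close> only; only \<open>s \<ge> 2\<close> is used below.
  In this range equality in \<open>H\<^sup>s\<close> is equality of functions, and spatial derivatives of order less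
  than \<open>s - 1/2\<close> are classical ones.
\<close>

definition sobolev :: "real \<Rightarrow> (real \<Rightarrow> real) set" where
  "sobolev s = {f. (\<forall>x. f (x + 2 * pi) = f x) \<and> continuous_on UNIV f \<and>
     (\<lambda>k. japanese k powr (2 * s) * (cmod (fourier_coeff f k))\<^sup>2) summable_on UNIV}"

definition sobolev_norm :: "real \<Rightarrow> (real \<Rightarrow> real) \<Rightarrow> real" where
  "sobolev_norm s f =
     sqrt (2 * pi * (\<Sum>\<^sub>\<infinity>k. japanese k powr (2 * s) * (cmod (fourier_coeff f k))\<^sup>2))"

definition zero_mean :: "(real \<Rightarrow> real) \<Rightarrow> bool" where
  "zero_mean f \<longleftrightarrow> (LINT x:{0..2*pi}|lborel. f x) = 0"

text \<open>
  The Hilbert transform is given by its Fourier series, which converges absolutely on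
  \<open>sobolev s\<close> for \<open>s > 1/2\<close>. The function \<open>f\<close> is real, so the series is real, too, and taking
  the real part only changes the type; see \<open>fourier_coeff_hilbert\<close> below.
\<close>

definition hilbert :: "(real \<Rightarrow> real) \<Rightarrow> real \<Rightarrow> real" where
  "hilbert f x =
     Re (\<Sum>\<^sub>\<infinity>k. (- \<i> * of_int (sgn k)) * fourier_coeff f k * exp (\<i> * of_int k * of_real x))"

lemma japanese_pos: "japanese k > 0"
  by (simp add: japanese_def add_pos_nonneg)

lemma summable_on_int_iff:
  fixes f :: "int \<Rightarrow> real"
  assumes "(\<lambda>n. f (int n)) summable_on UNIV" "(\<lambda>n. f (- int n)) summable_on UNIV"
  shows "f summable_on UNIV"
proof -
  have 1: "f summable_on range int"
    using assms(1) by (subst summable_on_reindex) (auto simp: o_def)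
  have 2: "f summable_on range (\<lambda>n. - int n)"
    using assms(2) by (subst summable_on_reindex) (auto simp: o_def inj_def)
  have "range int \<union> range (\<lambda>n. - int n) = UNIV"
    by (auto intro: int_cases2)
  moreover have "f summable_on (range int \<union> (range (\<lambda>n. - int n) - range int))"
    by (intro summable_on_Un_disjoint 1 summable_on_subset_banach[OF 2]) auto
  ultimately show ?thesis by (metis Un_Diff_cancel)
qed

lemma japanese_summable:
  assumes "s > 1/2"
  shows "(\<lambda>k. japanese k powr (- 2 * s)) summable_on UNIV"
proof -
  have "summable (\<lambda>n. real n powr (- 2 * s))"
    using assms by (subst summable_real_powr_iff) auto
  hence "summable (\<lambda>n. japanese (int n) powr (- 2 * s))"
  proof (rule summable_comparison_test[rotated], intro exI allI impI)
    fix n :: nat assume "n \<ge> 1"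
    hence "japanese (int n) \<ge> real n" "real n > 0"
      by (auto simp: japanese_def intro!: real_le_rsqrt)
    thus "norm (japanese (int n) powr (- 2 * s)) \<le> real n powr (- 2 * s)"
      using assms by (simp add: powr_mono2')
  qed
  hence *: "(\<lambda>n. japanese (int n) powr (- 2 * s)) summable_on UNIV"
    by (intro norm_summable_imp_summable_on) auto
  show ?thesis
    by (rule summable_on_int_iff) (use * in \<open>auto simp: japanese_def\<close>)
qed

lemma fourier_coeff_abs_summable:
  assumes "f \<in> sobolev s" "s > 1/2"
  shows "(\<lambda>k. norm (fourier_coeff f k)) summable_on UNIV"
proof -
  let ?g = "\<lambda>k. japanese k powr (2 * s) * (cmod (fourier_coeff f k))\<^sup>2 + japanese k powr (- 2 * s)"
  have g: "?g summable_on UNIV"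
    using assms by (intro summable_on_add japanese_summable) (auto simp: sobolev_def)
  have "norm (norm (fourier_coeff f k)) \<le> ?g k" for k
  proof -
    define a where "a = japanese k powr s"
    have a: "a > 0" "japanese k powr (2 * s) = a\<^sup>2" "japanese k powr (- 2 * s) = (1 / a)\<^sup>2"
      using japanese_pos[of k]
      by (auto simp: a_def powr_minus power2_eq_square divide_simps simp flip: powr_add)
    have "2 * ((a * cmod (fourier_coeff f k)) * (1 / a)) \<le> (a * cmod (fourier_coeff f k))\<^sup>2 + (1 / a)\<^sup>2"
      using sum_squares_bound[of "a * cmod (fourier_coeff f k)" "1 / a"] by (simp only: mult.assoc)
    moreover have "(a * cmod (fourier_coeff f k)) * (1 / a) = cmod (fourier_coeff f k)"
      using a by simp
    ultimately have "2 * cmod (fourier_coeff f k) \<le> ?g k"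
      unfolding a(2,3) power_mult_distrib by metis
    thus ?thesis using norm_ge_zero[of "fourier_coeff f k"]
      unfolding real_norm_def abs_norm_cancel by linarith
  qed
  thus ?thesis
    by (intro summable_on_comparison_test[OF g]) auto
qed

lemma integral_exp_int:
  "(LINT x:{0..2*pi}|lborel. exp (\<i> * of_int k * of_real x)) = (if k = 0 then 2 * pi else 0)"
proof (cases "k = 0")
  case True
  have "(LINT x:{0..2*pi}|lborel. (1::complex)) = 2 * pi"
    by (simp add: set_lebesgue_integral_def scaleR_conv_of_real)
  with True show ?thesis by simp
next
  case False
  let ?F = "\<lambda>x. exp (\<i> * of_int k * of_real x) / (\<i> * of_int k)"
  have "(\<integral>x. indicator {0..2*pi} x *\<^sub>R exp (\<i> * of_int k * complex_of_real x) \<partial>lborel) = ?F (2*pi) - ?F 0"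
    by (rule integral_FTC_Icc)
       (use False in \<open>auto intro!: derivative_eq_intros continuous_intros has_vector_derivative_real_field\<close>)
  also have "exp (\<i> * of_int k * of_real (2*pi)) = 1"
    by (simp add: exp_eq_1 mult_ac)
  finally show ?thesis using False by (simp add: set_lebesgue_integral_def)
qed

lemma cnj_fourier_coeff: "cnj (fourier_coeff f k) = fourier_coeff f (- k)"
proof -
  let ?h = "\<lambda>x. indicator {0..2*pi} x *\<^sub>R (complex_of_real (f x) * exp (- (\<i> * of_int k * of_real x)))"
  have "cnj (\<integral>x. ?h x \<partial>lborel) = (\<integral>x. cnj (?h x) \<partial>lborel)"
    by (rule Bochner_Integration.integral_cnj[symmetric])
  also have "(\<lambda>x. cnj (?h x)) =
      (\<lambda>x. indicator {0..2*pi} x *\<^sub>R (complex_of_real (f x) * exp (- (\<i> * of_int (- k) * of_real x))))"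
    by (simp add: exp_cnj scaleR_conv_of_real)
  finally show ?thesis
    by (simp add: fourier_coeff_def set_lebesgue_integral_def)
qed

lemma fourier_coeff_hilbert:
  assumes "f \<in> sobolev s" "s > 1/2"
  shows "fourier_coeff (hilbert f) k = - \<i> * of_int (sgn k) * fourier_coeff f k"
proof -
  define a where "a j = (- \<i> * of_int (sgn j)) * fourier_coeff f j" for j
  define e where "e j x = exp (\<i> * of_int j * complex_of_real x)" for j x
  have e: "norm (e j x) = 1" for j x by (simp add: e_def norm_exp_eq_Re)
  have ee: "e j x * exp (- (\<i> * of_int k * complex_of_real x)) = e (j - k) x" for j x
    by (simp add: e_def algebra_simps flip: exp_add)
  have "norm (a j) \<le> norm (fourier_coeff f j)" for j
    by (auto simp: a_def norm_mult sgn_if)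
  hence na: "(\<lambda>j. norm (a j)) summable_on UNIV"
    by (intro summable_on_comparison_test[OF fourier_coeff_abs_summable[OF assms]]) auto
  have ae: "(\<lambda>j. norm (a j * e j x)) summable_on UNIV" for x
    using na by (simp add: norm_mult e)
  have real: "complex_of_real (hilbert f x) = (\<Sum>\<^sub>\<infinity>j. a j * e j x)" for x
  proof -
    have "cnj (\<Sum>\<^sub>\<infinity>j. a j * e j x) = (\<Sum>\<^sub>\<infinity>j. cnj (a j * e j x))"
      by (simp only: infsum_cnj)
    also have "\<dots> = (\<Sum>\<^sub>\<infinity>j. a (- j) * e (- j) x)"
      by (intro infsum_cong) (simp add: a_def e_def cnj_fourier_coeff exp_cnj sgn_if)
    also have "\<dots> = (\<Sum>\<^sub>\<infinity>j. a j * e j x)"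
      by (rule infsum_reindex_bij_betw[of uminus UNIV UNIV "\<lambda>j. a j * e j x"]) (rule bij_uminus)
    finally show ?thesis
      by (simp add: hilbert_def a_def e_def complex_eq_iff)
  qed
  define b where "b = int_decode"
  have b: "bij_betw b UNIV UNIV" by (simp add: b_def bij_int_decode)
  have nab: "summable (\<lambda>n. norm (a (b n)))"
    using na summable_on_reindex_bij_betw[OF b, of "\<lambda>j. norm (a j)"]
    by (auto intro: summable_on_imp_summable)
  have ser: "complex_of_real (hilbert f x) = (\<Sum>n. a (b n) * e (b n) x)" for x
  proof -
    have "(\<lambda>n. a (b n) * e (b n) x) summable_on UNIV"
      using ae[of x] summable_on_reindex_bij_betw[OF b, of "\<lambda>j. a j * e j x"]
      by (auto intro: abs_summable_summable)
    hence "(\<lambda>n. a (b n) * e (b n) x) sums (\<Sum>\<^sub>\<infinity>n. a (b n) * e (b n) x)"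
      by (intro has_sum_imp_sums has_sum_infsum)
    thus ?thesis
      using infsum_reindex_bij_betw[OF b, of "\<lambda>j. a j * e j x"] by (simp add: real sums_iff)
  qed
  define g where "g n x = indicator {0..2*pi} x *\<^sub>R (a (b n) * e (b n - k) x)" for n x
  have sg: "summable (\<lambda>n. norm (g n x))" for x
    unfolding g_def by (intro summable_comparison_test'[OF nab, of 0]) (auto simp: norm_mult e indicator_def)
  have cont: "continuous_on A (e j)" for A j
    unfolding e_def by (intro continuous_intros)
  have ig: "integrable lborel (g n)" for n
    unfolding g_def using borel_integrable_compact[of "{0..2*pi}" "\<lambda>x. a (b n) * e (b n - k) x"]
    by (simp add: indicator_scaleR_eq_if continuous_on_mult cont)
  have ng: "(\<integral>x. norm (g n x) \<partial>lborel) = 2 * pi * norm (a (b n))" for n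
  proof -
    have "(\<integral>x. norm (g n x) \<partial>lborel) = (\<integral>x. indicator {0..2*pi} x *\<^sub>R norm (a (b n)) \<partial>lborel)"
      by (intro Bochner_Integration.integral_cong) (auto simp: g_def norm_mult e)
    thus ?thesis by simp
  qed
  have int_g: "(\<integral>x. g n x \<partial>lborel) = (if b n = k then 2 * pi * a k else 0)" for n
    using integral_exp_int[of "b n - k"]
    by (auto simp: g_def set_lebesgue_integral_def e_def scaleR_conv_of_real mult.left_commute)
  have "(LINT x:{0..2*pi}|lborel. complex_of_real (hilbert f x) * exp (- (\<i> * of_int k * of_real x)))
      = (\<integral>x. (\<Sum>n. g n x) \<partial>lborel)"
    unfolding set_lebesgue_integral_def
  proof (intro Bochner_Integration.integral_cong refl)
    fix x
    have "summable (\<lambda>n. a (b n) * e (b n) x)"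
      by (rule summable_norm_cancel) (use nab in \<open>simp add: norm_mult e\<close>)
    hence "(\<Sum>n. a (b n) * e (b n) x) * exp (- (\<i> * of_int k * of_real x)) = (\<Sum>n. a (b n) * e (b n - k) x)"
      by (simp only: suminf_mult2 ee mult.assoc[of "a _"])
    thus "indicat_real {0..2*pi} x *\<^sub>R (complex_of_real (hilbert f x) * exp (- (\<i> * of_int k * of_real x)))
        = (\<Sum>n. g n x)"
      by (auto simp: g_def ser indicator_def)
  qed
  also have "\<dots> = (\<Sum>n. \<integral>x. g n x \<partial>lborel)"
    by (rule integral_suminf) (use ig sg nab ng in \<open>auto intro: summable_mult\<close>)
  also have "\<dots> = (\<Sum>n. if n = int_encode k then 2 * pi * a k else 0)"
    by (intro arg_cong[where f = suminf] ext) (auto simp: int_g b_def)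
  also have "\<dots> = 2 * pi * a k"
    using sums_single[of "int_encode k" "\<lambda>_. 2 * pi * a k"] by (simp add: sums_iff)
  finally show ?thesis
    by (simp add: fourier_coeff_def a_def)
qed

text \<open>
  Below, \<open>I\<close> is the time interval \<open>[0, T\<^sub>0)\<close>. The time derivative is taken within \<open>I\<close>, hence it is
  one-sided at \<open>0\<close>, and the values of \<open>u\<close> outside \<open>I\<close> are irrelevant.
\<close>

definition time_deriv :: "real set \<Rightarrow> (real \<Rightarrow> real \<Rightarrow> real) \<Rightarrow> real \<Rightarrow> real \<Rightarrow> real" where
  "time_deriv I u t x = vector_derivative (\<lambda>\<tau>. u \<tau> x) (at t within I)"

definition C0_sobolev :: "real set \<Rightarrow> real \<Rightarrow> (real \<Rightarrow> real \<Rightarrow> real) set" where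
  "C0_sobolev I s = {u. \<forall>t\<in>I. u t \<in> sobolev s \<and>
     ((\<lambda>\<tau>. sobolev_norm s (\<lambda>x. u \<tau> x - u t x)) \<longlongrightarrow> 0) (at t within I)}"

text \<open>
  The difference quotients converge in \<open>H\<^sup>s\<close>. As \<open>s > 1/2\<close>, they then converge pointwise, so the
  limit can only be the pointwise time derivative.
\<close>

definition C1_sobolev :: "real set \<Rightarrow> real \<Rightarrow> (real \<Rightarrow> real \<Rightarrow> real) set" where
  "C1_sobolev I s = {u. u \<in> C0_sobolev I s \<and> time_deriv I u \<in> C0_sobolev I s \<and>
     (\<forall>t\<in>I. ((\<lambda>\<tau>. sobolev_norm s (\<lambda>x. (u \<tau> x - u t x) / (\<tau> - t) - time_deriv I u t x)) \<longlongrightarrow> 0)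
        (at t within I))}"

definition partial_t :: "(real \<Rightarrow> real \<Rightarrow> real) \<Rightarrow> real \<Rightarrow> real \<Rightarrow> real" where
  "partial_t \<eta> t x = deriv (\<lambda>\<tau>. \<eta> \<tau> x) t"

definition partial_x :: "(real \<Rightarrow> real \<Rightarrow> real) \<Rightarrow> real \<Rightarrow> real \<Rightarrow> real" where
  "partial_x \<eta> t x = deriv (\<eta> t) x"

definition smooth2 :: "(real \<Rightarrow> real \<Rightarrow> real) \<Rightarrow> bool" where
  "smooth2 \<eta> \<longleftrightarrow> (\<forall>i j. let \<theta> = (partial_t ^^ i) ((partial_x ^^ j) \<eta>) in
     continuous_on UNIV (\<lambda>(t, x). \<theta> t x) \<and>
     (\<forall>t x. (\<lambda>\<tau>. \<theta> \<tau> x) differentiable (at t) \<and> \<theta> t differentiable (at x)))"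

definition test_function :: "real set \<Rightarrow> (real \<Rightarrow> real \<Rightarrow> real) \<Rightarrow> bool" where
  "test_function I \<eta> \<longleftrightarrow> smooth2 \<eta> \<and> (\<forall>t x. \<eta> t (x + 2 * pi) = \<eta> t x) \<and>
     (\<exists>a b. 0 < a \<and> {a..b} \<subseteq> I \<and> (\<forall>t x. t \<notin> {a..b} \<longrightarrow> \<eta> t x = 0))"

definition flux :: "(real \<Rightarrow> real) \<Rightarrow> real \<Rightarrow> real" where
  "flux f x = 1/2 * deriv (deriv (hilbert (\<lambda>y. (hilbert f y)\<^sup>2))) x + hilbert f x * deriv (deriv f) x"

text \<open>
  \<open>\<phi>\<^sub>t\<^sub>t - \<mu> \<phi>\<^sub>x\<^sub>x = (flux \<phi>)\<^sub>x\<close> in the sense of distributions on \<open>(0, T\<^sub>0) \<times> \<T>\<close>.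
  For \<open>u\<close> in \<open>C(I; H\<^sup>3)\<close> the flux is continuous in \<open>(t, x)\<close>, so the integrand is continuous with
  compact support in time.
\<close>

definition distributional_solution :: "real \<Rightarrow> real set \<Rightarrow> (real \<Rightarrow> real \<Rightarrow> real) \<Rightarrow> bool" where
  "distributional_solution \<mu> I u \<longleftrightarrow> (\<forall>\<eta>. test_function I \<eta> \<longrightarrow>
     (LINT (t, x):I \<times> {0..2*pi}|lborel.
        u t x * partial_t (partial_t \<eta>) t x - \<mu> * u t x * partial_x (partial_x \<eta>) t x
        + flux (u t) x * partial_x \<eta> t x) = 0)"

definition cauchy_solution ::
  "real \<Rightarrow> real set \<Rightarrow> (real \<Rightarrow> real) \<Rightarrow> (real \<Rightarrow> real) \<Rightarrow> (real \<Rightarrow> real \<Rightarrow> real) \<Rightarrow> bool" where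
  "cauchy_solution \<mu> I u0 u1 u \<longleftrightarrow>
     u \<in> C0_sobolev I 3 \<and> u \<in> C1_sobolev I 2 \<and>
     distributional_solution \<mu> I u \<and> u 0 = u0 \<and> time_deriv I u 0 = u1 \<and>
     (\<forall>t\<in>I. zero_mean (u t))"

definition data_size :: "(real \<Rightarrow> real) \<Rightarrow> (real \<Rightarrow> real) \<Rightarrow> real" where
  "data_size u0 u1 = (sobolev_norm 2 (deriv u0))\<^sup>2 + (sobolev_norm 2 u1)\<^sup>2"

definition lifespan :: "real \<Rightarrow> (real \<Rightarrow> real) \<Rightarrow> (real \<Rightarrow> real) \<Rightarrow> ereal" where
  "lifespan C u0 u1 =
     (if u0 = (\<lambda>_. 0) \<and> u1 = (\<lambda>_. 0) then \<infinity> else ereal (C * data_size u0 u1 powr (- 1/2)))"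

definition time_interval :: "ereal \<Rightarrow> real set" where
  "time_interval T = {t. 0 \<le> t \<and> ereal t < T}"

end

theory Submission
  imports Defs
begin

text \<open>
  For a function of zero mean the equation is an infinite system for the Fourier coefficients
  \<open>u k\<close>: after the Hilbert transforms in the flux have been expanded and the product has been
  symmetrised, the coefficients satisfy

    \<open>u''\<^sub>k = - \<mu> k\<^sup>2 u\<^sub>k + \<bar>k\<bar> (\<Sum>\<^sub>l kern k l u\<^bsub>k-l\<^esub> u\<^sub>l)\<close>.

  The symmetrisation is the decisive cancellation (\<open>kern_symmetrized\<close>, \<open>flux_eq_synth\<close>): averaged over
  the exchange of \<open>l\<close> and \<open>k - l\<close>, the kernel is the product of the two smallest of the three numbers
  \<open>\<bar>k\<bar>\<close>, \<open>\<bar>l\<bar>\<close>, \<open>\<bar>k - l\<bar>\<close>. Hence, when \<open>k - l\<close> is small, the coefficient of \<open>u\<^sub>l\<close> is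
  \<open>\<bar>k\<bar>\<bar>l\<bar>\<close> times a low frequency, as for a wave equation with a variable speed.

  A term that is symmetric in \<open>k\<close> and \<open>l\<close> and costs two derivatives is absorbed by the energy. For a
  weight \<open>m\<close> the energy is

    \<open>\<Sum>\<^sub>k m\<^sub>k\<^sup>2 (\<bar>u'\<^sub>k\<bar>\<^sup>2 + \<mu> k\<^sup>2 \<bar>u\<^sub>k\<bar>\<^sup>2) - 2 Re (\<Sum>\<^bsub>k,l\<^esub> \<bar>k-l\<bar>\<bar>k\<bar>\<bar>l\<bar> m\<^sub>k m\<^sub>l u\<^bsub>k-l\<^esub> u\<^sub>l cnj u\<^sub>k)\<close>.

  For \<open>m = 1\<close> it is, up to the factor \<open>2\<pi>\<close>, the integral of
  \<open>\<phi>\<^sub>t\<^sup>2 + (\<mu> - 2 H[\<phi>]\<^sub>x) H[\<phi>]\<^sub>x\<^sup>2\<close>. It is coercive as long as the sum of \<open>\<bar>n\<bar>\<bar>u\<^sub>n\<bar>\<close> is at most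
  \<open>\<mu>/4\<close>. Its time derivative contains only the commutator of the kernel with the weight
  (\<open>weight_commutator\<close>), which costs a single derivative, and is therefore bounded by the energy times
  the sum of \<open>n\<^sup>2\<bar>u\<^sub>n\<bar>\<close> and \<open>\<bar>n\<bar>\<bar>u'\<^sub>n\<bar>\<close> (\<open>energy_derivative_le\<close>). By Cauchy-Schwarz these sums are of
  the size of the data in \<open>H\<^sup>3 \<times> H\<^sup>2\<close>, and Gronwall's inequality gives a lifespan inversely
  proportional to that size.

  The sums may be truncated to \<open>\<bar>k\<bar> \<le> N\<close> without any change of the argument. So the Galerkin
  approximations exist on a common time interval with common bounds (\<open>galerkin_exists\<close>). The same
  energy, with \<open>m = 1\<close>, shows that two solutions of the equations with \<open>\<bar>k\<bar> \<le> N\<close> and with the same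
  data in these modes differ by \<open>O(1/N)\<close> in energy (\<open>difference_bound\<close>). This single estimate makes the Galerkin
  approximations converge (\<open>modes_exist\<close>) and also proves uniqueness (\<open>cauchy_solution_unique\<close>).

  All weights of growth at most \<open>\<bar>k\<bar>\<^sup>q\<close> are propagated with one constant. The weights \<open>\<bar>k\<bar>\<^sup>s\<^sup>-\<^sup>1\<close> give
  the energy estimate in \<open>H\<^sup>s \<times> H\<^sup>s\<^sup>-\<^sup>1\<close>; the weights \<open>\<bar>k\<bar>\<^sup>s\<^sup>-\<^sup>1 min(1, \<bar>k\<bar>/J)\<close> give tails of the norm that are small
  uniformly in time (\<open>uniform_tails_en\<close>), and with them the continuity of each mode in time becomes
  continuity in the Sobolev norm. As the lifespan refers to the size in \<open>H\<^sup>3 \<times> H\<^sup>2\<close> only, it is the same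
  for all \<open>s\<close>.

  The passage between functions and coefficients rests on the uniqueness of Fourier coefficients. A
  distributional solution is tested with \<open>\<theta>(t) cos kx\<close> and \<open>\<theta>(t) sin kx\<close>, and the lemma of du Bois-Reymond
  turns the result into the differential equation of the mode (\<open>distributional_imp_modes\<close>). Conversely,
  every mode satisfies the weak equation and the series converges uniformly
  (\<open>modes_imp_distributional\<close>).
\<close>

section \<open>The interaction kernel and its commutator with weights\<close>

text \<open>
  Only the larger of the two frequencies \<open>l\<close> and \<open>k - l\<close> carries the interaction, with half the
  coefficient for each if they are equal. The sum over \<open>l\<close> of \<open>kern k l * u (k - l) * u l\<close> is thus the one
  over unordered pairs, but the factor \<open>u l\<close> always has the higher frequency and \<open>u (k - l)\<close> the lower
  one, which is what the energy estimate needs.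
\<close>

definition kern :: "int \<Rightarrow> int \<Rightarrow> real" where
  "kern k l = (if \<bar>k - l\<bar> < \<bar>l\<bar> then 2 else if \<bar>k - l\<bar> = \<bar>l\<bar> then 1 else 0)
     * of_int (\<bar>k - l\<bar> * min \<bar>k\<bar> \<bar>l\<bar>)"

lemma kern_nonneg: "0 \<le> kern k l"
  by (simp add: kern_def)

lemma kern_minus: "kern (- k) (- l) = kern k l"
proof -
  have "\<bar>- k - - l\<bar> = \<bar>k - l\<bar>" by simp
  then show ?thesis by (simp only: kern_def abs_minus_cancel)
qed

lemma kern_le: "kern k l \<le> 2 * (of_int \<bar>k - l\<bar> * of_int \<bar>l\<bar>)"
proof -
  have "of_int (\<bar>k - l\<bar> * min \<bar>k\<bar> \<bar>l\<bar>) \<le> (of_int (\<bar>k - l\<bar> * \<bar>l\<bar>) :: real)"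
    by (intro of_int_le_iff[THEN iffD2] mult_left_mono) auto
  then have "kern k l \<le> 2 * of_int (\<bar>k - l\<bar> * \<bar>l\<bar>)"
    unfolding kern_def by (intro mult_mono) auto
  then show ?thesis by simp
qed

text \<open>
  The kernel vanishes unless \<open>\<bar>k - l\<bar> \<le> \<bar>l\<bar>\<close>, and then \<open>\<bar>k\<bar> \<le> 2\<bar>l\<bar>\<close>: both derivatives may be put on
  the factor of frequency \<open>l\<close>.
\<close>

lemma abs_mult_kern_le: "of_int \<bar>k\<bar> * kern k l \<le> 4 * of_int \<bar>k - l\<bar> * (of_int l)\<^sup>2"
proof (cases "\<bar>k - l\<bar> \<le> \<bar>l\<bar>")
  case True
  then have "\<bar>k\<bar> \<le> 2 * \<bar>l\<bar>" by linarith
  then have "of_int \<bar>k\<bar> * kern k l \<le> (2 * of_int \<bar>l\<bar>) * (2 * (of_int \<bar>k - l\<bar> * of_int \<bar>l\<bar>))"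
    using kern_le by (intro mult_mono kern_nonneg) auto
  then show ?thesis by (simp add: power2_eq_square algebra_simps)
qed (simp add: kern_def)

text \<open>
  Such weights are even, and frequencies within a factor of two have weights within a factor \<open>2\<^sup>q\<close>,
  as the commutator estimate requires. The class contains
  the powers \<open>\<bar>k\<bar>\<^sup>p\<close>, \<open>p \<le> q\<close>, and their modifications at low frequencies that detect tails.
\<close>

definition weight :: "nat \<Rightarrow> (int \<Rightarrow> real) \<Rightarrow> bool" where
  "weight q m \<longleftrightarrow> (\<forall>k. 0 \<le> m k) \<and>
     (\<forall>k l. \<bar>k\<bar> \<le> \<bar>l\<bar> \<longrightarrow> m k \<le> m l \<and> (of_int \<bar>k\<bar>) ^ q * m l \<le> (of_int \<bar>l\<bar>) ^ q * m k)"

lemma one_plus_power_le: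
  fixes x :: real
  assumes "0 \<le> x" "x \<le> 1"
  shows "(1 + x) ^ q \<le> 1 + (2 ^ q - 1) * x"
proof (induction q)
  case (Suc q)
  have "(1 + x) ^ Suc q \<le> (1 + x) * (1 + (2 ^ q - 1) * x)"
    using Suc assms by (simp add: mult_left_mono)
  also have "\<dots> = 1 + x + (2 ^ q - 1) * x + (2 ^ q - 1) * x * x" by (simp add: algebra_simps)
  also have "\<dots> \<le> 1 + x + (2 ^ q - 1) * x + (2 ^ q - 1) * x * 1"
    using assms by (intro add_left_mono mult_left_mono) auto
  finally show ?case by (simp add: algebra_simps)
qed (use assms in simp)

text \<open>
  The principal part of the interaction, moved through the weight, is symmetric in \<open>k\<close> and \<open>l\<close> up to
  an error with an additional factor \<open>\<bar>k - l\<bar>\<close> in place of one derivative on the high frequency. If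
  \<open>\<bar>k - l\<bar> < \<bar>l\<bar>\<close>, this holds because \<open>m k\<close> and \<open>m l\<close> differ by a relative error of order
  \<open>\<bar>k - l\<bar>/\<bar>l\<bar>\<close>. Otherwise \<open>\<bar>k\<bar> \<le> 2\<bar>k - l\<bar>\<close>, and both terms are already of the size of the error.
\<close>

lemma weight_commutator:
  assumes m: "weight q m"
  shows "\<bar>m k * (of_int \<bar>k\<bar> * kern k l) - 2 * of_int \<bar>k - l\<bar> * of_int \<bar>k\<bar> * of_int \<bar>l\<bar> * m l\<bar>
     \<le> 4 * (2 ^ q + 1) * (of_int (k - l))\<^sup>2 * of_int \<bar>l\<bar> * m l"
proof -
  define \<kappa> lam \<nu> :: real where "\<kappa> = of_int \<bar>k\<bar>" and "lam = of_int \<bar>l\<bar>" and "\<nu> = of_int \<bar>k - l\<bar>"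
  have nn: "0 \<le> m k" "0 \<le> m l" using m by (auto simp: weight_def)
  have pos: "0 \<le> \<kappa>" "0 \<le> lam" "0 \<le> \<nu>" by (auto simp: \<kappa>_def lam_def \<nu>_def)
  have tri: "\<kappa> \<le> lam + \<nu>" "lam \<le> \<kappa> + \<nu>"
    by (auto simp: \<kappa>_def lam_def \<nu>_def simp flip: of_int_add of_int_le_iff)
  have up: "m k \<le> m l \<and> \<kappa> ^ q * m l \<le> lam ^ q * m k" if "\<kappa> \<le> lam"
    using m that by (auto simp: weight_def \<kappa>_def lam_def)
  have dn: "m l \<le> m k \<and> lam ^ q * m k \<le> \<kappa> ^ q * m l" if "lam \<le> \<kappa>"
    using m that by (auto simp: weight_def \<kappa>_def lam_def)
  \<comment> \<open>The factor \<open>th\<close> is half the numerical factor in the kernel: \<open>1\<close>, \<open>1/2\<close> or \<open>0\<close>.\<close>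
  define th :: real where "th = (if \<nu> < lam then 1 else if \<nu> = lam then 1/2 else 0)"
  have kern: "kern k l = 2 * th * \<nu> * min \<kappa> lam"
  proof -
    have "\<nu> < lam \<longleftrightarrow> \<bar>k - l\<bar> < \<bar>l\<bar>" "\<nu> = lam \<longleftrightarrow> \<bar>k - l\<bar> = \<bar>l\<bar>"
      by (simp_all only: \<nu>_def lam_def of_int_less_iff of_int_eq_iff)
    moreover have "of_int (min \<bar>k\<bar> \<bar>l\<bar>) = min \<kappa> lam"
      by (simp add: min_def \<kappa>_def lam_def del: of_int_abs)
    ultimately show ?thesis
      unfolding kern_def th_def of_int_mult \<nu>_def by (simp del: of_int_abs)
  qed
  have key: "\<bar>\<kappa> * (th * m k * min \<kappa> lam - lam * m l)\<bar> \<le> 2 * (2 ^ q + 1) * \<nu> * lam * m l"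
  proof (cases "lam = 0")
    case True
    then show ?thesis using pos by simp
  next
    case False
    then have l0: "lam > 0" using pos by simp
    have lm: "0 \<le> \<nu> * (lam * m l)" "0 \<le> lam * m l" using pos nn by auto
    have q1: "(1::real) \<le> 2 ^ q" by simp
    \<comment> \<open>Comparable frequencies have comparable weights.\<close>
    have mk: "m k \<le> 2 ^ q * m l" if "\<kappa> \<le> 2 * lam"
    proof (cases "\<kappa> \<le> lam")
      case True
      then show ?thesis using up mult_right_mono[OF q1, of "m l"] nn by simp
    next
      case False
      have "lam ^ q * m k \<le> \<kappa> ^ q * m l" using dn False by simp
      also have "\<dots> \<le> (2 * lam) ^ q * m l"
        using that pos nn by (intro mult_right_mono power_mono) auto
      finally show ?thesis using l0 by (simp add: power_mult_distrib)
    qed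
    consider "\<nu> > lam" | "\<nu> = lam" | "\<nu> < lam" "lam \<le> \<kappa>" | "\<nu> < lam" "\<kappa> < lam" by linarith
    then show ?thesis
    proof cases
      case 1
      then have "\<kappa> \<le> 2 * \<nu>" using tri by simp
      then have "\<kappa> * (lam * m l) \<le> (2 * \<nu>) * (lam * m l)" using lm by (intro mult_right_mono) auto
      also have "\<dots> \<le> 2 * (2 ^ q + 1) * \<nu> * lam * m l"
        using mult_right_mono[of 1 "2 ^ q + 1" "2 * (\<nu> * (lam * m l))"] lm by (simp add: mult_ac)
      finally show ?thesis using 1 pos nn by (simp add: th_def abs_mult)
    next
      case 2
      then have k2: "\<kappa> \<le> 2 * lam" using tri by simp
      have "th * m k * min \<kappa> lam \<le> m k * lam"
        using nn pos l0 2 mult_mono[of "m k / 2" "m k" "min \<kappa> lam" lam] by (simp add: th_def)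
      also have "\<dots> \<le> (2 ^ q * m l) * lam" using mk[OF k2] l0 by simp
      finally have "th * m k * min \<kappa> lam \<le> 2 ^ q * m l * lam" .
      moreover have "0 \<le> th * m k * min \<kappa> lam" using nn pos by (simp add: th_def)
      moreover have "0 \<le> 2 ^ q * m l * lam" using nn pos by simp
      ultimately have "\<bar>th * m k * min \<kappa> lam - lam * m l\<bar> \<le> (2 ^ q + 1) * (lam * m l)"
        using lm unfolding abs_le_iff by (auto simp: algebra_simps)
      then have "\<kappa> * \<bar>th * m k * min \<kappa> lam - lam * m l\<bar> \<le> (2 * lam) * ((2 ^ q + 1) * (lam * m l))"
        using k2 pos lm by (intro mult_mono) auto
      then show ?thesis using 2 pos by (simp add: abs_mult mult_ac)
    next
      case 3
      define x where "x = (\<kappa> - lam) / lam"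
      have x: "0 \<le> x" "x \<le> \<nu> / lam" "\<kappa> = lam * (1 + x)"
        using 3 l0 tri divide_right_mono[of "\<kappa> - lam" \<nu> lam] by (auto simp: x_def field_simps)
      have x1: "x \<le> 1" using x(2) 3 l0 by (smt (verit) divide_le_eq_1)
      have "lam ^ q * m k \<le> (lam * (1 + x)) ^ q * m l" using dn 3 x by simp
      then have "m k \<le> (1 + x) ^ q * m l" using l0 by (simp add: power_mult_distrib)
      also have "\<dots> \<le> (1 + 2 ^ q * x) * m l"
        using one_plus_power_le[OF x(1) x1, of q] x(1) nn
        by (intro mult_right_mono) (auto simp: algebra_simps)
      finally have "m k - m l \<le> 2 ^ q * x * m l" by (simp add: algebra_simps)
      also have "\<dots> \<le> 2 ^ q * (\<nu> / lam) * m l"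
        using x nn by (intro mult_right_mono mult_left_mono) auto
      finally have "lam * (m k - m l) \<le> lam * (2 ^ q * (\<nu> / lam) * m l)"
        using l0 by (intro mult_left_mono) auto
      then have A: "lam * (m k - m l) \<le> 2 ^ q * \<nu> * m l" using l0 by simp
      have B: "\<kappa> \<le> 2 * lam" "0 \<le> 2 * lam" using tri 3 pos by auto
      have C: "0 \<le> lam * (m k - m l)" using dn 3 pos by simp
      have "\<kappa> * (lam * (m k - m l)) \<le> (2 * lam) * (2 ^ q * \<nu> * m l)"
        by (rule mult_mono[OF B(1) A B(2) C])
      also have "\<dots> \<le> 2 * (2 ^ q + 1) * \<nu> * lam * m l"
        using lm by (simp add: algebra_simps)
      finally show ?thesis using 3 pos dn by (simp add: th_def abs_mult algebra_simps)
    next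
      case 4
      define x where "x = \<kappa> / lam"
      have "1 - x = (lam - \<kappa>) / lam" using l0 by (simp add: x_def diff_divide_distrib)
      also have "\<dots> \<le> \<nu> / lam" using tri l0 by (intro divide_right_mono) auto
      finally have x: "1 - x \<le> \<nu> / lam" "0 \<le> x" "x \<le> 1" "\<kappa> = lam * x"
        using 4 l0 pos by (auto simp: x_def)
      \<comment> \<open>The weight may decrease like \<open>x\<^sup>q\<close> and the minimum in the kernel gives one more power.\<close>
      have "1 + real (Suc q) * (x - 1) \<le> (1 + (x - 1)) ^ Suc q"
        by (rule Bernoulli_inequality) (use x in auto)
      then have b: "1 - x ^ Suc q \<le> real (Suc q) * (1 - x)" by (simp add: algebra_simps)
      have q2: "real (Suc q) \<le> 2 ^ q + 1"
        using of_nat_less_two_power[of q, where 'a=real] by simp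
      have "real (Suc q) * (1 - x) \<le> (2 ^ q + 1) * (\<nu> / lam)"
        by (rule mult_mono[OF q2 x(1)]) (use x in auto)
      then have b2: "1 - x ^ Suc q \<le> (2 ^ q + 1) * (\<nu> / lam)" using b by linarith
      have "(lam * x) ^ q * m l \<le> lam ^ q * m k" using up 4 x by simp
      then have "x ^ q * m l \<le> m k" using l0 by (simp add: power_mult_distrib)
      then have "lam * m l - \<kappa> * m k \<le> lam * m l - lam * x * (x ^ q * m l)"
        using x l0 by (simp add: mult_left_mono)
      also have "\<dots> = (1 - x ^ Suc q) * (lam * m l)" by (simp add: algebra_simps)
      also have "\<dots> \<le> ((2 ^ q + 1) * (\<nu> / lam)) * (lam * m l)"
        using b2 lm by (intro mult_right_mono) auto
      finally have 5: "lam * m l - \<kappa> * m k \<le> (2 ^ q + 1) * \<nu> * m l" using l0 by simp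
      have 6: "\<kappa> * m k \<le> lam * m l" using up 4 pos nn by (intro mult_mono) auto
      have "\<kappa> * (lam * m l - \<kappa> * m k) \<le> lam * ((2 ^ q + 1) * \<nu> * m l)"
        using 5 6 4 pos by (intro mult_mono) auto
      also have "\<dots> \<le> 2 * (2 ^ q + 1) * \<nu> * lam * m l"
        using lm mult_nonneg_nonneg[OF _ lm(1), of "2 ^ q"] by (simp add: algebra_simps)
      finally show ?thesis using 4 pos 6
        by (simp add: th_def abs_mult abs_minus_commute[of "m k * \<kappa>"] mult.commute[of "m k"])
    qed
  qed
  have "m k * (\<kappa> * kern k l) - 2 * \<nu> * \<kappa> * lam * m l = 2 * \<nu> * (\<kappa> * (th * m k * min \<kappa> lam - lam * m l))"
    by (simp add: kern algebra_simps)
  then have "\<bar>m k * (\<kappa> * kern k l) - 2 * \<nu> * \<kappa> * lam * m l\<bar>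
      = 2 * \<nu> * \<bar>\<kappa> * (th * m k * min \<kappa> lam - lam * m l)\<bar>"
    using pos by (simp add: abs_mult)
  also have "\<dots> \<le> 2 * \<nu> * (2 * (2 ^ q + 1) * \<nu> * lam * m l)"
    using key pos by (intro mult_left_mono) auto
  also have "\<dots> = 4 * (2 ^ q + 1) * \<nu>\<^sup>2 * lam * m l"
    by (simp add: power2_eq_square algebra_simps)
  finally show ?thesis by (simp add: \<kappa>_def lam_def \<nu>_def)
qed

section \<open>The corrected energy\<close>

text \<open>
  A bound on all finite partial sums. For nonnegative functions it says that the sum exists and is at
  most \<open>c\<close>, but it needs no summability argument before it is used.
\<close>

definition sums_below :: "('a \<Rightarrow> real) \<Rightarrow> real \<Rightarrow> bool" where
  "sums_below f c \<longleftrightarrow> (\<forall>F. finite F \<longrightarrow> sum f F \<le> c)"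

lemma sums_belowD: "sums_below f c \<Longrightarrow> finite F \<Longrightarrow> sum f F \<le> c"
  by (simp add: sums_below_def)

lemma sums_below_nonneg: "sums_below f c \<Longrightarrow> 0 \<le> c"
  using sums_belowD[of f c "{}"] by simp

lemma sums_below_point: "sums_below f c \<Longrightarrow> f x \<le> c"
  using sums_belowD[of f c "{x}"] by simp

lemma sums_below_mono:
  "sums_below g c \<Longrightarrow> (\<And>x. f x \<le> g x) \<Longrightarrow> c \<le> d \<Longrightarrow> sums_below f d"
  unfolding sums_below_def by (meson order_trans sum_mono)

lemma sums_below_cmult: "sums_below f c \<Longrightarrow> 0 \<le> a \<Longrightarrow> sums_below (\<lambda>x. a * f x) (a * c)"
  by (auto simp: sums_below_def mult_left_mono simp flip: sum_distrib_left)

lemma sums_below_add: "sums_below f c \<Longrightarrow> sums_below g d \<Longrightarrow> sums_below (\<lambda>x. f x + g x) (c + d)"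
  by (auto simp: sums_below_def sum.distrib add_mono)

lemma sums_below_inj_sum:
  assumes "sums_below f c" "finite F" "inj_on h F"
  shows "(\<Sum>x\<in>F. f (h x)) \<le> c"
  using sums_belowD[OF assms(1), of "h ` F"] assms(2,3) by (simp add: sum.reindex o_def)

lemma sums_below_infsum:
  assumes "f summable_on UNIV" "\<And>x. 0 \<le> f x"
  shows "sums_below f (infsum f UNIV)"
  unfolding sums_below_def using assms by (auto intro: finite_sum_le_infsum)

lemma sums_below_imp_summable:
  assumes "sums_below f c" "\<And>x. 0 \<le> f x"
  shows "f summable_on A" "infsum f A \<le> c"
proof -
  show *: "f summable_on A"
    by (rule nonneg_bounded_partial_sums_imp_summable_on[of _ _ c])
       (use assms in \<open>auto simp: sums_below_def intro!: eventually_finite_subsets_at_top_weakI\<close>)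
  show "infsum f A \<le> c"
    by (rule infsum_le_finite_sums[OF *]) (use assms in \<open>auto simp: sums_below_def\<close>)
qed

text \<open>
  Young's inequality for convolutions with an \<open>l\<^sup>1\<close> kernel, paired with an \<open>l\<^sup>2\<close> sequence; the sums are
  finite, so that it applies to truncated systems.
\<close>

lemma young_sum_diff:
  fixes x y :: "int \<Rightarrow> real"
  assumes "finite S" "finite T" "sums_below A a" and A0: "\<And>n. 0 \<le> A n"
  shows "(\<Sum>k\<in>S. \<Sum>l\<in>T. A (k - l) * x l * y k) \<le> a / 2 * ((\<Sum>l\<in>T. (x l)\<^sup>2) + (\<Sum>k\<in>S. (y k)\<^sup>2))"
proof -
  have le: "A (k - l) * x l * y k \<le> (A (k - l) * (x l)\<^sup>2 + A (k - l) * (y k)\<^sup>2) / 2" for k l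
    using mult_left_mono[OF sum_squares_bound[of "x l" "y k"] A0[of "k - l"]] by (simp add: algebra_simps)
  have 1: "(\<Sum>l\<in>T. \<Sum>k\<in>S. A (k - l) * (x l)\<^sup>2) \<le> a * (\<Sum>l\<in>T. (x l)\<^sup>2)"
    unfolding sum_distrib_left[of a] sum_distrib_right[symmetric]
    by (intro sum_mono mult_right_mono sums_below_inj_sum[OF assms(3,1)]) (auto simp: inj_on_def)
  have 2: "(\<Sum>k\<in>S. \<Sum>l\<in>T. A (k - l) * (y k)\<^sup>2) \<le> a * (\<Sum>k\<in>S. (y k)\<^sup>2)"
    unfolding sum_distrib_left[of a] sum_distrib_right[symmetric]
    by (intro sum_mono mult_right_mono sums_below_inj_sum[OF assms(3,2)]) (auto simp: inj_on_def)
  have "(\<Sum>k\<in>S. \<Sum>l\<in>T. A (k - l) * x l * y k)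
      \<le> (\<Sum>k\<in>S. \<Sum>l\<in>T. (A (k - l) * (x l)\<^sup>2 + A (k - l) * (y k)\<^sup>2) / 2)"
    by (intro sum_mono le)
  also have "\<dots> = ((\<Sum>l\<in>T. \<Sum>k\<in>S. A (k - l) * (x l)\<^sup>2) + (\<Sum>k\<in>S. \<Sum>l\<in>T. A (k - l) * (y k)\<^sup>2)) / 2"
    by (simp add: sum.distrib sum.swap[of "\<lambda>l k. A (k - l) * (x l)\<^sup>2" S T] flip: sum_divide_distrib)
  finally show ?thesis using 1 2 by (simp add: algebra_simps)
qed

lemma young_sum_left:
  fixes x y :: "int \<Rightarrow> real"
  assumes "finite S" "finite T" "sums_below A a" and A0: "\<And>n. 0 \<le> A n"
    and "sums_below (\<lambda>n. (x n)\<^sup>2) X"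
  shows "(\<Sum>k\<in>S. \<Sum>l\<in>T. A l * x (k - l) * y k) \<le> a / 2 * (X + (\<Sum>k\<in>S. (y k)\<^sup>2))"
proof -
  have le: "A l * x (k - l) * y k \<le> (A l * (x (k - l))\<^sup>2 + A l * (y k)\<^sup>2) / 2" for k l
    using mult_left_mono[OF sum_squares_bound[of "x (k - l)" "y k"] A0[of "l"]] by (simp add: algebra_simps)
  have "(\<Sum>l\<in>T. \<Sum>k\<in>S. A l * (x (k - l))\<^sup>2) \<le> (\<Sum>l\<in>T. A l * X)"
    unfolding sum_distrib_left[symmetric]
    by (intro sum_mono mult_left_mono A0 sums_below_inj_sum[OF assms(5,1)]) (auto simp: inj_on_def)
  also have "\<dots> \<le> a * X"
    unfolding sum_distrib_right[symmetric]
    by (intro mult_right_mono sums_belowD[OF assms(3,2)] sums_below_nonneg[OF assms(5)])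
  finally have 1: "(\<Sum>l\<in>T. \<Sum>k\<in>S. A l * (x (k - l))\<^sup>2) \<le> a * X" .
  have 2: "(\<Sum>k\<in>S. \<Sum>l\<in>T. A l * (y k)\<^sup>2) \<le> a * (\<Sum>k\<in>S. (y k)\<^sup>2)"
    unfolding sum_distrib_left[of a] sum_distrib_right[symmetric]
    by (intro sum_mono mult_right_mono sums_belowD[OF assms(3,2)]) auto
  have "(\<Sum>k\<in>S. \<Sum>l\<in>T. A l * x (k - l) * y k)
      \<le> (\<Sum>k\<in>S. \<Sum>l\<in>T. (A l * (x (k - l))\<^sup>2 + A l * (y k)\<^sup>2) / 2)"
    by (intro sum_mono le)
  also have "\<dots> = ((\<Sum>l\<in>T. \<Sum>k\<in>S. A l * (x (k - l))\<^sup>2) + (\<Sum>k\<in>S. \<Sum>l\<in>T. A l * (y k)\<^sup>2)) / 2"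
    by (simp add: sum.distrib sum.swap[of "\<lambda>l k. A l * (x (k - l))\<^sup>2" S T] flip: sum_divide_distrib)
  finally show ?thesis using 1 2 by (simp add: algebra_simps)
qed

text \<open>
  The part of the \<open>m\<close>-weighted energy at frequency \<open>k\<close> that does not see \<open>\<mu>\<close> or the interaction.
\<close>

definition en :: "(int \<Rightarrow> real) \<Rightarrow> (int \<Rightarrow> complex) \<Rightarrow> (int \<Rightarrow> complex) \<Rightarrow> int \<Rightarrow> real" where
  "en m z z' k = (m k)\<^sup>2 * ((cmod (z' k))\<^sup>2 + (of_int k * cmod (z k))\<^sup>2)"

lemma en_nonneg: "0 \<le> en m z z' k"
  by (simp add: en_def)

text \<open>
  The cubic term of the energy, as a sesquilinear form in \<open>z\<close> and \<open>w\<close> with the coefficient \<open>u\<close>. For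
  \<open>m = 1\<close> and \<open>S\<close> exhausting the integers it is \<open>1/(2\<pi>)\<close> times the integral of
  \<open>H[u]\<^sub>x H[z]\<^sub>x H[w]\<^sub>x\<close>.
\<close>

definition correction :: "int set \<Rightarrow> (int \<Rightarrow> real) \<Rightarrow> (int \<Rightarrow> complex) \<Rightarrow> (int \<Rightarrow> complex) \<Rightarrow> (int \<Rightarrow> complex) \<Rightarrow> complex" where
  "correction S m u z w = (\<Sum>k\<in>S. \<Sum>l\<in>S.
     of_real (of_int \<bar>k - l\<bar> * of_int \<bar>k\<bar> * of_int \<bar>l\<bar> * m k * m l) * (u (k - l) * z l * cnj (w k)))"

definition energy :: "real \<Rightarrow> int set \<Rightarrow> (int \<Rightarrow> real) \<Rightarrow> (int \<Rightarrow> complex) \<Rightarrow> (int \<Rightarrow> complex) \<Rightarrow> (int \<Rightarrow> complex) \<Rightarrow> real" where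
  "energy \<mu> S m u z z' = (\<Sum>k\<in>S. (m k)\<^sup>2 * ((cmod (z' k))\<^sup>2 + \<mu> * (of_int k * cmod (z k))\<^sup>2))
     - 2 * Re (correction S m u z z)"

lemma Re_sum_sum_le:
  "\<bar>Re (\<Sum>k\<in>S. \<Sum>l\<in>T. f k l)\<bar> \<le> (\<Sum>k\<in>S. \<Sum>l\<in>T. cmod (f k l))"
  by (rule order_trans[OF abs_Re_le_cmod]) (intro order_trans[OF norm_sum] sum_mono norm_sum)

lemma correction_le:
  assumes S: "finite S" and m: "\<And>k. 0 \<le> m k" and a: "sums_below (\<lambda>n. of_int \<bar>n\<bar> * cmod (u n)) a"
  shows "\<bar>Re (correction S m u z z)\<bar> \<le> a * (\<Sum>k\<in>S. (m k)\<^sup>2 * (of_int k * cmod (z k))\<^sup>2)"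
proof -
  define x where "x k = m k * \<bar>of_int k\<bar> * cmod (z k)" for k
  have "\<bar>Re (correction S m u z z)\<bar> \<le> (\<Sum>k\<in>S. \<Sum>l\<in>S. of_int \<bar>k - l\<bar> * cmod (u (k - l)) * x l * x k)"
    unfolding correction_def
    by (rule order_trans[OF Re_sum_sum_le], intro sum_mono) (simp add: norm_mult m x_def mult_ac)
  also have "\<dots> \<le> a / 2 * ((\<Sum>k\<in>S. (x k)\<^sup>2) + (\<Sum>k\<in>S. (x k)\<^sup>2))"
    by (rule young_sum_diff[OF S S a]) simp
  also have "(\<Sum>k\<in>S. (x k)\<^sup>2) = (\<Sum>k\<in>S. (m k)\<^sup>2 * (of_int k * cmod (z k))\<^sup>2)"
    by (simp add: x_def power_mult_distrib mult_ac)
  finally show ?thesis by simp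
qed

text \<open>
  The correction is at most the fraction \<open>a/\<mu> \<le> 1/4\<close> of the potential energy.
\<close>

lemma energy_bounds:
  assumes S: "finite S" and m: "\<And>k. 0 \<le> m k" and a: "sums_below (\<lambda>n. of_int \<bar>n\<bar> * cmod (u n)) a"
    and small: "4 * a \<le> \<mu>"
  shows "min 1 \<mu> / 2 * (\<Sum>k\<in>S. en m z z' k) \<le> energy \<mu> S m u z z'"
    and "energy \<mu> S m u z z' \<le> (1 + 2 * \<mu>) * (\<Sum>k\<in>S. en m z z' k)"
proof -
  define P where "P = (\<Sum>k\<in>S. (m k)\<^sup>2 * (cmod (z' k))\<^sup>2)"
  define Q where "Q = (\<Sum>k\<in>S. (m k)\<^sup>2 * (of_int k * cmod (z k))\<^sup>2)"
  have PQ: "0 \<le> P" "0 \<le> Q" by (auto simp: P_def Q_def intro!: sum_nonneg)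
  have a0: "0 \<le> a" using sums_below_nonneg[OF a] .
  have en: "(\<Sum>k\<in>S. en m z z' k) = P + Q"
    by (simp add: en_def P_def Q_def distrib_left sum.distrib)
  have e: "energy \<mu> S m u z z' = P + \<mu> * Q - 2 * Re (correction S m u z z)"
    by (simp add: energy_def P_def Q_def distrib_left sum.distrib sum_distrib_left mult_ac)
  have c: "\<bar>Re (correction S m u z z)\<bar> \<le> a * Q"
    using correction_le[OF S m a] by (simp add: Q_def)
  have "4 * a * Q \<le> \<mu> * Q" using small PQ by (intro mult_right_mono) auto
  then have c2: "2 * \<bar>Re (correction S m u z z)\<bar> \<le> \<mu> * Q / 2" using c by simp
  have "min 1 \<mu> * P \<le> 1 * P" "min 1 \<mu> * Q \<le> \<mu> * Q" by (intro mult_right_mono PQ; simp)+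
  then show "min 1 \<mu> / 2 * (\<Sum>k\<in>S. en m z z' k) \<le> energy \<mu> S m u z z'"
    using c2 PQ by (simp add: e en distrib_left)
  have "0 \<le> \<mu> * P" using a0 small PQ by simp
  then show "energy \<mu> S m u z z' \<le> (1 + 2 * \<mu>) * (\<Sum>k\<in>S. en m z z' k)"
    using c2 PQ by (simp add: e en algebra_simps)
qed

text \<open>
  The coefficient is real-valued as a function of \<open>x\<close>, so the form is Hermitian.
\<close>

lemma correction_swap:
  assumes "\<And>n. u (- n) = cnj (u n)"
  shows "Re (correction S m u z w) = Re (correction S m u w z)"
proof -
  have "cnj (correction S m u z w) = (\<Sum>k\<in>S. \<Sum>l\<in>S.
     of_real (of_int \<bar>k - l\<bar> * of_int \<bar>k\<bar> * of_int \<bar>l\<bar> * m k * m l) * (u (l - k) * cnj (z l) * w k))"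
    unfolding correction_def by (simp flip: assms)
  also have "\<dots> = correction S m u w z"
    unfolding correction_def
    by (subst sum.swap) (intro sum.cong refl, simp add: abs_minus_commute mult_ac)
  finally show ?thesis by (metis cnj.sel(1))
qed

lemma has_real_derivative_cmod_power2:
  assumes "(f has_vector_derivative f') (at t within T)"
  shows "((\<lambda>t. (cmod (f t))\<^sup>2) has_real_derivative 2 * Re (f' * cnj (f t))) (at t within T)"
proof -
  have "((\<lambda>t. Re (f t)) has_real_derivative Re f') (at t within T)"
    "((\<lambda>t. Im (f t)) has_real_derivative Im f') (at t within T)"
    using bounded_linear.has_vector_derivative[OF bounded_linear_Re assms]
      bounded_linear.has_vector_derivative[OF bounded_linear_Im assms]
    by (simp_all add: has_real_derivative_iff_has_vector_derivative)
  then show ?thesis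
    unfolding cmod_power2
    by (rule DERIV_cong[OF DERIV_add[OF DERIV_power[where n = 2] DERIV_power[where n = 2]]])
       (simp add: algebra_simps)
qed

lemma has_real_derivative_energy:
  assumes S: "finite S"
    and u: "\<And>n. ((\<lambda>t. u t n) has_vector_derivative u' n) (at t within T)"
    and z: "\<And>k. k \<in> S \<Longrightarrow> ((\<lambda>t. z t k) has_vector_derivative z' t k) (at t within T)"
    and z': "\<And>k. k \<in> S \<Longrightarrow> ((\<lambda>t. z' t k) has_vector_derivative z'' k) (at t within T)"
    and herm: "\<And>n. u t (- n) = cnj (u t n)"
  shows "((\<lambda>t. energy \<mu> S m (u t) (z t) (z' t)) has_real_derivative
     2 * (\<Sum>k\<in>S. (m k)\<^sup>2 * Re ((z'' k + of_real (\<mu> * (of_int k)\<^sup>2) * z t k) * cnj (z' t k)))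
     - 2 * Re (correction S m u' (z t) (z t)) - 4 * Re (correction S m (u t) (z t) (z' t))) (at t within T)"
proof -
  have "((\<lambda>t. correction S m (u t) (z t) (z t)) has_vector_derivative
     (\<Sum>k\<in>S. \<Sum>l\<in>S. of_real (of_int \<bar>k - l\<bar> * of_int \<bar>k\<bar> * of_int \<bar>l\<bar> * m k * m l) *
      (u t (k - l) * z t l * cnj (z' t k) + (u t (k - l) * z' t l + u' (k - l) * z t l) * cnj (z t k)))) (at t within T)"
    unfolding correction_def
    by (intro has_vector_derivative_sum has_vector_derivative_mult_right has_vector_derivative_mult u z
          bounded_linear.has_vector_derivative[OF bounded_linear_cnj])
  also have "(\<Sum>k\<in>S. \<Sum>l\<in>S. of_real (of_int \<bar>k - l\<bar> * of_int \<bar>k\<bar> * of_int \<bar>l\<bar> * m k * m l) *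
      (u t (k - l) * z t l * cnj (z' t k) + (u t (k - l) * z' t l + u' (k - l) * z t l) * cnj (z t k)))
     = correction S m (u t) (z t) (z' t) + correction S m (u t) (z' t) (z t) + correction S m u' (z t) (z t)"
    by (simp add: correction_def sum.distrib[symmetric] algebra_simps)
  finally have "((\<lambda>t. Re (correction S m (u t) (z t) (z t))) has_vector_derivative
      Re (correction S m (u t) (z t) (z' t) + correction S m (u t) (z' t) (z t) + correction S m u' (z t) (z t)))
      (at t within T)"
    by (rule bounded_linear.has_vector_derivative[OF bounded_linear_Re])
  moreover have "Re (correction S m (u t) (z' t) (z t)) = Re (correction S m (u t) (z t) (z' t))"
    by (rule correction_swap) (rule herm)
  ultimately have c: "((\<lambda>t. Re (correction S m (u t) (z t) (z t))) has_real_derivative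
      (2 * Re (correction S m (u t) (z t) (z' t)) + Re (correction S m u' (z t) (z t)))) (at t within T)"
    by (simp add: has_real_derivative_iff_has_vector_derivative)
  have q: "((\<lambda>t. \<Sum>k\<in>S. (m k)\<^sup>2 * ((cmod (z' t k))\<^sup>2 + \<mu> * (of_int k * cmod (z t k))\<^sup>2)) has_real_derivative
      (\<Sum>k\<in>S. (m k)\<^sup>2 * (2 * Re (z'' k * cnj (z' t k)) + \<mu> * ((of_int k)\<^sup>2 * (2 * Re (z' t k * cnj (z t k)))))))
      (at t within T)"
    unfolding power_mult_distrib
    by (intro DERIV_sum DERIV_cmult DERIV_add has_real_derivative_cmod_power2 z z')
  have e: "(m k)\<^sup>2 * (2 * Re (z'' k * cnj (z' t k)) + \<mu> * ((of_int k)\<^sup>2 * (2 * Re (z' t k * cnj (z t k)))))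
     = 2 * ((m k)\<^sup>2 * Re ((z'' k + of_real (\<mu> * (of_int k)\<^sup>2) * z t k) * cnj (z' t k)))" for k
    by (simp add: algebra_simps)
  show ?thesis
    unfolding energy_def
    by (rule DERIV_cong[OF DERIV_diff[OF q DERIV_cmult[OF c, of 2]]])
       (simp add: e sum_distrib_left algebra_simps)
qed

lemma real_gronwall:
  fixes E E' :: "real \<Rightarrow> real"
  assumes E: "\<And>t. t \<in> {0..\<tau>} \<Longrightarrow> (E has_real_derivative E' t) (at t within {0..\<tau>})"
    and le: "\<And>t. t \<in> {0..\<tau>} \<Longrightarrow> E' t \<le> c * E t + e" and "0 \<le> c" "0 \<le> e" and t: "t \<in> {0..\<tau>}"
  shows "E t \<le> (E 0 + e * t) * exp (c * t)"
proof -
  \<comment> \<open>The derivative of \<open>h\<close> is not positive since \<open>exp (- c * t) \<le> 1\<close>.\<close>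
  define h where "h t = E t * exp (- c * t) - e * t" for t
  have h: "(h has_real_derivative (E' s - c * E s) * exp (- c * s) - e) (at s within {0..\<tau>})" if "s \<in> {0..\<tau>}" for s
    unfolding h_def by (rule derivative_eq_intros E that refl)+ (simp add: algebra_simps)
  have "h t \<le> h 0"
  proof (rule DERIV_nonpos_imp_decreasing_open[of 0 t h])
    fix s assume s: "0 < s" "s < t"
    then have "at s within {0..\<tau>} = at s" using t by (intro at_within_interior) auto
    then have "DERIV h s :> (E' s - c * E s) * exp (- c * s) - e" using h[of s] s t by simp
    moreover have "(E' s - c * E s) * exp (- c * s) \<le> e * exp (- c * s)"
      using le[of s] s t by (intro mult_right_mono) auto
    moreover have "e * exp (- c * s) \<le> e * 1"
      using s assms(3,4) by (intro mult_left_mono) auto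
    ultimately show "\<exists>y. DERIV h s :> y \<and> y \<le> 0"
      by (intro exI conjI) (assumption, linarith)
  next
    show "continuous_on {0..t} h"
      using h t by (intro continuous_on_subset[of "{0..\<tau>}" h "{0..t}"] DERIV_continuous_on) auto
  qed (use t in auto)
  then have "E t * exp (- c * t) \<le> E 0 + e * t" by (simp add: h_def)
  then have "E t * exp (- c * t) * exp (c * t) \<le> (E 0 + e * t) * exp (c * t)"
    by (rule mult_right_mono) simp
  then show ?thesis by (simp add: mult.assoc flip: exp_add)
qed

lemma of_real_abs_of_int: "complex_of_real \<bar>real_of_int k\<bar> = of_int \<bar>k\<bar>"
  by (metis of_int_abs of_real_of_int_eq)

text \<open>
  This is where the derivative loss disappears. The interaction contributes
  \<open>(m k)\<^sup>2 \<bar>k\<bar> kern k l\<close> and the time derivative of the correction removes from it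
  \<open>2 \<bar>k - l\<bar>\<bar>k\<bar>\<bar>l\<bar> m k m l\<close>. What remains is \<open>m k\<close> times the commutator of \<open>weight_commutator\<close>, to
  which Young's inequality applies. The remaining part of the derivative of the correction falls on
  its coefficient \<open>u\<close> and is bounded through \<open>u'\<close>. The remainder \<open>r\<close> is free; it is zero for a single
  solution, and it collects the lower-order terms and the tails for a difference of solutions.
\<close>

lemma energy_derivative_le:
  assumes S: "finite S" and m: "weight q m"
    and herm: "\<And>n. u (- n) = cnj (u n)"
    and eq: "\<And>k. k \<in> S \<Longrightarrow> z'' k = - of_real (\<mu> * (of_int k)\<^sup>2) * z k
        + of_int \<bar>k\<bar> * (\<Sum>l\<in>S. of_real (kern k l) * u (k - l) * z l) + r k"
    and u: "sums_below (\<lambda>n. (of_int n)\<^sup>2 * cmod (u n)) A"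
    and u': "sums_below (\<lambda>n. of_int \<bar>n\<bar> * cmod (u' n)) A"
    and r: "(\<Sum>k\<in>S. (m k)\<^sup>2 * (cmod (r k) * cmod (z' k))) \<le> c * (\<Sum>k\<in>S. en m z z' k) + e"
  shows "2 * (\<Sum>k\<in>S. (m k)\<^sup>2 * Re ((z'' k + of_real (\<mu> * (of_int k)\<^sup>2) * z k) * cnj (z' k)))
     - 2 * Re (correction S m u' z z) - 4 * Re (correction S m u z z')
     \<le> ((4 * (2 ^ q + 1) + 2) * A + 2 * c) * (\<Sum>k\<in>S. en m z z' k) + 2 * e"
proof -
  have m0: "0 \<le> m k" for k using m by (simp add: weight_def)
  define X where "X = (\<Sum>k\<in>S. en m z z' k)"
  define P where "P = (\<Sum>k\<in>S. (m k * cmod (z' k))\<^sup>2)"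
  define Q where "Q = (\<Sum>k\<in>S. (m k * \<bar>of_int k\<bar> * cmod (z k))\<^sup>2)"
  have X: "X = P + Q" and "0 \<le> P"
    by (auto simp: en_def X_def P_def Q_def distrib_left sum.distrib power_mult_distrib mult_ac intro!: sum_nonneg)
  \<comment> \<open>\<open>c1\<close> is the commutator, \<open>M\<close> its contribution to the derivative of the energy.\<close>
  define c1 where "c1 k l = m k * (of_int \<bar>k\<bar> * kern k l) - 2 * of_int \<bar>k - l\<bar> * of_int \<bar>k\<bar> * of_int \<bar>l\<bar> * m l" for k l
  define M where "M = (\<Sum>k\<in>S. \<Sum>l\<in>S. of_real (m k * c1 k l) * (u (k - l) * z l * cnj (z' k)))"
  have split: "(\<Sum>k\<in>S. (m k)\<^sup>2 * Re ((z'' k + of_real (\<mu> * (of_int k)\<^sup>2) * z k) * cnj (z' k)))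
      - 2 * Re (correction S m u z z') = Re M + (\<Sum>k\<in>S. (m k)\<^sup>2 * Re (r k * cnj (z' k)))"
  proof -
    have "of_real ((m k)\<^sup>2) * ((z'' k + of_real (\<mu> * (of_int k)\<^sup>2) * z k) * cnj (z' k))
        = (\<Sum>l\<in>S. of_real ((m k)\<^sup>2 * (of_int \<bar>k\<bar> * kern k l)) * (u (k - l) * z l * cnj (z' k)))
          + of_real ((m k)\<^sup>2) * (r k * cnj (z' k))" if "k \<in> S" for k
      by (simp add: eq[OF that] algebra_simps sum_distrib_left of_real_abs_of_int)
    then have "(\<Sum>k\<in>S. of_real ((m k)\<^sup>2) * ((z'' k + of_real (\<mu> * (of_int k)\<^sup>2) * z k) * cnj (z' k)))
        - 2 * correction S m u z z' = M + (\<Sum>k\<in>S. of_real ((m k)\<^sup>2) * (r k * cnj (z' k)))"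
      by (simp add: M_def c1_def correction_def sum.distrib sum_subtractf sum_distrib_left
            power2_eq_square algebra_simps)
    from arg_cong[OF this, of Re] show ?thesis by (simp del: of_real_power)
  qed
  have "\<bar>Re M\<bar> \<le> (\<Sum>k\<in>S. \<Sum>l\<in>S. 4 * (2 ^ q + 1) * ((of_int (k - l))\<^sup>2 * cmod (u (k - l))
      * (m l * \<bar>of_int l\<bar> * cmod (z l)) * (m k * cmod (z' k))))"
    unfolding M_def
  proof (rule order_trans[OF Re_sum_sum_le], intro sum_mono)
    fix k l
    have "cmod (of_real (m k * c1 k l) * (u (k - l) * z l * cnj (z' k)))
        = \<bar>c1 k l\<bar> * (m k * cmod (u (k - l)) * cmod (z l) * cmod (z' k))"
      by (simp add: norm_mult abs_mult m0)
    also have "\<dots> \<le> (4 * (2 ^ q + 1) * (of_int (k - l))\<^sup>2 * of_int \<bar>l\<bar> * m l)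
        * (m k * cmod (u (k - l)) * cmod (z l) * cmod (z' k))"
      unfolding c1_def by (intro mult_right_mono weight_commutator m) (simp add: m0)
    finally show "cmod (of_real (m k * c1 k l) * (u (k - l) * z l * cnj (z' k)))
      \<le> 4 * (2 ^ q + 1) * ((of_int (k - l))\<^sup>2 * cmod (u (k - l))
      * (m l * \<bar>of_int l\<bar> * cmod (z l)) * (m k * cmod (z' k)))"
      by (simp only: mult_ac of_int_abs)
  qed
  also have "\<dots> = 4 * (2 ^ q + 1) * (\<Sum>k\<in>S. \<Sum>l\<in>S. ((of_int (k - l))\<^sup>2 * cmod (u (k - l))
      * (m l * \<bar>of_int l\<bar> * cmod (z l)) * (m k * cmod (z' k))))"
    by (simp only: sum_distrib_left)
  also have "\<dots> \<le> 4 * (2 ^ q + 1) * (A / 2 * (Q + P))"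
    unfolding P_def Q_def by (intro mult_left_mono young_sum_diff S u) auto
  also have "\<dots> = 4 * (2 ^ q + 1) * A / 2 * X" by (simp add: X add.commute)
  finally have M: "\<bar>Re M\<bar> \<le> 4 * (2 ^ q + 1) * A / 2 * X" .
  have "\<bar>Re (correction S m u' z z)\<bar> \<le> A * Q"
    using correction_le[of S m, OF S m0 u', of z] by (simp add: Q_def power_mult_distrib mult_ac)
  also have "\<dots> \<le> A * X" using \<open>0 \<le> P\<close> sums_below_nonneg[OF u] by (simp add: X mult_left_mono)
  finally have C: "\<bar>Re (correction S m u' z z)\<bar> \<le> A * X" .
  have "(\<Sum>k\<in>S. (m k)\<^sup>2 * Re (r k * cnj (z' k))) \<le> (\<Sum>k\<in>S. (m k)\<^sup>2 * (cmod (r k) * cmod (z' k)))"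
  proof (intro sum_mono mult_left_mono)
    show "Re (r k * cnj (z' k)) \<le> cmod (r k) * cmod (z' k)" for k
      using complex_Re_le_cmod[of "r k * cnj (z' k)"] by (simp add: norm_mult)
  qed simp
  then have R: "(\<Sum>k\<in>S. (m k)\<^sup>2 * Re (r k * cnj (z' k))) \<le> c * X + e" using r by (simp add: X_def)
  show ?thesis using split M C R unfolding X_def[symmetric] by (simp add: algebra_simps)
qed

text \<open>
  The linear equation for \<open>z\<close> has the coefficient \<open>u\<close>. A solution is the case \<open>z = u\<close>, a difference of
  two solutions is the other case of interest.
\<close>

lemma energy_growth:
  assumes S: "finite S" and m: "weight q m" and \<mu>: "0 < \<mu>"
    and u: "\<And>t n. t \<in> {0..\<tau>} \<Longrightarrow> ((\<lambda>t. u t n) has_vector_derivative u' t n) (at t within {0..\<tau>})"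
    and z: "\<And>t k. t \<in> {0..\<tau>} \<Longrightarrow> k \<in> S \<Longrightarrow> ((\<lambda>t. z t k) has_vector_derivative z' t k) (at t within {0..\<tau>})"
    and z': "\<And>t k. t \<in> {0..\<tau>} \<Longrightarrow> k \<in> S \<Longrightarrow> ((\<lambda>t. z' t k) has_vector_derivative
        - of_real (\<mu> * (of_int k)\<^sup>2) * z t k
        + of_int \<bar>k\<bar> * (\<Sum>l\<in>S. of_real (kern k l) * u t (k - l) * z t l) + r t k) (at t within {0..\<tau>})"
    and herm: "\<And>t n. t \<in> {0..\<tau>} \<Longrightarrow> u t (- n) = cnj (u t n)"
    and small: "\<And>t. t \<in> {0..\<tau>} \<Longrightarrow> sums_below (\<lambda>n. of_int \<bar>n\<bar> * cmod (u t n)) (\<mu> / 4)"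
    and A: "\<And>t. t \<in> {0..\<tau>} \<Longrightarrow> sums_below (\<lambda>n. (of_int n)\<^sup>2 * cmod (u t n)) A"
    and A': "\<And>t. t \<in> {0..\<tau>} \<Longrightarrow> sums_below (\<lambda>n. of_int \<bar>n\<bar> * cmod (u' t n)) A"
    and r: "\<And>t. t \<in> {0..\<tau>} \<Longrightarrow> (\<Sum>k\<in>S. (m k)\<^sup>2 * (cmod (r t k) * cmod (z' t k)))
        \<le> c * (\<Sum>k\<in>S. en m (z t) (z' t) k) + e"
    and ce: "0 \<le> c" "0 \<le> e" and t: "t \<in> {0..\<tau>}"
  shows "(\<Sum>k\<in>S. en m (z t) (z' t) k) \<le> 2 / min 1 \<mu> *
    (((1 + 2 * \<mu>) * (\<Sum>k\<in>S. en m (z 0) (z' 0) k) + 2 * e * t)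
      * exp (2 / min 1 \<mu> * ((4 * (2 ^ q + 1) + 2) * A + 2 * c) * t))"
proof -
  have m0: "0 \<le> m k" for k using m by (simp add: weight_def)
  define X where "X t = (\<Sum>k\<in>S. en m (z t) (z' t) k)" for t
  define E where "E t = energy \<mu> S m (u t) (z t) (z' t)" for t
  define K where "K = (4 * (2 ^ q + 1) + 2) * A + 2 * c"
  define \<nu> where "\<nu> = min 1 \<mu>"
  define z'' where "z'' t k = - of_real (\<mu> * (of_int k)\<^sup>2) * z t k
        + of_int \<bar>k\<bar> * (\<Sum>l\<in>S. of_real (kern k l) * u t (k - l) * z t l) + r t k" for t k
  define E' where "E' t = 2 * (\<Sum>k\<in>S. (m k)\<^sup>2 * Re ((z'' t k + of_real (\<mu> * (of_int k)\<^sup>2) * z t k) * cnj (z' t k)))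
     - 2 * Re (correction S m (u' t) (z t) (z t)) - 4 * Re (correction S m (u t) (z t) (z' t))" for t
  have \<nu>: "\<nu> > 0" using \<mu> by (simp add: \<nu>_def)
  have lo: "\<nu> / 2 * X s \<le> E s" and up: "E s \<le> (1 + 2 * \<mu>) * X s" if "s \<in> {0..\<tau>}" for s
    unfolding X_def E_def \<nu>_def by (rule energy_bounds[OF S m0 small[OF that]]; simp)+
  have "0 \<le> A" using sums_below_nonneg A t by blast
  then have K: "0 \<le> K" using ce by (simp add: K_def)
  have "E t \<le> (E 0 + 2 * e * t) * exp (K * (2 / \<nu>) * t)"
  proof (rule real_gronwall[where \<tau> = \<tau> and E' = E'])
    fix s assume s: "s \<in> {0..\<tau>}"
    show "(E has_real_derivative E' s) (at s within {0..\<tau>})"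
      unfolding E_def E'_def using z'[OF s]
      by (intro has_real_derivative_energy S u z herm s) (auto simp: z''_def)
    have "E' s \<le> K * X s + 2 * e"
      unfolding E'_def K_def X_def
      by (rule energy_derivative_le[OF S m herm[OF s] _ A[OF s] A'[OF s] r[OF s]]) (simp add: z''_def)
    also have "X s \<le> 2 / \<nu> * E s" using lo[OF s] \<nu> by (simp add: field_simps)
    finally show "E' s \<le> K * (2 / \<nu>) * E s + 2 * e" using K by (simp add: mult_left_mono mult.assoc)
  qed (use K \<nu> ce t in auto)
  also have "\<dots> \<le> ((1 + 2 * \<mu>) * X 0 + 2 * e * t) * exp (K * (2 / \<nu>) * t)"
    using up[of 0] t by (intro mult_right_mono) auto
  finally have "\<nu> / 2 * X t \<le> ((1 + 2 * \<mu>) * X 0 + 2 * e * t) * exp (K * (2 / \<nu>) * t)"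
    using lo[OF t] by simp
  then have "2 / \<nu> * (\<nu> / 2 * X t) \<le> 2 / \<nu> * (((1 + 2 * \<mu>) * X 0 + 2 * e * t) * exp (K * (2 / \<nu>) * t))"
    using \<nu> by (intro mult_left_mono) auto
  moreover have "2 / \<nu> * (\<nu> / 2 * X t) = X t" using \<nu> by simp
  ultimately have "X t \<le> 2 / \<nu> * (((1 + 2 * \<mu>) * X 0 + 2 * e * t) * exp (2 / \<nu> * K * t))"
    by (simp only: mult.commute[of K])
  then show ?thesis by (simp only: X_def K_def \<nu>_def)
qed

section \<open>Picard iteration for finite systems\<close>

lemma has_integral_power_over_fact:
  fixes t :: real
  assumes "0 \<le> t"
  shows "((\<lambda>s. M * (c * s) ^ n / fact n) has_integral (M * c ^ n * t ^ Suc n / fact (Suc n))) {0..t}"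
proof -
  have "((\<lambda>s. M * (c * s) ^ n / fact n) has_integral
      (M * c ^ n * t ^ Suc n / fact (Suc n) - M * c ^ n * 0 ^ Suc n / fact (Suc n))) {0..t}"
  proof (rule fundamental_theorem_of_calculus[OF assms])
    fix s
    have "((\<lambda>t. M * c ^ n * t ^ Suc n / fact (Suc n)) has_real_derivative
        M * c ^ n * (real (Suc n) * s ^ n) / fact (Suc n)) (at s within {0..t})"
      by (rule derivative_eq_intros refl | simp)+
    also have "M * c ^ n * (real (Suc n) * s ^ n) / fact (Suc n) = M * (c * s) ^ n / fact n"
      by (simp add: power_mult_distrib field_simps del: of_nat_Suc)
    finally show "((\<lambda>t. M * c ^ n * t ^ Suc n / fact (Suc n)) has_vector_derivative M * (c * s) ^ n / fact n)
        (at s within {0..t})"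
      by (simp add: has_real_derivative_iff_has_vector_derivative)
  qed
  then show ?thesis by simp
qed

text \<open>
  A global Lipschitz condition makes the Picard iteration converge on the whole of a given interval.
  The index set is finite but not a type, because the number of Galerkin modes varies.
\<close>

lemma picard_system:
  fixes f :: "('i \<Rightarrow> complex) \<Rightarrow> 'i \<Rightarrow> complex" and a :: "'i \<Rightarrow> complex"
  assumes I: "finite I" and L: "0 \<le> L" and \<tau>: "0 \<le> \<tau>"
    and lip: "\<And>y z i. i \<in> I \<Longrightarrow> cmod (f y i - f z i) \<le> L * (\<Sum>j\<in>I. cmod (y j - z j))"
  obtains y where "\<And>i. i \<in> I \<Longrightarrow> y 0 i = a i"
    "\<And>i t. i \<in> I \<Longrightarrow> t \<in> {0..\<tau>} \<Longrightarrow> ((\<lambda>s. y s i) has_vector_derivative f (y t) i) (at t within {0..\<tau>})"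
proof -
  define Y :: "nat \<Rightarrow> real \<Rightarrow> 'i \<Rightarrow> complex" where "Y = rec_nat (\<lambda>t i. a i) (\<lambda>_ y t i. a i + integral {0..t} (\<lambda>s. f (y s) i))"
  have Y0: "Y 0 t i = a i" and YS: "Y (Suc n) t i = a i + integral {0..t} (\<lambda>s. f (Y n s) i)" for n t i
    by (simp_all add: Y_def)
  have contf: "continuous_on T (\<lambda>s. f (y s) i)" if "i \<in> I" "\<And>j. j \<in> I \<Longrightarrow> continuous_on T (\<lambda>s. y s j)"
    for T :: "real set" and y i
    unfolding continuous_on_def
  proof
    fix t assume t: "t \<in> T"
    have "((\<lambda>s. cmod (f (y s) i - f (y t) i)) \<longlongrightarrow> 0) (at t within T)"
    proof (rule tendsto_sandwich[OF _ _ tendsto_const])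
      show "((\<lambda>s. L * (\<Sum>j\<in>I. cmod (y s j - y t j))) \<longlongrightarrow> 0) (at t within T)"
        using that(2) t by (auto intro!: tendsto_eq_intros simp: continuous_on_def)
    qed (use lip[OF that(1)] in auto)
    then show "((\<lambda>s. f (y s) i) \<longlongrightarrow> f (y t) i) (at t within T)"
      by (rule LIM_zero_cancel[OF tendsto_norm_zero_cancel])
  qed
  have contY: "continuous_on {0..\<tau>} (\<lambda>s. Y n s i)" if "i \<in> I" for n i
    using that
  proof (induction n arbitrary: i)
    case (Suc n)
    have "(\<lambda>s. f (Y n s) i) integrable_on {0..\<tau>}"
      by (rule integrable_continuous_real) (rule contf[OF Suc.prems Suc.IH])
    then show ?case unfolding YS by (intro continuous_intros indefinite_integral_continuous_1)
  qed (simp add: Y0)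
  have fint: "(\<lambda>s. f (Y n s) i) integrable_on {0..t}" if "i \<in> I" "t \<in> {0..\<tau>}" for n i t
    by (rule integrable_continuous_real, rule continuous_on_subset[of "{0..\<tau>}"])
       (use that contY in \<open>auto intro!: contf\<close>)
  define M where "M = \<tau> * (\<Sum>i\<in>I. cmod (f a i))"
  define c where "c = real (card I) * L"
  have c: "0 \<le> c" using L by (simp add: c_def)
  have M: "0 \<le> M" using \<tau> by (auto simp: M_def intro!: mult_nonneg_nonneg sum_nonneg)
  have diff: "(\<Sum>i\<in>I. cmod (Y (Suc n) t i - Y n t i)) \<le> M * (c * t) ^ n / fact n" if "t \<in> {0..\<tau>}" for n t
    using that
  proof (induction n arbitrary: t)
    case 0
    have "(\<Sum>i\<in>I. cmod (Y (Suc 0) t i - Y 0 t i)) = (\<Sum>i\<in>I. t * cmod (f a i))"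
      using 0 by (simp add: YS Y0[abs_def] norm_mult)
    also have "\<dots> = t * (\<Sum>i\<in>I. cmod (f a i))" by (simp add: sum_distrib_left)
    also have "\<dots> \<le> M" unfolding M_def using 0 by (intro mult_right_mono sum_nonneg) auto
    finally show ?case by simp
  next
    case (Suc n)
    have "cmod (Y (Suc (Suc n)) t i - Y (Suc n) t i) \<le> L * (M * c ^ n * t ^ Suc n / fact (Suc n))" if i: "i \<in> I" for i
    proof -
      have "cmod (Y (Suc (Suc n)) t i - Y (Suc n) t i)
          = cmod (integral {0..t} (\<lambda>s. f (Y (Suc n) s) i - f (Y n s) i))"
        by (simp add: YS[of "Suc n"] YS[of n] Henstock_Kurzweil_Integration.integral_diff[OF fint[OF i Suc.prems] fint[OF i Suc.prems]])
      also have "\<dots> \<le> integral {0..t} (\<lambda>s. L * (M * (c * s) ^ n / fact n))"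
      proof (rule integral_norm_bound_integral)
        show "(\<lambda>s. f (Y (Suc n) s) i - f (Y n s) i) integrable_on {0..t}"
          by (intro integrable_diff fint i Suc.prems)
        show "(\<lambda>s. L * (M * (c * s) ^ n / fact n)) integrable_on {0..t}"
          by (intro integrable_continuous_real continuous_intros) auto
        fix s assume "s \<in> {0..t}"
        then have "s \<in> {0..\<tau>}" using Suc.prems by auto
        from mult_left_mono[OF Suc.IH[OF this] L]
        show "cmod (f (Y (Suc n) s) i - f (Y n s) i) \<le> L * (M * (c * s) ^ n / fact n)"
          using lip[OF i] order_trans by blast
      qed
      also have "\<dots> = L * (M * c ^ n * t ^ Suc n / fact (Suc n))"
        using has_integral_mult_right[OF has_integral_power_over_fact[of t M c n], of L] Suc.prems by (intro integral_unique) auto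
      finally show ?thesis .
    qed
    then have "(\<Sum>i\<in>I. cmod (Y (Suc (Suc n)) t i - Y (Suc n) t i))
        \<le> (\<Sum>i\<in>I. L * (M * c ^ n * t ^ Suc n / fact (Suc n)))" by (rule sum_mono)
    also have "\<dots> = M * (c * t) ^ Suc n / fact (Suc n)"
      by (simp add: c_def power_mult_distrib)
    finally show ?case .
  qed
  have step: "cmod (Y (Suc n) t i - Y n t i) \<le> M * (c * \<tau>) ^ n / fact n" if "i \<in> I" "t \<in> {0..\<tau>}" for n t i
  proof -
    have "cmod (Y (Suc n) t i - Y n t i) \<le> (\<Sum>i\<in>I. cmod (Y (Suc n) t i - Y n t i))"
      by (rule member_le_sum[OF that(1) _ I]) simp
    also have "\<dots> \<le> M * (c * t) ^ n / fact n" by (rule diff[OF that(2)])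
    also have "\<dots> \<le> M * (c * \<tau>) ^ n / fact n"
      using that M c by (intro divide_right_mono mult_left_mono power_mono) auto
    finally show ?thesis .
  qed
  have summ: "summable (\<lambda>n. M * (c * \<tau>) ^ n / fact n)"
    using summable_mult[OF summable_exp[of "c * \<tau>"], of M] by (simp add: field_simps)
  define y where "y t i = a i + (\<Sum>n. Y (Suc n) t i - Y n t i)" for t i
  have unif: "uniform_limit {0..\<tau>} (\<lambda>n t. Y n t i) (\<lambda>t. y t i) sequentially" if i: "i \<in> I" for i
  proof -
    have "uniform_limit {0..\<tau>} (\<lambda>n t. \<Sum>m<n. Y (Suc m) t i - Y m t i) (\<lambda>t. \<Sum>m. Y (Suc m) t i - Y m t i) sequentially"
      by (rule Weierstrass_m_test[OF _ summ]) (use step[OF i] in auto)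
    then have "uniform_limit {0..\<tau>} (\<lambda>n t. a i + (\<Sum>m<n. Y (Suc m) t i - Y m t i)) (\<lambda>t. y t i) sequentially"
      unfolding y_def by (intro uniform_limit_intros)
    moreover have "(\<Sum>m<n. Y (Suc m) t i - Y m t i) = Y n t i - a i" for n t
      using sum_lessThan_telescope[of "\<lambda>m. Y m t i" n] by (simp add: Y0)
    ultimately show ?thesis by simp
  qed
  have conty: "continuous_on {0..\<tau>} (\<lambda>t. y t i)" if i: "i \<in> I" for i
    by (rule uniform_limit_theorem[OF _ unif[OF i]]) (simp_all add: contY[OF i])
  have fy: "y t i = a i + integral {0..t} (\<lambda>s. f (y s) i)" if i: "i \<in> I" and t: "t \<in> {0..\<tau>}" for t i
  proof -
    have "uniform_limit {0..t} (\<lambda>n s. f (Y n s) i) (\<lambda>s. f (y s) i) sequentially"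
      unfolding uniform_limit_iff
    proof (intro allI impI)
      fix e :: real assume e: "e > 0"
      have "\<forall>\<^sub>F n in sequentially. \<forall>j\<in>I. \<forall>s\<in>{0..\<tau>}. dist (Y n s j) (y s j) < e / (c + 1)"
        using unif e c by (intro eventually_ball_finite[OF I] ballI) (auto simp: uniform_limit_iff)
      then show "\<forall>\<^sub>F n in sequentially. \<forall>s\<in>{0..t}. dist (f (Y n s) i) (f (y s) i) < e"
      proof eventually_elim
        case (elim n)
        show ?case
        proof
          fix s assume s: "s \<in> {0..t}"
          have "dist (f (Y n s) i) (f (y s) i) \<le> L * (\<Sum>j\<in>I. cmod (Y n s j - y s j))"
            using lip[OF i] by (simp add: dist_norm)
          also have "\<dots> \<le> L * (\<Sum>j\<in>I. e / (c + 1))"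
            using elim s t L by (intro mult_left_mono sum_mono) (auto simp: dist_norm less_imp_le)
          also have "\<dots> = c * e / (c + 1)" by (simp add: c_def)
          also have "\<dots> < e" using e c by (simp add: field_simps)
          finally show "dist (f (Y n s) i) (f (y s) i) < e" .
        qed
      qed
    qed
    moreover have "continuous_on {0..t} (\<lambda>s. f (Y n s) i)" for n
      by (rule continuous_on_subset[OF contf[OF i contY]]) (use t in auto)
    ultimately obtain A B where AB: "\<And>n. ((\<lambda>s. f (Y n s) i) has_integral A n) {0..t}"
        "((\<lambda>s. f (y s) i) has_integral B) {0..t}" "A \<longlonglongrightarrow> B"
      by (rule uniform_limit_integral) (simp, blast)
    then have "(\<lambda>n. integral {0..t} (\<lambda>s. f (Y n s) i)) \<longlonglongrightarrow> integral {0..t} (\<lambda>s. f (y s) i)"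
      by (simp add: integral_unique[OF AB(1)] integral_unique[OF AB(2)])
    then have "(\<lambda>n. Y (Suc n) t i) \<longlonglongrightarrow> a i + integral {0..t} (\<lambda>s. f (y s) i)"
      unfolding YS by (intro tendsto_intros)
    moreover have "(\<lambda>n. Y (Suc n) t i) \<longlonglongrightarrow> y t i"
      using tendsto_uniform_limitI[OF unif[OF i] t] by (rule LIMSEQ_Suc)
    ultimately show ?thesis using LIMSEQ_unique by blast
  qed
  show ?thesis
  proof
    show "y 0 i = a i" if "i \<in> I" for i
      using fy[OF that, of 0] \<tau> by simp
    fix i t assume i: "i \<in> I" and t: "t \<in> {0..\<tau>}"
    have "((\<lambda>t. a i + integral {0..t} (\<lambda>s. f (y s) i)) has_vector_derivative f (y t) i) (at t within {0..\<tau>})"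
      using integral_has_vector_derivative[OF contf[OF i conty] t]
      by (auto intro!: derivative_eq_intros)
    then show "((\<lambda>s. y s i) has_vector_derivative f (y t) i) (at t within {0..\<tau>})"
      by (rule has_vector_derivative_transform[OF t, rotated]) (simp add: fy[OF i])
  qed
qed

section \<open>Galerkin approximations\<close>

lemma inverse_square_summable_int: "(\<lambda>n::int. 1 / (of_int n)\<^sup>2 :: real) summable_on UNIV"
proof (rule summable_on_int_iff)
  have "summable (\<lambda>n. 1 / (real n)\<^sup>2)"
    using inverse_power_summable[of 2, where 'a = real] by (simp add: field_simps)
  then have "(\<lambda>n. 1 / (real n)\<^sup>2) summable_on UNIV"
    by (intro norm_summable_imp_summable_on) auto
  then show "(\<lambda>n. 1 / (of_int (int n))\<^sup>2 :: real) summable_on UNIV"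
    "(\<lambda>n. 1 / (of_int (- int n))\<^sup>2 :: real) summable_on UNIV" by simp_all
qed

definition sqrt_zeta :: real where
  "sqrt_zeta = sqrt (\<Sum>\<^sub>\<infinity>n::int. 1 / (of_int n)\<^sup>2)"

lemma sqrt_zeta_nonneg: "0 \<le> sqrt_zeta"
  by (simp add: sqrt_zeta_def infsum_nonneg)

text \<open>
  Cauchy-Schwarz against \<open>1/n\<close>; the value at \<open>0\<close> is not seen by the left-hand side and is required to
  vanish.
\<close>

lemma sums_below_l2_l1:
  fixes f :: "int \<Rightarrow> real"
  assumes "sums_below (\<lambda>n. (of_int n * f n)\<^sup>2) M" "f 0 = 0"
  shows "sums_below f (sqrt_zeta * sqrt M)"
  unfolding sums_below_def
proof (intro allI impI)
  fix F :: "int set" assume F: "finite F"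
  have "(\<Sum>n\<in>F. f n) = (\<Sum>n\<in>F. (1 / of_int n) * (of_int n * f n))"
    using assms(2) by (intro sum.cong) auto
  also have "\<dots> \<le> sqrt (\<Sum>n\<in>F. (1 / of_int n)\<^sup>2) * sqrt (\<Sum>n\<in>F. (of_int n * f n)\<^sup>2)"
    unfolding real_sqrt_mult[symmetric] by (intro real_le_rsqrt Cauchy_Schwarz_ineq_sum)
  also have "\<dots> \<le> sqrt_zeta * sqrt M"
  proof (rule mult_mono)
    have "(\<Sum>n\<in>F. 1 / (of_int n)\<^sup>2) \<le> (\<Sum>\<^sub>\<infinity>n::int. 1 / (of_int n)\<^sup>2 :: real)"
      by (rule finite_sum_le_infsum[OF inverse_square_summable_int F]) auto
    then show "sqrt (\<Sum>n\<in>F. (1 / of_int n)\<^sup>2) \<le> sqrt_zeta"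
      by (simp add: sqrt_zeta_def power_divide)
    show "sqrt (\<Sum>n\<in>F. (of_int n * f n)\<^sup>2) \<le> sqrt M"
      using sums_belowD[OF assms(1) F] by simp
  qed (auto simp: sqrt_zeta_nonneg intro: sum_nonneg)
  finally show "sum f F \<le> sqrt_zeta * sqrt M" .
qed

abbreviation sq :: "int \<Rightarrow> real" where "sq k \<equiv> (of_int k)\<^sup>2"

lemma weight_sq: "weight 2 (\<lambda>k. sq k)"
proof -
  have "sq k \<le> sq l" if "\<bar>k\<bar> \<le> \<bar>l\<bar>" for k l :: int
  proof -
    have "k\<^sup>2 \<le> l\<^sup>2" using that by (simp only: abs_le_square_iff)
    then show ?thesis by (metis of_int_le_iff of_int_power)
  qed
  then show ?thesis by (simp add: weight_def mult.commute)
qed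

text \<open>
  The weight \<open>k\<^sup>2\<close> is the level \<open>H\<^sup>3 \<times> H\<^sup>2\<close>, which controls all coefficients of the energy estimate.
\<close>

lemma en_sq: "en (\<lambda>k. sq k) u v k = (of_int k ^ 2 * cmod (v k))\<^sup>2 + (of_int k ^ 3 * cmod (u k))\<^sup>2"
proof -
  have "(of_int k ^ 3)\<^sup>2 = (sq k)\<^sup>2 * sq k" by (simp flip: power_mult power_add)
  then show ?thesis by (simp add: en_def power_mult_distrib distrib_left)
qed

lemma en_sq_bounds:
  assumes "sums_below (en (\<lambda>k. sq k) u v) M"
  shows "sums_below (\<lambda>n. (of_int n)\<^sup>2 * cmod (u n)) (sqrt_zeta * sqrt M)"
    and "sums_below (\<lambda>n. of_int \<bar>n\<bar> * cmod (v n)) (sqrt_zeta * sqrt M)"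
    and "sums_below (\<lambda>n. of_int \<bar>n\<bar> * cmod (u n)) (sqrt_zeta * sqrt M)"
proof -
  show *: "sums_below (\<lambda>n. (of_int n)\<^sup>2 * cmod (u n)) (sqrt_zeta * sqrt M)"
  proof (rule sums_below_l2_l1[OF sums_below_mono[OF assms]])
    show "(of_int n * ((of_int n)\<^sup>2 * cmod (u n)))\<^sup>2 \<le> en (\<lambda>k. sq k) u v n" for n
      unfolding en_sq power_mult_distrib by (simp add: power_mult_distrib flip: power_add power_mult power_Suc)
  qed auto
  show "sums_below (\<lambda>n. of_int \<bar>n\<bar> * cmod (v n)) (sqrt_zeta * sqrt M)"
  proof (rule sums_below_l2_l1[OF sums_below_mono[OF assms]])
    show "(of_int n * (of_int \<bar>n\<bar> * cmod (v n)))\<^sup>2 \<le> en (\<lambda>k. sq k) u v n" for n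
      unfolding en_sq power_mult_distrib by (simp add: power_mult_distrib flip: power_add power_mult)
  qed auto
  show "sums_below (\<lambda>n. of_int \<bar>n\<bar> * cmod (u n)) (sqrt_zeta * sqrt M)"
  proof (rule sums_below_mono[OF *])
    fix n :: int
    have "\<bar>n\<bar> \<le> n\<^sup>2"
    proof (cases "n = 0")
      case False
      then have "\<bar>n\<bar> * 1 \<le> \<bar>n\<bar> * \<bar>n\<bar>" by (intro mult_left_mono) auto
      then show ?thesis by (simp add: power2_eq_square)
    qed simp
    then have "real_of_int \<bar>n\<bar> \<le> of_int (n\<^sup>2)" by (rule of_int_le_iff[THEN iffD2])
    then show "of_int \<bar>n\<bar> * cmod (u n) \<le> (of_int n)\<^sup>2 * cmod (u n)"
      by (intro mult_right_mono) auto
  qed auto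
qed

definition bilin :: "(int \<Rightarrow> complex) \<Rightarrow> int \<Rightarrow> complex" where
  "bilin u k = (\<Sum>\<^sub>\<infinity>l. of_real (kern k l) * u (k - l) * u l)"

text \<open>
  The velocity \<open>v\<close> is the derivative of \<open>u\<close> in all modes, but the equation of motion is required for
  \<open>\<bar>k\<bar> \<le> N\<close> only. Both the Galerkin approximation of order \<open>N\<close> and the exact solution satisfy this, so
  that they can be compared.
\<close>

definition modes_upto :: "real \<Rightarrow> int \<Rightarrow> real set \<Rightarrow> (real \<Rightarrow> int \<Rightarrow> complex) \<Rightarrow> (real \<Rightarrow> int \<Rightarrow> complex) \<Rightarrow> bool" where
  "modes_upto \<mu> N I u v \<longleftrightarrow> (\<forall>t\<in>I. (\<forall>k. u t (- k) = cnj (u t k)) \<and>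
     (\<forall>k. ((\<lambda>t. u t k) has_vector_derivative v t k) (at t within I)) \<and>
     (\<forall>k. \<bar>k\<bar> \<le> N \<longrightarrow> ((\<lambda>t. v t k) has_vector_derivative
        - of_real (\<mu> * (of_int k)\<^sup>2) * u t k + of_int \<bar>k\<bar> * bilin (u t) k) (at t within I)))"

lemma bilin_finite:
  assumes "\<And>k. N < \<bar>k\<bar> \<Longrightarrow> u k = 0"
  shows "bilin u k = (\<Sum>l\<in>{-N..N}. of_real (kern k l) * u (k - l) * u l)"
  unfolding bilin_def
  by (subst infsum_finite[symmetric], simp, rule infsum_cong_neutral) (use assms in auto)

text \<open>
  At the first time at which \<open>c\<close> is attained the value would have to be smaller than \<open>c\<close>.
\<close>

lemma bootstrap:
  fixes P :: "real \<Rightarrow> real"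
  assumes cont: "continuous_on {0..\<tau>} P" and P0: "P 0 \<le> c"
    and step: "\<And>t. t \<in> {0..\<tau>} \<Longrightarrow> (\<And>s. s \<in> {0..t} \<Longrightarrow> P s \<le> c) \<Longrightarrow> P t < c"
    and t: "t \<in> {0..\<tau>}"
  shows "P t < c"
proof (rule ccontr)
  assume nt: "\<not> P t < c"
  define C where "C = {s \<in> {0..\<tau>}. c \<le> P s}"
  have "compact C"
  proof -
    have "C = {0..\<tau>} \<inter> P -` {c..}" by (auto simp: C_def)
    then have "closed C" using continuous_closed_preimage[OF cont, of "{c..}"] by simp
    moreover have "bounded C" by (rule bounded_subset[of "{0..\<tau>}"]) (auto simp: C_def)
    ultimately show ?thesis by (simp add: compact_eq_bounded_closed)
  qed
  moreover have "C \<noteq> {}" using nt t by (auto simp: C_def)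
  ultimately obtain m where m: "m \<in> C" "\<And>s. s \<in> C \<Longrightarrow> m \<le> s"
    by (meson compact_attains_inf)
  have lt: "P s < c" if "0 \<le> s" "s < m" for s
    using m that by (force simp: C_def)
  have "P m \<le> c"
  proof (rule ccontr)
    assume "\<not> P m \<le> c"
    then have mc: "c < P m" by simp
    then have "0 < m" using P0 m by (cases "m = 0") (auto simp: C_def)
    moreover have "continuous_on {0..m} P" by (rule continuous_on_subset[OF cont]) (use m in \<open>auto simp: C_def\<close>)
    ultimately obtain s where s: "0 \<le> s" "s \<le> m" "P s = c" using IVT'[of P 0 c m] P0 mc by auto
    then show False using lt[of s] mc by (cases "s = m") auto
  qed
  then have "P m < c" using lt m by (intro step) (force simp: C_def)+
  then show False using m by (auto simp: C_def)
qed

text \<open>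
  For sequences supported in \<open>\<bar>k\<bar> \<le> N\<close> the interaction is the truncated sum, and the energy estimate
  applies with \<open>z = u\<close> and without remainder.
\<close>

lemma modes_energy_growth:
  assumes sol: "modes_upto \<mu> N {0..\<tau>} u v" and m: "weight q m" and \<mu>: "0 < \<mu>"
    and supp: "\<And>t k. t \<in> {0..\<tau>} \<Longrightarrow> N < \<bar>k\<bar> \<Longrightarrow> u t k = 0"
    and M: "\<And>t. t \<in> {0..\<tau>} \<Longrightarrow> sums_below (en (\<lambda>k. sq k) (u t) (v t)) M"
    and small: "sqrt_zeta * sqrt M \<le> \<mu> / 4" and t: "t \<in> {0..\<tau>}"
  shows "(\<Sum>k\<in>{-N..N}. en m (u t) (v t) k) \<le> 2 / min 1 \<mu> * (1 + 2 * \<mu>)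
    * exp (2 / min 1 \<mu> * (4 * (2 ^ q + 1) + 2) * (sqrt_zeta * sqrt M) * t) * (\<Sum>k\<in>{-N..N}. en m (u 0) (v 0) k)"
proof -
  have "(\<Sum>k\<in>{-N..N}. en m (u t) (v t) k) \<le> 2 / min 1 \<mu> *
    (((1 + 2 * \<mu>) * (\<Sum>k\<in>{-N..N}. en m (u 0) (v 0) k) + 2 * 0 * t)
      * exp (2 / min 1 \<mu> * ((4 * (2 ^ q + 1) + 2) * (sqrt_zeta * sqrt M) + 2 * 0) * t))"
  proof (rule energy_growth[where r = "\<lambda>_ _. 0" and \<tau> = \<tau> and u = u and u' = v])
    fix s k assume s: "s \<in> {0..\<tau>}" and k: "k \<in> {-N..N}"
    have "((\<lambda>t. v t k) has_vector_derivative
        - of_real (\<mu> * (of_int k)\<^sup>2) * u s k + of_int \<bar>k\<bar> * bilin (u s) k) (at s within {0..\<tau>})"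
      using sol s k by (auto simp: modes_upto_def)
    then show "((\<lambda>t. v t k) has_vector_derivative
        - of_real (\<mu> * (of_int k)\<^sup>2) * u s k + of_int \<bar>k\<bar> *
        (\<Sum>l\<in>{-N..N}. of_real (kern k l) * u s (k - l) * u s l) + 0) (at s within {0..\<tau>})"
      by (simp add: bilin_finite[OF supp[OF s]])
  next
    fix s assume s: "s \<in> {0..\<tau>}"
    show "sums_below (\<lambda>n. of_int \<bar>n\<bar> * cmod (u s n)) (\<mu> / 4)"
      by (rule sums_below_mono[OF en_sq_bounds(3)[OF M[OF s]] _ small]) simp
    show "sums_below (\<lambda>n. (of_int n)\<^sup>2 * cmod (u s n)) (sqrt_zeta * sqrt M)"
      "sums_below (\<lambda>n. of_int \<bar>n\<bar> * cmod (v s n)) (sqrt_zeta * sqrt M)"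
      by (rule en_sq_bounds[OF M[OF s]])+
  qed (use sol m \<mu> t in \<open>auto simp: modes_upto_def\<close>)
  then show ?thesis by (simp only: mult_zero_right mult_zero_left add_0_right mult_ac)
qed

lemma sum_kern_cnj:
  assumes "\<And>k. u (- k) = cnj (u k)"
  shows "(\<Sum>l\<in>{-N..N}. of_real (kern (- k) l) * u (- k - l) * u l)
    = cnj (\<Sum>l\<in>{-N..N}. of_real (kern k l) * u (k - l) * u l)"
proof -
  have "(\<Sum>l\<in>{-N..N}. of_real (kern (- k) l) * u (- k - l) * u l)
      = (\<Sum>l\<in>{-N..N}. of_real (kern (- k) (- l)) * u (- k - - l) * u (- l))"
    by (rule sum.reindex_bij_witness[of _ uminus uminus]) auto
  also have "\<dots> = (\<Sum>l\<in>{-N..N}. cnj (of_real (kern k l) * u (k - l) * u l))"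
  proof (intro sum.cong refl)
    fix l
    have "u (- k - - l) = cnj (u (k - l))" using assms[of "k - l"] by simp
    then show "of_real (kern (- k) (- l)) * u (- k - - l) * u (- l) = cnj (of_real (kern k l) * u (k - l) * u l)"
      by (simp add: kern_minus assms)
  qed
  finally show ?thesis by simp
qed

text \<open>
  The quadratic vector field is made globally Lipschitz by clipping every coefficient to the closed
  unit disc. The energy bound \<open>B * D \<le> 1\<close> then shows that the clipping is never active. Bounds of the
  form \<open>P \<le> B * D\<close> are bootstrapped: under this assumption the energy estimate gives \<open>P \<le> B * D / 2\<close>, since
  the constant \<open>B\<close> is twice the constant of the estimate, with exponential factor at most \<open>exp 1\<close>.
\<close>

lemma galerkin_exists:
  fixes a b :: "int \<Rightarrow> complex" and N :: int
  assumes \<mu>: "0 < \<mu>" and \<tau>: "0 \<le> \<tau>"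
    and herm: "\<And>k. a (- k) = cnj (a k)" "\<And>k. b (- k) = cnj (b k)"
    and zero: "a 0 = 0" "b 0 = 0"
    and D: "sums_below (en (\<lambda>k. sq k) a b) D" "0 < D"
    and B: "B = 4 / min 1 \<mu> * (1 + 2 * \<mu>) * exp 1"
    and BD: "B * D \<le> 1" "sqrt_zeta * sqrt (B * D) \<le> \<mu> / 4"
    and time: "44 / min 1 \<mu> * (sqrt_zeta * sqrt (B * D)) * \<tau> \<le> 1"
  obtains u v where "modes_upto \<mu> N {0..\<tau>} u v"
    and "\<And>t k. t \<in> {0..\<tau>} \<Longrightarrow> k = 0 \<or> N < \<bar>k\<bar> \<Longrightarrow> u t k = 0 \<and> v t k = 0"
    and "\<And>k. \<bar>k\<bar> \<le> N \<Longrightarrow> u 0 k = a k \<and> v 0 k = b k"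
    and "\<And>t. t \<in> {0..\<tau>} \<Longrightarrow> sums_below (en (\<lambda>k. sq k) (u t) (v t)) (B * D)"
proof -
  define S where "S = {-N..N}"
  have fS: "finite S" by (simp add: S_def)
  \<comment> \<open>The projection onto the unit disc is Lipschitz and the identity on the disc.\<close>
  define clip :: "complex \<Rightarrow> complex" where "clip = closest_point (cball 0 1)"
  have clip1: "cmod (clip z) \<le> 1" for z
    using closest_point_in_set[of "cball 0 1 :: complex set" z] by (simp add: clip_def)
  have clip_lip: "cmod (clip z - clip w) \<le> cmod (z - w)" for z w
    using closest_point_lipschitz[of "cball 0 1 :: complex set" z w] by (simp add: clip_def dist_norm)
  have clip_id: "clip z = z" if "cmod z \<le> 1" for z
    using that by (simp add: clip_def closest_point_self)
  \<comment> \<open>The unknowns are the positions and velocities, with flags \<open>False\<close> and \<open>True\<close>, for positive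
    frequencies only. The negative ones are defined by conjugation, so the solution is Hermitian.\<close>
  define ext :: "(bool \<times> int \<Rightarrow> complex) \<Rightarrow> bool \<Rightarrow> int \<Rightarrow> complex" where
    "ext y c k = (if 0 < k \<and> k \<le> N then y (c, k) else if k < 0 \<and> - N \<le> k then cnj (y (c, - k)) else 0)" for y c k
  define I where "I = (UNIV :: bool set) \<times> {1..N}"
  have fI: "finite I" by (simp add: I_def)
  define rhs where "rhs y k = - of_real (\<mu> * (of_int k)\<^sup>2) * ext y False k + of_int \<bar>k\<bar> *
     (\<Sum>l\<in>S. of_real (kern k l) * clip (ext y False (k - l)) * clip (ext y False l))" for y k
  define f where "f y i = (if fst i then rhs y (snd i) else y (True, snd i))" for y i
  define L where "L = 1 + \<mu> * (of_int N)\<^sup>2 + of_int \<bar>N\<bar> * (\<Sum>k\<in>S. \<Sum>l\<in>S. 2 * kern k l)"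
  have kern_sum: "0 \<le> (\<Sum>k\<in>S. \<Sum>l\<in>S. 2 * kern k l)" by (intro sum_nonneg) (simp add: kern_nonneg)
  have L: "0 \<le> L" using \<mu> kern_sum by (simp add: L_def)
  have lip: "cmod (f y i - f z i) \<le> L * (\<Sum>j\<in>I. cmod (y j - z j))" if i: "i \<in> I" for y z i
  proof -
    define d where "d = (\<Sum>j\<in>I. cmod (y j - z j))"
    have d0: "0 \<le> d" by (auto simp: d_def intro: sum_nonneg)
    have le_d: "cmod (y j - z j) \<le> d" if "j \<in> I" for j
      unfolding d_def by (rule member_le_sum[OF that _ fI]) simp
    have ext_d: "cmod (ext y c k - ext z c k) \<le> d" for c k
    proof -
      have "cmod (cnj (y (c, - k)) - cnj (z (c, - k))) = cmod (y (c, - k) - z (c, - k))"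
        by (metis complex_cnj_diff complex_mod_cnj)
      then show ?thesis using d0 by (auto simp: ext_def I_def intro!: le_d)
    qed
    obtain c k where ck: "i = (c, k)" "1 \<le> k" "k \<le> N" using i by (auto simp: I_def)
    show ?thesis
    proof (cases c)
      case False
      have "cmod (f y i - f z i) \<le> d" using False ck by (auto simp: f_def I_def intro: le_d)
      also have "\<dots> \<le> L * d" using d0 \<mu> kern_sum ck
        by (intro mult_right_mono[of 1 L d, simplified]) (auto simp: L_def)
      finally show ?thesis by (simp add: d_def)
    next
      case True
      have q: "cmod (clip (ext y False m) * clip (ext y False l) - clip (ext z False m) * clip (ext z False l)) \<le> 2 * d" for m l
      proof -
        have "cmod (clip (ext y False m) * clip (ext y False l) - clip (ext z False m) * clip (ext z False l))
          = cmod (clip (ext y False m) * (clip (ext y False l) - clip (ext z False l))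
            + (clip (ext y False m) - clip (ext z False m)) * clip (ext z False l))"
          by (simp add: algebra_simps)
        also have "\<dots> \<le> 1 * d + d * 1"
        proof (intro order_trans[OF norm_triangle_ineq] add_mono)
          show "cmod (clip (ext y False m) * (clip (ext y False l) - clip (ext z False l))) \<le> 1 * d"
            "cmod ((clip (ext y False m) - clip (ext z False m)) * clip (ext z False l)) \<le> d * 1"
            unfolding norm_mult by (intro mult_mono clip1 order_trans[OF clip_lip ext_d] d0 norm_ge_zero zero_le_one)+
        qed
        finally show ?thesis by simp
      qed
      have "f y i - f z i = - of_real (\<mu> * (of_int k)\<^sup>2) * (ext y False k - ext z False k)
         + of_int \<bar>k\<bar> * (\<Sum>l\<in>S. of_real (kern k l) * (clip (ext y False (k - l)) * clip (ext y False l)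
           - clip (ext z False (k - l)) * clip (ext z False l)))"
        using True ck by (simp add: f_def rhs_def sum_subtractf right_diff_distrib mult.assoc)
      also have "cmod \<dots> \<le> \<mu> * (of_int k)\<^sup>2 * d + of_int \<bar>k\<bar> * (\<Sum>l\<in>S. kern k l * (2 * d))"
      proof (intro order_trans[OF norm_triangle_ineq] add_mono)
        show "cmod (- of_real (\<mu> * (of_int k)\<^sup>2) * (ext y False k - ext z False k)) \<le> \<mu> * (of_int k)\<^sup>2 * d"
          using \<mu> ext_d[of False k] by (simp add: norm_mult norm_power mult_left_mono)
        have "cmod (\<Sum>l\<in>S. of_real (kern k l) * (clip (ext y False (k - l)) * clip (ext y False l)
           - clip (ext z False (k - l)) * clip (ext z False l))) \<le> (\<Sum>l\<in>S. kern k l * (2 * d))"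
        proof (intro sum_norm_le)
          show "cmod (of_real (kern k l) * (clip (ext y False (k - l)) * clip (ext y False l)
             - clip (ext z False (k - l)) * clip (ext z False l))) \<le> kern k l * (2 * d)" for l
            using q[of "k - l" l] by (simp add: norm_mult kern_nonneg mult_left_mono)
        qed
        then show "cmod (of_int \<bar>k\<bar> * (\<Sum>l\<in>S. of_real (kern k l) * (clip (ext y False (k - l)) * clip (ext y False l)
           - clip (ext z False (k - l)) * clip (ext z False l)))) \<le> of_int \<bar>k\<bar> * (\<Sum>l\<in>S. kern k l * (2 * d))"
          by (simp add: norm_mult mult_left_mono)
      qed
      also have "\<dots> = (\<mu> * (of_int k)\<^sup>2 + of_int \<bar>k\<bar> * (\<Sum>l\<in>S. 2 * kern k l)) * d"
        by (simp add: algebra_simps sum_distrib_left)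
      also have "\<dots> \<le> L * d"
      proof (intro mult_right_mono d0)
        have "(of_int k)\<^sup>2 \<le> (of_int N :: real)\<^sup>2" using ck by (intro power_mono) auto
        then have "\<mu> * (of_int k)\<^sup>2 \<le> \<mu> * (of_int N)\<^sup>2" using \<mu> by simp
        moreover have "(\<Sum>l\<in>S. 2 * kern k l) \<le> (\<Sum>k\<in>S. \<Sum>l\<in>S. 2 * kern k l)"
          by (rule member_le_sum[of k S "\<lambda>k. \<Sum>l\<in>S. 2 * kern k l"])
             (use ck fS in \<open>auto simp: S_def kern_nonneg intro!: sum_nonneg\<close>)
        then have "of_int \<bar>k\<bar> * (\<Sum>l\<in>S. 2 * kern k l) \<le> of_int \<bar>N\<bar> * (\<Sum>k\<in>S. \<Sum>l\<in>S. 2 * kern k l)"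
          using ck by (intro mult_mono sum_nonneg) (auto simp: kern_nonneg)
        ultimately show "\<mu> * (of_int k)\<^sup>2 + of_int \<bar>k\<bar> * (\<Sum>l\<in>S. 2 * kern k l) \<le> L"
          by (simp add: L_def)
      qed
      finally show ?thesis by (simp add: d_def)
    qed
  qed
  obtain y where y0: "\<And>i. i \<in> I \<Longrightarrow> y 0 i = (if fst i then b (snd i) else a (snd i))"
    and y: "\<And>i t. i \<in> I \<Longrightarrow> t \<in> {0..\<tau>} \<Longrightarrow> ((\<lambda>s. y s i) has_vector_derivative f (y t) i) (at t within {0..\<tau>})"
    by (rule picard_system[where f = f and a = "\<lambda>i. if fst i then b (snd i) else a (snd i)", OF fI L \<tau> lip]) (assumption, rule that)
  define u where "u t = ext (y t) False" for t
  define v where "v t = ext (y t) True" for t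
  have hu: "u t (- k) = cnj (u t k)" "v t (- k) = cnj (v t k)" for t k
    by (auto simp: u_def v_def ext_def)
  have supp: "u t k = 0 \<and> v t k = 0" if "k = 0 \<or> N < \<bar>k\<bar>" for t k
    using that by (auto simp: u_def v_def ext_def)
  have init: "u 0 k = a k \<and> v 0 k = b k" if "\<bar>k\<bar> \<le> N" for k
  proof -
    consider "k = 0" | "0 < k" | "k < 0" by linarith
    then show ?thesis
    proof cases
      case 3
      then have "u 0 k = cnj (a (- k))" "v 0 k = cnj (b (- k))"
        using that by (auto simp: u_def v_def ext_def y0 I_def)
      then show ?thesis by (simp add: herm)
    qed (use that zero in \<open>auto simp: u_def v_def ext_def y0 I_def\<close>)
  qed
  have du: "((\<lambda>t. u t k) has_vector_derivative v t k) (at t within {0..\<tau>})" if t: "t \<in> {0..\<tau>}" for t k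
  proof -
    have "((\<lambda>s. y s (False, k)) has_vector_derivative y t (True, k)) (at t within {0..\<tau>})" if "1 \<le> k" "k \<le> N" for k
      using y[of "(False, k)", OF _ t] that by (simp add: f_def I_def)
    then show ?thesis
      by (auto simp: u_def v_def ext_def intro!: bounded_linear.has_vector_derivative[OF bounded_linear_cnj])
  qed
  have dvp: "((\<lambda>t. v t k) has_vector_derivative rhs (y t) k) (at t within {0..\<tau>})" if t: "t \<in> {0..\<tau>}" "0 < k" "k \<le> N" for t k
    using y[of "(True, k)", OF _ t(1)] that by (simp add: f_def I_def v_def ext_def)
  define P where "P t = (\<Sum>k\<in>S. en (\<lambda>k. sq k) (u t) (v t) k)" for t
  have en_P: "sums_below (en (\<lambda>k. sq k) (u t) (v t)) M" if "P t \<le> M" for t M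
    unfolding sums_below_def
  proof (intro allI impI)
    fix F :: "int set" assume F: "finite F"
    have "sum (en (\<lambda>k. sq k) (u t) (v t)) F = sum (en (\<lambda>k. sq k) (u t) (v t)) (F \<inter> S)"
      by (rule sum.mono_neutral_right[OF F]) (auto simp: S_def en_def not_le supp)
    also have "\<dots> \<le> P t" unfolding P_def by (rule sum_mono2[OF fS]) (auto simp: en_nonneg)
    finally show "sum (en (\<lambda>k. sq k) (u t) (v t)) F \<le> M" using that by simp
  qed
  have small: "cmod (u t k) \<le> 1" if "P t \<le> B * D" for t k
  proof (cases "k = 0")
    case False
    have "(of_int k ^ 3 * cmod (u t k))\<^sup>2 \<le> 1"
      using sums_below_point[OF en_P[OF that], of k] BD(1) zero_le_power2[of "of_int k ^ 2 * cmod (v t k)"]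
      unfolding en_sq by linarith
    then have "\<bar>of_int k ^ 3 * cmod (u t k)\<bar> \<le> 1" by (simp only: abs_square_le_1)
    then have "\<bar>of_int k\<bar> ^ 3 * cmod (u t k) \<le> 1" by (simp add: abs_mult power_abs)
    moreover have "1 * cmod (u t k) \<le> \<bar>of_int k\<bar> ^ 3 * cmod (u t k)"
      using False by (intro mult_right_mono one_le_power) auto
    ultimately show ?thesis by simp
  qed (simp add: supp)
  have sol: "modes_upto \<mu> N {0..t} u v" if t: "t \<in> {0..\<tau>}" and Ps: "\<And>s. s \<in> {0..t} \<Longrightarrow> P s \<le> B * D" for t
    unfolding modes_upto_def
  proof (intro ballI conjI allI impI)
    fix s k assume s: "s \<in> {0..t}"
    then have s\<tau>: "s \<in> {0..\<tau>}" and sub: "{0..t} \<subseteq> {0..\<tau>}" using t by auto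
    show "u s (- k) = cnj (u s k)" by (rule hu)
    show "((\<lambda>t. u t k) has_vector_derivative v s k) (at s within {0..t})"
      by (rule has_vector_derivative_within_subset[OF du[OF s\<tau>] sub])
    define g where "g k = - of_real (\<mu> * (of_int k)\<^sup>2) * u s k + of_int \<bar>k\<bar> * bilin (u s) k" for k
    have bil: "bilin (u s) k = (\<Sum>l\<in>S. of_real (kern k l) * u s (k - l) * u s l)" for k
      unfolding S_def by (rule bilin_finite) (simp add: supp)
    have pos: "((\<lambda>t. v t k) has_vector_derivative g k) (at s within {0..t})" if k: "0 < k" "k \<le> N" for k
    proof -
      have "rhs (y s) k = g k"
        using small[OF Ps[OF s]] by (simp add: rhs_def g_def bil clip_id u_def[symmetric])
      then show ?thesis using has_vector_derivative_within_subset[OF dvp[OF s\<tau> k] sub] by simp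
    qed
    assume k: "\<bar>k\<bar> \<le> N"
    consider "k = 0" | "0 < k" | "k < 0" by linarith
    then have "((\<lambda>t. v t k) has_vector_derivative g k) (at s within {0..t})"
    proof cases
      case 1
      then show ?thesis by (simp add: supp g_def)
    next
      case 2
      then show ?thesis using pos k by simp
    next
      case 3
      have "bilin (u s) k = cnj (bilin (u s) (- k))"
        unfolding bil S_def using sum_kern_cnj[where u = "u s" and N = N and k = "- k", OF hu(1)] by simp
      then have "g k = cnj (g (- k))" by (simp add: g_def hu)
      moreover have "(\<lambda>t. v t k) = (\<lambda>t. cnj (v t (- k)))" by (simp add: hu)
      ultimately show ?thesis
        using bounded_linear.has_vector_derivative[OF bounded_linear_cnj pos[of "- k"]] 3 k by simp
    qed
    then show "((\<lambda>t. v t k) has_vector_derivative - of_real (\<mu> * (of_int k)\<^sup>2) * u s k + of_int \<bar>k\<bar> * bilin (u s) k)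
        (at s within {0..t})"
      by (simp add: g_def)
  qed
  have BD0: "0 < B" using \<mu> by (simp add: B)
  have P0: "P 0 \<le> D"
  proof -
    have "P 0 = (\<Sum>k\<in>S. en (\<lambda>k. sq k) a b k)"
      unfolding P_def by (intro sum.cong) (auto simp: en_def S_def init)
    then show ?thesis using sums_belowD[OF D(1) fS] by simp
  qed
  have B1: "1 \<le> B"
  proof -
    have "1 \<le> 4 / min 1 \<mu> * (1 + 2 * \<mu>)" using \<mu> by (auto simp: field_simps min_def)
    then have "1 * 1 \<le> (4 / min 1 \<mu> * (1 + 2 * \<mu>)) * exp 1" by (rule mult_mono) (use \<mu> in auto)
    then show ?thesis by (simp add: B)
  qed
  \<comment> \<open>For the weight \<open>k\<^sup>2\<close> the constant is \<open>2 * (4 * (2\<^sup>2 + 1) + 2) = 44\<close>.\<close>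
  have step: "P t < B * D" if t: "t \<in> {0..\<tau>}" and Ps: "\<And>s. s \<in> {0..t} \<Longrightarrow> P s \<le> B * D" for t
  proof -
    have "P t \<le> 2 / min 1 \<mu> * (1 + 2 * \<mu>)
      * exp (2 / min 1 \<mu> * (4 * (2 ^ 2 + 1) + 2) * (sqrt_zeta * sqrt (B * D)) * t) * P 0"
      unfolding P_def S_def
      by (rule modes_energy_growth[OF sol[OF t Ps] weight_sq \<mu> _ en_P[OF Ps] BD(2)])
         (use t in \<open>auto simp: supp\<close>)
    also have "\<dots> \<le> 2 / min 1 \<mu> * (1 + 2 * \<mu>) * exp 1 * D"
    proof -
      have "2 / min 1 \<mu> * (4 * (2 ^ 2 + 1) + 2) * (sqrt_zeta * sqrt (B * D)) * t
          \<le> 44 / min 1 \<mu> * (sqrt_zeta * sqrt (B * D)) * \<tau>"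
        using t \<mu> D BD0 by (simp add: sqrt_zeta_nonneg mult_left_mono divide_right_mono)
      also have "\<dots> \<le> 1" by (rule time)
      finally show ?thesis using \<mu> P0 by (intro mult_mono) (auto simp: P_def intro!: sum_nonneg en_nonneg)
    qed
    also have "\<dots> = B * D / 2" using \<mu> by (simp add: B field_simps)
    also have "\<dots> < B * D" using BD0 D by simp
    finally show ?thesis .
  qed
  have contP: "continuous_on {0..\<tau>} P"
  proof -
    have cu: "continuous_on {0..\<tau>} (\<lambda>t. u t k)" for k
      by (rule continuous_on_vector_derivative) (rule du)
    have "continuous_on {0..\<tau>} (\<lambda>t. v t k)" for k
    proof -
      have p: "continuous_on {0..\<tau>} (\<lambda>t. v t k)" if "0 < k" "k \<le> N" for k
        by (rule continuous_on_vector_derivative) (rule dvp[OF _ that])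
      consider "k = 0 \<or> N < \<bar>k\<bar>" | "0 < k" "k \<le> N" | "k < 0" "- k \<le> N" by linarith
      then show ?thesis
      proof cases
        case 3
        then have "continuous_on {0..\<tau>} (\<lambda>t. cnj (v t (- k)))" using p[of "- k"] by (intro continuous_intros) auto
        then show ?thesis by (simp add: hu)
      qed (use p in \<open>auto simp: supp\<close>)
    qed
    with cu show ?thesis unfolding P_def en_def by (intro continuous_intros)
  qed
  have PB: "P t \<le> B * D" if "t \<in> {0..\<tau>}" for t
    using bootstrap[OF contP _ step that] P0 mult_right_mono[OF B1, of D] D by fastforce
  show ?thesis
    by (rule that[OF sol[of \<tau>]]) (use \<tau> PB init supp en_P in auto)
qed

section \<open>Differences of solutions\<close>

lemma kern_sum_l1:
  assumes a: "\<And>n. of_int \<bar>n\<bar> * cmod (a n) \<le> A" and b: "sums_below (\<lambda>n. of_int \<bar>n\<bar> * cmod (b n)) B"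
  shows "sums_below (\<lambda>l. cmod (of_real (kern k l) * a (k - l) * b l)) (2 * A * B)"
proof (rule sums_below_mono[OF sums_below_cmult[OF b]])
  have "0 \<le> A" using a[of 0] by simp
  then show "0 \<le> 2 * A" by simp
  fix l
  have "cmod (of_real (kern k l) * a (k - l) * b l) = kern k l * (cmod (a (k - l)) * cmod (b l))"
    by (simp add: norm_mult kern_nonneg)
  also have "\<dots> \<le> 2 * (of_int \<bar>k - l\<bar> * of_int \<bar>l\<bar>) * (cmod (a (k - l)) * cmod (b l))"
    by (intro mult_right_mono kern_le) simp
  also have "\<dots> = 2 * (of_int \<bar>k - l\<bar> * cmod (a (k - l))) * (of_int \<bar>l\<bar> * cmod (b l))" by (simp only: mult_ac)
  also have "\<dots> \<le> 2 * A * (of_int \<bar>l\<bar> * cmod (b l))"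
    using a[of "k - l"] by (intro mult_right_mono mult_left_mono) auto
  finally show "cmod (of_real (kern k l) * a (k - l) * b l) \<le> 2 * A * (of_int \<bar>l\<bar> * cmod (b l))" .
qed simp

lemma kern_summable:
  assumes "sums_below (\<lambda>n. of_int \<bar>n\<bar> * cmod (a n)) A" "sums_below (\<lambda>n. of_int \<bar>n\<bar> * cmod (b n)) B"
  shows "(\<lambda>l. cmod (of_real (kern k l) * a (k - l) * b l)) summable_on T"
    and "(\<lambda>l. of_real (kern k l) * a (k - l) * b l) summable_on T"
proof -
  show *: "(\<lambda>l. cmod (of_real (kern k l) * a (k - l) * b l)) summable_on T" for T
    by (rule sums_below_imp_summable(1)[OF kern_sum_l1[OF sums_below_point[OF assms(1)] assms(2)]]) simp
  show "(\<lambda>l. of_real (kern k l) * a (k - l) * b l) summable_on T"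
    by (rule abs_summable_summable[OF *])
qed

lemma has_sum_finite_sum:
  fixes f :: "'a \<Rightarrow> 'b \<Rightarrow> 'c::{topological_comm_monoid_add,t2_space}"
  assumes "finite S" "\<And>k. k \<in> S \<Longrightarrow> (f k has_sum s k) T"
  shows "((\<lambda>l. \<Sum>k\<in>S. f k l) has_sum (\<Sum>k\<in>S. s k)) T"
  using assms by (induction S rule: finite_induct) (auto intro: has_sum_add)

text \<open>
  Allows the infinite tail of a convolution to be estimated by Young's inequality for finite sums.
\<close>

lemma weighted_infsum_le:
  fixes G :: "'a \<Rightarrow> 'b \<Rightarrow> real"
  assumes S: "finite S" and G: "\<And>k. k \<in> S \<Longrightarrow> G k summable_on T"
    and le: "\<And>F. finite F \<Longrightarrow> F \<subseteq> T \<Longrightarrow> (\<Sum>k\<in>S. \<Sum>l\<in>F. c k * G k l) \<le> b"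
  shows "(\<Sum>k\<in>S. c k * infsum (G k) T) \<le> b"
proof -
  have hs: "((\<lambda>l. \<Sum>k\<in>S. c k * G k l) has_sum (\<Sum>k\<in>S. c k * infsum (G k) T)) T"
    by (intro has_sum_finite_sum has_sum_cmult_right has_sum_infsum G S)
  have "(\<Sum>k\<in>S. c k * infsum (G k) T) = infsum (\<lambda>l. \<Sum>k\<in>S. c k * G k l) T"
    by (rule infsumI[OF hs, symmetric])
  also have "\<dots> \<le> b"
  proof (rule infsum_le_finite_sums)
    show "(\<lambda>l. \<Sum>k\<in>S. c k * G k l) summable_on T"
      using hs by (rule has_sum_imp_summable)
    show "(\<Sum>l\<in>F. \<Sum>k\<in>S. c k * G k l) \<le> b" if "finite F" "F \<subseteq> T" for F
      using le[OF that] by (subst sum.swap)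
  qed
  finally show ?thesis .
qed

text \<open>
  One power of \<open>\<bar>l\<bar> > N\<close> of the \<open>H\<^sup>3\<close>-norm is left over and becomes the factor \<open>1/N\<close>.
\<close>

lemma kern_tail_le:
  assumes N: "1 \<le> N" and A: "sums_below (\<lambda>n. of_int \<bar>n\<bar> * cmod (u n)) A"
    and M: "sums_below (\<lambda>n. (of_int n ^ 3 * cmod (u n))\<^sup>2) M"
  shows "(\<Sum>k\<in>{-N..N}. (of_int \<bar>k\<bar> * cmod (w k)) * infsum (\<lambda>l. cmod (of_real (kern k l) * u (k - l) * u l)) (- {-N..N}))
    \<le> 2 * A / of_int N * (M + (\<Sum>k\<in>{-N..N}. (cmod (w k))\<^sup>2))"
proof (rule weighted_infsum_le)
  show "(\<lambda>l. cmod (of_real (kern k l) * u (k - l) * u l)) summable_on - {-N..N}" for k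
    by (rule kern_summable(1)[OF A A])
  fix F assume F: "finite F" "F \<subseteq> - {-N..N}"
  define x where "x l = \<bar>of_int l\<bar> ^ 3 * cmod (u l)" for l
  have "of_int \<bar>k\<bar> * cmod (w k) * cmod (of_real (kern k l) * u (k - l) * u l)
      \<le> 4 / of_int N * ((of_int \<bar>k - l\<bar> * cmod (u (k - l))) * x l * cmod (w k))" if l: "l \<in> F" for k l
  proof -
    have "l \<notin> {-N..N}" using l F by blast
    then have "N \<le> \<bar>l\<bar>" by auto
    then have Nl: "of_int N \<le> \<bar>of_int l :: real\<bar>" by linarith
    have "(of_int l)\<^sup>2 * of_int N \<le> (of_int l)\<^sup>2 * \<bar>of_int l :: real\<bar>" using Nl by (intro mult_left_mono) auto
    also have "\<dots> = \<bar>of_int l\<bar> ^ 3" by (simp add: power3_eq_cube power2_eq_square)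
    finally have l3: "(of_int l)\<^sup>2 \<le> \<bar>of_int l :: real\<bar> ^ 3 / of_int N" using N by (simp add: field_simps)
    have "of_int \<bar>k\<bar> * cmod (w k) * cmod (of_real (kern k l) * u (k - l) * u l)
        = (of_int \<bar>k\<bar> * kern k l) * (cmod (w k) * cmod (u (k - l)) * cmod (u l))"
      by (simp add: norm_mult kern_nonneg)
    also have "\<dots> \<le> (4 * of_int \<bar>k - l\<bar> * (\<bar>of_int l\<bar> ^ 3 / of_int N)) * (cmod (w k) * cmod (u (k - l)) * cmod (u l))"
      by (intro mult_right_mono order_trans[OF abs_mult_kern_le] mult_left_mono l3) auto
    also have "\<dots> = 4 / of_int N * ((of_int \<bar>k - l\<bar> * cmod (u (k - l))) * x l * cmod (w k))"
      by (simp add: x_def mult_ac)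
    finally show ?thesis .
  qed
  then have "(\<Sum>k\<in>{-N..N}. \<Sum>l\<in>F. of_int \<bar>k\<bar> * cmod (w k) * cmod (of_real (kern k l) * u (k - l) * u l))
      \<le> (\<Sum>k\<in>{-N..N}. \<Sum>l\<in>F. 4 / of_int N * ((of_int \<bar>k - l\<bar> * cmod (u (k - l))) * x l * cmod (w k)))"
    by (intro sum_mono)
  also have "\<dots> = 4 / of_int N * (\<Sum>k\<in>{-N..N}. \<Sum>l\<in>F. (of_int \<bar>k - l\<bar> * cmod (u (k - l))) * x l * cmod (w k))"
    by (simp only: sum_distrib_left)
  also have "\<dots> \<le> 4 / of_int N * (A / 2 * ((\<Sum>l\<in>F. (x l)\<^sup>2) + (\<Sum>k\<in>{-N..N}. (cmod (w k))\<^sup>2)))"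
    using N F by (intro mult_left_mono young_sum_diff A) auto
  also have "(\<Sum>l\<in>F. (x l)\<^sup>2) \<le> M"
    using sums_belowD[OF M F(1)] by (simp add: x_def power_mult_distrib power_even_abs flip: power_mult)
  also have "4 / of_int N * (A / 2 * (M + (\<Sum>k\<in>{-N..N}. (cmod (w k))\<^sup>2))) = 2 * A / of_int N * (M + (\<Sum>k\<in>{-N..N}. (cmod (w k))\<^sup>2))"
    by simp
  finally show "(\<Sum>k\<in>{-N..N}. \<Sum>l\<in>F. of_int \<bar>k\<bar> * cmod (w k) * cmod (of_real (kern k l) * u (k - l) * u l))
      \<le> 2 * A / of_int N * (M + (\<Sum>k\<in>{-N..N}. (cmod (w k))\<^sup>2))"
    using N sums_below_nonneg[OF A] by (simp add: divide_right_mono mult_left_mono)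
qed simp

lemma weight_one: "weight 1 (\<lambda>_. 1)"
  by (simp add: weight_def del: of_int_abs)

text \<open>
  The first sum is the linearised principal part for \<open>u - y\<close>, which the energy handles. In the second
  sum the difference is at the low frequency and does not cost a derivative. The tails lie outside the
  range in which the equations are assumed.
\<close>

lemma bilin_diff:
  assumes A: "sums_below (\<lambda>n. of_int \<bar>n\<bar> * cmod (u n)) A" "sums_below (\<lambda>n. of_int \<bar>n\<bar> * cmod (y n)) A'"
    and S: "finite S"
  shows "bilin u k - bilin y k = (\<Sum>l\<in>S. of_real (kern k l) * u (k - l) * (u l - y l))
    + (\<Sum>l\<in>S. of_real (kern k l) * (u (k - l) - y (k - l)) * y l)
    + (infsum (\<lambda>l. of_real (kern k l) * u (k - l) * u l) (- S) - infsum (\<lambda>l. of_real (kern k l) * y (k - l) * y l) (- S))"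
proof -
  have split: "bilin u k = (\<Sum>l\<in>S. of_real (kern k l) * u (k - l) * u l) + infsum (\<lambda>l. of_real (kern k l) * u (k - l) * u l) (- S)"
    if "sums_below (\<lambda>n. of_int \<bar>n\<bar> * cmod (u n)) A" for u A
  proof -
    have "bilin u k = infsum (\<lambda>l. of_real (kern k l) * u (k - l) * u l) (S \<union> - S)" by (simp add: bilin_def)
    also have "\<dots> = infsum (\<lambda>l. of_real (kern k l) * u (k - l) * u l) S + infsum (\<lambda>l. of_real (kern k l) * u (k - l) * u l) (- S)"
      by (intro infsum_Un_disjoint kern_summable(2)[OF that that]) auto
    finally show ?thesis using S by simp
  qed
  show ?thesis unfolding split[OF A(1)] split[OF A(2)]
    by (simp add: algebra_simps sum_subtractf sum.distrib)
qed

text \<open>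
  The energy estimate with \<open>m = 1\<close> and \<open>q = 1\<close> for the difference, with the solution \<open>u\<close> as coefficient. The
  remainder consists of the interaction in which the difference is at the low frequency, bounded
  because \<open>y\<close> has two derivatives in \<open>l\<^sup>1\<close>, and of the tails, which are \<open>O(1/N)\<close>.
\<close>

lemma difference_bound:
  assumes \<mu>: "0 < \<mu>" and N: "1 \<le> N"
    and u: "modes_upto \<mu> N {0..\<tau>} u u'" and y: "modes_upto \<mu> N {0..\<tau>} y y'"
    and Mu: "\<And>t. t \<in> {0..\<tau>} \<Longrightarrow> sums_below (en (\<lambda>k. sq k) (u t) (u' t)) M"
    and My: "\<And>t. t \<in> {0..\<tau>} \<Longrightarrow> sums_below (en (\<lambda>k. sq k) (y t) (y' t)) M"
    and small: "\<And>t. t \<in> {0..\<tau>} \<Longrightarrow> sums_below (\<lambda>n. of_int \<bar>n\<bar> * cmod (u t n)) (\<mu> / 4)"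
    and init: "\<And>k. \<bar>k\<bar> \<le> N \<Longrightarrow> u 0 k = y 0 k \<and> u' 0 k = y' 0 k"
    and t: "t \<in> {0..\<tau>}" and A: "A = sqrt_zeta * sqrt M"
  shows "(\<Sum>k\<in>{-N..N}. en (\<lambda>_. 1) (\<lambda>k. u t k - y t k) (\<lambda>k. u' t k - y' t k) k)
    \<le> 16 / min 1 \<mu> * A * M * \<tau> * exp (52 / min 1 \<mu> * A * \<tau>) / of_int N"
proof -
  define S where "S = {-N..N}"
  have S: "finite S" by (simp add: S_def)
  define z where "z t k = u t k - y t k" for t k
  define z' where "z' t k = u' t k - y' t k" for t k
  define tl where "tl w k = infsum (\<lambda>l. of_real (kern k l) * w (k - l) * w l) (- S)" for w :: "int \<Rightarrow> complex" and k
  define r where "r t k = of_int \<bar>k\<bar> * ((\<Sum>l\<in>S. of_real (kern k l) * z t (k - l) * y t l) + (tl (u t) k - tl (y t) k))" for t k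
  have M0: "0 \<le> M" using Mu[OF t] sums_below_nonneg by blast
  have A0: "0 \<le> A" using M0 by (simp add: A sqrt_zeta_nonneg)
  note bu = en_sq_bounds[OF Mu, folded A] and b_y = en_sq_bounds[OF My, folded A]
  have "(\<Sum>k\<in>S. en (\<lambda>_. 1) (z t) (z' t) k) \<le> 2 / min 1 \<mu> *
    (((1 + 2 * \<mu>) * (\<Sum>k\<in>S. en (\<lambda>_. 1) (z 0) (z' 0) k) + 2 * (4 * A * M / of_int N) * t)
      * exp (2 / min 1 \<mu> * ((4 * (2 ^ 1 + 1) + 2) * A + 2 * (6 * A)) * t))"
  proof (rule energy_growth[OF S weight_one \<mu>, where r = r and \<tau> = \<tau> and u = u and u' = u' and z = z and z' = z'])
    fix s k assume s: "s \<in> {0..\<tau>}"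
    show "((\<lambda>t. u t k) has_vector_derivative u' s k) (at s within {0..\<tau>})"
      using u s by (simp add: modes_upto_def)
    show "u s (- k) = cnj (u s k)" using u s by (simp add: modes_upto_def)
    show "((\<lambda>t. z t k) has_vector_derivative z' s k) (at s within {0..\<tau>})"
      unfolding z_def z'_def using u y s by (intro has_vector_derivative_diff) (auto simp: modes_upto_def)
    assume k: "k \<in> S"
    have "((\<lambda>t. z' t k) has_vector_derivative
        (- of_real (\<mu> * (of_int k)\<^sup>2) * u s k + of_int \<bar>k\<bar> * bilin (u s) k)
        - (- of_real (\<mu> * (of_int k)\<^sup>2) * y s k + of_int \<bar>k\<bar> * bilin (y s) k)) (at s within {0..\<tau>})"
      unfolding z'_def using u y s k by (intro has_vector_derivative_diff) (auto simp: modes_upto_def S_def)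
    also have "(- of_real (\<mu> * (of_int k)\<^sup>2) * u s k + of_int \<bar>k\<bar> * bilin (u s) k)
        - (- of_real (\<mu> * (of_int k)\<^sup>2) * y s k + of_int \<bar>k\<bar> * bilin (y s) k)
       = - of_real (\<mu> * (of_int k)\<^sup>2) * z s k + of_int \<bar>k\<bar> * (bilin (u s) k - bilin (y s) k)"
      by (simp add: z_def algebra_simps)
    also have "\<dots> = - of_real (\<mu> * (of_int k)\<^sup>2) * z s k
        + of_int \<bar>k\<bar> * (\<Sum>l\<in>S. of_real (kern k l) * u s (k - l) * z s l) + r s k"
      unfolding bilin_diff[OF bu(3)[OF s] b_y(3)[OF s] S] by (simp add: r_def tl_def z_def algebra_simps)
    finally show "((\<lambda>t. z' t k) has_vector_derivative - of_real (\<mu> * (of_int k)\<^sup>2) * z s k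
        + of_int \<bar>k\<bar> * (\<Sum>l\<in>S. of_real (kern k l) * u s (k - l) * z s l) + r s k) (at s within {0..\<tau>})" .
  next
    fix s assume s: "s \<in> {0..\<tau>}"
    define X where "X = (\<Sum>k\<in>S. en (\<lambda>_. 1) (z s) (z' s) k)"
    define P where "P = (\<Sum>k\<in>S. (cmod (z' s k))\<^sup>2)"
    define Q where "Q = (\<Sum>k\<in>S. (of_int k * cmod (z s k))\<^sup>2)"
    have X: "X = P + Q" by (simp add: X_def P_def Q_def en_def sum.distrib)
    have PQ: "0 \<le> P" "0 \<le> Q" by (auto simp: P_def Q_def intro: sum_nonneg)
    define x where "x n = (if n \<in> S then of_int \<bar>n\<bar> * cmod (z s n) else 0)" for n
    have xQ: "sums_below (\<lambda>n. (x n)\<^sup>2) Q"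
      unfolding sums_below_def
    proof (intro allI impI)
      fix F :: "int set" assume F: "finite F"
      have "(\<Sum>n\<in>F. (x n)\<^sup>2) = (\<Sum>n\<in>F \<inter> S. (x n)\<^sup>2)"
        by (rule sum.mono_neutral_right[OF F]) (auto simp: x_def)
      also have "\<dots> \<le> (\<Sum>n\<in>S. (x n)\<^sup>2)" by (rule sum_mono2[OF S]) auto
      also have "\<dots> = Q" by (simp add: Q_def x_def power_mult_distrib)
      finally show "(\<Sum>n\<in>F. (x n)\<^sup>2) \<le> Q" .
    qed
    \<comment> \<open>If \<open>k - l\<close> is outside \<open>S\<close> and \<open>l\<close> is inside, the kernel vanishes; so \<open>x\<close> may be cut off to \<open>S\<close>.\<close>
    have r_le: "cmod (r s k) * cmod (z' s k) \<le>
        (\<Sum>l\<in>S. 4 * (((of_int l)\<^sup>2 * cmod (y s l)) * x (k - l) * cmod (z' s k)))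
        + (of_int \<bar>k\<bar> * cmod (z' s k)) * infsum (\<lambda>l. cmod (of_real (kern k l) * u s (k - l) * u s l)) (- S)
        + (of_int \<bar>k\<bar> * cmod (z' s k)) * infsum (\<lambda>l. cmod (of_real (kern k l) * y s (k - l) * y s l)) (- S)" for k
    proof -
      have 1: "of_int \<bar>k\<bar> * cmod (\<Sum>l\<in>S. of_real (kern k l) * z s (k - l) * y s l)
          \<le> (\<Sum>l\<in>S. 4 * (((of_int l)\<^sup>2 * cmod (y s l)) * x (k - l)))"
      proof -
        have "of_int \<bar>k\<bar> * cmod (\<Sum>l\<in>S. of_real (kern k l) * z s (k - l) * y s l)
            \<le> of_int \<bar>k\<bar> * (\<Sum>l\<in>S. kern k l * (cmod (z s (k - l)) * cmod (y s l)))"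
          by (intro mult_left_mono order_trans[OF norm_sum] sum_mono) (auto simp: norm_mult kern_nonneg)
        also have "\<dots> = (\<Sum>l\<in>S. (of_int \<bar>k\<bar> * kern k l) * (cmod (z s (k - l)) * cmod (y s l)))"
          by (simp add: sum_distrib_left mult.assoc)
        also have "\<dots> \<le> (\<Sum>l\<in>S. 4 * (((of_int l)\<^sup>2 * cmod (y s l)) * x (k - l)))"
        proof (rule sum_mono)
          fix l assume l: "l \<in> S"
          show "(of_int \<bar>k\<bar> * kern k l) * (cmod (z s (k - l)) * cmod (y s l)) \<le> 4 * (((of_int l)\<^sup>2 * cmod (y s l)) * x (k - l))"
          proof (cases "k - l \<in> S")
            case True
            have "(of_int \<bar>k\<bar> * kern k l) * (cmod (z s (k - l)) * cmod (y s l))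
                \<le> (4 * of_int \<bar>k - l\<bar> * (of_int l)\<^sup>2) * (cmod (z s (k - l)) * cmod (y s l))"
              by (intro mult_right_mono abs_mult_kern_le) auto
            then show ?thesis using True by (simp add: x_def mult_ac)
          next
            case False
            then have "kern k l = 0" using l by (auto simp: kern_def S_def)
            then show ?thesis using False by (simp add: x_def)
          qed
        qed
        finally show ?thesis .
      qed
      have 2: "cmod (tl (u s) k) \<le> infsum (\<lambda>l. cmod (of_real (kern k l) * u s (k - l) * u s l)) (- S)"
        "cmod (tl (y s) k) \<le> infsum (\<lambda>l. cmod (of_real (kern k l) * y s (k - l) * y s l)) (- S)"
        unfolding tl_def by (intro norm_infsum_bound kern_summable(1)[OF bu(3)[OF s] bu(3)[OF s]]
            kern_summable(1)[OF b_y(3)[OF s] b_y(3)[OF s]])+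
      have "cmod (r s k) \<le> (\<Sum>l\<in>S. 4 * (((of_int l)\<^sup>2 * cmod (y s l)) * x (k - l)))
          + of_int \<bar>k\<bar> * (cmod (tl (u s) k) + cmod (tl (y s) k))"
      proof -
        have "cmod (r s k) \<le> of_int \<bar>k\<bar> * (cmod (\<Sum>l\<in>S. of_real (kern k l) * z s (k - l) * y s l)
            + (cmod (tl (u s) k) + cmod (tl (y s) k)))"
          unfolding r_def norm_mult
          by (intro mult_mono order_trans[OF norm_triangle_ineq] add_left_mono norm_triangle_ineq4) auto
        then show ?thesis using 1 by (simp add: distrib_left)
      qed
      also have "\<dots> \<le> (\<Sum>l\<in>S. 4 * (((of_int l)\<^sup>2 * cmod (y s l)) * x (k - l)))
          + of_int \<bar>k\<bar> * (infsum (\<lambda>l. cmod (of_real (kern k l) * u s (k - l) * u s l)) (- S)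
            + infsum (\<lambda>l. cmod (of_real (kern k l) * y s (k - l) * y s l)) (- S))"
        by (intro add_left_mono mult_left_mono add_mono 2) simp
      finally have "cmod (r s k) * cmod (z' s k) \<le> \<dots> * cmod (z' s k)" by (rule mult_right_mono) simp
      then show ?thesis by (simp add: algebra_simps sum_distrib_left)
    qed
    have T1: "(\<Sum>k\<in>S. \<Sum>l\<in>S. 4 * (((of_int l)\<^sup>2 * cmod (y s l)) * x (k - l) * cmod (z' s k))) \<le> 2 * A * X"
    proof -
      have "(\<Sum>k\<in>S. \<Sum>l\<in>S. ((of_int l)\<^sup>2 * cmod (y s l)) * x (k - l) * cmod (z' s k)) \<le> A / 2 * (Q + P)"
        unfolding P_def by (rule young_sum_left[OF S S b_y(1)[OF s] _ xQ]) simp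
      then show ?thesis by (simp add: X algebra_simps flip: sum_distrib_left)
    qed
    have T2: "(\<Sum>k\<in>S. (of_int \<bar>k\<bar> * cmod (z' s k)) * infsum (\<lambda>l. cmod (of_real (kern k l) * w (k - l) * w l)) (- S))
        \<le> 2 * A * X + 2 * A * M / of_int N"
      if en: "sums_below (en (\<lambda>k. sq k) w w') M" for w w' :: "int \<Rightarrow> complex"
    proof -
      have "(\<Sum>k\<in>S. (of_int \<bar>k\<bar> * cmod (z' s k)) * infsum (\<lambda>l. cmod (of_real (kern k l) * w (k - l) * w l)) (- S))
          \<le> 2 * A / of_int N * (M + P)"
        unfolding P_def S_def
        by (rule kern_tail_le[OF N en_sq_bounds(3)[OF en, folded A] sums_below_mono[OF en]]) (auto simp: en_sq)
      also have "\<dots> = 2 * A * M / of_int N + 2 * A * P / of_int N" by (simp add: distrib_left)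
      also have "2 * A * P / of_int N \<le> 2 * A * X"
      proof -
        have "2 * A * P / of_int N \<le> 2 * A * P / 1" using A0 PQ N by (intro divide_left_mono) auto
        also have "\<dots> \<le> 2 * A * X" using A0 PQ by (simp add: X mult_left_mono)
        finally show ?thesis .
      qed
      finally show ?thesis by simp
    qed
    have "(\<Sum>k\<in>S. cmod (r s k) * cmod (z' s k)) \<le> 2 * A * X + (2 * A * X + 2 * A * M / of_int N) + (2 * A * X + 2 * A * M / of_int N)"
      by (rule order_trans[OF sum_mono[OF r_le]])
         (unfold sum.distrib, intro add_mono T1 T2[OF Mu[OF s]] T2[OF My[OF s]])
    then show "(\<Sum>k\<in>S. 1\<^sup>2 * (cmod (r s k) * cmod (z' s k))) \<le> 6 * A * (\<Sum>k\<in>S. en (\<lambda>_. 1) (z s) (z' s) k) + 4 * A * M / of_int N"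
      unfolding X_def[symmetric] by simp
  qed (use bu b_y small A0 M0 N t in auto)
  also have "(\<Sum>k\<in>S. en (\<lambda>_. 1) (z 0) (z' 0) k) = 0"
    using init by (intro sum.neutral) (auto simp: S_def z_def z'_def en_def)
  also have "2 / min 1 \<mu> * (((1 + 2 * \<mu>) * 0 + 2 * (4 * A * M / of_int N) * t)
      * exp (2 / min 1 \<mu> * ((4 * (2 ^ 1 + 1) + 2) * A + 2 * (6 * A)) * t))
    = 16 / min 1 \<mu> * A * M / of_int N * (t * exp (52 / min 1 \<mu> * A * t))" by simp
  also have "\<dots> \<le> 16 / min 1 \<mu> * A * M / of_int N * (\<tau> * exp (52 / min 1 \<mu> * A * \<tau>))"
    using t A0 M0 N \<mu> by (intro mult_left_mono mult_mono) (auto intro!: mult_left_mono divide_right_mono)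
  finally show ?thesis by (simp add: S_def z_def z'_def mult_ac)
qed

section \<open>Existence for the Fourier modes\<close>

lemma modes_upto_mono: "modes_upto \<mu> N I u v \<Longrightarrow> N' \<le> N \<Longrightarrow> modes_upto \<mu> N' I u v"
  by (auto simp: modes_upto_def)

lemma has_vector_derivative_uniform_limit:
  fixes f :: "nat \<Rightarrow> real \<Rightarrow> 'a::banach"
  assumes S: "convex S" and x: "x \<in> S"
    and f: "\<And>n x. x \<in> S \<Longrightarrow> (f n has_vector_derivative f' n x) (at x within S)"
    and lim: "\<And>x. x \<in> S \<Longrightarrow> (\<lambda>n. f n x) \<longlonglongrightarrow> g x"
    and unif: "uniform_limit S f' g' sequentially"
  shows "(g has_vector_derivative g' x) (at x within S)"
proof -
  have "\<exists>h. \<forall>x\<in>S. (\<lambda>n. f n x) \<longlonglongrightarrow> h x \<and> (h has_derivative (\<lambda>y. y *\<^sub>R g' x)) (at x within S)"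
  proof (rule has_derivative_sequence[OF S, where ?x0.0 = x and l = "g x" and f' = "\<lambda>n x y. y *\<^sub>R f' n x"])
    show "(f n has_derivative (\<lambda>y. y *\<^sub>R f' n x)) (at x within S)" if "x \<in> S" for n x
      using f[OF that] by (simp add: has_vector_derivative_def)
    show "x \<in> S" "(\<lambda>n. f n x) \<longlonglongrightarrow> g x" by (rule x, rule lim[OF x])
    fix e :: real assume "0 < e"
    then have "\<forall>\<^sub>F n in sequentially. \<forall>x\<in>S. dist (f' n x) (g' x) < e"
      using unif by (simp add: uniform_limit_iff)
    then show "\<forall>\<^sub>F n in sequentially. \<forall>x\<in>S. \<forall>h. norm (h *\<^sub>R f' n x - h *\<^sub>R g' x) \<le> e * norm h"
    proof eventually_elim
      case (elim n)
      show ?case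
      proof (intro ballI allI)
        fix x h assume "x \<in> S"
        have "norm (h *\<^sub>R f' n x - h *\<^sub>R g' x) = norm h * dist (f' n x) (g' x)"
          by (simp add: dist_norm flip: scaleR_diff_right)
        also have "\<dots> \<le> norm h * e" using elim \<open>x \<in> S\<close> by (intro mult_left_mono) auto
        finally show "norm (h *\<^sub>R f' n x - h *\<^sub>R g' x) \<le> e * norm h" by (simp add: mult.commute)
      qed
    qed
  qed
  then obtain h where h: "\<And>x. x \<in> S \<Longrightarrow> (\<lambda>n. f n x) \<longlonglongrightarrow> h x"
      "\<And>x. x \<in> S \<Longrightarrow> (h has_derivative (\<lambda>y. y *\<^sub>R g' x)) (at x within S)" by blast
  have "h y = g y" if "y \<in> S" for y using h(1)[OF that] lim[OF that] LIMSEQ_unique by blast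
  then have "(g has_derivative (\<lambda>y. y *\<^sub>R g' x)) (at x within S)"
    by (intro has_derivative_transform[OF x _ h(2)[OF x]]) auto
  then show ?thesis by (simp add: has_vector_derivative_def)
qed

lemma cauchy_rate_limit:
  fixes f :: "nat \<Rightarrow> 'a \<Rightarrow> 'b::banach"
  assumes le: "\<And>m n t. n0 \<le> n \<Longrightarrow> n \<le> m \<Longrightarrow> t \<in> T \<Longrightarrow> norm (f m t - f n t) \<le> e n" and e: "e \<longlonglongrightarrow> 0"
    and n: "n0 \<le> n" and t: "t \<in> T"
  shows "(\<lambda>n. f n t) \<longlonglongrightarrow> lim (\<lambda>n. f n t)" and "norm (f n t - lim (\<lambda>n. f n t)) \<le> e n"
proof -
  have "Cauchy (\<lambda>n. f n t)"
    unfolding Cauchy_def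
  proof (intro allI impI)
    fix \<epsilon> :: real assume "0 < \<epsilon>"
    then obtain N where N: "\<And>n. N \<le> n \<Longrightarrow> \<bar>e n\<bar> < \<epsilon> / 2"
      using e by (metis LIMSEQ_D half_gt_zero diff_zero real_norm_def)
    have b: "dist (f m t) (f n' t) < \<epsilon> / 2" if "m \<ge> n'" "n' \<ge> max N n0" for m n'
      using le[of n' m t] N[of n'] that t by (auto simp: dist_norm)
    show "\<exists>M. \<forall>m\<ge>M. \<forall>n\<ge>M. dist (f m t) (f n t) < \<epsilon>"
    proof (intro exI allI impI)
      fix m n' assume "m \<ge> max N n0" "n' \<ge> max N n0"
      then have "dist (f m t) (f (max N n0) t) < \<epsilon> / 2" "dist (f n' t) (f (max N n0) t) < \<epsilon> / 2"
        by (intro b; simp)+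
      then show "dist (f m t) (f n' t) < \<epsilon>" by (rule dist_triangle_half_l)
    qed
  qed
  then show *: "(\<lambda>n. f n t) \<longlonglongrightarrow> lim (\<lambda>n. f n t)"
    using Cauchy_convergent convergent_LIMSEQ_iff by blast
  have "(\<lambda>m. norm (f m t - f n t)) \<longlonglongrightarrow> norm (lim (\<lambda>n. f n t) - f n t)"
    by (intro tendsto_intros *)
  then have "norm (lim (\<lambda>n. f n t) - f n t) \<le> e n"
    by (rule LIMSEQ_le_const2) (use le[OF n _ t] in blast)
  then show "norm (f n t - lim (\<lambda>n. f n t)) \<le> e n" by (simp add: norm_minus_commute)
qed

text \<open>
  Only the modes up to \<open>N\<close> are assumed to be close; the other ones are small by the common bound.
\<close>

lemma bilin_close:
  assumes u: "sums_below (en (\<lambda>k. sq k) u u') M" and y: "sums_below (en (\<lambda>k. sq k) y y') M" and N: "1 \<le> N"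
    and d: "\<And>l. \<bar>l\<bar> \<le> N \<Longrightarrow> of_int \<bar>l\<bar> * cmod (u l - y l) \<le> d" and A: "A = sqrt_zeta * sqrt M"
  shows "cmod (bilin u k - bilin y k) \<le> 4 * A * d + 4 * A * sqrt M / of_int N"
proof -
  define S where "S = {-N..N}"
  have S: "finite S" by (simp add: S_def)
  note bu = en_sq_bounds(3)[OF u, folded A] and b_y = en_sq_bounds(3)[OF y, folded A]
  have d0: "0 \<le> d" using d[of 0] N by simp
  have M0: "0 \<le> M" using sums_below_nonneg[OF u] .
  have tail: "cmod (infsum (\<lambda>l. of_real (kern k l) * w (k - l) * w l) (- S)) \<le> 2 * A * sqrt M / of_int N"
    if w: "sums_below (en (\<lambda>k. sq k) w w') M" for w w'
  proof -
    note bw = en_sq_bounds(3)[OF w, folded A]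
    have "cmod (infsum (\<lambda>l. of_real (kern k l) * w (k - l) * w l) (- S))
        \<le> infsum (\<lambda>l. cmod (of_real (kern k l) * w (k - l) * w l)) (- S)"
      by (rule norm_infsum_bound[OF kern_summable(1)[OF bw bw]])
    also have "\<dots> \<le> 2 * A * sqrt M / of_int N"
    proof (rule infsum_le_finite_sums[OF kern_summable(1)[OF bw bw]])
      fix F assume F: "finite F" "F \<subseteq> - S"
      have "(\<Sum>l\<in>F. cmod (of_real (kern k l) * w (k - l) * w l))
          \<le> (\<Sum>l\<in>F. 2 * sqrt M / of_int N * (of_int \<bar>k - l\<bar> * cmod (w (k - l))))"
      proof (rule sum_mono)
        fix l assume l: "l \<in> F"
        then have "l \<notin> {-N..N}" using F by (auto simp: S_def)
        then have "N \<le> \<bar>l\<bar>" by auto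
        then have Nl: "of_int N \<le> \<bar>of_int l :: real\<bar>" by linarith
        have l1: "1 \<le> \<bar>of_int l :: real\<bar>" using N Nl by linarith
        have "(of_int l ^ 3 * cmod (w l))\<^sup>2 \<le> M"
          using sums_below_point[OF w, of l] zero_le_power2[of "of_int l ^ 2 * cmod (w' l)"] unfolding en_sq by linarith
        then have "\<bar>of_int l ^ 3 * cmod (w l)\<bar> \<le> sqrt M" by (simp only: real_sqrt_abs[symmetric] real_sqrt_le_iff)
        then have 3: "\<bar>of_int l\<bar> ^ 3 * cmod (w l) \<le> sqrt M" by (simp add: abs_mult power_abs)
        have "of_int N * (\<bar>of_int l\<bar> * cmod (w l)) \<le> \<bar>of_int l\<bar> ^ 3 * cmod (w l)"
        proof -
          have "of_int N * 1 \<le> \<bar>of_int l\<bar> * \<bar>of_int l :: real\<bar>" using Nl l1 N by (intro mult_mono) auto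
          then have "of_int N * (\<bar>of_int l\<bar> * cmod (w l)) \<le> (\<bar>of_int l\<bar> * \<bar>of_int l\<bar>) * (\<bar>of_int l\<bar> * cmod (w l))"
            by (intro mult_right_mono) auto
          then show ?thesis by (simp add: power3_eq_cube mult.assoc)
        qed
        then have 4: "\<bar>of_int l\<bar> * cmod (w l) \<le> sqrt M / of_int N" using 3 N by (simp add: field_simps)
        have "cmod (of_real (kern k l) * w (k - l) * w l) = kern k l * (cmod (w (k - l)) * cmod (w l))"
          by (simp add: norm_mult kern_nonneg)
        also have "\<dots> \<le> 2 * (of_int \<bar>k - l\<bar> * of_int \<bar>l\<bar>) * (cmod (w (k - l)) * cmod (w l))"
          by (intro mult_right_mono kern_le) auto
        also have "\<dots> = 2 * (of_int \<bar>k - l\<bar> * cmod (w (k - l))) * (\<bar>of_int l\<bar> * cmod (w l))" by simp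
        also have "\<dots> \<le> 2 * (of_int \<bar>k - l\<bar> * cmod (w (k - l))) * (sqrt M / of_int N)"
          by (intro mult_left_mono 4) auto
        finally show "cmod (of_real (kern k l) * w (k - l) * w l)
            \<le> 2 * sqrt M / of_int N * (of_int \<bar>k - l\<bar> * cmod (w (k - l)))" by (simp add: mult_ac)
      qed
      also have "\<dots> = 2 * sqrt M / of_int N * (\<Sum>l\<in>F. of_int \<bar>k - l\<bar> * cmod (w (k - l)))"
        by (simp only: sum_distrib_left)
      also have "\<dots> \<le> 2 * sqrt M / of_int N * A"
        using N M0 by (intro mult_left_mono sums_below_inj_sum[OF bw F(1)]) (auto simp: inj_on_def)
      finally show "(\<Sum>l\<in>F. cmod (of_real (kern k l) * w (k - l) * w l)) \<le> 2 * A * sqrt M / of_int N"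
        by (simp add: mult_ac)
    qed
    finally show ?thesis .
  qed
  have s1: "cmod (\<Sum>l\<in>S. of_real (kern k l) * u (k - l) * (u l - y l)) \<le> 2 * A * d"
  proof -
    have "cmod (\<Sum>l\<in>S. of_real (kern k l) * u (k - l) * (u l - y l))
        \<le> (\<Sum>l\<in>S. 2 * d * (of_int \<bar>k - l\<bar> * cmod (u (k - l))))"
    proof (rule sum_norm_le)
      fix l assume l: "l \<in> S"
      have "cmod (of_real (kern k l) * u (k - l) * (u l - y l)) = kern k l * (cmod (u (k - l)) * cmod (u l - y l))"
        by (simp add: norm_mult kern_nonneg)
      also have "\<dots> \<le> 2 * (of_int \<bar>k - l\<bar> * of_int \<bar>l\<bar>) * (cmod (u (k - l)) * cmod (u l - y l))"
        by (intro mult_right_mono kern_le) auto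
      also have "\<dots> = 2 * (of_int \<bar>k - l\<bar> * cmod (u (k - l))) * (of_int \<bar>l\<bar> * cmod (u l - y l))" by simp
      also have "\<dots> \<le> 2 * (of_int \<bar>k - l\<bar> * cmod (u (k - l))) * d"
        using l by (intro mult_left_mono d) (auto simp: S_def)
      finally show "cmod (of_real (kern k l) * u (k - l) * (u l - y l)) \<le> 2 * d * (of_int \<bar>k - l\<bar> * cmod (u (k - l)))"
        by (simp add: mult_ac)
    qed
    also have "\<dots> = 2 * d * (\<Sum>l\<in>S. of_int \<bar>k - l\<bar> * cmod (u (k - l)))" by (simp only: sum_distrib_left)
    also have "\<dots> \<le> 2 * d * A"
      using d0 by (intro mult_left_mono sums_below_inj_sum[OF bu S]) (auto simp: inj_on_def)
    finally show ?thesis by (simp add: mult_ac)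
  qed
  have s2: "cmod (\<Sum>l\<in>S. of_real (kern k l) * (u (k - l) - y (k - l)) * y l) \<le> 2 * A * d"
  proof -
    have "cmod (\<Sum>l\<in>S. of_real (kern k l) * (u (k - l) - y (k - l)) * y l)
        \<le> (\<Sum>l\<in>S. 2 * d * (of_int \<bar>l\<bar> * cmod (y l)))"
    proof (rule sum_norm_le)
      fix l assume l: "l \<in> S"
      show "cmod (of_real (kern k l) * (u (k - l) - y (k - l)) * y l) \<le> 2 * d * (of_int \<bar>l\<bar> * cmod (y l))"
      proof (cases "\<bar>k - l\<bar> \<le> N")
        case True
        have "cmod (of_real (kern k l) * (u (k - l) - y (k - l)) * y l) = kern k l * (cmod (u (k - l) - y (k - l)) * cmod (y l))"
          by (simp add: norm_mult kern_nonneg)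
        also have "\<dots> \<le> 2 * (of_int \<bar>k - l\<bar> * of_int \<bar>l\<bar>) * (cmod (u (k - l) - y (k - l)) * cmod (y l))"
          by (intro mult_right_mono kern_le) auto
        also have "\<dots> = 2 * (of_int \<bar>k - l\<bar> * cmod (u (k - l) - y (k - l))) * (of_int \<bar>l\<bar> * cmod (y l))" by simp
        also have "\<dots> \<le> 2 * d * (of_int \<bar>l\<bar> * cmod (y l))"
          using d[OF True] by (intro mult_right_mono mult_left_mono) auto
        finally show ?thesis .
      next
        case False
        then have "kern k l = 0" using l by (auto simp: kern_def S_def)
        then show ?thesis using d0 by simp
      qed
    qed
    also have "\<dots> = 2 * d * (\<Sum>l\<in>S. of_int \<bar>l\<bar> * cmod (y l))" by (simp only: sum_distrib_left)
    also have "\<dots> \<le> 2 * d * A" using d0 by (intro mult_left_mono sums_belowD[OF b_y S]) auto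
    finally show ?thesis by (simp add: mult_ac)
  qed
  have "cmod (bilin u k - bilin y k) \<le> (2 * A * d + 2 * A * d) + (2 * A * sqrt M / of_int N + 2 * A * sqrt M / of_int N)"
    unfolding bilin_diff[OF bu b_y S]
    by (intro order_trans[OF norm_triangle_ineq] add_mono s1 s2 order_trans[OF norm_triangle_ineq4] tail[OF u] tail[OF y])
  then show ?thesis by simp
qed

text \<open>
  The constant of the energy estimate for a weight of growth \<open>q\<close>, when the lifespan is such that the
  exponent for the weight \<open>k\<^sup>2\<close>, \<open>2 (4 (2\<^sup>2 + 1) + 2) = 44\<close> times \<open>A \<tau> / min 1 \<mu>\<close>, is at most \<open>1\<close>.
\<close>

definition growth_const :: "real \<Rightarrow> nat \<Rightarrow> real" where
  "growth_const \<mu> q = 2 / min 1 \<mu> * (1 + 2 * \<mu>) * exp ((4 * 2 ^ q + 6) / 22)"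

text \<open>
  The limit of the Galerkin approximations: by \<open>difference_bound\<close> every mode is a uniform Cauchy
  sequence in time, with a rate that does not depend on the mode. The bounds for all weights pass to
  the limit through finite partial sums, so they hold for every weight for which the data have finite
  energy, simultaneously and on the same interval.
\<close>

lemma modes_exist:
  fixes a b :: "int \<Rightarrow> complex"
  assumes \<mu>: "0 < \<mu>" and \<tau>: "0 \<le> \<tau>"
    and herm: "\<And>k. a (- k) = cnj (a k)" "\<And>k. b (- k) = cnj (b k)"
    and zero: "a 0 = 0" "b 0 = 0"
    and D: "sums_below (en (\<lambda>k. sq k) a b) D" "0 < D"
    and B: "B = 4 / min 1 \<mu> * (1 + 2 * \<mu>) * exp 1"
    and BD: "B * D \<le> 1" "sqrt_zeta * sqrt (B * D) \<le> \<mu> / 4"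
    and time: "44 / min 1 \<mu> * (sqrt_zeta * sqrt (B * D)) * \<tau> \<le> 1"
  obtains u v where "\<And>N. modes_upto \<mu> N {0..\<tau>} u v"
    and "\<And>t. t \<in> {0..\<tau>} \<Longrightarrow> u t 0 = 0 \<and> v t 0 = 0"
    and "u 0 = a" "v 0 = b"
    and "\<And>t. t \<in> {0..\<tau>} \<Longrightarrow> sums_below (en (\<lambda>k. sq k) (u t) (v t)) (B * D)"
    and "\<And>t m q c. t \<in> {0..\<tau>} \<Longrightarrow> weight q m \<Longrightarrow> sums_below (en m a b) c \<Longrightarrow>
      sums_below (en m (u t) (v t)) (growth_const \<mu> q * c)"
proof -
  define M where "M = B * D"
  define A where "A = sqrt_zeta * sqrt M"
  \<comment> \<open>Order \<open>Suc n\<close>, because \<open>difference_bound\<close> divides by the order.\<close>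
  define G where "G n u v \<longleftrightarrow> modes_upto \<mu> (int (Suc n)) {0..\<tau>} u v
    \<and> (\<forall>t k. t \<in> {0..\<tau>} \<longrightarrow> k = 0 \<or> int (Suc n) < \<bar>k\<bar> \<longrightarrow> u t k = 0 \<and> v t k = 0)
    \<and> (\<forall>k. \<bar>k\<bar> \<le> int (Suc n) \<longrightarrow> u 0 k = a k \<and> v 0 k = b k)
    \<and> (\<forall>t. t \<in> {0..\<tau>} \<longrightarrow> sums_below (en (\<lambda>k. sq k) (u t) (v t)) M)" for n u v
  have "\<exists>u v. G n u v" for n
    by (rule galerkin_exists[OF \<mu> \<tau> herm zero D B BD time, of "int (Suc n)"]) (unfold M_def G_def, blast)
  then obtain U V where "\<And>n. G n (U n) (V n)" by metis
  then have sol: "\<And>n. modes_upto \<mu> (int (Suc n)) {0..\<tau>} (U n) (V n)"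
    and supp: "\<And>n t k. t \<in> {0..\<tau>} \<Longrightarrow> k = 0 \<or> int (Suc n) < \<bar>k\<bar> \<Longrightarrow> U n t k = 0 \<and> V n t k = 0"
    and init: "\<And>n k. \<bar>k\<bar> \<le> int (Suc n) \<Longrightarrow> U n 0 k = a k \<and> V n 0 k = b k"
    and bd: "\<And>n t. t \<in> {0..\<tau>} \<Longrightarrow> sums_below (en (\<lambda>k. sq k) (U n t) (V n t)) M"
    unfolding G_def by blast+
  have M0: "0 \<le> M" using bd[of 0] \<tau> sums_below_nonneg by auto
  have A0: "0 \<le> A" by (simp add: A_def M0 sqrt_zeta_nonneg)
  define C where "C = 16 / min 1 \<mu> * A * M * \<tau> * exp (52 / min 1 \<mu> * A * \<tau>)"
  have C0: "0 \<le> C" using A0 M0 \<mu> \<tau> by (simp add: C_def)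
  define e where "e n = sqrt (C / real (Suc n))" for n
  have e0: "0 \<le> e n" for n by (simp add: e_def C0)
  have e_lim: "e \<longlonglongrightarrow> 0"
  proof -
    have "(\<lambda>n. C * (1 / real (Suc n))) \<longlonglongrightarrow> C * 0"
      by (intro tendsto_intros LIMSEQ_Suc[OF lim_1_over_n])
    from tendsto_real_sqrt[OF this] show ?thesis unfolding e_def[abs_def] by simp
  qed
  have diff: "cmod (V m t k - V n t k) \<le> e n \<and> of_int \<bar>k\<bar> * cmod (U m t k - U n t k) \<le> e n \<and> cmod (U m t k - U n t k) \<le> e n"
    if k: "\<bar>k\<bar> \<le> int (Suc n)" and "n \<le> m" "t \<in> {0..\<tau>}" for m n t k
  proof -
    have "(\<Sum>k\<in>{-int (Suc n)..int (Suc n)}. en (\<lambda>_. 1) (\<lambda>k. U m t k - U n t k) (\<lambda>k. V m t k - V n t k) k)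
      \<le> 16 / min 1 \<mu> * A * M * \<tau> * exp (52 / min 1 \<mu> * A * \<tau>) / of_int (int (Suc n))"
    proof (rule difference_bound[OF \<mu> _ modes_upto_mono[OF sol] sol bd bd _ _ \<open>t \<in> {0..\<tau>}\<close> A_def])
      show "sums_below (\<lambda>n. of_int \<bar>n\<bar> * cmod (U m t n)) (\<mu> / 4)" if "t \<in> {0..\<tau>}" for t
        by (rule sums_below_mono[OF en_sq_bounds(3)[OF bd[OF that]]]) (use BD(2) in \<open>auto simp: M_def\<close>)
    qed (use that init[of _ m] init[of _ n] in auto)
    then have le: "(\<Sum>k\<in>{-int (Suc n)..int (Suc n)}. en (\<lambda>_. 1) (\<lambda>k. U m t k - U n t k) (\<lambda>k. V m t k - V n t k) k) \<le> C / real (Suc n)"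
      by (simp add: C_def)
    have "en (\<lambda>_. 1) (\<lambda>k. U m t k - U n t k) (\<lambda>k. V m t k - V n t k) k
        \<le> (\<Sum>k\<in>{-int (Suc n)..int (Suc n)}. en (\<lambda>_. 1) (\<lambda>k. U m t k - U n t k) (\<lambda>k. V m t k - V n t k) k)"
      by (rule member_le_sum) (use k in \<open>auto simp: en_nonneg\<close>)
    with le have "(cmod (V m t k - V n t k))\<^sup>2 + (of_int k * cmod (U m t k - U n t k))\<^sup>2 \<le> C / real (Suc n)"
      by (simp add: en_def)
    then have 0: "(cmod (V m t k - V n t k))\<^sup>2 \<le> C / real (Suc n)" "(of_int k * cmod (U m t k - U n t k))\<^sup>2 \<le> C / real (Suc n)"
      using zero_le_power2[of "cmod (V m t k - V n t k)"] zero_le_power2[of "of_int k * cmod (U m t k - U n t k)"]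
      by linarith+
    have "(of_int \<bar>k\<bar> * cmod (U m t k - U n t k))\<^sup>2 = (of_int k * cmod (U m t k - U n t k))\<^sup>2"
      by (simp add: power_mult_distrib)
    with 0 have 1: "(cmod (V m t k - V n t k))\<^sup>2 \<le> C / real (Suc n)" "(of_int \<bar>k\<bar> * cmod (U m t k - U n t k))\<^sup>2 \<le> C / real (Suc n)"
      by simp_all
    have 2: "of_int \<bar>k\<bar> * cmod (U m t k - U n t k) \<le> e n" unfolding e_def by (rule real_le_rsqrt[OF 1(2)])
    have "cmod (U m t k - U n t k) \<le> e n"
    proof (cases "k = 0")
      case True
      then show ?thesis using supp[OF \<open>t \<in> {0..\<tau>}\<close>, of 0 m] supp[OF \<open>t \<in> {0..\<tau>}\<close>, of 0 n] e0 by simp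
    next
      case False
      then have "1 * cmod (U m t k - U n t k) \<le> of_int \<bar>k\<bar> * cmod (U m t k - U n t k)" by (intro mult_right_mono) auto
      then show ?thesis using 2 by simp
    qed
    then show ?thesis using 2 1(1) unfolding e_def by (auto intro: real_le_rsqrt)
  qed
  define u where "u t k = lim (\<lambda>n. U n t k)" for t k
  define v where "v t k = lim (\<lambda>n. V n t k)" for t k
  have kn: "\<bar>k\<bar> \<le> int (Suc n)" if "nat \<bar>k\<bar> \<le> n" for k n using that by linarith
  have uC: "cmod (U m t k - U n t k) \<le> e n" and vC: "cmod (V m t k - V n t k) \<le> e n"
    if "nat \<bar>k\<bar> \<le> n" "n \<le> m" "t \<in> {0..\<tau>}" for m n t k
    using diff[OF kn[OF that(1)] that(2,3)] by simp_all
  have ulim: "(\<lambda>n. U n t k) \<longlonglongrightarrow> u t k" if "t \<in> {0..\<tau>}" for t k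
    unfolding u_def by (rule cauchy_rate_limit(1)[where f = "\<lambda>n t. U n t k", OF uC e_lim order_refl that])
  have vlim: "(\<lambda>n. V n t k) \<longlonglongrightarrow> v t k" if "t \<in> {0..\<tau>}" for t k
    unfolding v_def by (rule cauchy_rate_limit(1)[where f = "\<lambda>n t. V n t k", OF vC e_lim order_refl that])
  have uerr: "cmod (U n t k - u t k) \<le> e n" if "t \<in> {0..\<tau>}" "nat \<bar>k\<bar> \<le> n" for t k n
    unfolding u_def by (rule cauchy_rate_limit(2)[where f = "\<lambda>n t. U n t k", OF uC e_lim that(2,1)])
  have verr: "cmod (V n t k - v t k) \<le> e n" if "t \<in> {0..\<tau>}" "nat \<bar>k\<bar> \<le> n" for t k n
    unfolding v_def by (rule cauchy_rate_limit(2)[where f = "\<lambda>n t. V n t k", OF vC e_lim that(2,1)])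
  have kuerr: "of_int \<bar>k\<bar> * cmod (U n t k - u t k) \<le> e n" if t: "t \<in> {0..\<tau>}" and k: "\<bar>k\<bar> \<le> int (Suc n)" for t k n
  proof -
    have "(\<lambda>m. of_int \<bar>k\<bar> * cmod (U m t k - U n t k)) \<longlonglongrightarrow> of_int \<bar>k\<bar> * cmod (u t k - U n t k)"
      by (intro tendsto_intros ulim t)
    then have "of_int \<bar>k\<bar> * cmod (u t k - U n t k) \<le> e n"
      by (rule LIMSEQ_le_const2) (use diff[OF k _ t] in blast)
    then show ?thesis by (simp add: norm_minus_commute)
  qed
  have en_lim: "(\<lambda>n. \<Sum>k\<in>F. en m (U n t) (V n t) k) \<longlonglongrightarrow> (\<Sum>k\<in>F. en m (u t) (v t) k)" if "t \<in> {0..\<tau>}" for t m F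
    unfolding en_def by (intro tendsto_intros ulim vlim that)
  have bdu: "sums_below (en (\<lambda>k. sq k) (u t) (v t)) M" if t: "t \<in> {0..\<tau>}" for t
    unfolding sums_below_def
    using LIMSEQ_le_const2[OF en_lim[OF t]] sums_belowD[OF bd[OF t]] by blast
  have unif_u: "uniform_limit {0..\<tau>} (\<lambda>n t. U n t k) (\<lambda>t. u t k) sequentially"
    and unif_v: "uniform_limit {0..\<tau>} (\<lambda>n t. V n t k) (\<lambda>t. v t k) sequentially" for k
  proof -
    have u: "\<forall>\<^sub>F n in sequentially. e n < \<epsilon> \<and> nat \<bar>k\<bar> \<le> n" if "\<epsilon> > 0" for \<epsilon>
      using order_tendstoD(2)[OF e_lim that] by (intro eventually_conj eventually_ge_at_top)
    show "uniform_limit {0..\<tau>} (\<lambda>n t. U n t k) (\<lambda>t. u t k) sequentially"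
      "uniform_limit {0..\<tau>} (\<lambda>n t. V n t k) (\<lambda>t. v t k) sequentially"
      unfolding uniform_limit_iff
      by (intro allI impI eventually_mono[OF u]; force simp: dist_norm intro: le_less_trans[OF uerr] le_less_trans[OF verr])+
  qed
  have du: "((\<lambda>t. u t k) has_vector_derivative v t k) (at t within {0..\<tau>})" if t: "t \<in> {0..\<tau>}" for t k
    by (rule has_vector_derivative_uniform_limit[OF _ t _ ulim unif_v])
       (use sol in \<open>auto simp: modes_upto_def\<close>)
  \<comment> \<open>The equation for mode \<open>k\<close> is available for approximations of order at least \<open>\<bar>k\<bar>\<close>, hence the shift.\<close>
  have dv: "((\<lambda>t. v t k) has_vector_derivative - of_real (\<mu> * (of_int k)\<^sup>2) * u t k + of_int \<bar>k\<bar> * bilin (u t) k)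
     (at t within {0..\<tau>})" if t: "t \<in> {0..\<tau>}" for t k
  proof (rule has_vector_derivative_uniform_limit[OF _ t,
      where f = "\<lambda>n t. V (n + nat \<bar>k\<bar>) t k"
       and f' = "\<lambda>n t. - of_real (\<mu> * (of_int k)\<^sup>2) * U (n + nat \<bar>k\<bar>) t k + of_int \<bar>k\<bar> * bilin (U (n + nat \<bar>k\<bar>) t) k"])
    show "(\<lambda>n. V (n + nat \<bar>k\<bar>) x k) \<longlonglongrightarrow> v x k" if "x \<in> {0..\<tau>}" for x
      by (rule LIMSEQ_ignore_initial_segment[OF vlim[OF that]])
    show "((\<lambda>t. V (n + nat \<bar>k\<bar>) t k) has_vector_derivative - of_real (\<mu> * (of_int k)\<^sup>2) * U (n + nat \<bar>k\<bar>) x k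
        + of_int \<bar>k\<bar> * bilin (U (n + nat \<bar>k\<bar>) x) k) (at x within {0..\<tau>})" if "x \<in> {0..\<tau>}" for n x
      using sol[of "n + nat \<bar>k\<bar>"] that by (auto simp: modes_upto_def)
    have sh: "filterlim (\<lambda>n. n + nat \<bar>k\<bar>) sequentially sequentially" by (rule filterlim_add_const_nat_at_top)
    have ub: "uniform_limit {0..\<tau>} (\<lambda>n t. bilin (U n t) k) (\<lambda>t. bilin (u t) k) sequentially"
      unfolding uniform_limit_iff
    proof (intro allI impI)
      fix \<epsilon> :: real assume \<epsilon>: "0 < \<epsilon>"
      have "(\<lambda>n. 4 * A * e n + 4 * A * sqrt M * (1 / real (Suc n))) \<longlonglongrightarrow> 4 * A * 0 + 4 * A * sqrt M * 0"
        by (intro tendsto_intros e_lim LIMSEQ_Suc[OF lim_1_over_n])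
      then have "\<forall>\<^sub>F n in sequentially. 4 * A * e n + 4 * A * sqrt M * (1 / real (Suc n)) < \<epsilon>"
        using \<epsilon> by (intro order_tendstoD(2)) auto
      then show "\<forall>\<^sub>F n in sequentially. \<forall>t\<in>{0..\<tau>}. dist (bilin (U n t) k) (bilin (u t) k) < \<epsilon>"
      proof eventually_elim
        case (elim n)
        show ?case
        proof
          fix t assume t: "t \<in> {0..\<tau>}"
          have "cmod (bilin (U n t) k - bilin (u t) k) \<le> 4 * A * e n + 4 * A * sqrt M / of_int (int (Suc n))"
            by (rule bilin_close[OF bd[OF t] bdu[OF t] _ kuerr[OF t] A_def]) auto
          then show "dist (bilin (U n t) k) (bilin (u t) k) < \<epsilon>" using elim by (simp add: dist_norm)
        qed
      qed
    qed
    have "uniform_limit {0..\<tau>} (\<lambda>n t. - of_real (\<mu> * (of_int k)\<^sup>2) * U n t k + of_int \<bar>k\<bar> * bilin (U n t) k)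
       (\<lambda>t. - of_real (\<mu> * (of_int k)\<^sup>2) * u t k + of_int \<bar>k\<bar> * bilin (u t) k) sequentially"
      by (intro uniform_limit_add bounded_linear.uniform_limit[OF bounded_linear_mult_right] ub unif_u)
    from filterlim_compose[OF this sh]
    show "uniform_limit {0..\<tau>} (\<lambda>n t. - of_real (\<mu> * (of_int k)\<^sup>2) * U (n + nat \<bar>k\<bar>) t k + of_int \<bar>k\<bar> * bilin (U (n + nat \<bar>k\<bar>) t) k)
       (\<lambda>t. - of_real (\<mu> * (of_int k)\<^sup>2) * u t k + of_int \<bar>k\<bar> * bilin (u t) k) sequentially" .
  qed simp
  have hu: "u t (- k) = cnj (u t k)" if t: "t \<in> {0..\<tau>}" for t k
  proof (rule LIMSEQ_unique[OF ulim[OF t]])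
    have "U n t (- k) = cnj (U n t k)" for n using sol t by (auto simp: modes_upto_def)
    then show "(\<lambda>n. U n t (- k)) \<longlonglongrightarrow> cnj (u t k)" using tendsto_cnj[OF ulim[OF t]] by simp
  qed
  have fin0: "u 0 k = a k \<and> v 0 k = b k" for k
  proof
    have ev: "\<forall>\<^sub>F n in sequentially. nat \<bar>k\<bar> \<le> n" by (rule eventually_ge_at_top)
    show "u 0 k = a k"
      by (rule LIMSEQ_unique[OF ulim tendsto_eventually]) (use \<tau> in \<open>auto intro!: eventually_mono[OF ev] simp: init\<close>)
    show "v 0 k = b k"
      by (rule LIMSEQ_unique[OF vlim tendsto_eventually]) (use \<tau> in \<open>auto intro!: eventually_mono[OF ev] simp: init\<close>)
  qed
  show ?thesis
  proof (rule that[of u v])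
    show "modes_upto \<mu> N {0..\<tau>} u v" for N
      unfolding modes_upto_def using hu du dv by blast
    show "u t 0 = 0 \<and> v t 0 = 0" if "t \<in> {0..\<tau>}" for t
      using ulim[OF that, of 0] vlim[OF that, of 0] supp[OF that, of 0] LIMSEQ_unique[OF tendsto_const] by force
    show "u 0 = a" "v 0 = b" using fin0 by auto
    show "sums_below (en (\<lambda>k. sq k) (u t) (v t)) (B * D)" if "t \<in> {0..\<tau>}" for t
      using bdu[OF that] by (simp add: M_def)
    fix t m q c assume t: "t \<in> {0..\<tau>}" and m: "weight q m" and c: "sums_below (en m a b) c"
    have c0: "0 \<le> c" using sums_below_nonneg[OF c] .
    define K where "K = 2 / min 1 \<mu> * (1 + 2 * \<mu>) * exp (2 / min 1 \<mu> * (4 * (2 ^ q + 1) + 2) * A * t)"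
    have K: "K \<le> growth_const \<mu> q"
    proof -
      have "44 / min 1 \<mu> * A * t \<le> 44 / min 1 \<mu> * A * \<tau>" using t \<mu> A0 by (intro mult_left_mono) auto
      also have "\<dots> \<le> 1" using time by (simp add: A_def M_def)
      finally have le: "44 / min 1 \<mu> * A * t * ((4 * 2 ^ q + 6) / 22) \<le> 1 * ((4 * 2 ^ q + 6) / 22)"
        by (intro mult_right_mono) auto
      have "2 / min 1 \<mu> * (4 * (2 ^ q + 1) + 2) * A * t \<le> (4 * 2 ^ q + 6) / 22"
      proof -
        define c :: real where "c = 4 * 2 ^ q + 6"
        have c: "4 * (2 ^ q + 1) + 2 = c" "4 * 2 ^ q + 6 = c" by (simp_all add: c_def)
        have "2 / min 1 \<mu> * c * A * t = 44 / min 1 \<mu> * A * t * (c / 22)" by simp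
        then show ?thesis using le unfolding c by (simp only: mult_1_left)
      qed
      then show ?thesis unfolding K_def growth_const_def using \<mu> by (intro mult_left_mono) auto
    qed
    have fin: "(\<Sum>k\<in>F. en m (U n t) (V n t) k) \<le> growth_const \<mu> q * c" if F: "finite F" for F n
    proof -
      define S where "S = {-int (Suc n)..int (Suc n)}"
      have "(\<Sum>k\<in>F. en m (U n t) (V n t) k) = (\<Sum>k\<in>F \<inter> S. en m (U n t) (V n t) k)"
        by (rule sum.mono_neutral_right[OF F]) (auto simp: S_def en_def supp[OF t])
      also have "\<dots> \<le> (\<Sum>k\<in>S. en m (U n t) (V n t) k)" by (rule sum_mono2) (auto simp: S_def en_nonneg)
      also have "\<dots> \<le> K * (\<Sum>k\<in>S. en m (U n 0) (V n 0) k)"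
        unfolding S_def K_def A_def
        by (rule modes_energy_growth[OF sol m \<mu> _ bd _ t]) (use supp BD(2) in \<open>auto simp: M_def\<close>)
      also have "(\<Sum>k\<in>S. en m (U n 0) (V n 0) k) = (\<Sum>k\<in>S. en m a b k)"
        by (intro sum.cong) (auto simp: S_def en_def init)
      also have "K * \<dots> \<le> growth_const \<mu> q * c"
        using K sums_belowD[OF c, of S] by (intro mult_mono) (auto simp: S_def K_def growth_const_def en_nonneg \<mu> less_imp_le c0 intro!: sum_nonneg)
      finally show ?thesis .
    qed
    show "sums_below (en m (u t) (v t)) (growth_const \<mu> q * c)"
      unfolding sums_below_def using LIMSEQ_le_const2[OF en_lim[OF t]] fin by blast
  qed
qed

section \<open>Absolutely convergent Fourier series\<close>

definition expi :: "int \<Rightarrow> real \<Rightarrow> complex" where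
  "expi k x = exp (\<i> * of_int k * of_real x)"

lemma norm_expi [simp]: "cmod (expi k x) = 1"
  by (simp add: expi_def norm_exp_eq_Re)

lemma expi_0 [simp]: "expi 0 x = 1"
  by (simp add: expi_def)

lemma expi_add: "expi (k + l) x = expi k x * expi l x"
  by (simp add: expi_def algebra_simps flip: exp_add)

lemma expi_minus: "expi (- k) x = cnj (expi k x)"
  by (simp add: expi_def exp_cnj)

lemma exp_minus_expi: "exp (- (\<i> * of_int k * of_real x)) = expi (- k) x"
  by (simp add: expi_def)

lemma continuous_on_expi [continuous_intros]: "continuous_on A (expi k)"
  unfolding expi_def by (intro continuous_intros)

lemma expi_periodic: "expi k (x + 2 * pi) = expi k x"
proof -
  have "expi k (x + 2 * pi) = expi k x * exp (2 * of_int k * of_real pi * \<i>)"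
    by (simp add: expi_def algebra_simps flip: exp_add)
  also have "exp (2 * of_int k * of_real pi * \<i>) = 1"
    using exp_integer_2pi[of "of_int k"] by (simp add: mult_ac)
  finally show ?thesis by simp
qed

lemma expi_has_vector_derivative:
  "(expi k has_vector_derivative \<i> * of_int k * expi k x) (at x within A)"
  unfolding expi_def
  by (auto intro!: derivative_eq_intros has_vector_derivative_real_field)

lemma set_lebesgue_integral_Icc_continuous:
  fixes f :: "real \<Rightarrow> 'a::euclidean_space"
  assumes "continuous_on {a..b} f"
  shows "(LINT x:{a..b}|lborel. f x) = integral {a..b} f"
  by (rule set_borel_integral_eq_integral(2))
     (use borel_integrable_compact[OF _ assms] in \<open>auto simp: set_integrable_def indicator_scaleR_eq_if\<close>)

lemma fourier_coeff_integral:
  assumes "continuous_on {0..2*pi} f"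
  shows "fourier_coeff f k = integral {0..2*pi} (\<lambda>x. of_real (f x) * expi (- k) x) / (2 * pi)"
  unfolding fourier_coeff_def exp_minus_expi
  by (subst set_lebesgue_integral_Icc_continuous) (auto intro!: continuous_intros assms)

lemma integral_expi: "integral {0..2*pi} (expi k) = (if k = 0 then 2 * pi else 0)"
  using integral_exp_int[of k] set_lebesgue_integral_Icc_continuous[OF continuous_on_expi, of 0 "2*pi" k]
  by (simp add: expi_def[abs_def])

lemma fourier_coeff_diff:
  assumes "continuous_on {0..2*pi} f" "continuous_on {0..2*pi} g"
  shows "fourier_coeff (\<lambda>x. f x - g x) k = fourier_coeff f k - fourier_coeff g k"
proof -
  have i: "(\<lambda>x. of_real (h x) * expi (- k) x) integrable_on {0..2*pi}" if "continuous_on {0..2*pi} h" for h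
    by (intro integrable_continuous_real continuous_intros that)
  show ?thesis
    using assms by (simp add: fourier_coeff_integral continuous_on_diff left_diff_distrib diff_divide_distrib
       Henstock_Kurzweil_Integration.integral_diff[OF i i])
qed

lemma fourier_coeff_cmult: "fourier_coeff (\<lambda>x. c * f x) k = of_real c * fourier_coeff f k"
proof -
  have "(LINT x:{0..2*pi}|lborel. complex_of_real (c * f x) * exp (- (\<i> * of_int k * of_real x)))
      = of_real c * (LINT x:{0..2*pi}|lborel. complex_of_real (f x) * exp (- (\<i> * of_int k * of_real x)))"
    by (subst set_integral_mult_right[symmetric]) (simp add: mult.assoc)
  then show ?thesis by (simp add: fourier_coeff_def)
qed

definition hermitian :: "(int \<Rightarrow> complex) \<Rightarrow> bool" where
  "hermitian a \<longleftrightarrow> (\<forall>k. a (- k) = cnj (a k))"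

text \<open>
  For Hermitian coefficients the series is real, and the real part changes the type only.
\<close>

definition synth :: "(int \<Rightarrow> complex) \<Rightarrow> real \<Rightarrow> real" where
  "synth a x = Re (\<Sum>\<^sub>\<infinity>k. a k * expi k x)"

lemma synth_summable:
  assumes "(\<lambda>k. cmod (a k)) summable_on UNIV"
  shows "(\<lambda>k. a k * expi k x) summable_on UNIV"
  by (rule abs_summable_summable) (use assms in \<open>simp add: norm_mult\<close>)

lemma of_real_synth:
  assumes a: "(\<lambda>k. cmod (a k)) summable_on UNIV" and h: "hermitian a"
  shows "of_real (synth a x) = (\<Sum>\<^sub>\<infinity>k. a k * expi k x)"
proof -
  have "cnj (\<Sum>\<^sub>\<infinity>k. a k * expi k x) = (\<Sum>\<^sub>\<infinity>k. cnj (a k * expi k x))"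
    by (simp only: infsum_cnj)
  also have "\<dots> = (\<Sum>\<^sub>\<infinity>k. a (- k) * expi (- k) x)"
    using h by (intro infsum_cong) (simp add: hermitian_def expi_minus)
  also have "\<dots> = (\<Sum>\<^sub>\<infinity>k. a k * expi k x)"
    by (rule infsum_reindex_bij_betw[of uminus UNIV UNIV "\<lambda>j. a j * expi j x"]) (rule bij_uminus)
  finally show ?thesis by (simp add: synth_def complex_eq_iff)
qed

lemma uniform_limit_synth_finite:
  assumes a: "(\<lambda>k. cmod (a k)) summable_on UNIV"
  shows "uniform_limit UNIV (\<lambda>F x. \<Sum>k\<in>F. a k * expi k x) (\<lambda>x. \<Sum>\<^sub>\<infinity>k. a k * expi k x) (finite_subsets_at_top UNIV)"
  by (rule Weierstrass_m_test_general[OF _ a]) (simp add: norm_mult)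

lemma filterlim_int_intervals: "filterlim (\<lambda>n. {- int n..int n}) (finite_subsets_at_top UNIV) sequentially"
  unfolding filterlim_finite_subsets_at_top
proof (intro allI impI)
  fix X :: "int set" assume X: "finite X \<and> X \<subseteq> UNIV"
  define m where "m = nat (Max (insert 0 (abs ` X)))"
  have "\<bar>k\<bar> \<le> int m" if "k \<in> X" for k
  proof -
    have "\<bar>k\<bar> \<le> Max (insert 0 (abs ` X))" using X that by (intro Max_ge) auto
    then show ?thesis unfolding m_def by linarith
  qed
  then have "\<forall>n\<ge>m. finite {- int n..int n} \<and> X \<subseteq> {- int n..int n} \<and> {- int n..int n} \<subseteq> UNIV"
    by (auto simp: abs_le_iff) (smt (verit) of_nat_mono)+
  then show "\<forall>\<^sub>F n in sequentially. finite {- int n..int n} \<and> X \<subseteq> {- int n..int n} \<and> {- int n..int n} \<subseteq> UNIV"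
    using eventually_at_top_linorder by blast
qed

lemma uniform_limit_synth:
  assumes a: "(\<lambda>k. cmod (a k)) summable_on UNIV"
  shows "uniform_limit UNIV (\<lambda>n x. \<Sum>k\<in>{- int n..int n}. a k * expi k x) (\<lambda>x. \<Sum>\<^sub>\<infinity>k. a k * expi k x) sequentially"
  by (rule filterlim_compose[OF uniform_limit_synth_finite[OF a] filterlim_int_intervals])

lemma continuous_on_synth [continuous_intros]:
  assumes a: "(\<lambda>k. cmod (a k)) summable_on UNIV"
  shows "continuous_on A (synth a)"
proof -
  have "continuous_on UNIV (\<lambda>x. \<Sum>\<^sub>\<infinity>k. a k * expi k x)"
    by (rule uniform_limit_theorem[OF _ uniform_limit_synth[OF a]]) (auto intro!: always_eventually continuous_intros)
  then have "continuous_on UNIV (synth a)" unfolding synth_def[abs_def] by (intro continuous_intros)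
  then show ?thesis by (rule continuous_on_subset) simp
qed

lemma synth_periodic: "synth a (x + 2 * pi) = synth a x"
  by (simp add: synth_def expi_periodic)

lemma abs_synth_le:
  assumes a: "(\<lambda>k. cmod (a k)) summable_on UNIV"
  shows "\<bar>synth a x\<bar> \<le> (\<Sum>\<^sub>\<infinity>k. cmod (a k))"
proof -
  have "\<bar>synth a x\<bar> \<le> cmod (\<Sum>\<^sub>\<infinity>k. a k * expi k x)" unfolding synth_def by (rule abs_Re_le_cmod)
  also have "\<dots> \<le> (\<Sum>\<^sub>\<infinity>k. cmod (a k * expi k x))"
    by (rule norm_infsum_bound) (use a in \<open>simp add: norm_mult\<close>)
  finally show ?thesis by (simp add: norm_mult)
qed

text \<open>
  An absolutely convergent series converges uniformly and may be integrated term by term.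
\<close>

lemma fourier_coeff_synth:
  assumes a: "(\<lambda>k. cmod (a k)) summable_on UNIV" and h: "hermitian a"
  shows "fourier_coeff (synth a) k = a k"
proof -
  define g where "g x = (\<Sum>\<^sub>\<infinity>k. a k * expi k x)" for x
  have "uniform_limit {0..2*pi} (\<lambda>n x. (\<Sum>j\<in>{- int n..int n}. a j * expi j x)) g sequentially"
    using uniform_limit_synth[OF a] uniform_limit_on_subset unfolding g_def by blast
  moreover have "uniform_limit {0..2*pi} (\<lambda>n :: nat. expi (- k)) (expi (- k)) sequentially"
    by (rule uniform_limit_const)
  moreover have "bounded (g ` {0..2*pi})" "bounded (expi (- k) ` {0..2*pi})"
  proof -
    have "continuous_on UNIV g" unfolding g_def
      by (rule uniform_limit_theorem[OF _ uniform_limit_synth[OF a]]) (auto intro!: always_eventually continuous_intros)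
    then have "continuous_on {0..2*pi} g" by (rule continuous_on_subset) simp
    then show "bounded (g ` {0..2*pi})"
      by (intro compact_imp_bounded compact_continuous_image) auto
    show "bounded (expi (- k) ` {0..2*pi})"
      by (intro compact_imp_bounded compact_continuous_image continuous_on_expi) auto
  qed
  ultimately have "uniform_limit {0..2*pi} (\<lambda>n x. (\<Sum>j\<in>{- int n..int n}. a j * expi j x) * expi (- k) x)
      (\<lambda>x. g x * expi (- k) x) sequentially"
    by (rule uniform_lim_mult)
  then obtain I J where I: "\<And>n. ((\<lambda>x. (\<Sum>j\<in>{- int n..int n}. a j * expi j x) * expi (- k) x) has_integral I n) {0..2*pi}"
    and J: "((\<lambda>x. g x * expi (- k) x) has_integral J) {0..2*pi}" and IJ: "I \<longlonglongrightarrow> J"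
    by (rule uniform_limit_integral) (auto intro!: continuous_intros)
  have "I n = 2 * pi * a k" if n: "nat \<bar>k\<bar> \<le> n" for n
  proof -
    have "I n = integral {0..2*pi} (\<lambda>x. \<Sum>j\<in>{- int n..int n}. a j * expi (j - k) x)"
      using integral_unique[OF I[of n]] expi_add[of _ "- k"] by (simp add: sum_distrib_right mult.assoc)
    also have "\<dots> = (\<Sum>j\<in>{- int n..int n}. a j * integral {0..2*pi} (expi (j - k)))"
      by (subst integral_sum) (auto intro!: integrable_continuous_real continuous_intros)
    also have "\<dots> = (\<Sum>j\<in>{- int n..int n}. if j = k then 2 * pi * a k else 0)"
      by (intro sum.cong) (auto simp: integral_expi)
    also have "\<dots> = 2 * pi * a k" using n by (subst sum.delta) auto
    finally show ?thesis .
  qed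
  then have "\<forall>\<^sub>F n in sequentially. I n = 2 * pi * a k"
    by (rule eventually_mono[OF eventually_ge_at_top[of "nat \<bar>k\<bar>"]])
  then have "J = 2 * pi * a k" using IJ LIMSEQ_unique tendsto_eventually by blast
  then have "integral {0..2*pi} (\<lambda>x. of_real (synth a x) * expi (- k) x) = 2 * pi * a k"
    using integral_unique[OF J] by (simp add: of_real_synth[OF a h] g_def)
  then show ?thesis by (simp add: fourier_coeff_integral continuous_on_synth[OF a])
qed

text \<open>
  The derivatives of the partial sums converge uniformly.
\<close>

lemma synth_has_real_derivative:
  assumes a: "(\<lambda>k. cmod (a k)) summable_on UNIV" and b: "(\<lambda>k. of_int \<bar>k\<bar> * cmod (a k)) summable_on UNIV"
  shows "(synth a has_real_derivative synth (\<lambda>k. \<i> * of_int k * a k) x) (at x)"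
proof -
  have b': "(\<lambda>k. cmod (\<i> * of_int k * a k)) summable_on UNIV" using b by (simp add: norm_mult)
  have "((\<lambda>x. \<Sum>\<^sub>\<infinity>k. a k * expi k x) has_vector_derivative (\<Sum>\<^sub>\<infinity>k. \<i> * of_int k * a k * expi k x)) (at x within UNIV)"
  proof (rule has_vector_derivative_uniform_limit[OF _ _ _ _ uniform_limit_synth[OF b']])
    show "((\<lambda>x. \<Sum>k\<in>{- int n..int n}. a k * expi k x) has_vector_derivative
        (\<Sum>k\<in>{- int n..int n}. \<i> * of_int k * a k * expi k x)) (at x within UNIV)" for n x
    proof (rule has_vector_derivative_sum)
      fix k
      show "((\<lambda>x. a k * expi k x) has_vector_derivative \<i> * of_int k * a k * expi k x) (at x within UNIV)"
        using has_vector_derivative_mult_right[OF expi_has_vector_derivative, of "a k" k x UNIV] by (simp add: mult_ac)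
    qed
    show "(\<lambda>n. \<Sum>k\<in>{- int n..int n}. a k * expi k x) \<longlonglongrightarrow> (\<Sum>\<^sub>\<infinity>k. a k * expi k x)" for x
      by (rule tendsto_uniform_limitI[OF uniform_limit_synth[OF a]]) simp
  qed auto
  from bounded_linear.has_vector_derivative[OF bounded_linear_Re this]
  show ?thesis by (simp add: has_real_derivative_iff_has_vector_derivative synth_def[abs_def])
qed

lemma deriv_synth:
  assumes "(\<lambda>k. cmod (a k)) summable_on UNIV" "(\<lambda>k. of_int \<bar>k\<bar> * cmod (a k)) summable_on UNIV"
  shows "deriv (synth a) = synth (\<lambda>k. \<i> * of_int k * a k)"
  using DERIV_imp_deriv[OF synth_has_real_derivative[OF assms]] by blast

lemma hermitian_deriv: "hermitian a \<Longrightarrow> hermitian (\<lambda>k. \<i> * of_int k * a k)"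
  by (simp add: hermitian_def)

lemma periodic_int:
  fixes f :: "real \<Rightarrow> 'a"
  assumes "\<And>x. f (x + 2 * pi) = f x"
  shows "f (x + of_int n * (2 * pi)) = f x"
proof -
  have nat: "f (x + of_nat n * (2 * pi)) = f x" for n x
  proof (induction n arbitrary: x)
    case (Suc n)
    have "f (x + of_nat (Suc n) * (2 * pi)) = f ((x + of_nat n * (2 * pi)) + 2 * pi)"
      by (simp add: algebra_simps)
    then show ?case using Suc by (simp only: assms)
  qed simp
  show ?thesis
  proof (cases n)
    case (nonneg m)
    then show ?thesis using nat[of x m] by simp
  next
    case (neg m)
    then have "real_of_int n = - of_nat (Suc m)" by simp
    then have eq: "x + of_int n * (2 * pi) + of_nat (Suc m) * (2 * pi) = x" by (simp only: minus_mult_left[symmetric])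
    show ?thesis using nat[of "x + of_int n * (2 * pi)" "Suc m"] unfolding eq by simp
  qed
qed

text \<open>
  A continuous function on the circle whose Fourier coefficients vanish is orthogonal to all
  trigonometric polynomials, hence to itself by the Stone-Weierstrass theorem. The function is
  transported to the unit circle in the complex plane, where polynomials in two real variables restrict
  to trigonometric polynomials.
\<close>

lemma fourier_coeff_zero_imp_zero:
  assumes f: "continuous_on UNIV f" and per: "\<And>x. f (x + 2 * pi) = f x"
    and zero: "\<And>k. fourier_coeff f k = 0"
  shows "f x = 0"
proof -
  have f': "continuous_on A f" for A using f by (rule continuous_on_subset) simp
  define F where "F z = f (Arg z)" for z
  have F_exp: "F (expi 1 x) = f x" for x
  proof -
    have "is_Arg (expi 1 x) (Arg (expi 1 x))" by (rule is_Arg_Arg) (simp add: expi_def)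
    then have "exp (\<i> * of_real x) = exp (\<i> * of_real (Arg (expi 1 x)))" by (simp add: is_Arg_def expi_def)
    then obtain n :: int where "\<i> * of_real x = \<i> * of_real (Arg (expi 1 x)) + (of_int (2 * n) * pi) * \<i>"
      unfolding exp_eq by blast
    then have "of_real x = complex_of_real (Arg (expi 1 x) + of_int n * (2 * pi))"
      by (simp add: complex_eq_iff algebra_simps)
    then have "x = Arg (expi 1 x) + of_int n * (2 * pi)" by (simp only: of_real_eq_iff)
    then show ?thesis unfolding F_def using periodic_int[where f = f, OF per] by metis
  qed
  \<comment> \<open>Two branches of the argument, with cuts on opposite half-lines, give the continuity of \<open>F\<close>.\<close>
  have F2: "F z = f (Arg2pi z)" for z
  proof (cases "z = 0")
    case True
    then show ?thesis by (simp add: F_def Arg_zero)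
  next
    case False
    have "z / of_real (cmod z) = expi 1 (Arg2pi z)" "z / of_real (cmod z) = expi 1 (Arg z)"
      using Arg2pi[of z] is_Arg_Arg[OF False] False by (auto simp: is_Arg_def expi_def field_simps)
    then show ?thesis by (metis F_exp F_def)
  qed
  have contF: "continuous_on (sphere 0 1) F"
  proof (rule continuous_at_imp_continuous_on, rule ballI)
    fix z :: complex assume "z \<in> sphere 0 1"
    then have "z \<noteq> 0" by auto
    then have "z \<notin> \<real>\<^sub>\<le>\<^sub>0 \<or> z \<notin> \<real>\<^sub>\<ge>\<^sub>0"
      by (auto simp: complex_nonpos_Reals_iff complex_nonneg_Reals_iff complex_eq_iff)
    then consider "z \<notin> \<real>\<^sub>\<le>\<^sub>0" | "z \<notin> \<real>\<^sub>\<ge>\<^sub>0" by blast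
    then show "isCont F z"
    proof cases
      case 1
      have "isCont f (Arg z)" using f by (simp add: continuous_on_eq_continuous_at)
      then show ?thesis unfolding F_def[abs_def] using continuous_at_Arg[OF 1] by (rule isCont_o2[rotated])
    next
      case 2
      have "isCont f (Arg2pi z)" using f by (simp add: continuous_on_eq_continuous_at)
      moreover have "F = (\<lambda>z. f (Arg2pi z))" using F2 by blast
      ultimately show ?thesis using continuous_at_Arg2pi[OF 2] by (auto intro: isCont_o2)
    qed
  qed
  \<comment> \<open>The functions \<open>g\<close> such that \<open>f * g\<close> is orthogonal to all exponentials form a space that is
    closed under multiplication by exponentials, hence by polynomials on the circle.\<close>
  define V where "V g \<longleftrightarrow> continuous_on UNIV g \<and> (\<forall>k. integral {0..2*pi} (\<lambda>x. of_real (f x) * g x * expi k x) = 0)"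
    for g :: "real \<Rightarrow> complex"
  have int: "(\<lambda>x. of_real (f x) * g x * expi k x) integrable_on {0..2*pi}" if "V g" for g k
    using that continuous_on_subset[of UNIV g "{0..2*pi}"]
    by (intro integrable_continuous_real continuous_intros f') (auto simp: V_def)
  have V_add: "V (\<lambda>x. g x + h x)" if "V g" "V h" for g h
    using that int[OF that(1)] int[OF that(2)]
    by (auto simp: V_def distrib_left distrib_right Henstock_Kurzweil_Integration.integral_add intro!: continuous_intros)
  have V_cmult: "V (\<lambda>x. c * g x)" if "V g" for g c
  proof -
    have "integral {0..2*pi} (\<lambda>x. of_real (f x) * (c * g x) * expi k x) = c * integral {0..2*pi} (\<lambda>x. of_real (f x) * g x * expi k x)" for k
      by (subst integral_mult_right[symmetric]) (simp add: mult_ac)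
    then show ?thesis using that by (auto simp: V_def intro!: continuous_intros)
  qed
  have V_expi: "V (\<lambda>x. g x * expi j x)" if "V g" for g j
    using that unfolding V_def mult.assoc expi_add[symmetric]
    by (auto simp: mult.assoc intro!: continuous_intros)
  have V_poly: "V (\<lambda>x. g x * of_real (p (expi 1 x)))" if "real_polynomial_function p" "V g" for p g
    using that
  proof (induction p arbitrary: g rule: real_polynomial_function.induct)
    case (linear h)
    interpret bounded_linear h by (rule linear)
    have e: "h (expi 1 x) = cos x * h 1 + sin x * h \<i>" for x
    proof -
      have "expi 1 x = cos x *\<^sub>R 1 + sin x *\<^sub>R \<i>"
        by (simp add: expi_def exp_Euler cos_of_real sin_of_real scaleR_conv_of_real mult.commute)
      then show ?thesis by (simp only: add scaleR) simp
    qed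
    have cs: "complex_of_real (cos x) = (expi 1 x + expi (- 1) x) / 2" "complex_of_real (sin x) = - \<i> * (expi 1 x - expi (- 1) x) / 2" for x
      by (simp_all add: expi_def exp_Euler exp_minus_Euler cos_of_real sin_of_real)
    have "V (\<lambda>x. ((h 1 / 2 - h \<i> / 2 * \<i>) * (g x * expi 1 x)) + ((h 1 / 2 + h \<i> / 2 * \<i>) * (g x * expi (- 1) x)))"
      by (intro V_add V_cmult V_expi \<open>V g\<close>)
    also have "(\<lambda>x. ((h 1 / 2 - h \<i> / 2 * \<i>) * (g x * expi 1 x)) + ((h 1 / 2 + h \<i> / 2 * \<i>) * (g x * expi (- 1) x)))
       = (\<lambda>x. g x * of_real (h (expi 1 x)))"
      unfolding e of_real_add of_real_mult cs by (simp add: field_simps)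
    finally show ?case .
  next
    case (const c)
    then show ?case using V_cmult[of g "of_real c"] by (simp add: mult.commute)
  next
    case (add p q)
    then show ?case using V_add[of "\<lambda>x. g x * of_real (p (expi 1 x))" "\<lambda>x. g x * of_real (q (expi 1 x))"]
      by (simp add: distrib_left)
  next
    case (mult p q)
    have "V (\<lambda>x. (g x * of_real (p (expi 1 x))) * of_real (q (expi 1 x)))" by (intro mult.IH mult.prems)
    then show ?case by (simp add: mult.assoc)
  qed
  have V1: "V (\<lambda>_. 1)"
    unfolding V_def
  proof (intro conjI allI)
    fix k
    show "integral {0..2*pi} (\<lambda>x. of_real (f x) * 1 * expi k x) = 0"
      using zero[of "- k"] by (simp add: fourier_coeff_integral[OF f'])
  qed simp
  obtain c where "\<forall>x\<in>{0..2*pi}. \<bar>f x\<bar> \<le> c"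
    using compact_imp_bounded[OF compact_continuous_image[OF f', of "{0..2*pi}"]]
    by (auto simp: bounded_iff)
  then have c: "\<And>x. x \<in> {0..2*pi} \<Longrightarrow> \<bar>f x\<bar> \<le> c" by blast
  have c0: "0 \<le> c" using c[of 0] by simp
  have le: "integral {0..2*pi} (\<lambda>x. (f x)\<^sup>2) \<le> (c * e) * (2 * pi)" if e: "0 < e" for e
  proof -
    obtain p where p: "real_polynomial_function p" "\<And>z. z \<in> sphere 0 1 \<Longrightarrow> \<bar>F z - p z\<bar> < e"
      using Stone_Weierstrass_real_polynomial_function[OF _ contF e] by auto
    have pe: "\<bar>f x - p (expi 1 x)\<bar> \<le> e" for x using p(2)[of "expi 1 x"] by (simp add: F_exp less_imp_le)
    have "V (\<lambda>x. 1 * of_real (p (expi 1 x)))" by (rule V_poly[OF p(1) V1])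
    then have contp: "continuous_on UNIV (\<lambda>x. complex_of_real (p (expi 1 x)))"
      and int0: "integral {0..2*pi} (\<lambda>x. complex_of_real (f x * p (expi 1 x))) = 0"
      by (auto simp: V_def dest: spec[of _ 0])
    have "continuous_on UNIV (\<lambda>x. Re (complex_of_real (p (expi 1 x))))" by (intro continuous_intros contp)
    then have contp: "continuous_on {0..2*pi} (\<lambda>x. p (expi 1 x))" using continuous_on_subset by auto
    have ip: "(\<lambda>x. f x * p (expi 1 x)) integrable_on {0..2*pi}" "(\<lambda>x. (f x)\<^sup>2) integrable_on {0..2*pi}"
      by (intro integrable_continuous_real continuous_intros contp f')+
    have "complex_of_real (integral {0..2*pi} (\<lambda>x. f x * p (expi 1 x))) = integral {0..2*pi} (\<lambda>x. complex_of_real (f x * p (expi 1 x)))"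
      using integral_linear[OF ip(1) bounded_linear_of_real[where 'a = complex]] by (simp add: o_def)
    then have "integral {0..2*pi} (\<lambda>x. f x * p (expi 1 x)) = 0" using int0 by simp
    then have "integral {0..2*pi} (\<lambda>x. (f x)\<^sup>2) = integral {0..2*pi} (\<lambda>x. f x * (f x - p (expi 1 x)))"
      using Henstock_Kurzweil_Integration.integral_diff[OF ip(2,1)] by (simp add: power2_eq_square right_diff_distrib)
    also have "\<dots> \<le> \<bar>\<dots>\<bar>" by simp
    also have "\<dots> \<le> (c * e) * (2 * pi - 0)"
      unfolding real_norm_def[symmetric]
    proof (rule integral_bound)
      fix x assume "x \<in> {0..2*pi}"
      then show "norm (f x * (f x - p (expi 1 x))) \<le> c * e"
        unfolding norm_mult using c pe[of x] c0 by (intro mult_mono) auto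
    qed (auto intro!: continuous_intros contp f')
    finally show ?thesis by simp
  qed
  have "integral {0..2*pi} (\<lambda>x. (f x)\<^sup>2) \<le> 0"
  proof (rule field_le_epsilon)
    fix e :: real assume e: "0 < e"
    have "(c * (e / ((c + 1) * (2 * pi)))) * (2 * pi) = c / (c + 1) * e"
      using pi_gt_zero by (simp add: divide_simps)
    also have "\<dots> \<le> 1 * e" using e c0 by (intro mult_right_mono) auto
    finally have "(c * (e / ((c + 1) * (2 * pi)))) * (2 * pi) \<le> e" by simp
    moreover have "0 < e / ((c + 1) * (2 * pi))" using e c0 by simp
    ultimately show "integral {0..2*pi} (\<lambda>x. (f x)\<^sup>2) \<le> 0 + e" using le[of "e / ((c + 1) * (2 * pi))"] by simp
  qed
  moreover have "0 \<le> integral {0..2*pi} (\<lambda>x. (f x)\<^sup>2)"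
    by (intro integral_nonneg integrable_continuous_real continuous_intros f') auto
  ultimately have "integral {0..2*pi} (\<lambda>x. (f x)\<^sup>2) = 0" by simp
  then have z: "f y = 0" if "y \<in> {0..2*pi}" for y
    using that by (subst (asm) integral_eq_0_iff) (auto intro!: continuous_intros f')
  define n where "n = \<lfloor>x / (2 * pi)\<rfloor>"
  have "of_int n \<le> x / (2 * pi)" "x / (2 * pi) \<le> of_int n + 1" unfolding n_def by linarith+
  then have "x + of_int (- n) * (2 * pi) \<in> {0..2*pi}" by (simp add: field_simps)
  then show ?thesis using z periodic_int[where f = f, OF per, of x "- n"] by metis
qed

section \<open>Convolutions and the Fourier coefficients of the flux\<close>

lemma japanese_ge: "of_int \<bar>k\<bar> \<le> japanese k" "1 \<le> japanese k"
  by (auto simp: japanese_def intro!: real_le_rsqrt)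

text \<open>
  Cauchy-Schwarz against \<open>japanese k powr (j - s)\<close>, which is square summable for \<open>s > j + 1/2\<close>.
\<close>

lemma summable_pow_mult:
  fixes a :: "int \<Rightarrow> complex"
  assumes a: "(\<lambda>k. japanese k powr (2 * s) * (cmod (a k))\<^sup>2) summable_on UNIV" and s: "real j + 1/2 < s"
  shows "(\<lambda>k. of_int \<bar>k\<bar> ^ j * cmod (a k)) summable_on UNIV"
proof -
  let ?g = "\<lambda>k. japanese k powr (2 * s) * (cmod (a k))\<^sup>2 + japanese k powr (- 2 * (s - real j))"
  have g: "?g summable_on UNIV"
    using s by (intro summable_on_add a japanese_summable) auto
  have "norm (of_int \<bar>k\<bar> ^ j * cmod (a k)) \<le> ?g k" for k
  proof -
    \<comment> \<open>\<open>2 x y \<le> x\<^sup>2 + y\<^sup>2\<close> with \<open>x = p * cmod (a k)\<close> and \<open>y = q\<close>.\<close>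
    define p where "p = japanese k powr s"
    define q where "q = japanese k powr (real j - s)"
    have p: "0 < p" "0 < q" using japanese_pos[of k] by (auto simp: p_def q_def)
    have pq: "japanese k powr (2 * s) = p\<^sup>2" "japanese k powr (- 2 * (s - real j)) = q\<^sup>2" "p * q = japanese k ^ j"
      using japanese_pos[of k]
      by (auto simp: p_def q_def power2_eq_square powr_realpow simp flip: powr_add)
    have "of_int \<bar>k\<bar> ^ j * cmod (a k) \<le> japanese k ^ j * cmod (a k)"
      by (intro mult_right_mono power_mono japanese_ge) auto
    also have "\<dots> = (p * cmod (a k)) * q" by (simp flip: pq(3))
    also have "\<dots> \<le> (p * cmod (a k))\<^sup>2 + q\<^sup>2"
    proof -
      have "0 \<le> (p * cmod (a k)) * q" using p by simp
      then show ?thesis using sum_squares_bound[of "p * cmod (a k)" q] by linarith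
    qed
    finally show ?thesis by (simp only: pq power_mult_distrib) simp
  qed
  then show ?thesis by (intro summable_on_comparison_test[OF g]) auto
qed

lemma sobolevD:
  assumes "f \<in> sobolev s"
  shows "f (x + 2 * pi) = f x" "continuous_on A f"
    "(\<lambda>k. japanese k powr (2 * s) * (cmod (fourier_coeff f k))\<^sup>2) summable_on UNIV"
  using assms continuous_on_subset[of UNIV f A] by (auto simp: sobolev_def)

lemma hermitian_fourier_coeff: "hermitian (fourier_coeff f)"
  by (simp add: hermitian_def cnj_fourier_coeff)

text \<open>
  The difference of both sides is continuous and has vanishing Fourier coefficients.
\<close>

lemma synth_fourier_coeff:
  assumes f: "f \<in> sobolev s" and s: "1/2 < s"
  shows "synth (fourier_coeff f) = f"
proof
  fix x
  note a = fourier_coeff_abs_summable[OF f s]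
  have "f x - synth (fourier_coeff f) x = 0"
  proof (rule fourier_coeff_zero_imp_zero[where f = "\<lambda>x. f x - synth (fourier_coeff f) x"])
    show "continuous_on UNIV (\<lambda>x. f x - synth (fourier_coeff f) x)"
      by (intro continuous_intros sobolevD(2)[OF f] a)
    show "f (x + 2 * pi) - synth (fourier_coeff f) (x + 2 * pi) = f x - synth (fourier_coeff f) x" for x
      by (simp add: synth_periodic sobolevD(1)[OF f])
    show "fourier_coeff (\<lambda>x. f x - synth (fourier_coeff f) x) k = 0" for k
      by (subst fourier_coeff_diff) (auto intro!: sobolevD(2)[OF f] continuous_intros a
        simp: fourier_coeff_synth[OF a hermitian_fourier_coeff])
  qed
  then show "synth (fourier_coeff f) x = f x" by simp
qed

lemma synth_in_sobolev:
  assumes a: "(\<lambda>k. japanese k powr (2 * s) * (cmod (a k))\<^sup>2) summable_on UNIV" and h: "hermitian a" and s: "1/2 < s"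
  shows "synth a \<in> sobolev s" "fourier_coeff (synth a) = a"
proof -
  have l1: "(\<lambda>k. cmod (a k)) summable_on UNIV" using summable_pow_mult[OF a, of 0] s by simp
  show fc: "fourier_coeff (synth a) = a" using fourier_coeff_synth[OF l1 h] by blast
  show "synth a \<in> sobolev s"
    using a by (simp add: sobolev_def fc synth_periodic continuous_on_synth[OF l1])
qed

definition conv :: "(int \<Rightarrow> complex) \<Rightarrow> (int \<Rightarrow> complex) \<Rightarrow> int \<Rightarrow> complex" where
  "conv a b k = (\<Sum>\<^sub>\<infinity>l. a (k - l) * b l)"

lemma conv_pair_summable:
  fixes a b :: "int \<Rightarrow> complex"
  assumes a: "(\<lambda>k. cmod (a k)) summable_on UNIV" and b: "(\<lambda>k. cmod (b k)) summable_on UNIV"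
  shows "(\<lambda>(k, l). cmod (a (k - l) * b l)) summable_on UNIV \<times> UNIV"
proof -
  have "(\<lambda>(j, l). cmod (a j * b l)) summable_on UNIV \<times> UNIV"
  proof -
    have "(\<lambda>l. cmod (a j * b l)) summable_on UNIV" for j
      using summable_on_cmult_right[OF b, of "cmod (a j)"] by (simp add: norm_mult)
    moreover have "(\<lambda>j. \<Sum>\<^sub>\<infinity>l. cmod (a j * b l)) summable_on UNIV"
      using summable_on_cmult_left[OF a] by (simp add: norm_mult infsum_cmult_right')
    ultimately show ?thesis
      using Infinite_Sum.abs_summable_on_Sigma_iff[of "\<lambda>(j, l). a j * b l" UNIV "\<lambda>_. UNIV"]
      by (simp add: abs_of_nonneg infsum_nonneg case_prod_unfold)
  qed
  moreover have "bij_betw (\<lambda>(k, l). (k - l, l)) (UNIV \<times> UNIV) (UNIV \<times> (UNIV :: int set))"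
    by (rule bij_betwI[where g = "\<lambda>(j, l). (j + l, l)"]) auto
  ultimately show ?thesis
    using summable_on_reindex_bij_betw[of "\<lambda>(k, l). (k - l, l)" "UNIV \<times> UNIV" "UNIV \<times> UNIV" "\<lambda>(j, l). cmod (a j * b l)"]
    by (simp add: case_prod_unfold flip: UNIV_Times_UNIV)
qed

lemmas conv_Sigma_iff = Infinite_Sum.abs_summable_on_Sigma_iff[of "\<lambda>(k, l). a (k - l) * b l" UNIV "\<lambda>_. UNIV",
  simplified case_prod_unfold fst_conv snd_conv] for a b :: "int \<Rightarrow> complex"

lemma conv_term_summable:
  fixes a b :: "int \<Rightarrow> complex"
  assumes a: "(\<lambda>k. cmod (a k)) summable_on UNIV" and b: "(\<lambda>k. cmod (b k)) summable_on UNIV"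
  shows "(\<lambda>l. cmod (a (k - l) * b l)) summable_on UNIV" "(\<lambda>l. a (k - l) * b l) summable_on UNIV"
proof -
  show "(\<lambda>l. cmod (a (k - l) * b l)) summable_on UNIV"
    using conv_pair_summable[OF a b] conv_Sigma_iff[of a b] by (simp add: case_prod_unfold)
  then show "(\<lambda>l. a (k - l) * b l) summable_on UNIV" by (rule abs_summable_summable)
qed

lemma conv_abs_summable:
  fixes a b :: "int \<Rightarrow> complex"
  assumes a: "(\<lambda>k. cmod (a k)) summable_on UNIV" and b: "(\<lambda>k. cmod (b k)) summable_on UNIV"
  shows "(\<lambda>k. cmod (conv a b k)) summable_on UNIV"
proof (rule summable_on_comparison_test)
  show "(\<lambda>k. \<Sum>\<^sub>\<infinity>l. cmod (a (k - l) * b l)) summable_on UNIV"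
    using conv_pair_summable[OF a b] conv_Sigma_iff[of a b]
    by (simp add: case_prod_unfold abs_of_nonneg infsum_nonneg)
  show "cmod (conv a b k) \<le> (\<Sum>\<^sub>\<infinity>l. cmod (a (k - l) * b l))" for k
    unfolding conv_def by (rule norm_infsum_bound[OF conv_term_summable(1)[OF a b]])
qed simp

lemma conv_expi:
  fixes a b :: "int \<Rightarrow> complex"
  assumes a: "(\<lambda>k. cmod (a k)) summable_on UNIV" and b: "(\<lambda>k. cmod (b k)) summable_on UNIV"
  shows "(\<Sum>\<^sub>\<infinity>k. a k * expi k x) * (\<Sum>\<^sub>\<infinity>k. b k * expi k x) = (\<Sum>\<^sub>\<infinity>k. conv a b k * expi k x)"
proof -
  have "(\<Sum>\<^sub>\<infinity>k. a k * expi k x) * (\<Sum>\<^sub>\<infinity>k. b k * expi k x)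
      = (\<Sum>\<^sub>\<infinity>l. (\<Sum>\<^sub>\<infinity>k. a k * expi k x) * (b l * expi l x))"
    by (rule infsum_cmult_right'[symmetric])
  also have "\<dots> = (\<Sum>\<^sub>\<infinity>l. \<Sum>\<^sub>\<infinity>k. a (k - l) * b l * expi k x)"
  proof (rule infsum_cong)
    fix l :: int
    have "bij_betw (\<lambda>k. k - l) UNIV UNIV" by (rule bij_betwI[where g = "\<lambda>k. k + l"]) auto
    then have "(\<Sum>\<^sub>\<infinity>k. a k * expi k x) = (\<Sum>\<^sub>\<infinity>k. a (k - l) * expi (k - l) x)"
      by (rule infsum_reindex_bij_betw[symmetric])
    then have "(\<Sum>\<^sub>\<infinity>k. a k * expi k x) * (b l * expi l x) = (\<Sum>\<^sub>\<infinity>k. a (k - l) * expi (k - l) x * (b l * expi l x))"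
      by (simp only: infsum_cmult_left')
    also have "\<dots> = (\<Sum>\<^sub>\<infinity>k. a (k - l) * b l * expi k x)"
    proof (rule infsum_cong)
      fix k
      show "a (k - l) * expi (k - l) x * (b l * expi l x) = a (k - l) * b l * expi k x"
        using expi_add[of "k - l" l x] by simp
    qed
    finally show "(\<Sum>\<^sub>\<infinity>k. a k * expi k x) * (b l * expi l x) = (\<Sum>\<^sub>\<infinity>k. a (k - l) * b l * expi k x)" .
  qed
  also have "\<dots> = (\<Sum>\<^sub>\<infinity>k. \<Sum>\<^sub>\<infinity>l. a (k - l) * b l * expi k x)"
  proof (rule infsum_swap_banach[symmetric])
    have "(\<lambda>p. cmod (case p of (k, l) \<Rightarrow> a (k - l) * b l * expi k x)) summable_on UNIV \<times> UNIV"
      using conv_pair_summable[OF a b] by (simp add: case_prod_unfold norm_mult)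
    then show "(\<lambda>(k, l). a (k - l) * b l * expi k x) summable_on UNIV \<times> UNIV" by (rule abs_summable_summable)
  qed
  also have "\<dots> = (\<Sum>\<^sub>\<infinity>k. conv a b k * expi k x)"
    by (simp add: conv_def infsum_cmult_left')
  finally show ?thesis .
qed

lemma synth_mult:
  assumes a: "(\<lambda>k. cmod (a k)) summable_on UNIV" "hermitian a" and b: "(\<lambda>k. cmod (b k)) summable_on UNIV" "hermitian b"
  shows "synth a x * synth b x = synth (conv a b) x"
  using arg_cong[OF conv_expi[OF a(1) b(1), of x], of Re]
  unfolding synth_def[of "conv a b"] by (simp flip: of_real_synth[OF a] of_real_synth[OF b])

lemma hermitian_conv:
  assumes "hermitian a" "hermitian b"
  shows "hermitian (conv a b)"
  unfolding hermitian_def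
proof
  fix k
  have "conv a b (- k) = (\<Sum>\<^sub>\<infinity>l. a (- k - - l) * b (- l))"
    unfolding conv_def by (rule infsum_reindex_bij_betw[symmetric]) (rule bij_uminus)
  also have "\<dots> = (\<Sum>\<^sub>\<infinity>l. cnj (a (k - l) * b l))"
  proof (rule infsum_cong)
    fix l
    have "a (- k - - l) = a (- (k - l))" by simp
    also have "\<dots> = cnj (a (k - l))" using assms(1) unfolding hermitian_def by blast
    finally show "a (- k - - l) * b (- l) = cnj (a (k - l) * b l)" using assms(2) by (simp add: hermitian_def)
  qed
  also have "\<dots> = cnj (conv a b k)" unfolding conv_def by (rule infsum_cnj)
  finally show "conv a b (- k) = cnj (conv a b k)" .
qed

lemma infsum_of_real:
  assumes "f summable_on A"
  shows "(\<Sum>\<^sub>\<infinity>x\<in>A. complex_of_real (f x)) = of_real (infsum f A)"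
  by (rule infsumI) (use has_sum_infsum[OF assms] in \<open>simp add: has_sum_of_real_iff\<close>)

text \<open>
  The weight \<open>k\<^sup>2 \<le> 2 (k - l)\<^sup>2 + 2 l\<^sup>2\<close> is distributed over the two factors.
\<close>

lemma conv_pow2_summable:
  assumes a: "(\<lambda>k. cmod (a k)) summable_on UNIV" "(\<lambda>k. (of_int k)\<^sup>2 * cmod (a k)) summable_on UNIV"
    and b: "(\<lambda>k. cmod (b k)) summable_on UNIV" "(\<lambda>k. (of_int k)\<^sup>2 * cmod (b k)) summable_on UNIV"
  shows "(\<lambda>k. (of_int k)\<^sup>2 * cmod (conv a b k)) summable_on UNIV"
proof -
  define A where "A k = complex_of_real (cmod (a k))" for k
  define A2 where "A2 k = complex_of_real ((of_int k)\<^sup>2 * cmod (a k))" for k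
  define B where "B k = complex_of_real (cmod (b k))" for k
  define B2 where "B2 k = complex_of_real ((of_int k)\<^sup>2 * cmod (b k))" for k
  have A: "(\<lambda>k. cmod (A k)) summable_on UNIV" "(\<lambda>k. cmod (A2 k)) summable_on UNIV"
    "(\<lambda>k. cmod (B k)) summable_on UNIV" "(\<lambda>k. cmod (B2 k)) summable_on UNIV"
    using a b by (simp_all add: A_def A2_def B_def B2_def norm_mult norm_power)
  have N: "cmod (A k) = cmod (a k)" "cmod (A2 k) = (of_int k)\<^sup>2 * cmod (a k)"
    "cmod (B k) = cmod (b k)" "cmod (B2 k) = (of_int k)\<^sup>2 * cmod (b k)" for k
    unfolding A_def A2_def B_def B2_def norm_of_real by (simp_all add: abs_mult)
  have R: "of_real (cmod (A k)) = A k" "of_real (cmod (A2 k)) = A2 k" "of_real (cmod (B k)) = B k" "of_real (cmod (B2 k)) = B2 k" for k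
    unfolding A_def A2_def B_def B2_def norm_of_real by (simp_all add: abs_mult)
  have le: "(of_int k)\<^sup>2 * cmod (conv a b k) \<le> 2 * cmod (conv A2 B k) + 2 * cmod (conv A B2 k)" for k
  proof -
    have c: "cmod (conv A2 B k) = (\<Sum>\<^sub>\<infinity>l. cmod (A2 (k - l) * B l))" "cmod (conv A B2 k) = (\<Sum>\<^sub>\<infinity>l. cmod (A (k - l) * B2 l))"
    proof -
      have "conv A2 B k = complex_of_real (\<Sum>\<^sub>\<infinity>l. cmod (A2 (k - l) * B l))"
        "conv A B2 k = complex_of_real (\<Sum>\<^sub>\<infinity>l. cmod (A (k - l) * B2 l))"
        unfolding conv_def infsum_of_real[OF conv_term_summable(1)[OF A(2,3)], symmetric]
          infsum_of_real[OF conv_term_summable(1)[OF A(1,4)], symmetric]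
        by (intro infsum_cong; simp add: norm_mult R)+
      then show "cmod (conv A2 B k) = (\<Sum>\<^sub>\<infinity>l. cmod (A2 (k - l) * B l))" "cmod (conv A B2 k) = (\<Sum>\<^sub>\<infinity>l. cmod (A (k - l) * B2 l))"
        by (simp_all add: infsum_nonneg)
    qed
    have "(of_int k)\<^sup>2 * cmod (conv a b k) \<le> (of_int k)\<^sup>2 * (\<Sum>\<^sub>\<infinity>l. cmod (a (k - l) * b l))"
      unfolding conv_def by (intro mult_left_mono norm_infsum_bound conv_term_summable(1)[OF a(1) b(1)]) auto
    also have "\<dots> = (\<Sum>\<^sub>\<infinity>l. (of_int k)\<^sup>2 * cmod (a (k - l) * b l))" by (rule infsum_cmult_right'[symmetric])
    also have "\<dots> \<le> (\<Sum>\<^sub>\<infinity>l. 2 * cmod (A2 (k - l) * B l) + 2 * cmod (A (k - l) * B2 l))"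
    proof (rule infsum_mono)
      show "(\<lambda>l. (of_int k)\<^sup>2 * cmod (a (k - l) * b l)) summable_on UNIV"
        by (rule summable_on_cmult_right[OF conv_term_summable(1)[OF a(1) b(1)]])
      show "(\<lambda>l. 2 * cmod (A2 (k - l) * B l) + 2 * cmod (A (k - l) * B2 l)) summable_on UNIV"
        by (rule summable_on_add[OF summable_on_cmult_right[OF conv_term_summable(1)[OF A(2,3)]]
            summable_on_cmult_right[OF conv_term_summable(1)[OF A(1,4)]]])
      fix l
      have "0 \<le> (real_of_int (k - l) - of_int l)\<^sup>2" by simp
      then have "(of_int k :: real)\<^sup>2 \<le> 2 * (of_int (k - l))\<^sup>2 + 2 * (of_int l)\<^sup>2"
        by (simp add: power2_eq_square algebra_simps)
      then have "(of_int k)\<^sup>2 * (cmod (a (k - l)) * cmod (b l)) \<le> (2 * (of_int (k - l))\<^sup>2 + 2 * (of_int l)\<^sup>2) * (cmod (a (k - l)) * cmod (b l))"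
        by (rule mult_right_mono) simp
      then show "(of_int k)\<^sup>2 * cmod (a (k - l) * b l) \<le> 2 * cmod (A2 (k - l) * B l) + 2 * cmod (A (k - l) * B2 l)"
        by (simp add: N norm_mult algebra_simps)
    qed
    also have "\<dots> = 2 * cmod (conv A2 B k) + 2 * cmod (conv A B2 k)"
      unfolding c infsum_add[OF summable_on_cmult_right[OF conv_term_summable(1)[OF A(2,3)]]
          summable_on_cmult_right[OF conv_term_summable(1)[OF A(1,4)]]]
      by (simp only: infsum_cmult_right')
    finally show ?thesis .
  qed
  show ?thesis
  proof (rule summable_on_comparison_test)
    show "(\<lambda>k. 2 * cmod (conv A2 B k) + 2 * cmod (conv A B2 k)) summable_on UNIV"
      by (rule summable_on_add[OF summable_on_cmult_right[OF conv_abs_summable[OF A(2,3)]]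
          summable_on_cmult_right[OF conv_abs_summable[OF A(1,4)]]])
    show "(of_int k)\<^sup>2 * cmod (conv a b k) \<le> 2 * cmod (conv A2 B k) + 2 * cmod (conv A B2 k)" for k
      by (rule le)
  qed simp
qed

lemma kern_symmetrized_aux:
  fixes l n :: int
  shows "(of_int l)\<^sup>2 * of_int (sgn n) + (of_int n)\<^sup>2 * of_int (sgn l)
     - (of_int (n + l))\<^sup>2 * of_int (sgn (n + l)) * of_int (sgn n) * of_int (sgn l)
     + of_int (sgn (n + l)) * (kern (n + l) l + kern (n + l) n) = 0"
proof -
  have d: "n + l - l = n" "n + l - n = l" by auto
  consider "n = 0" | "l = 0" | "0 < n" "0 < l" | "n < 0" "l < 0" | "0 < n" "l < 0" | "n < 0" "0 < l" by linarith
  then show ?thesis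
  proof cases
    case 3
    consider "n < l" | "n = l" | "l < n" by linarith
    then show ?thesis using 3 unfolding kern_def d
      by cases (simp_all add: min_def power2_eq_square algebra_simps)
  next
    case 4
    consider "n < l" | "n = l" | "l < n" by linarith
    then show ?thesis using 4 unfolding kern_def d
      by cases (simp_all add: min_def power2_eq_square algebra_simps)
  next
    case 5
    consider "n < - l" | "n = - l" | "- l < n" by linarith
    then show ?thesis using 5 unfolding kern_def d
      by cases (simp_all add: min_def power2_eq_square algebra_simps)
  next
    case 6
    consider "l < - n" | "l = - n" | "- n < l" by linarith
    then show ?thesis using 6 unfolding kern_def d
      by cases (simp_all add: min_def power2_eq_square algebra_simps)
  qed (simp_all add: kern_def sgn_if)
qed

text \<open>
  The first three terms are the symmetrised symbol of the flux: the two second derivatives of the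
  product \<open>H[f] f\<^sub>x\<^sub>x\<close> and the one outside \<open>H[H[f]\<^sup>2]\<^sub>x\<^sub>x / 2\<close>. Each is quadratic in the highest
  frequency, but if \<open>l\<close> and \<open>k - l\<close> have the same sign then \<open>k\<^sup>2 = (l + (k - l))\<^sup>2\<close> leaves only the
  product \<open>2 l (k - l)\<close>; for opposite signs a similar cancellation occurs.
\<close>

lemma kern_symmetrized:
  "(of_int l)\<^sup>2 * of_int (sgn (k - l)) + (of_int (k - l))\<^sup>2 * of_int (sgn l)
     - (of_int k)\<^sup>2 * of_int (sgn k) * of_int (sgn (k - l)) * of_int (sgn l)
     + of_int (sgn k) * (kern k l + kern k (k - l)) = 0"
  using kern_symmetrized_aux[of l "k - l"] by (simp only: diff_add_cancel)

text \<open>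
  The kernel costs one derivative on each factor, and a convolution of two \<open>l\<^sup>1\<close> sequences is in
  \<open>l\<^sup>1\<close>.
\<close>

lemma bilin_sum_l1:
  assumes a: "sums_below (\<lambda>n. of_int \<bar>n\<bar> * cmod (a n)) A" and b: "sums_below (\<lambda>n. of_int \<bar>n\<bar> * cmod (b n)) B"
  shows "sums_below (\<lambda>k. cmod (\<Sum>\<^sub>\<infinity>l. of_real (kern k l) * a (k - l) * b l)) (2 * A * B)"
  unfolding sums_below_def
proof (intro allI impI)
  fix S :: "int set" assume S: "finite S"
  note A0 = sums_below_nonneg[OF a]
  have "(\<Sum>k\<in>S. cmod (\<Sum>\<^sub>\<infinity>l. of_real (kern k l) * a (k - l) * b l))
      \<le> (\<Sum>k\<in>S. 1 * (\<Sum>\<^sub>\<infinity>l. cmod (of_real (kern k l) * a (k - l) * b l)))"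
    unfolding mult_1_left by (intro sum_mono norm_infsum_bound kern_summable(1)[OF a b])
  also have "\<dots> \<le> 2 * A * B"
  proof (rule weighted_infsum_le[OF S])
    show "(\<lambda>l. cmod (of_real (kern k l) * a (k - l) * b l)) summable_on UNIV" for k
      by (rule kern_summable(1)[OF a b])
    fix F :: "int set" assume F: "finite F"
    have "(\<Sum>k\<in>S. \<Sum>l\<in>F. 1 * cmod (of_real (kern k l) * a (k - l) * b l))
        \<le> (\<Sum>k\<in>S. \<Sum>l\<in>F. (of_int \<bar>l\<bar> * cmod (b l)) * (2 * (of_int \<bar>k - l\<bar> * cmod (a (k - l)))))"
    proof (intro sum_mono)
      fix k l
      have "1 * cmod (of_real (kern k l) * a (k - l) * b l) = kern k l * (cmod (a (k - l)) * cmod (b l))"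
        by (simp add: norm_mult kern_nonneg)
      also have "\<dots> \<le> 2 * (of_int \<bar>k - l\<bar> * of_int \<bar>l\<bar>) * (cmod (a (k - l)) * cmod (b l))"
        by (intro mult_right_mono kern_le) auto
      finally show "1 * cmod (of_real (kern k l) * a (k - l) * b l) \<le> (of_int \<bar>l\<bar> * cmod (b l)) * (2 * (of_int \<bar>k - l\<bar> * cmod (a (k - l))))"
        by (simp only: mult_ac)
    qed
    also have "\<dots> = (\<Sum>l\<in>F. (of_int \<bar>l\<bar> * cmod (b l)) * (2 * (\<Sum>k\<in>S. of_int \<bar>k - l\<bar> * cmod (a (k - l)))))"
      by (subst sum.swap) (simp only: sum_distrib_left)
    also have "\<dots> \<le> (\<Sum>l\<in>F. (of_int \<bar>l\<bar> * cmod (b l)) * (2 * A))"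
      by (intro sum_mono mult_left_mono sums_below_inj_sum[OF a S]) (auto simp: inj_on_def)
    also have "\<dots> = 2 * A * (\<Sum>l\<in>F. of_int \<bar>l\<bar> * cmod (b l))" by (simp add: sum_distrib_left mult_ac)
    also have "\<dots> \<le> 2 * A * B" using A0 by (intro mult_left_mono sums_belowD[OF b F]) auto
    finally show "(\<Sum>k\<in>S. \<Sum>l\<in>F. 1 * cmod (of_real (kern k l) * a (k - l) * b l)) \<le> 2 * A * B" .
  qed
  finally show "(\<Sum>k\<in>S. cmod (\<Sum>\<^sub>\<infinity>l. of_real (kern k l) * a (k - l) * b l)) \<le> 2 * A * B" .
qed

lemma bilin_diff_l1:
  assumes u: "sums_below (\<lambda>n. of_int \<bar>n\<bar> * cmod (u n)) A" and y: "sums_below (\<lambda>n. of_int \<bar>n\<bar> * cmod (y n)) B"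
    and d: "sums_below (\<lambda>n. of_int \<bar>n\<bar> * cmod (u n - y n)) d"
  shows "sums_below (\<lambda>k. cmod (bilin u k - bilin y k)) (2 * (A + B) * d)"
proof (rule sums_below_mono[OF sums_below_add[OF bilin_sum_l1[OF u d] bilin_sum_l1[OF d y]]])
  fix k
  have "bilin u k = (\<Sum>\<^sub>\<infinity>l. (of_real (kern k l) * u (k - l) * (u l - y l) + of_real (kern k l) * (u (k - l) - y (k - l)) * y l)
      + of_real (kern k l) * y (k - l) * y l)"
    unfolding bilin_def by (intro infsum_cong) (simp add: algebra_simps)
  also have "\<dots> = (\<Sum>\<^sub>\<infinity>l. of_real (kern k l) * u (k - l) * (u l - y l)) + (\<Sum>\<^sub>\<infinity>l. of_real (kern k l) * (u (k - l) - y (k - l)) * y l)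
      + bilin y k"
    unfolding bilin_def
    by (intro infsumI has_sum_add has_sum_infsum kern_summable(2)[OF u d] kern_summable(2)[OF d y] kern_summable(2)[OF y y])
  finally have eq: "bilin u k - bilin y k = (\<Sum>\<^sub>\<infinity>l. of_real (kern k l) * u (k - l) * (u l - y l))
      + (\<Sum>\<^sub>\<infinity>l. of_real (kern k l) * (u (k - l) - y (k - l)) * y l)" by simp
  show "cmod (bilin u k - bilin y k) \<le> cmod (\<Sum>\<^sub>\<infinity>l. of_real (kern k l) * u (k - l) * (u l - y l))
      + cmod (\<Sum>\<^sub>\<infinity>l. of_real (kern k l) * (u (k - l) - y (k - l)) * y l)"
    unfolding eq by (rule norm_triangle_ineq)
qed (simp add: algebra_simps)

lemma bilin_minus:
  assumes "hermitian u"
  shows "bilin u (- k) = cnj (bilin u k)"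
proof -
  have "bilin u (- k) = (\<Sum>\<^sub>\<infinity>l. of_real (kern (- k) (- l)) * u (- k - - l) * u (- l))"
    unfolding bilin_def by (rule infsum_reindex_bij_betw[symmetric]) (rule bij_uminus)
  also have "\<dots> = (\<Sum>\<^sub>\<infinity>l. cnj (of_real (kern k l) * u (k - l) * u l))"
  proof (rule infsum_cong)
    fix l
    have "u (- k - - l) = u (- (k - l))" by simp
    also have "\<dots> = cnj (u (k - l))" using assms unfolding hermitian_def by blast
    finally show "of_real (kern (- k) (- l)) * u (- k - - l) * u (- l) = cnj (of_real (kern k l) * u (k - l) * u l)"
      using assms by (simp add: hermitian_def kern_minus)
  qed
  also have "\<dots> = cnj (bilin u k)" unfolding bilin_def by (rule infsum_cnj)
  finally show ?thesis .
qed

text \<open>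
  The Fourier coefficients of the flux, when \<open>u\<close> are those of the function; differentiation then gives
  \<open>\<bar>k\<bar> * bilin u k\<close>, see \<open>flux_coeff_deriv\<close>.
\<close>

definition flux_coeff :: "(int \<Rightarrow> complex) \<Rightarrow> int \<Rightarrow> complex" where
  "flux_coeff u k = - \<i> * of_int (sgn k) * bilin u k"

lemma hermitian_flux_coeff: "hermitian u \<Longrightarrow> hermitian (flux_coeff u)"
  by (auto simp: hermitian_def flux_coeff_def bilin_minus sgn_if)

lemma cmod_sgn_mult_le: "cmod (- \<i> * of_int (sgn k) * z) \<le> cmod z"
  by (auto simp: norm_mult sgn_if)

lemma synth_add:
  assumes "(\<lambda>k. cmod (a k)) summable_on UNIV" "(\<lambda>k. cmod (b k)) summable_on UNIV"
  shows "synth a x + synth b x = synth (\<lambda>k. a k + b k) x"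
  using infsum_add[OF synth_summable[OF assms(1), of x] synth_summable[OF assms(2), of x]]
  by (simp add: synth_def distrib_right)

lemma synth_cmult: "c * synth a x = synth (\<lambda>k. of_real c * a k) x"
  by (simp add: synth_def mult.assoc infsum_cmult_right')

lemma summable_abs_of_sq:
  fixes g :: "int \<Rightarrow> real"
  assumes "(\<lambda>k. (of_int k)\<^sup>2 * g k) summable_on UNIV" "\<And>k. 0 \<le> g k"
  shows "(\<lambda>k. of_int \<bar>k\<bar> * g k) summable_on UNIV"
proof (rule summable_on_comparison_test[OF assms(1)])
  fix k :: int
  have "\<bar>k\<bar> \<le> k\<^sup>2"
  proof (cases "k = 0")
    case False
    then have "\<bar>k\<bar> * 1 \<le> \<bar>k\<bar> * \<bar>k\<bar>" by (intro mult_left_mono) auto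
    then show ?thesis by (simp add: power2_eq_square)
  qed simp
  then have "real_of_int \<bar>k\<bar> \<le> of_int (k\<^sup>2)" by (rule of_int_le_iff[THEN iffD2])
  then show "of_int \<bar>k\<bar> * g k \<le> (of_int k)\<^sup>2 * g k" using assms(2) by (intro mult_right_mono) auto
qed (use assms(2) in auto)

lemma deriv_deriv_synth:
  assumes "(\<lambda>k. cmod (a k)) summable_on UNIV" and 2: "(\<lambda>k. (of_int k)\<^sup>2 * cmod (a k)) summable_on UNIV"
  shows "deriv (deriv (synth a)) = synth (\<lambda>k. - (of_int k)\<^sup>2 * a k)"
proof -
  have 1: "(\<lambda>k. of_int \<bar>k\<bar> * cmod (a k)) summable_on UNIV" by (rule summable_abs_of_sq[OF 2]) simp
  have "deriv (synth (\<lambda>k. \<i> * of_int k * a k)) = synth (\<lambda>k. \<i> * of_int k * (\<i> * of_int k * a k))"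
  proof (rule deriv_synth)
    show "(\<lambda>k. cmod (\<i> * of_int k * a k)) summable_on UNIV" using 1 by (simp add: norm_mult)
    have "of_int \<bar>k\<bar> * cmod (\<i> * of_int k * a k) = (of_int k)\<^sup>2 * cmod (a k)" for k
      by (simp add: norm_mult power2_eq_square mult.assoc[symmetric])
    then show "(\<lambda>k. of_int \<bar>k\<bar> * cmod (\<i> * of_int k * a k)) summable_on UNIV" using 2 by simp
  qed
  moreover have "(\<lambda>k. \<i> * of_int k * (\<i> * of_int k * a k)) = (\<lambda>k. - (of_int k)\<^sup>2 * a k)"
  proof
    fix k
    have "\<i> * of_int k * (\<i> * of_int k * a k) = (\<i> * \<i>) * (of_int k * of_int k * a k)" by (simp only: mult_ac)
    then show "\<i> * of_int k * (\<i> * of_int k * a k) = - (of_int k)\<^sup>2 * a k" by (simp add: power2_eq_square)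
  qed
  ultimately show ?thesis by (simp add: deriv_synth[OF assms(1) 1])
qed

lemma hilbert_eq_synth: "hilbert f = synth (\<lambda>k. - \<i> * of_int (sgn k) * fourier_coeff f k)"
  by (simp add: fun_eq_iff hilbert_def synth_def expi_def)

text \<open>
  A sum over \<open>l\<close> is not changed by exchanging \<open>l\<close> and \<open>k - l\<close>. The summand \<open>G\<close> of the difference of
  both sides is antisymmetric under this exchange by \<open>kern_symmetrized\<close>.
\<close>

lemma flux_coeff_eq_conv:
  assumes u: "(\<lambda>k. cmod (u k)) summable_on UNIV" "(\<lambda>k. (of_int k)\<^sup>2 * cmod (u k)) summable_on UNIV"
    and h: "h = (\<lambda>k. - \<i> * of_int (sgn k) * u k)"
  shows "1/2 * (- (of_int k)\<^sup>2 * (- \<i> * of_int (sgn k) * conv h h k)) + conv h (\<lambda>k. - (of_int k)\<^sup>2 * u k) k = flux_coeff u k"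
proof -
  have le: "cmod (h k) \<le> cmod (u k)" for k unfolding h by (rule cmod_sgn_mult_le)
  have h0: "(\<lambda>k. cmod (h k)) summable_on UNIV"
    by (rule summable_on_comparison_test[OF u(1)]) (auto simp: le)
  have u2: "(\<lambda>k. cmod (- (of_int k)\<^sup>2 * u k)) summable_on UNIV" using u(2) by (simp add: norm_mult norm_power)
  have u1: "sums_below (\<lambda>n. of_int \<bar>n\<bar> * cmod (u n)) (\<Sum>\<^sub>\<infinity>n. of_int \<bar>n\<bar> * cmod (u n))"
    by (rule sums_below_infsum[OF summable_abs_of_sq[OF u(2)]]) auto
  define G where "G l = 1/2 * (\<i> * (of_int k)\<^sup>2 * of_int (sgn k)) * (h (k - l) * h l) + h (k - l) * (- (of_int l)\<^sup>2 * u l)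
     + \<i> * of_int (sgn k) * (of_real (kern k l) * u (k - l) * u l)" for l
  have s: "(\<lambda>l. h (k - l) * h l) summable_on UNIV" "(\<lambda>l. h (k - l) * (- (of_int l)\<^sup>2 * u l)) summable_on UNIV"
    "(\<lambda>l. of_real (kern k l) * u (k - l) * u l) summable_on UNIV"
    using conv_term_summable(2)[OF h0 h0, of k] conv_term_summable(2)[OF h0 u2, of k] kern_summable(2)[OF u1 u1] by auto
  have G: "(G has_sum (1/2 * (\<i> * (of_int k)\<^sup>2 * of_int (sgn k)) * conv h h k + conv h (\<lambda>k. - (of_int k)\<^sup>2 * u k) k
     + \<i> * of_int (sgn k) * bilin u k)) UNIV"
    unfolding G_def conv_def bilin_def by (intro has_sum_add has_sum_cmult_right has_sum_infsum s)
  have sym: "G l + G (k - l) = 0" for l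
  proof -
    have kk: "k - (k - l) = l" by simp
    have "G l + G (k - l) = \<i> * (u l * u (k - l)) * of_real (
        (of_int l)\<^sup>2 * of_int (sgn (k - l)) + (of_int (k - l))\<^sup>2 * of_int (sgn l)
        - (of_int k)\<^sup>2 * of_int (sgn k) * of_int (sgn (k - l)) * of_int (sgn l)
        + of_int (sgn k) * (kern k l + kern k (k - l)))"
      unfolding G_def h kk
      by (simp add: algebra_simps del: of_int_diff)
    then show ?thesis by (simp only: kern_symmetrized of_real_0 mult_zero_right)
  qed
  have "bij_betw (\<lambda>l. k - l) UNIV UNIV" by (rule bij_betwI[where g = "\<lambda>l. k - l"]) auto
  then have "infsum (\<lambda>l. G (k - l)) UNIV = infsum G UNIV" "(\<lambda>l. G (k - l)) summable_on UNIV"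
    using G by (auto simp: infsum_reindex_bij_betw summable_on_reindex_bij_betw intro: has_sum_imp_summable)
  then have "infsum G UNIV + infsum G UNIV = infsum (\<lambda>l. G l + G (k - l)) UNIV"
    using G by (subst infsum_add) (auto intro: has_sum_imp_summable)
  then have "infsum G UNIV = 0" by (simp add: sym)
  then have "1/2 * (\<i> * (of_int k)\<^sup>2 * of_int (sgn k)) * conv h h k + conv h (\<lambda>k. - (of_int k)\<^sup>2 * u k) k
     = - (\<i> * of_int (sgn k) * bilin u k)"
    using infsumI[OF G] by (simp only: eq_neg_iff_add_eq_0)
  then show ?thesis by (simp add: flux_coeff_def mult_ac)
qed

lemma sobolev_summable:
  assumes f: "f \<in> sobolev s" and s: "5/2 < s"
  shows "(\<lambda>k. cmod (fourier_coeff f k)) summable_on UNIV"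
    "(\<lambda>k. of_int \<bar>k\<bar> * cmod (fourier_coeff f k)) summable_on UNIV"
    "(\<lambda>k. (of_int k)\<^sup>2 * cmod (fourier_coeff f k)) summable_on UNIV"
  using summable_pow_mult[OF sobolevD(3)[OF f], of 0] summable_pow_mult[OF sobolevD(3)[OF f], of 1]
    summable_pow_mult[OF sobolevD(3)[OF f], of 2] s by simp_all

lemma flux_eq_synth:
  assumes f: "f \<in> sobolev 3"
  shows "flux f = synth (flux_coeff (fourier_coeff f))"
proof
  fix x
  define u where "u = fourier_coeff f"
  define h where "h = (\<lambda>k. - \<i> * of_int (sgn k) * u k)"
  note u = sobolev_summable[OF f, simplified, folded u_def]
  have hu: "hermitian u" by (simp add: u_def hermitian_fourier_coeff)
  have fu: "f = synth u" using synth_fourier_coeff[OF f] by (simp add: u_def)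
  have hh: "hermitian h" using hu by (auto simp: h_def hermitian_def sgn_if)
  have hil: "hilbert f = synth h" by (simp add: hilbert_eq_synth h_def u_def)
  have le: "cmod (h k) \<le> cmod (u k)" for k unfolding h_def by (rule cmod_sgn_mult_le)
  have h0: "(\<lambda>k. cmod (h k)) summable_on UNIV"
    by (rule summable_on_comparison_test[OF u(1)]) (auto simp: le)
  have h2: "(\<lambda>k. (of_int k)\<^sup>2 * cmod (h k)) summable_on UNIV"
    by (rule summable_on_comparison_test[OF u(3)]) (auto simp: le intro: mult_left_mono)
  define c where "c = conv h h"
  have c0: "(\<lambda>k. cmod (c k)) summable_on UNIV" unfolding c_def by (rule conv_abs_summable[OF h0 h0])
  have c2: "(\<lambda>k. (of_int k)\<^sup>2 * cmod (c k)) summable_on UNIV" unfolding c_def by (rule conv_pow2_summable[OF h0 h2 h0 h2])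
  have hc: "hermitian c" unfolding c_def by (rule hermitian_conv[OF hh hh])
  have "(\<lambda>y. (hilbert f y)\<^sup>2) = synth c"
    by (simp add: fun_eq_iff hil c_def power2_eq_square synth_mult[OF h0 hh h0 hh])
  then have fc: "fourier_coeff (\<lambda>y. (hilbert f y)\<^sup>2) = c" using fourier_coeff_synth[OF c0 hc] by auto
  define d where "d = (\<lambda>k. - \<i> * of_int (sgn k) * c k)"
  have led: "cmod (d k) \<le> cmod (c k)" for k unfolding d_def by (rule cmod_sgn_mult_le)
  have d0: "(\<lambda>k. cmod (d k)) summable_on UNIV"
    by (rule summable_on_comparison_test[OF c0]) (auto simp: led)
  have d2: "(\<lambda>k. (of_int k)\<^sup>2 * cmod (d k)) summable_on UNIV"
    by (rule summable_on_comparison_test[OF c2]) (auto simp: led intro: mult_left_mono)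
  have hd: "deriv (deriv (hilbert (\<lambda>y. (hilbert f y)\<^sup>2))) = synth (\<lambda>k. - (of_int k)\<^sup>2 * d k)"
    unfolding hilbert_eq_synth[of "\<lambda>y. (hilbert f y)\<^sup>2"] fc d_def[symmetric] by (rule deriv_deriv_synth[OF d0 d2])
  have fdd: "deriv (deriv f) = synth (\<lambda>k. - (of_int k)\<^sup>2 * u k)"
    using deriv_deriv_synth[OF u(1,3)] by (simp add: fu[symmetric])
  have u2: "(\<lambda>k. cmod (- (of_int k)\<^sup>2 * u k)) summable_on UNIV" using u(3) by (simp add: norm_mult norm_power)
  have hu2: "hermitian (\<lambda>k. - (of_int k)\<^sup>2 * u k)" using hu by (simp add: hermitian_def)
  have d2': "(\<lambda>k. cmod (of_real (1/2) * (- (of_int k)\<^sup>2 * d k))) summable_on UNIV"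
    using summable_on_cmult_right[OF d2, of "1/2"] by (simp add: norm_mult norm_power)
  have "flux f x = 1/2 * synth (\<lambda>k. - (of_int k)\<^sup>2 * d k) x + hilbert f x * synth (\<lambda>k. - (of_int k)\<^sup>2 * u k) x"
    by (simp only: flux_def hd fdd)
  also have "\<dots> = synth (\<lambda>k. of_real (1/2) * (- (of_int k)\<^sup>2 * d k)) x + synth (conv h (\<lambda>k. - (of_int k)\<^sup>2 * u k)) x"
    by (simp only: hil synth_cmult[of "1/2"] synth_mult[OF h0 hh u2 hu2])
  also have "\<dots> = synth (\<lambda>k. of_real (1/2) * (- (of_int k)\<^sup>2 * d k) + conv h (\<lambda>k. - (of_int k)\<^sup>2 * u k) k) x"
    by (rule synth_add[OF d2' conv_abs_summable[OF h0 u2]])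
  also have "(\<lambda>k. of_real (1/2) * (- (of_int k)\<^sup>2 * d k) + conv h (\<lambda>k. - (of_int k)\<^sup>2 * u k) k) = flux_coeff u"
    using flux_coeff_eq_conv[OF u(1,3) h_def] by (simp add: fun_eq_iff d_def c_def)
  finally show "flux f x = synth (flux_coeff (fourier_coeff f)) x" by (simp add: u_def)
qed

section \<open>Smooth functions on the line\<close>

text \<open>
  The relevant class for test functions is the intersection over all \<open>n\<close>; the recursive form makes closure under
  products and affine substitutions an induction.
\<close>

fun Ck :: "nat \<Rightarrow> (real \<Rightarrow> real) \<Rightarrow> bool" where
  "Ck 0 f \<longleftrightarrow> True"
| "Ck (Suc n) f \<longleftrightarrow> (\<exists>f'. (\<forall>x. (f has_real_derivative f' x) (at x)) \<and> Ck n f')"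

lemma Ck_Suc_imp: "Ck (Suc n) f \<Longrightarrow> Ck n f"
proof (induction n arbitrary: f)
  case (Suc n)
  then show ?case by (metis Ck.simps(2))
qed simp

lemma Ck_add: "Ck n f \<Longrightarrow> Ck n g \<Longrightarrow> Ck n (\<lambda>x. f x + g x)"
proof (induction n arbitrary: f g)
  case (Suc n)
  then obtain f' g' where d: "\<forall>x. (f has_real_derivative f' x) (at x)" "Ck n f'"
      "\<forall>x. (g has_real_derivative g' x) (at x)" "Ck n g'" by auto
  have "\<forall>x. ((\<lambda>x. f x + g x) has_real_derivative f' x + g' x) (at x)" using d(1,3) by (simp add: DERIV_add)
  moreover have "Ck n (\<lambda>x. f' x + g' x)" by (rule Suc.IH[OF d(2,4)])
  ultimately show ?case unfolding Ck.simps by (intro exI conjI)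
qed simp

lemma Ck_mult: "Ck n f \<Longrightarrow> Ck n g \<Longrightarrow> Ck n (\<lambda>x. f x * g x)"
proof (induction n arbitrary: f g)
  case (Suc n)
  then obtain f' g' where d: "\<forall>x. (f has_real_derivative f' x) (at x)" "Ck n f'"
      "\<forall>x. (g has_real_derivative g' x) (at x)" "Ck n g'" by auto
  have "Ck n (\<lambda>x. f' x * g x + g' x * f x)"
    by (intro Ck_add Suc.IH d(2,4) Ck_Suc_imp[OF Suc.prems(1)] Ck_Suc_imp[OF Suc.prems(2)])
  moreover have "\<forall>x. ((\<lambda>x. f x * g x) has_real_derivative f' x * g x + g' x * f x) (at x)" using d(1,3) by (simp add: DERIV_mult)
  ultimately show ?case unfolding Ck.simps by (intro exI conjI)
qed simp

lemma Ck_const: "Ck n (\<lambda>_. c)"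
proof (induction n arbitrary: c)
  case (Suc n)
  have "\<forall>x. ((\<lambda>_. c) has_real_derivative 0) (at x)" by simp
  with Suc[of 0] show ?case unfolding Ck.simps by (intro exI[of _ "\<lambda>_. 0"] conjI)
qed simp

lemma Ck_affine: "Ck n f \<Longrightarrow> Ck n (\<lambda>x. f (c * x + d))"
proof (induction n arbitrary: f)
  case (Suc n)
  then obtain f' where f': "\<forall>x. (f has_real_derivative f' x) (at x)" "Ck n f'" by auto
  have "((\<lambda>x. f (c * x + d)) has_real_derivative f' (c * x + d) * c) (at x)" for x
    by (rule DERIV_chain2[where g = "\<lambda>x. c * x + d"]) (use f' in \<open>auto intro!: derivative_eq_intros\<close>)
  moreover have "Ck n (\<lambda>x. f' (c * x + d) * c)" by (intro Ck_mult Ck_const Suc.IH f')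
  ultimately show ?case unfolding Ck.simps by (intro exI conjI allI)
qed simp

text \<open>
  The functions \<open>x\<^sup>-\<^sup>j exp (-1/x)\<close>, continued by zero. The derivative of each is a combination of two
  others, which makes all of them smooth.
\<close>

definition flat :: "nat \<Rightarrow> real \<Rightarrow> real" where
  "flat j x = (if 0 < x then inverse x ^ j * exp (- inverse x) else 0)"

lemma flat_tendsto_0: "(flat j \<longlongrightarrow> 0) (at 0)"
proof -
  have "((\<lambda>y::real. y ^ j / exp y) \<longlongrightarrow> 0) at_top" by (rule tendsto_power_div_exp_0)
  from filterlim_compose[OF this filterlim_inverse_at_top_right]
  have "((\<lambda>x::real. inverse x ^ j / exp (inverse x)) \<longlongrightarrow> 0) (at_right 0)" .
  then have r: "(flat j \<longlongrightarrow> 0) (at_right 0)"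
    by (rule tendsto_cong[THEN iffD2, rotated])
       (auto simp: eventually_at_right_field flat_def exp_minus field_simps intro!: exI[of _ 1])
  have l: "(flat j \<longlongrightarrow> 0) (at_left 0)"
    by (rule tendsto_eventually) (auto simp: eventually_at_left_field flat_def intro!: exI[of _ "- 1"])
  show ?thesis using l r by (simp add: filterlim_split_at)
qed

lemma flat_has_real_derivative:
  "(flat j has_real_derivative (- real j * flat (Suc j) x + flat (Suc (Suc j)) x)) (at x)"
proof -
  consider "x < 0" | "x = 0" | "0 < x" by linarith
  then show ?thesis
  proof cases
    case 1
    have "((\<lambda>_. 0) has_real_derivative 0) (at x)" by simp
    moreover have "\<forall>\<^sub>F y in nhds x. 0 = flat j y"
      using 1 by (intro eventually_mono[OF eventually_nhds_in_open[of "{..<0}"]]) (auto simp: flat_def)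
    ultimately have "(flat j has_real_derivative 0) (at x)" by (rule DERIV_cong_ev[OF refl _ refl, THEN iffD1, rotated])
    then show ?thesis using 1 by (simp add: flat_def)
  next
    case 2
    have "(flat j (0 + h) - flat j 0) / h = flat (Suc j) h" for h by (simp add: flat_def field_simps)
    then show ?thesis using flat_tendsto_0[of "Suc j"] 2 by (simp add: DERIV_def flat_def[of _ 0])
  next
    case 3
    have "((\<lambda>x. inverse x ^ j * exp (- inverse x)) has_real_derivative
        (- real j * (inverse x ^ Suc j * exp (- inverse x)) + inverse x ^ Suc (Suc j) * exp (- inverse x))) (at x)"
      using 3
      by (auto intro!: derivative_eq_intros simp: power2_eq_square algebra_simps; cases j; simp)
    moreover have "\<forall>\<^sub>F y in nhds x. inverse y ^ j * exp (- inverse y) = flat j y"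
      using 3 by (intro eventually_mono[OF eventually_nhds_in_open[of "{0<..}"]]) (auto simp: flat_def)
    ultimately have "(flat j has_real_derivative (- real j * (inverse x ^ Suc j * exp (- inverse x)) + inverse x ^ Suc (Suc j) * exp (- inverse x))) (at x)"
      by (rule DERIV_cong_ev[OF refl _ refl, THEN iffD1, rotated])
    then show ?thesis using 3 by (simp add: flat_def)
  qed
qed

lemma Ck_flat: "Ck n (flat j)"
proof (induction n arbitrary: j)
  case (Suc n)
  have "Ck n (\<lambda>x. - real j * flat (Suc j) x + flat (Suc (Suc j)) x)"
    by (intro Ck_add Ck_mult Ck_const Suc.IH)
  moreover have "\<forall>x. (flat j has_real_derivative (- real j * flat (Suc j) x + flat (Suc (Suc j)) x)) (at x)"
    by (intro allI flat_has_real_derivative)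
  ultimately show ?case unfolding Ck.simps by (intro exI conjI)
qed simp

text \<open>
  The normalised primitive of the bump \<open>exp (-1/x) exp (-1/(1 - x))\<close>. Its derivative \<open>\<rho>\<close> serves as a mollifier.
\<close>

lemma smooth_step_exists:
  obtains \<sigma> \<rho> :: "real \<Rightarrow> real" where "\<And>n. Ck n \<sigma>" "\<And>x. (\<sigma> has_real_derivative \<rho> x) (at x)"
    "\<And>x. 0 \<le> \<rho> x" "\<And>x. x \<le> 0 \<Longrightarrow> \<sigma> x = 0" "\<And>x. 1 \<le> x \<Longrightarrow> \<sigma> x = 1" "\<And>x. x \<notin> {0..1} \<Longrightarrow> \<rho> x = 0"
    "\<And>n. Ck n \<rho>"
proof -
  define f where "f x = flat 0 x * flat 0 (- 1 * x + 1)" for x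
  have Cf: "Ck n f" for n unfolding f_def by (intro Ck_mult Ck_affine Ck_flat)
  have f0: "0 \<le> f x" for x by (simp add: f_def flat_def)
  have fz: "f x = 0" if "x \<notin> {0<..<1}" for x using that by (auto simp: f_def flat_def)
  have contf: "continuous_on A f" for A
  proof -
    have "Ck (Suc 0) f" by (rule Cf)
    then obtain f' where "\<forall>x. (f has_real_derivative f' x) (at x)" by auto
    then show ?thesis by (meson DERIV_isCont continuous_at_imp_continuous_on)
  qed
  \<comment> \<open>The bump vanishes on \<open>{-1..0}\<close>; starting at \<open>-1\<close> makes \<open>0\<close> an interior point.\<close>
  define g where "g x = integral {-1..x} f" for x
  have gz: "g x = 0" if "x \<le> 0" for x
    unfolding g_def using that by (intro integral_unique has_integral_is_0) (auto intro: fz)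
  have dg: "(g has_real_derivative f x) (at x)" for x
  proof (cases "x < 0")
    case True
    have "((\<lambda>_. 0) has_real_derivative 0) (at x)" by simp
    moreover have "\<forall>\<^sub>F y in nhds x. 0 = g y"
      using True by (intro eventually_mono[OF eventually_nhds_in_open[of "{..<0}"]]) (auto simp: gz)
    ultimately have "(g has_real_derivative 0) (at x)" by (rule DERIV_cong_ev[OF refl _ refl, THEN iffD1, rotated])
    then show ?thesis using True by (simp add: fz)
  next
    case False
    have "(g has_real_derivative f x) (at x within {-1..x+1})"
      unfolding g_def by (rule integral_has_real_derivative[OF contf]) (use False in auto)
    moreover have "at x within {-1..x+1} = at x" using False by (intro at_within_interior) auto
    ultimately show ?thesis by simp
  qed
  have g1: "g x = g 1" if "1 \<le> x" for x
  proof -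
    have "g x = g 1 + integral {1..x} f"
      unfolding g_def using that
      by (intro Henstock_Kurzweil_Integration.integral_combine[symmetric] integrable_continuous_real contf) auto
    also have "integral {1..x} f = 0" by (intro integral_unique has_integral_is_0) (auto intro: fz)
    finally show ?thesis by simp
  qed
  have gpos: "0 < g 1"
  proof -
    have "0 \<le> g 1" unfolding g_def by (intro integral_nonneg integrable_continuous_real contf f0)
    moreover have "g 1 \<noteq> 0"
    proof
      assume "g 1 = 0"
      then have "\<forall>x\<in>{-1..1}. f x = 0"
        unfolding g_def by (subst (asm) integral_eq_0_iff) (auto simp: f0 contf)
      then have "f (1/2) = 0" by simp
      then show False by (simp add: f_def flat_def)
    qed
    ultimately show ?thesis by simp
  qed
  have r: "((\<lambda>x. inverse (g 1) * g x) has_real_derivative inverse (g 1) * f x) (at x)" for x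
    by (rule DERIV_cmult[OF dg])
  have Cr: "Ck n (\<lambda>x. inverse (g 1) * f x)" for n by (intro Ck_mult Ck_const Cf)
  have Cs: "Ck n (\<lambda>x. inverse (g 1) * g x)" for n
  proof (cases n)
    case (Suc m)
    have "\<forall>x. ((\<lambda>x. inverse (g 1) * g x) has_real_derivative inverse (g 1) * f x) (at x)" using r by simp
    with Cr[of m] show ?thesis unfolding Suc Ck.simps by (intro exI conjI)
  qed simp
  show ?thesis
  proof (rule that[of "\<lambda>x. inverse (g 1) * g x" "\<lambda>x. inverse (g 1) * f x"])
    fix n and x :: real
    show "Ck n (\<lambda>x. inverse (g 1) * g x)" by (rule Cs)
    show "Ck n (\<lambda>x. inverse (g 1) * f x)" by (rule Cr)
    show "((\<lambda>x. inverse (g 1) * g x) has_real_derivative inverse (g 1) * f x) (at x)" by (rule r)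
    show "0 \<le> inverse (g 1) * f x" using gpos f0 by simp
    show "inverse (g 1) * g x = 0" if "x \<le> 0" using gz[OF that] by simp
    show "inverse (g 1) * g x = 1" if "1 \<le> x" using g1[OF that] gpos by simp
    show "inverse (g 1) * f x = 0" if "x \<notin> {0..1}" using fz[of x] that by auto
  qed
qed

lemma Ck_deriv_funpow:
  assumes "\<And>n. Ck n f"
  shows "Ck n ((deriv ^^ i) f)" "((deriv ^^ i) f has_real_derivative (deriv ^^ Suc i) f x) (at x)"
proof -
  have step: "Ck n (deriv g) \<and> (g has_real_derivative deriv g x) (at x)" if "\<And>n. Ck n g" for g n x
  proof -
    have "Ck (Suc n) g" by (rule that)
    then obtain g' where g': "\<forall>x. (g has_real_derivative g' x) (at x)" "Ck n g'" by auto
    then have "deriv g = g'" using DERIV_imp_deriv by blast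
    with g' show ?thesis by auto
  qed
  have all: "\<forall>n. Ck n ((deriv ^^ i) f)" for i
    by (induction i) (use assms step in auto)
  then show "Ck n ((deriv ^^ i) f)" by blast
  show "((deriv ^^ i) f has_real_derivative (deriv ^^ Suc i) f x) (at x)"
    using step[of "(deriv ^^ i) f"] all by auto
qed

section \<open>Continuity in time of Sobolev functions\<close>

text \<open>
  Compactness of the interval, by bisection, for bounds that are not suprema of a function.
\<close>

lemma Icc_locally_bounded:
  fixes P :: "real \<Rightarrow> real \<Rightarrow> bool"
  assumes mono: "\<And>\<tau> M M'. P \<tau> M \<Longrightarrow> M \<le> M' \<Longrightarrow> P \<tau> M'"
    and loc: "\<And>t. t \<in> {a..b} \<Longrightarrow> \<exists>M. \<exists>d>0. \<forall>\<tau>\<in>{a..b}. dist \<tau> t < d \<longrightarrow> P \<tau> M"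
  shows "\<exists>M. \<forall>\<tau>\<in>{a..b}. P \<tau> M"
proof (cases "a \<le> b")
  case True
  define Q where "Q c d \<longleftrightarrow> (\<exists>M. \<forall>\<tau>\<in>{c..d} \<inter> {a..b}. P \<tau> M)" for c d
  have "Q a b"
  proof (rule Bolzano[OF True])
    fix x y z assume "Q x y" "Q y z" "x \<le> y" "y \<le> z"
    then obtain M M' where MM: "\<forall>\<tau>\<in>{x..y} \<inter> {a..b}. P \<tau> M" "\<forall>\<tau>\<in>{y..z} \<inter> {a..b}. P \<tau> M'" unfolding Q_def by blast
    have M': "P \<tau> M'" if "\<tau> \<in> {y..z} \<inter> {a..b}" for \<tau> using MM(2) that by blast
    have M: "P \<tau> M" if "\<tau> \<in> {x..y} \<inter> {a..b}" for \<tau> using MM(1) that by blast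
    have "P \<tau> (max M M')" if "\<tau> \<in> {x..z} \<inter> {a..b}" for \<tau>
    proof (cases "\<tau> \<le> y")
      case True
      then have "P \<tau> M" using that by (intro M) auto
      then show ?thesis by (rule mono) simp
    next
      case False
      then have "P \<tau> M'" using that by (intro M') auto
      then show ?thesis by (rule mono) simp
    qed
    then have "\<forall>\<tau>\<in>{x..z} \<inter> {a..b}. P \<tau> (max M M')" by blast
    then show "Q x z" unfolding Q_def by blast
  next
    fix x assume "a \<le> x" "x \<le> b"
    then obtain M d where "0 < d" "\<forall>\<tau>\<in>{a..b}. dist \<tau> x < d \<longrightarrow> P \<tau> M" using loc[of x] by auto
    then show "\<exists>d>0. \<forall>c e. c \<le> x \<and> x \<le> e \<and> e - c < d \<longrightarrow> Q c e"
      unfolding Q_def by (intro exI[of _ d] conjI allI impI exI[of _ M]) (auto simp: dist_real_def)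
  qed
  then show ?thesis by (simp add: Q_def)
qed auto

lemma sums_below_sobolev:
  assumes "f \<in> sobolev s"
  shows "sums_below (\<lambda>k. japanese k powr (2 * s) * (cmod (fourier_coeff f k))\<^sup>2) ((sobolev_norm s f)\<^sup>2)"
proof (rule sums_below_mono[OF sums_below_infsum[OF sobolevD(3)[OF assms]]])
  have nn: "0 \<le> (\<Sum>\<^sub>\<infinity>k. japanese k powr (2 * s) * (cmod (fourier_coeff f k))\<^sup>2)" by (intro infsum_nonneg) auto
  have "1 * (\<Sum>\<^sub>\<infinity>k. japanese k powr (2 * s) * (cmod (fourier_coeff f k))\<^sup>2)
      \<le> (2 * pi) * (\<Sum>\<^sub>\<infinity>k. japanese k powr (2 * s) * (cmod (fourier_coeff f k))\<^sup>2)"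
    using pi_gt3 by (intro mult_right_mono nn) auto
  then show "(\<Sum>\<^sub>\<infinity>k. japanese k powr (2 * s) * (cmod (fourier_coeff f k))\<^sup>2) \<le> (sobolev_norm s f)\<^sup>2"
    using nn by (simp add: sobolev_norm_def)
qed auto

lemma sobolev_norm_power2:
  "(sobolev_norm s f)\<^sup>2 = 2 * pi * (\<Sum>\<^sub>\<infinity>k. japanese k powr (2 * s) * (cmod (fourier_coeff f k))\<^sup>2)"
  by (simp add: sobolev_norm_def infsum_nonneg)

lemma sobolev_norm_nonneg: "0 \<le> sobolev_norm s f"
  by (simp add: sobolev_norm_def infsum_nonneg)

lemma cmod_diff_power2_le: "(cmod (a - b))\<^sup>2 \<le> 2 * (cmod a)\<^sup>2 + 2 * (cmod b)\<^sup>2"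
proof -
  have "(cmod (a - b))\<^sup>2 \<le> (cmod a + cmod b)\<^sup>2" by (intro power_mono norm_triangle_ineq4) auto
  also have "\<dots> \<le> 2 * (cmod a)\<^sup>2 + 2 * (cmod b)\<^sup>2"
    using sum_squares_bound[of "cmod a" "cmod b"] by (simp add: power2_eq_square algebra_simps)
  finally show ?thesis .
qed

lemma sobolev_diff:
  assumes f: "f \<in> sobolev s" and g: "g \<in> sobolev s"
  shows "(\<lambda>x. f x - g x) \<in> sobolev s" "fourier_coeff (\<lambda>x. f x - g x) k = fourier_coeff f k - fourier_coeff g k"
proof -
  show fc: "fourier_coeff (\<lambda>x. f x - g x) k = fourier_coeff f k - fourier_coeff g k" for k
    by (rule fourier_coeff_diff[OF sobolevD(2)[OF f] sobolevD(2)[OF g]])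
  have "(\<lambda>k. japanese k powr (2 * s) * (cmod (fourier_coeff f k - fourier_coeff g k))\<^sup>2) summable_on UNIV"
  proof (rule summable_on_comparison_test)
    show "(\<lambda>k. 2 * (japanese k powr (2 * s) * (cmod (fourier_coeff f k))\<^sup>2) + 2 * (japanese k powr (2 * s) * (cmod (fourier_coeff g k))\<^sup>2)) summable_on UNIV"
      by (intro summable_on_add summable_on_cmult_right sobolevD(3) f g)
    show "japanese k powr (2 * s) * (cmod (fourier_coeff f k - fourier_coeff g k))\<^sup>2
      \<le> 2 * (japanese k powr (2 * s) * (cmod (fourier_coeff f k))\<^sup>2) + 2 * (japanese k powr (2 * s) * (cmod (fourier_coeff g k))\<^sup>2)" for k
      using mult_left_mono[OF cmod_diff_power2_le[of "fourier_coeff f k" "fourier_coeff g k"], of "japanese k powr (2 * s)"]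
      by (simp add: algebra_simps)
  qed auto
  then show "(\<lambda>x. f x - g x) \<in> sobolev s"
    by (auto simp: sobolev_def fc sobolevD(1)[OF f] sobolevD(1)[OF g] intro!: continuous_intros sobolevD(2)[OF f] sobolevD(2)[OF g])
qed

lemma sobolev_cmult:
  assumes f: "f \<in> sobolev s"
  shows "(\<lambda>x. c * f x) \<in> sobolev s"
proof -
  have "(\<lambda>k. c\<^sup>2 * (japanese k powr (2 * s) * (cmod (fourier_coeff f k))\<^sup>2)) summable_on UNIV"
    by (intro summable_on_cmult_right sobolevD(3) f)
  also have "(\<lambda>k. c\<^sup>2 * (japanese k powr (2 * s) * (cmod (fourier_coeff f k))\<^sup>2))
      = (\<lambda>k. japanese k powr (2 * s) * (cmod (fourier_coeff (\<lambda>x. c * f x) k))\<^sup>2)"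
    by (simp add: fun_eq_iff fourier_coeff_cmult norm_mult power_mult_distrib mult_ac)
  finally show ?thesis
    by (auto simp: sobolev_def sobolevD(1)[OF f] intro!: continuous_intros sobolevD(2)[OF f])
qed

lemma fourier_coeff_le_sobolev_norm:
  assumes f: "f \<in> sobolev s" and s: "0 \<le> s"
  shows "cmod (fourier_coeff f k) \<le> sobolev_norm s f"
proof -
  have "1 * (cmod (fourier_coeff f k))\<^sup>2 \<le> japanese k powr (2 * s) * (cmod (fourier_coeff f k))\<^sup>2"
    using s japanese_ge(2)[of k] by (intro mult_right_mono ge_one_powr_ge_zero) auto
  also have "\<dots> \<le> (sobolev_norm s f)\<^sup>2" by (rule sums_below_point[OF sums_below_sobolev[OF f]])
  finally show ?thesis by (intro power2_le_imp_le[OF _ sobolev_norm_nonneg]) simp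
qed

lemma zero_mean_iff: "zero_mean f \<longleftrightarrow> fourier_coeff f 0 = 0"
proof -
  have "(LINT x:{0..2*pi}|lborel. complex_of_real (f x)) = of_real (LINT x:{0..2*pi}|lborel. f x)"
    by (rule set_integral_complex_of_real)
  then show ?thesis by (simp add: fourier_coeff_def zero_mean_def)
qed

text \<open>
  Continuity in time of a family of coefficients as a map into \<open>l\<^sup>1\<close>. This is the right notion for the
  flux: \<open>l\<^sup>1\<close> is an algebra under convolution, and the synthesised function is jointly continuous.
\<close>

definition l1_cont :: "real set \<Rightarrow> (real \<Rightarrow> int \<Rightarrow> complex) \<Rightarrow> bool" where
  "l1_cont I c \<longleftrightarrow> (\<forall>t\<in>I. (\<exists>a. sums_below (\<lambda>k. cmod (c t k)) a) \<and>
     (\<exists>\<delta>. (\<delta> \<longlongrightarrow> 0) (at t within I) \<and> (\<forall>\<tau>\<in>I. sums_below (\<lambda>k. cmod (c \<tau> k - c t k)) (\<delta> \<tau>))))"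

lemma l1_cont_dominated:
  assumes "l1_cont I c" and "\<And>t k. t \<in> I \<Longrightarrow> cmod (c' t k) \<le> cmod (c t k)"
    and "\<And>t \<tau> k. t \<in> I \<Longrightarrow> \<tau> \<in> I \<Longrightarrow> cmod (c' \<tau> k - c' t k) \<le> cmod (c \<tau> k - c t k)"
  shows "l1_cont I c'"
  unfolding l1_cont_def
proof (intro ballI conjI)
  fix t assume t: "t \<in> I"
  show "\<exists>a. sums_below (\<lambda>k. cmod (c' t k)) a"
  proof -
    obtain a where "sums_below (\<lambda>k. cmod (c t k)) a" using assms(1) t unfolding l1_cont_def by blast
    from sums_below_mono[OF this assms(2)[OF t] order_refl] show ?thesis by blast
  qed
  obtain \<delta> where "(\<delta> \<longlongrightarrow> 0) (at t within I)" "\<forall>\<tau>\<in>I. sums_below (\<lambda>k. cmod (c \<tau> k - c t k)) (\<delta> \<tau>)"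
    using assms(1) t unfolding l1_cont_def by blast
  moreover from this have "\<forall>\<tau>\<in>I. sums_below (\<lambda>k. cmod (c' \<tau> k - c' t k)) (\<delta> \<tau>)"
    by (meson assms(3)[OF t] order_refl sums_below_mono)
  ultimately show "\<exists>\<delta>. (\<delta> \<longlongrightarrow> 0) (at t within I) \<and> (\<forall>\<tau>\<in>I. sums_below (\<lambda>k. cmod (c' \<tau> k - c' t k)) (\<delta> \<tau>))"
    by blast
qed

lemma l1_cont_summable: "l1_cont I c \<Longrightarrow> t \<in> I \<Longrightarrow> (\<lambda>k. cmod (c t k)) summable_on UNIV"
  unfolding l1_cont_def by (meson norm_ge_zero sums_below_imp_summable(1))

lemma l1_cont_ball:
  assumes "l1_cont I c" "t \<in> I" "0 < e"
  obtains d where "0 < d" "\<And>\<tau>. \<tau> \<in> I \<Longrightarrow> dist \<tau> t < d \<Longrightarrow> sums_below (\<lambda>k. cmod (c \<tau> k - c t k)) e"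
proof -
  obtain \<delta> where \<delta>: "(\<delta> \<longlongrightarrow> 0) (at t within I)" "\<And>\<tau>. \<tau> \<in> I \<Longrightarrow> sums_below (\<lambda>k. cmod (c \<tau> k - c t k)) (\<delta> \<tau>)"
    using assms unfolding l1_cont_def by blast
  from tendstoD[OF \<delta>(1) assms(3)] obtain d where d: "0 < d" "\<And>\<tau>. \<tau> \<in> I \<Longrightarrow> \<tau> \<noteq> t \<Longrightarrow> dist \<tau> t < d \<Longrightarrow> dist (\<delta> \<tau>) 0 < e"
    unfolding eventually_at by auto
  show ?thesis
  proof (rule that[OF d(1)])
    fix \<tau> assume \<tau>: "\<tau> \<in> I" "dist \<tau> t < d"
    show "sums_below (\<lambda>k. cmod (c \<tau> k - c t k)) e"
    proof (cases "\<tau> = t")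
      case True
      then show ?thesis using assms(3) by (simp add: sums_below_def)
    next
      case False
      then show ?thesis using d(2)[OF \<tau>(1) False \<tau>(2)] by (intro sums_below_mono[OF \<delta>(2)[OF \<tau>(1)]]) auto
    qed
  qed
qed

lemma l1_cont_bounded:
  assumes c: "l1_cont I c" and sub: "{a..b} \<subseteq> I"
  shows "\<exists>A. \<forall>t\<in>{a..b}. sums_below (\<lambda>k. cmod (c t k)) A"
proof (rule Icc_locally_bounded)
  show "sums_below (\<lambda>k. cmod (c \<tau> k)) M'" if "sums_below (\<lambda>k. cmod (c \<tau> k)) M" "M \<le> M'" for \<tau> M M'
    by (rule sums_below_mono[OF that(1) order_refl that(2)])
  fix t assume "t \<in> {a..b}"
  then have t: "t \<in> I" using sub by blast
  obtain d where d: "0 < d" "\<And>\<tau>. \<tau> \<in> I \<Longrightarrow> dist \<tau> t < d \<Longrightarrow> sums_below (\<lambda>k. cmod (c \<tau> k - c t k)) 1"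
    using l1_cont_ball[OF c t zero_less_one] by blast
  obtain A where A: "sums_below (\<lambda>k. cmod (c t k)) A" using c t unfolding l1_cont_def by blast
  have "sums_below (\<lambda>k. cmod (c \<tau> k)) (1 + A)" if "\<tau> \<in> {a..b}" "dist \<tau> t < d" for \<tau>
  proof (rule sums_below_mono[OF sums_below_add[OF d(2) A]])
    show "cmod (c \<tau> k) \<le> cmod (c \<tau> k - c t k) + cmod (c t k)" for k
      using norm_triangle_ineq[of "c \<tau> k - c t k" "c t k"] by simp
  qed (use that sub in auto)
  then show "\<exists>M. \<exists>d>0. \<forall>\<tau>\<in>{a..b}. dist \<tau> t < d \<longrightarrow> sums_below (\<lambda>k. cmod (c \<tau> k)) M"
    using d(1) by blast
qed

lemma l1_cont_mode:
  assumes "l1_cont I c"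
  shows "continuous_on I (\<lambda>t. c t k)"
  unfolding continuous_on_iff
proof (intro ballI allI impI)
  fix t and e :: real assume t: "t \<in> I" and e: "0 < e"
  obtain d where d: "0 < d" "\<And>\<tau>. \<tau> \<in> I \<Longrightarrow> dist \<tau> t < d \<Longrightarrow> sums_below (\<lambda>k. cmod (c \<tau> k - c t k)) (e / 2)"
    using l1_cont_ball[OF assms t, of "e / 2"] e by auto
  have "dist (c \<tau> k) (c t k) < e" if "\<tau> \<in> I" "dist \<tau> t < d" for \<tau>
    using sums_below_point[OF d(2)[OF that], of k] e by (simp add: dist_norm)
  then show "\<exists>d>0. \<forall>x'\<in>I. dist x' t < d \<longrightarrow> dist (c x' k) (c t k) < e" using d(1) by blast
qed

lemma continuous_on_synth_pair:
  assumes c: "l1_cont I c"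
  shows "continuous_on (I \<times> UNIV) (\<lambda>(t, x). synth (c t) x)"
  unfolding continuous_on_iff
proof (intro ballI allI impI, clarify)
  fix t x and e :: real assume t: "t \<in> I" and e: "0 < e"
  obtain d where d: "0 < d" "\<And>\<tau>. \<tau> \<in> I \<Longrightarrow> dist \<tau> t < d \<Longrightarrow> sums_below (\<lambda>k. cmod (c \<tau> k - c t k)) (e / 3)"
    using l1_cont_ball[OF c t, of "e / 3"] e by auto
  have "isCont (synth (c t)) x"
    using continuous_on_synth[OF l1_cont_summable[OF c t], of UNIV] by (simp add: continuous_on_eq_continuous_at)
  then obtain d' where d': "0 < d'" "\<And>y. dist y x < d' \<Longrightarrow> dist (synth (c t) y) (synth (c t) x) < e / 3"
    unfolding continuous_at_eps_delta using e by (metis divide_pos_pos zero_less_numeral)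
  show "\<exists>d>0. \<forall>x'\<in>I \<times> UNIV. dist x' (t, x) < d \<longrightarrow>
      dist (case x' of (t, x) \<Rightarrow> synth (c t) x) (synth (c t) x) < e"
  proof (intro exI[of _ "min d d'"] conjI ballI impI)
    fix p assume p: "p \<in> I \<times> (UNIV :: real set)" "dist p (t, x) < min d d'"
    obtain \<tau> y where py: "p = (\<tau>, y)" by (cases p)
    have \<tau>: "\<tau> \<in> I" using p py by auto
    have d\<tau>: "dist \<tau> t < d" "dist y x < d'"
      using p(2) dist_fst_le[of p "(t, x)"] dist_snd_le[of p "(t, x)"] by (auto simp: py)
    note s = l1_cont_summable[OF c \<tau>] l1_cont_summable[OF c t]
    have "synth (c \<tau>) y - synth (c t) y = synth (\<lambda>k. c \<tau> k - c t k) y"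
    proof -
      have "synth (\<lambda>k. c \<tau> k + of_real (- 1) * c t k) y = synth (c \<tau>) y + (- 1) * synth (c t) y"
        unfolding synth_cmult using s by (intro synth_add[symmetric]) auto
      then show ?thesis by simp
    qed
    also have "\<bar>\<dots>\<bar> \<le> (\<Sum>\<^sub>\<infinity>k. cmod (c \<tau> k - c t k))"
      by (rule abs_synth_le) (rule sums_below_imp_summable(1)[OF d(2)[OF \<tau> d\<tau>(1)]], simp)
    also have "\<dots> \<le> e / 3" by (rule sums_below_imp_summable(2)[OF d(2)[OF \<tau> d\<tau>(1)]]) simp
    finally have "dist (synth (c \<tau>) y) (synth (c t) y) \<le> e / 3" by (simp add: dist_real_def)
    then have "dist (synth (c \<tau>) y) (synth (c t) x) < e"
      using d'(2)[OF d\<tau>(2)] dist_triangle[of "synth (c \<tau>) y" "synth (c t) x" "synth (c t) y"] e by linarith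
    then show "dist (case p of (t, x) \<Rightarrow> synth (c t) x) (synth (c t) x) < e" by (simp add: py)
  qed (use d d' in auto)
qed

lemma japanese_powr_ge: "of_int \<bar>k\<bar> ^ (2 * n) \<le> japanese k powr (2 * real n)"
proof -
  have "japanese k powr (2 * real n) = japanese k ^ (2 * n)"
    using powr_realpow[OF japanese_pos, of k "2 * n"] by simp
  then show ?thesis using power_mono[OF japanese_ge(1)[of k], of "2 * n"] by simp
qed

lemma C0_sobolev_diff_tendsto:
  assumes "\<phi> \<in> C0_sobolev I s" "t \<in> I"
  shows "((\<lambda>\<tau>. (sobolev_norm s (\<lambda>x. \<phi> \<tau> x - \<phi> t x))\<^sup>2) \<longlongrightarrow> 0) (at t within I)"
  using tendsto_power[of "\<lambda>\<tau>. sobolev_norm s (\<lambda>x. \<phi> \<tau> x - \<phi> t x)" 0 "at t within I" 2] assms by (simp add: C0_sobolev_def)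

lemma C0_sobolev_diff_sums:
  assumes "\<phi> \<in> C0_sobolev I s" "t \<in> I" "\<tau> \<in> I"
  shows "sums_below (\<lambda>k. japanese k powr (2 * s) * (cmod (fourier_coeff (\<phi> \<tau>) k - fourier_coeff (\<phi> t) k))\<^sup>2)
     ((sobolev_norm s (\<lambda>x. \<phi> \<tau> x - \<phi> t x))\<^sup>2)"
proof -
  have "\<phi> \<tau> \<in> sobolev s" "\<phi> t \<in> sobolev s" using assms by (auto simp: C0_sobolev_def)
  from sums_below_sobolev[OF sobolev_diff(1)[OF this]] sobolev_diff(2)[OF this] show ?thesis by simp
qed

lemma C0_sobolev_bounded:
  assumes \<phi>: "\<phi> \<in> C0_sobolev I s" and sub: "{a..b} \<subseteq> I"
  shows "\<exists>M. \<forall>t\<in>{a..b}. sums_below (\<lambda>k. japanese k powr (2 * s) * (cmod (fourier_coeff (\<phi> t) k))\<^sup>2) M"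
proof (rule Icc_locally_bounded)
  fix t assume "t \<in> {a..b}"
  then have t: "t \<in> I" using sub by blast
  from tendstoD[OF C0_sobolev_diff_tendsto[OF \<phi> t] zero_less_one] obtain d where
    d: "0 < d" "\<And>\<tau>. \<tau> \<in> I \<Longrightarrow> \<tau> \<noteq> t \<Longrightarrow> dist \<tau> t < d \<Longrightarrow> dist ((sobolev_norm s (\<lambda>x. \<phi> \<tau> x - \<phi> t x))\<^sup>2) 0 < 1"
    unfolding eventually_at by auto
  have ft: "\<phi> t \<in> sobolev s" using \<phi> t by (auto simp: C0_sobolev_def)
  define M where "M = (sobolev_norm s (\<phi> t))\<^sup>2"
  have "sums_below (\<lambda>k. japanese k powr (2 * s) * (cmod (fourier_coeff (\<phi> \<tau>) k))\<^sup>2) (2 * 1 + 2 * M)"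
    if \<tau>: "\<tau> \<in> {a..b}" "dist \<tau> t < d" for \<tau>
  proof (cases "\<tau> = t")
    case True
    then show ?thesis unfolding M_def
      by (intro sums_below_mono[OF sums_below_sobolev[OF ft]]) auto
  next
    case False
    have \<tau>I: "\<tau> \<in> I" using \<tau> sub by blast
    have "sums_below (\<lambda>k. japanese k powr (2 * s) * (cmod (fourier_coeff (\<phi> \<tau>) k - fourier_coeff (\<phi> t) k))\<^sup>2) 1"
      using d(2)[OF \<tau>I False \<tau>(2)] by (intro sums_below_mono[OF C0_sobolev_diff_sums[OF \<phi> t \<tau>I]]) auto
    then have "sums_below (\<lambda>k. 2 * (japanese k powr (2 * s) * (cmod (fourier_coeff (\<phi> \<tau>) k - fourier_coeff (\<phi> t) k))\<^sup>2)
        + 2 * (japanese k powr (2 * s) * (cmod (fourier_coeff (\<phi> t) k))\<^sup>2)) (2 * 1 + 2 * M)"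
      unfolding M_def by (intro sums_below_add sums_below_cmult sums_below_sobolev[OF ft]) auto
    then show ?thesis
    proof (rule sums_below_mono)
      fix k
      show "japanese k powr (2 * s) * (cmod (fourier_coeff (\<phi> \<tau>) k))\<^sup>2
         \<le> 2 * (japanese k powr (2 * s) * (cmod (fourier_coeff (\<phi> \<tau>) k - fourier_coeff (\<phi> t) k))\<^sup>2)
        + 2 * (japanese k powr (2 * s) * (cmod (fourier_coeff (\<phi> t) k))\<^sup>2)"
        using mult_left_mono[OF cmod_diff_power2_le[of "fourier_coeff (\<phi> \<tau>) k - fourier_coeff (\<phi> t) k" "- fourier_coeff (\<phi> t) k"], of "japanese k powr (2 * s)"]
        by (simp add: algebra_simps)
    qed simp
  qed
  then show "\<exists>M. \<exists>d>0. \<forall>\<tau>\<in>{a..b}. dist \<tau> t < d \<longrightarrow>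
      sums_below (\<lambda>k. japanese k powr (2 * s) * (cmod (fourier_coeff (\<phi> \<tau>) k))\<^sup>2) M" using d(1) by blast
qed (rule sums_below_mono[OF _ order_refl])

text \<open>
  The third derivative is in \<open>L\<^sup>2\<close>, so the second one has absolutely summable coefficients.
\<close>

lemma l1_cont_C0_sobolev:
  assumes \<phi>: "\<phi> \<in> C0_sobolev I 3" and zm: "\<And>t. t \<in> I \<Longrightarrow> zero_mean (\<phi> t)"
  shows "l1_cont I (\<lambda>t k. (of_int k)\<^sup>2 * fourier_coeff (\<phi> t) k)"
  unfolding l1_cont_def
proof (intro ballI conjI)
  fix t assume t: "t \<in> I"
  have le: "(of_int k * cmod ((of_int k)\<^sup>2 * z))\<^sup>2 \<le> japanese k powr (2 * 3) * (cmod z)\<^sup>2" for k :: int and z :: complex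
  proof -
    have "(of_int k * cmod ((of_int k)\<^sup>2 * z))\<^sup>2 = of_int \<bar>k\<bar> ^ (2 * 3) * (cmod z)\<^sup>2"
      by (simp add: norm_mult norm_power power_mult_distrib power_even_abs flip: power_mult power_Suc)
    also have "\<dots> \<le> japanese k powr (2 * 3) * (cmod z)\<^sup>2"
      using japanese_powr_ge[of k 3] by (intro mult_right_mono) auto
    finally show ?thesis .
  qed
  have ft: "\<phi> t \<in> sobolev 3" using \<phi> t by (auto simp: C0_sobolev_def)
  have "sums_below (\<lambda>k. cmod ((of_int k)\<^sup>2 * fourier_coeff (\<phi> t) k)) (sqrt_zeta * sqrt ((sobolev_norm 3 (\<phi> t))\<^sup>2))"
    by (rule sums_below_l2_l1[OF sums_below_mono[OF sums_below_sobolev[OF ft] le]]) auto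
  then show "\<exists>a. sums_below (\<lambda>k. cmod ((of_int k)\<^sup>2 * fourier_coeff (\<phi> t) k)) a" by blast
  define \<delta> where "\<delta> \<tau> = sqrt_zeta * sqrt ((sobolev_norm 3 (\<lambda>x. \<phi> \<tau> x - \<phi> t x))\<^sup>2)" for \<tau>
  have "(\<delta> \<longlongrightarrow> sqrt_zeta * sqrt 0) (at t within I)"
    unfolding \<delta>_def by (intro tendsto_intros C0_sobolev_diff_tendsto[OF \<phi> t])
  moreover have "sums_below (\<lambda>k. cmod ((of_int k)\<^sup>2 * fourier_coeff (\<phi> \<tau>) k - (of_int k)\<^sup>2 * fourier_coeff (\<phi> t) k)) (\<delta> \<tau>)"
    if \<tau>: "\<tau> \<in> I" for \<tau>
    unfolding \<delta>_def right_diff_distrib[symmetric]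
    by (rule sums_below_l2_l1[OF sums_below_mono[OF C0_sobolev_diff_sums[OF \<phi> t \<tau>] le]]) auto
  ultimately show "\<exists>\<delta>. (\<delta> \<longlongrightarrow> 0) (at t within I) \<and> (\<forall>\<tau>\<in>I. sums_below (\<lambda>k. cmod ((of_int k)\<^sup>2 * fourier_coeff (\<phi> \<tau>) k
      - (of_int k)\<^sup>2 * fourier_coeff (\<phi> t) k)) (\<delta> \<tau>))"
    by (intro exI[of _ \<delta>]) auto
qed

lemma l1_cont_lower:
  assumes c: "l1_cont I (\<lambda>t k. (of_int k)\<^sup>2 * c t k)" and z: "\<And>t. t \<in> I \<Longrightarrow> c t 0 = 0"
  shows "l1_cont I (\<lambda>t k. of_int k * c t k)" "l1_cont I c"
proof -
  have le: "cmod (of_int k * z) \<le> cmod ((of_int k)\<^sup>2 * z)" "k \<noteq> 0 \<Longrightarrow> cmod z \<le> cmod ((of_int k)\<^sup>2 * z)" for k :: int and z :: complex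
  proof -
    have 1: "1 \<le> \<bar>real_of_int k\<bar>" if "k \<noteq> 0" using that by linarith
    show "k \<noteq> 0 \<Longrightarrow> cmod z \<le> cmod ((of_int k)\<^sup>2 * z)"
      using mult_right_mono[OF one_le_power[OF 1, of 2], of "cmod z"] by (simp add: norm_mult norm_power)
    have "\<bar>real_of_int k\<bar> * cmod z \<le> \<bar>real_of_int k\<bar>\<^sup>2 * cmod z"
      using 1 mult_left_mono[OF 1, of "\<bar>real_of_int k\<bar>"] by (cases "k = 0") (auto intro!: mult_right_mono simp: power2_eq_square)
    then show "cmod (of_int k * z) \<le> cmod ((of_int k)\<^sup>2 * z)" by (simp add: norm_mult norm_power)
  qed
  show "l1_cont I (\<lambda>t k. of_int k * c t k)"
    by (rule l1_cont_dominated[OF c]) (simp_all only: right_diff_distrib[symmetric] le)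
  show "l1_cont I c"
  proof (rule l1_cont_dominated[OF c])
    show "cmod (c t k) \<le> cmod ((of_int k)\<^sup>2 * c t k)" if "t \<in> I" for t k
      using le(2)[of k] z[OF that] by (cases "k = 0") auto
    show "cmod (c \<tau> k - c t k) \<le> cmod ((of_int k)\<^sup>2 * c \<tau> k - (of_int k)\<^sup>2 * c t k)" if "t \<in> I" "\<tau> \<in> I" for t \<tau> k
      unfolding right_diff_distrib[symmetric] using le(2)[of k] z[OF that(1)] z[OF that(2)] by (cases "k = 0") auto
  qed
qed

lemma l1_cont_bilin:
  assumes c: "l1_cont I (\<lambda>t k. of_int k * c t k)"
  shows "l1_cont I (\<lambda>t. bilin (c t))"
  unfolding l1_cont_def
proof (intro ballI conjI)
  fix t assume t: "t \<in> I"
  obtain A where A: "sums_below (\<lambda>k. cmod (of_int k * c t k)) A" using c t unfolding l1_cont_def by blast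
  then have A': "sums_below (\<lambda>k. of_int \<bar>k\<bar> * cmod (c t k)) A" by (simp add: norm_mult)
  show "\<exists>a. sums_below (\<lambda>k. cmod (bilin (c t) k)) a"
    unfolding bilin_def using bilin_sum_l1[OF A' A'] by blast
  obtain \<delta> where \<delta>: "(\<delta> \<longlongrightarrow> 0) (at t within I)" "\<And>\<tau>. \<tau> \<in> I \<Longrightarrow> sums_below (\<lambda>k. cmod (of_int k * c \<tau> k - of_int k * c t k)) (\<delta> \<tau>)"
    using c t unfolding l1_cont_def by blast
  have "((\<lambda>\<tau>. 2 * ((A + \<delta> \<tau>) + A) * \<delta> \<tau>) \<longlongrightarrow> 2 * ((A + 0) + A) * 0) (at t within I)" by (intro tendsto_intros \<delta>)
  moreover have "sums_below (\<lambda>k. cmod (bilin (c \<tau>) k - bilin (c t) k)) (2 * ((A + \<delta> \<tau>) + A) * \<delta> \<tau>)" if \<tau>: "\<tau> \<in> I" for \<tau>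
  proof -
    have d: "sums_below (\<lambda>k. of_int \<bar>k\<bar> * cmod (c \<tau> k - c t k)) (\<delta> \<tau>)"
      using \<delta>(2)[OF \<tau>] by (simp add: norm_mult flip: right_diff_distrib)
    have "sums_below (\<lambda>k. of_int \<bar>k\<bar> * cmod (c \<tau> k)) (A + \<delta> \<tau>)"
    proof (rule sums_below_mono[OF sums_below_add[OF A' d]])
      show "of_int \<bar>k\<bar> * cmod (c \<tau> k) \<le> of_int \<bar>k\<bar> * cmod (c t k) + of_int \<bar>k\<bar> * cmod (c \<tau> k - c t k)" for k
        unfolding distrib_left[symmetric] using norm_triangle_ineq[of "c t k" "c \<tau> k - c t k"] by (intro mult_left_mono) auto
    qed simp
    from bilin_diff_l1[OF this A' d] show ?thesis .
  qed
  ultimately show "\<exists>\<delta>. (\<delta> \<longlongrightarrow> 0) (at t within I) \<and> (\<forall>\<tau>\<in>I. sums_below (\<lambda>k. cmod (bilin (c \<tau>) k - bilin (c t) k)) (\<delta> \<tau>))"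
    by (intro exI[of _ "\<lambda>\<tau>. 2 * ((A + \<delta> \<tau>) + A) * \<delta> \<tau>"]) auto
qed

lemma l1_cont_flux_coeff:
  assumes c: "l1_cont I (\<lambda>t k. of_int k * c t k)"
  shows "l1_cont I (\<lambda>t. flux_coeff (c t))"
proof (rule l1_cont_dominated[OF l1_cont_bilin[OF c]])
  show "cmod (flux_coeff (c t) k) \<le> cmod (bilin (c t) k)" for t k
    unfolding flux_coeff_def by (rule cmod_sgn_mult_le)
  show "cmod (flux_coeff (c \<tau>) k - flux_coeff (c t) k) \<le> cmod (bilin (c \<tau>) k - bilin (c t) k)" for t \<tau> k
    unfolding flux_coeff_def right_diff_distrib[symmetric] by (rule cmod_sgn_mult_le)
qed

lemma has_vector_derivative_iff_quotient:
  fixes f :: "real \<Rightarrow> complex"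
  shows "(f has_vector_derivative d) (at t within I) \<longleftrightarrow>
    ((\<lambda>\<tau>. of_real (1 / (\<tau> - t)) * (f \<tau> - f t)) \<longlongrightarrow> d) (at t within I)"
proof -
  have "(f has_vector_derivative d) (at t within I) \<longleftrightarrow>
      ((\<lambda>\<tau>. norm (f \<tau> - f t - (\<tau> - t) *\<^sub>R d) / norm (\<tau> - t)) \<longlongrightarrow> 0) (at t within I)"
    by (simp add: has_vector_derivative_def has_derivative_iff_norm bounded_linear_scaleR_left)
  also have "\<dots> \<longleftrightarrow> ((\<lambda>\<tau>. norm (of_real (1 / (\<tau> - t)) * (f \<tau> - f t) - d)) \<longlongrightarrow> 0) (at t within I)"
  proof (rule tendsto_cong)
    have scale: "of_real (1 / h) * w - d = of_real (1 / h) * (w - h *\<^sub>R d)" if "h \<noteq> 0" for h w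
      using that by (simp add: scaleR_conv_of_real right_diff_distrib)
    have "norm (f \<tau> - f t - (\<tau> - t) *\<^sub>R d) / norm (\<tau> - t) = norm (of_real (1 / (\<tau> - t)) * (f \<tau> - f t) - d)"
      if "\<tau> \<noteq> t" for \<tau>
    proof -
      have "of_real (1 / (\<tau> - t)) * (f \<tau> - f t) - d = of_real (1 / (\<tau> - t)) * (f \<tau> - f t - (\<tau> - t) *\<^sub>R d)"
        using scale[of "\<tau> - t"] that by simp
      then show ?thesis by (simp only: norm_mult norm_of_real) simp
    qed
    then show "\<forall>\<^sub>F \<tau> in at t within I. norm (f \<tau> - f t - (\<tau> - t) *\<^sub>R d) / norm (\<tau> - t)
        = norm (of_real (1 / (\<tau> - t)) * (f \<tau> - f t) - d)"
      by (simp add: eventually_at_filter)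
  qed
  also have "\<dots> \<longleftrightarrow> ((\<lambda>\<tau>. of_real (1 / (\<tau> - t)) * (f \<tau> - f t)) \<longlongrightarrow> d) (at t within I)"
    unfolding tendsto_norm_zero_iff by (rule LIM_zero_iff)
  finally show ?thesis .
qed

text \<open>
  A single coefficient is bounded by the Sobolev norm, so the convergence of the difference quotients
  carries over.
\<close>

lemma C1_sobolev_mode:
  assumes \<phi>: "\<phi> \<in> C1_sobolev I s" and s: "0 \<le> s" and t: "t \<in> I"
  shows "((\<lambda>\<tau>. fourier_coeff (\<phi> \<tau>) k) has_vector_derivative fourier_coeff (time_deriv I \<phi> t) k) (at t within I)"
proof -
  define q where "q \<tau> x = (\<phi> \<tau> x - \<phi> t x) / (\<tau> - t) - time_deriv I \<phi> t x" for \<tau> x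
  have lim: "((\<lambda>\<tau>. sobolev_norm s (q \<tau>)) \<longlongrightarrow> 0) (at t within I)"
    using \<phi> t by (simp add: C1_sobolev_def q_def[abs_def])
  have sob: "\<phi> \<tau> \<in> sobolev s" "time_deriv I \<phi> \<tau> \<in> sobolev s" if "\<tau> \<in> I" for \<tau>
    using \<phi> that by (auto simp: C1_sobolev_def C0_sobolev_def)
  have q: "q \<tau> \<in> sobolev s" "fourier_coeff (q \<tau>) k = of_real (1 / (\<tau> - t)) * (fourier_coeff (\<phi> \<tau>) k - fourier_coeff (\<phi> t) k) - fourier_coeff (time_deriv I \<phi> t) k"
    if \<tau>: "\<tau> \<in> I" for \<tau>
  proof -
    have qe: "q \<tau> = (\<lambda>x. (1 / (\<tau> - t)) * (\<phi> \<tau> x - \<phi> t x) - time_deriv I \<phi> t x)" by (simp add: q_def fun_eq_iff)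
    note d = sobolev_diff[OF sob(1)[OF \<tau>] sob(1)[OF t]]
    show "q \<tau> \<in> sobolev s" unfolding qe by (intro sobolev_diff(1) sobolev_cmult d sob t)
    show "fourier_coeff (q \<tau>) k = of_real (1 / (\<tau> - t)) * (fourier_coeff (\<phi> \<tau>) k - fourier_coeff (\<phi> t) k) - fourier_coeff (time_deriv I \<phi> t) k"
      unfolding qe sobolev_diff(2)[OF sobolev_cmult[OF d(1)] sob(2)[OF t]] fourier_coeff_cmult d(2) ..
  qed
  have "((\<lambda>\<tau>. fourier_coeff (q \<tau>) k) \<longlongrightarrow> 0) (at t within I)"
  proof (rule Lim_null_comparison[OF _ lim])
    show "\<forall>\<^sub>F \<tau> in at t within I. norm (fourier_coeff (q \<tau>) k) \<le> sobolev_norm s (q \<tau>)"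
      by (auto simp: eventually_at_filter intro!: always_eventually fourier_coeff_le_sobolev_norm q s)
  qed
  then have "((\<lambda>\<tau>. of_real (1 / (\<tau> - t)) * (fourier_coeff (\<phi> \<tau>) k - fourier_coeff (\<phi> t) k) - fourier_coeff (time_deriv I \<phi> t) k) \<longlongrightarrow> 0) (at t within I)"
    by (rule Lim_transform_eventually) (auto simp: eventually_at_filter q intro!: always_eventually)
  then have "((\<lambda>\<tau>. of_real (1 / (\<tau> - t)) * (fourier_coeff (\<phi> \<tau>) k - fourier_coeff (\<phi> t) k)) \<longlongrightarrow> fourier_coeff (time_deriv I \<phi> t) k) (at t within I)"
    by (rule LIM_zero_cancel)
  then show ?thesis
    unfolding has_vector_derivative_iff_quotient .
qed

section \<open>From distributional solutions to the mode equations\<close>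

text \<open>
  The test function \<open>\<theta>\<close> is the difference of two steps, at \<open>s1\<close> and at \<open>s2\<close>, of width \<open>\<epsilon>\<close>. It has compact
  support, and its derivative is the difference of two mollifiers. Integration by parts turns the weak
  equation into the equality of the mollified values of \<open>V - G\<close> at both points.
\<close>

lemma du_bois_reymond_const:
  fixes U V G g :: "real \<Rightarrow> complex"
  assumes U: "\<And>t. t \<in> {0..b} \<Longrightarrow> (U has_vector_derivative V t) (at t within {0..b})"
    and G: "\<And>t. t \<in> {0..b} \<Longrightarrow> (G has_vector_derivative g t) (at t within {0..b})"
    and V: "continuous_on {0..b} V" and g: "continuous_on {0..b} g"
    and weak: "\<And>\<theta> c d. (\<And>n. Ck n \<theta>) \<Longrightarrow> 0 < c \<Longrightarrow> c \<le> d \<Longrightarrow> d \<le> b \<Longrightarrow> (\<And>t. t \<notin> {c..d} \<Longrightarrow> \<theta> t = 0) \<Longrightarrow>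
       integral {c..d} (\<lambda>t. of_real (deriv (deriv \<theta>) t) * U t - of_real (\<theta> t) * g t) = 0"
    and s: "0 < s1" "s1 < s2" "s2 < b"
  shows "V s1 - G s1 = V s2 - G s2"
proof -
  define p where "p t = V t - G t" for t
  have contG: "continuous_on {0..b} G" by (rule continuous_on_vector_derivative[OF G])
  have contU: "continuous_on {0..b} U" by (rule continuous_on_vector_derivative[OF U])
  have contp: "continuous_on {0..b} p" unfolding p_def by (intro continuous_intros V contG)
  obtain \<sigma> \<rho> :: "real \<Rightarrow> real" where \<sigma>: "\<And>n. Ck n \<sigma>" and d\<sigma>: "\<And>x. (\<sigma> has_real_derivative \<rho> x) (at x)"
    and \<rho>0: "\<And>x. 0 \<le> \<rho> x" and \<sigma>0: "\<And>x. x \<le> 0 \<Longrightarrow> \<sigma> x = 0" and \<sigma>1: "\<And>x. 1 \<le> x \<Longrightarrow> \<sigma> x = 1"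
    and \<rho>z: "\<And>x. x \<notin> {0..1} \<Longrightarrow> \<rho> x = 0" and \<rho>C: "\<And>n. Ck n \<rho>"
    by (rule smooth_step_exists, rule that) (assumption | simp)+
  \<comment> \<open>The mollified value of \<open>V - G\<close> is within \<open>e\<close> of the value at the point, once \<open>\<epsilon>\<close> is small.\<close>
  have close: "cmod (p s1 - p s2) \<le> 2 * e" if e: "0 < e" for e
  proof -
    obtain d1 where d1: "0 < d1" "\<And>t. t \<in> {0..b} \<Longrightarrow> dist t s1 \<le> d1 \<Longrightarrow> dist (p t) (p s1) < e"
      by (rule continuous_onE[OF contp _ e, of s1]) (use s in auto)
    obtain d2 where d2: "0 < d2" "\<And>t. t \<in> {0..b} \<Longrightarrow> dist t s2 \<le> d2 \<Longrightarrow> dist (p t) (p s2) < e"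
      by (rule continuous_onE[OF contp _ e, of s2]) (use s in auto)
    define \<epsilon> where "\<epsilon> = min (min d1 d2) (b - s2) / 3"
    have \<epsilon>: "0 < \<epsilon>" "\<epsilon> < d1" "\<epsilon> < d2" "s2 + 2 * \<epsilon> \<le> b" using d1 d2 s by (auto simp: \<epsilon>_def min_def field_simps)
    define c d where "c = s1 / 2" and "d = s2 + 2 * \<epsilon>"
    have cd: "0 < c" "c \<le> d" "d \<le> b" "c < s1" "s2 + \<epsilon> < d" using s \<epsilon> by (auto simp: c_def d_def)
    define st where "st a t = \<sigma> (inverse \<epsilon> * t + (- inverse \<epsilon> * a))" for a t
    define r where "r a t = inverse \<epsilon> * \<rho> (inverse \<epsilon> * t + (- inverse \<epsilon> * a))" for a t
    have arg: "inverse \<epsilon> * t + (- inverse \<epsilon> * a) = (t - a) / \<epsilon>" for t a by (simp add: divide_inverse algebra_simps)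
    have st: "(st a has_real_derivative r a t) (at t)" for a t
      unfolding st_def r_def
      by (rule DERIV_cong[OF DERIV_chain2[OF d\<sigma>]]) (auto intro!: derivative_eq_intros)
    have rC: "Ck n (r a)" for n a unfolding r_def by (intro Ck_mult Ck_const Ck_affine \<rho>C)
    have stC: "Ck n (st a)" for n a unfolding st_def by (intro Ck_affine \<sigma>)
    have contr: "continuous_on A (r a)" for A a
    proof -
      have "Ck (Suc 0) (r a)" by (rule rC)
      then obtain f' where "\<forall>x. (r a has_real_derivative f' x) (at x)" by auto
      then show ?thesis by (meson DERIV_isCont continuous_at_imp_continuous_on)
    qed
    have r0: "0 \<le> r a t" for a t using \<epsilon> \<rho>0 by (simp add: r_def)
    have rz: "r a t = 0" if "t \<notin> {a..a+\<epsilon>}" for a t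
      unfolding r_def arg using that \<epsilon> by (subst \<rho>z) (auto simp: field_simps)
    have st0: "st a t = 0" if "t \<le> a" for a t
      unfolding st_def arg using that \<epsilon> by (intro \<sigma>0) (auto simp: divide_nonpos_pos)
    have st1: "st a t = 1" if "a + \<epsilon> \<le> t" for a t
      unfolding st_def arg using that \<epsilon> by (intro \<sigma>1) (auto simp: field_simps)
    have int_r: "(r a has_integral 1) {c..d}" if "c \<le> a" "a + \<epsilon> \<le> d" for a
    proof -
      have "(r a has_integral (st a d - st a c)) {c..d}"
        using st cd(2) by (intro fundamental_theorem_of_calculus)
          (auto simp: has_real_derivative_iff_has_vector_derivative[symmetric] intro: has_field_derivative_at_within)
      then show ?thesis using that by (simp add: st0 st1)
    qed
    define \<theta> where "\<theta> t = st s1 t + (- 1) * st s2 t" for t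
    have C\<theta>: "Ck n \<theta>" for n unfolding \<theta>_def by (intro Ck_add Ck_mult Ck_const stC)
    have \<theta>z: "\<theta> t = 0" if "t \<notin> {c<..<d}" for t
    proof (cases "t \<le> c")
      case True
      then show ?thesis using cd s by (simp add: \<theta>_def st0)
    next
      case False
      then show ?thesis using that cd s by (simp add: \<theta>_def st1)
    qed
    have d\<theta>: "deriv \<theta> t = r s1 t - r s2 t" for t
      unfolding \<theta>_def by (rule DERIV_imp_deriv) (auto intro!: derivative_eq_intros st)
    have d\<theta>z: "deriv \<theta> c = 0" "deriv \<theta> d = 0" using cd s \<epsilon> by (auto simp: d\<theta> rz)
    have D1: "(\<theta> has_real_derivative deriv \<theta> t) (at t)" and D2: "(deriv \<theta> has_real_derivative deriv (deriv \<theta>) t) (at t)" for t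
      using Ck_deriv_funpow(2)[of \<theta> 0 t, OF C\<theta>] Ck_deriv_funpow(2)[of \<theta> 1 t, OF C\<theta>] by simp_all
    have contD2: "continuous_on A (deriv (deriv \<theta>))" for A
    proof -
      have "(deriv (deriv \<theta>) has_real_derivative deriv (deriv (deriv \<theta>)) t) (at t)" for t
        using Ck_deriv_funpow(2)[of \<theta> 2 t, OF C\<theta>] by (simp add: numeral_2_eq_2)
      then show ?thesis by (meson DERIV_isCont continuous_at_imp_continuous_on)
    qed
    have int0: "integral {c..d} (\<lambda>t. of_real (deriv \<theta> t) * p t) = 0"
    proof -
      \<comment> \<open>A primitive whose derivative is the weak integrand plus \<open>\<theta>' (V - G)\<close>.\<close>
      define H where "H t = of_real (deriv \<theta> t) * U t - of_real (\<theta> t) * G t" for t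
      have sub: "{c..d} \<subseteq> {0..b}" using cd by auto
      have c1: "continuous_on {c..d} U" "continuous_on {c..d} V" "continuous_on {c..d} G" "continuous_on {c..d} g" "continuous_on {c..d} p"
        using contU V contG g contp sub by (auto intro: continuous_on_subset)
      have c2: "continuous_on {c..d} \<theta>" "continuous_on {c..d} (deriv \<theta>)"
        using DERIV_isCont[OF D1] DERIV_isCont[OF D2] by (auto intro!: continuous_at_imp_continuous_on)
      have "((\<lambda>t. of_real (deriv \<theta> t) * V t + of_real (deriv (deriv \<theta>) t) * U t - (of_real (\<theta> t) * g t + of_real (deriv \<theta> t) * G t))
          has_integral H d - H c) {c..d}"
      proof (rule fundamental_theorem_of_calculus[OF cd(2)])
        fix t assume t: "t \<in> {c..d}"
        have o: "((\<lambda>t. complex_of_real (f t)) has_vector_derivative of_real f') (at t within {c..d})"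
          if "(f has_real_derivative f') (at t)" for f f'
          using that has_field_derivative_at_within has_real_derivative_iff_has_vector_derivative
            bounded_linear.has_vector_derivative[OF bounded_linear_of_real] by blast
        have "(U has_vector_derivative V t) (at t within {c..d})" "(G has_vector_derivative g t) (at t within {c..d})"
          using U[of t] G[of t] t sub by (blast intro: has_vector_derivative_within_subset)+
        then show "(H has_vector_derivative of_real (deriv \<theta> t) * V t + of_real (deriv (deriv \<theta>) t) * U t
            - (of_real (\<theta> t) * g t + of_real (deriv \<theta> t) * G t)) (at t within {c..d})"
          unfolding H_def by (intro has_vector_derivative_diff has_vector_derivative_mult o D1 D2)
      qed
      moreover have "H d = 0" "H c = 0" using \<theta>z[of c] \<theta>z[of d] d\<theta>z by (auto simp: H_def)
      ultimately have "integral {c..d} (\<lambda>t. of_real (deriv \<theta> t) * V t + of_real (deriv (deriv \<theta>) t) * U t - (of_real (\<theta> t) * g t + of_real (deriv \<theta> t) * G t)) = 0"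
        by (simp add: integral_unique)
      also have "(\<lambda>t. of_real (deriv \<theta> t) * V t + of_real (deriv (deriv \<theta>) t) * U t - (of_real (\<theta> t) * g t + of_real (deriv \<theta> t) * G t))
        = (\<lambda>t. (of_real (deriv (deriv \<theta>) t) * U t - of_real (\<theta> t) * g t) + of_real (deriv \<theta> t) * p t)"
        by (simp add: fun_eq_iff p_def algebra_simps)
      also have "integral {c..d} \<dots> = integral {c..d} (\<lambda>t. of_real (deriv (deriv \<theta>) t) * U t - of_real (\<theta> t) * g t)
          + integral {c..d} (\<lambda>t. of_real (deriv \<theta> t) * p t)"
        by (intro Henstock_Kurzweil_Integration.integral_add integrable_continuous_real continuous_intros c1 c2 contD2)
      also have "integral {c..d} (\<lambda>t. of_real (deriv (deriv \<theta>) t) * U t - of_real (\<theta> t) * g t) = 0"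
        by (rule weak[OF C\<theta> cd(1,2,3)]) (auto intro: \<theta>z)
      finally show ?thesis by simp
    qed
    have err: "cmod (integral {c..d} (\<lambda>t. of_real (r a t) * (p a - p t))) \<le> e"
      "((\<lambda>t. of_real (r a t) * (p a - p t)) has_integral (p a - integral {c..d} (\<lambda>t. of_real (r a t) * p t))) {c..d}"
      if a: "a = s1 \<or> a = s2" for a
    proof -
      have ad: "c \<le> a" "a + \<epsilon> \<le> d" "0 \<le> a" "a + \<epsilon> \<le> b" using a cd s \<epsilon> by auto
      have cp: "continuous_on {c..d} p" by (rule continuous_on_subset[OF contp]) (use cd in auto)
      have i: "(\<lambda>t. of_real (r a t) * (p a - p t)) integrable_on {c..d}"
        "(\<lambda>t. of_real (r a t) * p t) integrable_on {c..d}"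
        by (intro integrable_continuous_real continuous_intros contr cp)+
      have "cmod (integral {c..d} (\<lambda>t. of_real (r a t) * (p a - p t))) \<le> integral {c..d} (\<lambda>t. r a t * e)"
      proof (rule integral_norm_bound_integral[OF i(1)])
        show "(\<lambda>t. r a t * e) integrable_on {c..d}" by (intro integrable_continuous_real continuous_intros contr)
        fix t assume t: "t \<in> {c..d}"
        show "cmod (of_real (r a t) * (p a - p t)) \<le> r a t * e"
        proof (cases "t \<in> {a..a+\<epsilon>}")
          case True
          then have "t \<in> {0..b}" "dist t a < d1" "dist t a < d2" using ad \<epsilon> by (auto simp: dist_real_def)
          then have "dist (p t) (p a) < e" using a d1(2) d2(2) by auto
          then have "cmod (p a - p t) \<le> e" by (simp add: dist_norm norm_minus_commute)
          then show ?thesis using r0 by (simp add: norm_mult mult_left_mono)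
        next
          case False
          then show ?thesis by (simp add: rz)
        qed
      qed
      also have "\<dots> = e" using integral_unique[OF has_integral_mult_left[OF int_r[OF ad(1,2)], of e]] by simp
      finally show "cmod (integral {c..d} (\<lambda>t. of_real (r a t) * (p a - p t))) \<le> e" .
      have "((\<lambda>t. complex_of_real (r a t)) has_integral of_real 1) {c..d}"
        using has_integral_linear[OF int_r[OF ad(1,2)] bounded_linear_of_real[where 'a = complex]] by (simp add: o_def)
      from has_integral_diff[OF has_integral_mult_left[OF this, of "p a"] integrable_integral[OF i(2)]]
      show "((\<lambda>t. of_real (r a t) * (p a - p t)) has_integral (p a - integral {c..d} (\<lambda>t. of_real (r a t) * p t))) {c..d}"
        by (simp add: right_diff_distrib)
    qed
    have "integral {c..d} (\<lambda>t. of_real (r s1 t) * p t) - integral {c..d} (\<lambda>t. of_real (r s2 t) * p t) = 0"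
    proof -
      have cp: "continuous_on {c..d} p" by (rule continuous_on_subset[OF contp]) (use cd in auto)
      have i: "(\<lambda>t. of_real (r a t) * p t) integrable_on {c..d}" for a
        by (intro integrable_continuous_real continuous_intros contr cp)
      show ?thesis using int0 unfolding Henstock_Kurzweil_Integration.integral_diff[OF i i, symmetric]
        by (simp add: d\<theta> left_diff_distrib)
    qed
    then have "p s1 - p s2 = integral {c..d} (\<lambda>t. of_real (r s1 t) * (p s1 - p t)) - integral {c..d} (\<lambda>t. of_real (r s2 t) * (p s2 - p t))"
      using integral_unique[OF err(2)[of s1]] integral_unique[OF err(2)[of s2]] by simp
    also have "cmod \<dots> \<le> e + e" by (intro order_trans[OF norm_triangle_ineq4] add_mono err) auto
    finally show ?thesis by simp
  qed
  have "cmod (p s1 - p s2) \<le> 0"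
  proof (rule field_le_epsilon)
    fix e :: real assume "0 < e"
    then show "cmod (p s1 - p s2) \<le> 0 + e" using close[of "e / 2"] by simp
  qed
  then show ?thesis by (simp add: p_def)
qed

lemma time_interval_Icc: "b \<in> time_interval T \<Longrightarrow> {0..b} \<subseteq> time_interval T"
  by (auto simp: time_interval_def intro: le_less_trans[of _ "ereal b"])

lemma time_interval_larger:
  assumes "t \<in> time_interval T"
  obtains b where "t < b" "b \<in> time_interval T"
proof -
  obtain b where "ereal t < ereal b" "ereal b < T"
    using assms ereal_dense2[of "ereal t" T] by (auto simp: time_interval_def)
  then show ?thesis using that[of b] assms by (auto simp: time_interval_def)
qed

lemma at_within_time_interval:
  assumes "t \<in> {0..<b}" "b \<in> time_interval T"
  shows "at t within time_interval T = at t within {0..b}"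
proof (rule at_within_nhd[of _ "{..<b}"])
  show "time_interval T \<inter> {..<b} - {t} = {0..b} \<inter> {..<b} - {t}"
    using time_interval_Icc[OF assms(2)] by (auto simp: time_interval_def)
qed (use assms in auto)

text \<open>
  Here \<open>V - G\<close> is constant for a primitive \<open>G\<close> of \<open>g\<close>, first in the interior, where test functions
  live, and then up to time \<open>0\<close> by continuity.
\<close>

lemma weak_second_derivative:
  fixes U V g :: "real \<Rightarrow> complex"
  assumes U: "\<And>t. t \<in> time_interval T \<Longrightarrow> (U has_vector_derivative V t) (at t within time_interval T)"
    and V: "continuous_on (time_interval T) V" and g: "continuous_on (time_interval T) g"
    and weak: "\<And>\<theta> c d. (\<And>n. Ck n \<theta>) \<Longrightarrow> 0 < c \<Longrightarrow> c \<le> d \<Longrightarrow> d \<in> time_interval T \<Longrightarrow> (\<And>t. t \<notin> {c..d} \<Longrightarrow> \<theta> t = 0) \<Longrightarrow>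
       integral {c..d} (\<lambda>t. of_real (deriv (deriv \<theta>) t) * U t - of_real (\<theta> t) * g t) = 0"
    and t: "t \<in> time_interval T"
  shows "(V has_vector_derivative g t) (at t within time_interval T)"
proof -
  obtain b where b: "t < b" "b \<in> time_interval T" using time_interval_larger[OF t] .
  have t0: "0 \<le> t" using t by (simp add: time_interval_def)
  note sub = time_interval_Icc[OF b(2)]
  have V': "continuous_on {0..b} V" and g': "continuous_on {0..b} g" using V g sub continuous_on_subset by blast+
  define G where "G s = integral {0..s} g" for s
  have G: "(G has_vector_derivative g s) (at s within {0..b})" if "s \<in> {0..b}" for s
    unfolding G_def by (rule integral_has_vector_derivative[OF g' that])
  have contG: "continuous_on {0..b} G" by (rule continuous_on_vector_derivative[OF G])
  define C where "C = V (b / 2) - G (b / 2)"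
  have eq: "V s1 - G s1 = V s2 - G s2" if "0 < s1" "s1 < s2" "s2 < b" for s1 s2
  proof (rule du_bois_reymond_const[OF _ G V' g' _ that])
    show "(U has_vector_derivative V s) (at s within {0..b})" if "s \<in> {0..b}" for s
      using U[of s] that sub by (blast intro: has_vector_derivative_within_subset)
    show "integral {c..d} (\<lambda>t. of_real (deriv (deriv \<theta>) t) * U t - of_real (\<theta> t) * g t) = 0"
      if "\<And>n. Ck n \<theta>" "0 < c" "c \<le> d" "d \<le> b" "\<And>t. t \<notin> {c..d} \<Longrightarrow> \<theta> t = 0" for \<theta> c d
      using that sub by (intro weak) auto
  qed
  have const: "V s - G s = C" if "s \<in> {0<..<b}" for s
  proof -
    have b0: "0 < b" using that by simp
    consider "s = b / 2" | "s < b / 2" | "b / 2 < s" by linarith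
    then show ?thesis
    proof cases
      case 2
      then show ?thesis using eq[of s "b / 2"] that b0 by (simp add: C_def)
    next
      case 3
      then show ?thesis using eq[of "b / 2" s] that b0 by (simp add: C_def)
    next
      case 1
      show ?thesis unfolding 1 C_def ..
    qed
  qed
  have const': "V s - G s = C" if s: "s \<in> {0..b}" for s
  proof (rule continuous_constant_on_closure[where S = "{0<..<b}" and f = "\<lambda>s. V s - G s"])
    have cl: "closure {0<..<b} = {0..b}" using t0 b by (intro closure_greaterThanLessThan) auto
    show "continuous_on (closure {0<..<b}) (\<lambda>s. V s - G s)" unfolding cl by (intro continuous_intros V' contG)
    show "s \<in> closure {0<..<b}" using s cl by simp
    show "V x - G x = C" if "x \<in> {0<..<b}" for x by (rule const[OF that])
  qed
  have "((\<lambda>s. G s + C) has_vector_derivative g t + 0) (at t within {0..b})"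
    by (intro has_vector_derivative_add G has_vector_derivative_const) (use t0 b in auto)
  then have "((\<lambda>s. G s + C) has_vector_derivative g t) (at t within {0..b})" by simp
  then have "(V has_vector_derivative g t) (at t within {0..b})"
    by (rule has_vector_derivative_transform[rotated 2]) (use t0 b const' in \<open>auto simp: algebra_simps\<close>)
  then show ?thesis using at_within_time_interval[of t b T] t0 b by simp
qed

lemma lint_eq_box_integral:
  fixes f :: "real \<Rightarrow> real \<Rightarrow> real"
  assumes sub: "{c..d} \<subseteq> I" and cont: "continuous_on ({c..d} \<times> {0..2*pi}) (\<lambda>(t, x). f t x)"
    and z: "\<And>t x. t \<notin> {c..d} \<Longrightarrow> f t x = 0"
  shows "(LINT (t, x):I \<times> {0..2*pi}|lborel. f t x) = integral (cbox (c, 0) (d, 2 * pi)) (\<lambda>(t, x). f t x)"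
proof -
  have box: "cbox (c, 0) (d, 2 * pi) = {c..d} \<times> {0..2*pi}" by (simp add: cbox_Pair_eq)
  have "(LINT (t, x):I \<times> {0..2*pi}|lborel. f t x) = (LINT p:cbox (c, 0) (d, 2 * pi)|lborel. (case p of (t, x) \<Rightarrow> f t x))"
    unfolding set_lebesgue_integral_def
    by (rule Bochner_Integration.integral_cong[OF refl]) (use sub z in \<open>auto simp: box indicator_def split: prod.splits\<close>)
  also have "\<dots> = integral (cbox (c, 0) (d, 2 * pi)) (\<lambda>(t, x). f t x)"
  proof (rule set_borel_integral_eq_integral(2))
    show "set_integrable lborel (cbox (c, 0) (d, 2 * pi)) (\<lambda>(t, x). f t x)"
      using borel_integrable_compact[OF compact_cbox, of "(c, 0)" "(d, 2 * pi)" "\<lambda>(t, x). f t x"] cont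
      by (simp add: set_integrable_def box indicator_scaleR_eq_if)
  qed
  finally show ?thesis .
qed

lemma Ck_trig: "Ck n (\<lambda>x. c * sin (a * x)) \<and> Ck n (\<lambda>x. c * cos (a * x))"
proof (induction n arbitrary: c)
  case (Suc n)
  have "\<forall>x. ((\<lambda>x. c * sin (a * x)) has_real_derivative (c * a) * cos (a * x)) (at x)"
    "\<forall>x. ((\<lambda>x. c * cos (a * x)) has_real_derivative (- c * a) * sin (a * x)) (at x)"
    by (auto intro!: derivative_eq_intros)
  with Suc[of "c * a"] Suc[of "- c * a"] show ?case unfolding Ck.simps by (intro conjI exI) auto
qed simp

lemma smooth2_product:
  assumes \<theta>: "\<And>n. Ck n \<theta>" and w: "\<And>n. Ck n w"
  shows "smooth2 (\<lambda>t x. \<theta> t * w x)"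
proof -
  note D\<theta> = Ck_deriv_funpow(2)[of \<theta>, OF \<theta>] and Dw = Ck_deriv_funpow(2)[of w, OF w]
  have x: "(partial_x ^^ j) (\<lambda>t x. \<theta> t * w x) = (\<lambda>t x. \<theta> t * (deriv ^^ j) w x)" for j
  proof (induction j)
    case (Suc j)
    have "deriv (\<lambda>x. \<theta> t * (deriv ^^ j) w x) x = \<theta> t * (deriv ^^ Suc j) w x" for t x
      by (rule DERIV_imp_deriv[OF DERIV_cmult[OF Dw]])
    then have "partial_x (\<lambda>t x. \<theta> t * (deriv ^^ j) w x) = (\<lambda>t x. \<theta> t * (deriv ^^ Suc j) w x)"
      unfolding partial_x_def by blast
    then show ?case by (simp add: Suc)
  qed simp
  have t: "(partial_t ^^ i) (\<lambda>t x. \<theta> t * v x) = (\<lambda>t x. (deriv ^^ i) \<theta> t * v x)" for i v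
  proof (induction i)
    case (Suc i)
    have "deriv (\<lambda>t. (deriv ^^ i) \<theta> t * v x) t = (deriv ^^ Suc i) \<theta> t * v x" for t x
      by (rule DERIV_imp_deriv[OF DERIV_cmult_right[OF D\<theta>]])
    then have "partial_t (\<lambda>t x. (deriv ^^ i) \<theta> t * v x) = (\<lambda>t x. (deriv ^^ Suc i) \<theta> t * v x)"
      unfolding partial_t_def by blast
    then show ?case by (simp add: Suc)
  qed simp
  have c: "continuous_on UNIV ((deriv ^^ i) \<theta>)" "continuous_on UNIV ((deriv ^^ i) w)" for i
    using DERIV_isCont[OF D\<theta>] DERIV_isCont[OF Dw] by (auto intro!: continuous_at_imp_continuous_on)
  show ?thesis
    unfolding smooth2_def x t Let_def
  proof (intro allI conjI)
    fix i j t0 x0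
    show "continuous_on UNIV (\<lambda>(t, x). (deriv ^^ i) \<theta> t * (deriv ^^ j) w x)"
      unfolding case_prod_unfold
      by (intro continuous_intros continuous_on_compose2[OF c(1), of UNIV fst] continuous_on_compose2[OF c(2), of UNIV snd]) auto
    show "(\<lambda>\<tau>. (deriv ^^ i) \<theta> \<tau> * (deriv ^^ j) w x0) differentiable at t0"
      using DERIV_cmult_right[OF D\<theta>] real_differentiable_def by blast
    show "(\<lambda>x. (deriv ^^ i) \<theta> t0 * (deriv ^^ j) w x) differentiable at x0"
      using DERIV_cmult[OF Dw] real_differentiable_def by blast
  qed
qed

lemma deriv_zero_outside:
  fixes f :: "real \<Rightarrow> real"
  assumes "\<And>t. t \<notin> {c..d} \<Longrightarrow> f t = 0" "t \<notin> {c..d}"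
  shows "deriv f t = 0"
proof -
  have o: "open (- {c..d})" by auto
  have "\<forall>\<^sub>F s in nhds t. f s = 0"
    using eventually_nhds_in_open[OF o, of t] assms by (auto elim: eventually_mono)
  then have "deriv f t = deriv (\<lambda>_. 0) t" by (intro deriv_cong_ev) auto
  then show ?thesis by simp
qed

lemma C0_sobolev_mode:
  assumes \<phi>: "\<phi> \<in> C0_sobolev I s" and s: "0 \<le> s"
  shows "continuous_on I (\<lambda>t. fourier_coeff (\<phi> t) k)"
  unfolding continuous_on_def
proof
  fix t assume t: "t \<in> I"
  have sob: "\<phi> \<tau> \<in> sobolev s" if "\<tau> \<in> I" for \<tau> using \<phi> that by (auto simp: C0_sobolev_def)
  have "((\<lambda>\<tau>. fourier_coeff (\<phi> \<tau>) k - fourier_coeff (\<phi> t) k) \<longlongrightarrow> 0) (at t within I)"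
  proof (rule Lim_null_comparison)
    show "((\<lambda>\<tau>. sobolev_norm s (\<lambda>x. \<phi> \<tau> x - \<phi> t x)) \<longlongrightarrow> 0) (at t within I)"
      using \<phi> t by (simp add: C0_sobolev_def)
    have "norm (fourier_coeff (\<phi> \<tau>) k - fourier_coeff (\<phi> t) k) \<le> sobolev_norm s (\<lambda>x. \<phi> \<tau> x - \<phi> t x)" if "\<tau> \<in> I" for \<tau>
      using fourier_coeff_le_sobolev_norm[OF sobolev_diff(1)[OF sob[OF that] sob[OF t]] s]
        sobolev_diff(2)[OF sob[OF that] sob[OF t]] by simp
    then show "\<forall>\<^sub>F \<tau> in at t within I. norm (fourier_coeff (\<phi> \<tau>) k - fourier_coeff (\<phi> t) k) \<le> sobolev_norm s (\<lambda>x. \<phi> \<tau> x - \<phi> t x)"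
      by (simp add: eventually_at_filter)
  qed
  then show "((\<lambda>\<tau>. fourier_coeff (\<phi> \<tau>) k) \<longlongrightarrow> fourier_coeff (\<phi> t) k) (at t within I)" by (rule LIM_zero_cancel)
qed

text \<open>
  The factor \<open>\<i> k\<close> comes from the derivative outside the flux; with \<open>-\<i> sgn k\<close> it makes \<open>\<bar>k\<bar>\<close>.
\<close>

lemma flux_coeff_deriv: "\<i> * of_int k * flux_coeff u k = of_int \<bar>k\<bar> * bilin u k"
proof -
  have "\<i> * of_int k * (- \<i> * of_int (sgn k) * bilin u k) = - (\<i> * \<i>) * (of_int (k * sgn k) * bilin u k)"
    by (simp add: mult_ac)
  then show ?thesis by (simp add: flux_coeff_def abs_sgn mult.commute)
qed

lemma C0_sobolev_fourier:
  assumes \<phi>: "\<phi> \<in> C0_sobolev I 3" and zm: "\<forall>t\<in>I. zero_mean (\<phi> t)"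
  shows "l1_cont I (\<lambda>t. fourier_coeff (\<phi> t))" "l1_cont I (\<lambda>t k. of_int k * fourier_coeff (\<phi> t) k)"
    "l1_cont I (\<lambda>t. flux_coeff (fourier_coeff (\<phi> t)))"
    "\<And>t. t \<in> I \<Longrightarrow> \<phi> t = synth (fourier_coeff (\<phi> t))"
    "\<And>t. t \<in> I \<Longrightarrow> flux (\<phi> t) = synth (flux_coeff (fourier_coeff (\<phi> t)))"
proof -
  note l = l1_cont_lower[OF l1_cont_C0_sobolev[OF \<phi> bspec[OF zm]] zero_mean_iff[THEN iffD1, OF bspec[OF zm]]]
  show "l1_cont I (\<lambda>t. fourier_coeff (\<phi> t))" "l1_cont I (\<lambda>t k. of_int k * fourier_coeff (\<phi> t) k)"
    using l by auto
  show "l1_cont I (\<lambda>t. flux_coeff (fourier_coeff (\<phi> t)))" by (rule l1_cont_flux_coeff[OF l(1)])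
  have s: "\<phi> t \<in> sobolev 3" if "t \<in> I" for t using \<phi> that by (auto simp: C0_sobolev_def)
  show "\<phi> t = synth (fourier_coeff (\<phi> t))" if "t \<in> I" for t using synth_fourier_coeff[OF s[OF that]] by simp
  show "flux (\<phi> t) = synth (flux_coeff (fourier_coeff (\<phi> t)))" if "t \<in> I" for t by (rule flux_eq_synth[OF s[OF that]])
qed

lemma continuous_on_pair_C0_sobolev:
  assumes \<phi>: "\<phi> \<in> C0_sobolev I 3" and zm: "\<forall>t\<in>I. zero_mean (\<phi> t)"
  shows "continuous_on (I \<times> UNIV) (\<lambda>(t, x). \<phi> t x)" "continuous_on (I \<times> UNIV) (\<lambda>(t, x). flux (\<phi> t) x)"
proof -
  note f = C0_sobolev_fourier[OF \<phi> zm]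
  have "\<And>p. p \<in> I \<times> UNIV \<Longrightarrow> (case p of (t, x) \<Rightarrow> \<phi> t x) = (case p of (t, x) \<Rightarrow> synth (fourier_coeff (\<phi> t)) x)"
    using f(4) by fastforce
  then show "continuous_on (I \<times> UNIV) (\<lambda>(t, x). \<phi> t x)"
    using continuous_on_synth_pair[OF f(1)] continuous_on_cong[OF refl] by (metis (no_types, lifting))
  have "\<And>p. p \<in> I \<times> UNIV \<Longrightarrow> (case p of (t, x) \<Rightarrow> flux (\<phi> t) x) = (case p of (t, x) \<Rightarrow> synth (flux_coeff (fourier_coeff (\<phi> t))) x)"
    using f(5) by fastforce
  then show "continuous_on (I \<times> UNIV) (\<lambda>(t, x). flux (\<phi> t) x)"
    using continuous_on_synth_pair[OF f(3)] continuous_on_cong[OF refl] by (metis (no_types, lifting))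
qed

text \<open>
  Test functions are real, so the exponential is assembled from a cosine and a sine. For the product
  \<open>\<theta>(t) w(x)\<close> the spatial integral yields Fourier coefficients, and a weak equation in time for a single
  mode remains.
\<close>

lemma distributional_imp_modes:
  assumes I: "I = time_interval T"
    and \<phi>: "\<phi> \<in> C0_sobolev I 3" and \<phi>1: "\<phi> \<in> C1_sobolev I 2" and zm: "\<forall>t\<in>I. zero_mean (\<phi> t)"
    and sol: "distributional_solution \<mu> I \<phi>" and t: "t \<in> I"
  shows "((\<lambda>t. fourier_coeff (time_deriv I \<phi> t) k) has_vector_derivative
    - of_real (\<mu> * (of_int k)\<^sup>2) * fourier_coeff (\<phi> t) k + of_int \<bar>k\<bar> * bilin (fourier_coeff (\<phi> t)) k) (at t within I)"
proof (rule weak_second_derivative[where T = T and U = "\<lambda>t. fourier_coeff (\<phi> t) k"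
      and V = "\<lambda>t. fourier_coeff (time_deriv I \<phi> t) k"
      and g = "\<lambda>t. - of_real (\<mu> * (of_int k)\<^sup>2) * fourier_coeff (\<phi> t) k + of_int \<bar>k\<bar> * bilin (fourier_coeff (\<phi> t)) k", folded I])
  note f = C0_sobolev_fourier[OF \<phi> zm] and cp = continuous_on_pair_C0_sobolev[OF \<phi> zm]
  show "((\<lambda>t. fourier_coeff (\<phi> t) k) has_vector_derivative fourier_coeff (time_deriv I \<phi> t) k) (at t within I)"
    if "t \<in> I" for t
    using C1_sobolev_mode[OF \<phi>1, of t k] that by simp
  show "continuous_on I (\<lambda>t. fourier_coeff (time_deriv I \<phi> t) k)"
    using C0_sobolev_mode[of "time_deriv I \<phi>" I 2 k] \<phi>1 by (simp add: C1_sobolev_def)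
  have cu: "continuous_on I (\<lambda>t. fourier_coeff (\<phi> t) k)" by (rule l1_cont_mode[OF f(1)])
  have cb: "continuous_on I (\<lambda>t. bilin (fourier_coeff (\<phi> t)) k)" by (rule l1_cont_mode[OF l1_cont_bilin[OF f(2)]])
  show "continuous_on I (\<lambda>t. - of_real (\<mu> * (of_int k)\<^sup>2) * fourier_coeff (\<phi> t) k + of_int \<bar>k\<bar> * bilin (fourier_coeff (\<phi> t)) k)"
    using cu cb by (intro continuous_intros)
  show "t \<in> I" by (rule t)
  fix \<theta> :: "real \<Rightarrow> real" and c d
  assume \<theta>: "\<And>n. Ck n \<theta>" and c: "0 < c" and cd: "c \<le> d" and d: "d \<in> I" and z: "\<And>t. t \<notin> {c..d} \<Longrightarrow> \<theta> t = 0"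
  have sub: "{c..d} \<subseteq> I" using time_interval_Icc[of d T] d c I by auto
  define R where "R = cbox (c, 0) (d, 2 * pi)"
  have R: "R = {c..d} \<times> {0..2*pi}" by (simp add: R_def cbox_Pair_eq)
  have z1: "deriv \<theta> t = 0" if "t \<notin> {c..d}" for t using deriv_zero_outside[OF z that] by simp
  have z2: "deriv (deriv \<theta>) t = 0" if "t \<notin> {c..d}" for t using deriv_zero_outside[OF z1 that] by simp
  have D1: "(\<theta> has_real_derivative deriv \<theta> t) (at t)" and D2: "(deriv \<theta> has_real_derivative deriv (deriv \<theta>) t) (at t)"
    and D3: "(deriv (deriv \<theta>) has_real_derivative deriv (deriv (deriv \<theta>)) t) (at t)" for t
    using Ck_deriv_funpow(2)[of \<theta> 0 t, OF \<theta>] Ck_deriv_funpow(2)[of \<theta> 1 t, OF \<theta>] Ck_deriv_funpow(2)[of \<theta> 2 t, OF \<theta>]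
    by (simp_all add: numeral_2_eq_2)
  have c\<theta>: "continuous_on UNIV \<theta>" "continuous_on UNIV (deriv (deriv \<theta>))"
    using DERIV_isCont[OF D1] DERIV_isCont[OF D3] by (auto intro!: continuous_at_imp_continuous_on)
  have c\<theta>R: "continuous_on A (\<lambda>p. \<theta> (fst p))" "continuous_on A (\<lambda>p. deriv (deriv \<theta>) (fst p))" for A :: "(real \<times> real) set"
    by (intro continuous_on_compose2[OF c\<theta>(1)] continuous_on_compose2[OF c\<theta>(2)] continuous_intros; simp)+
  have cpR: "continuous_on R (\<lambda>p. \<phi> (fst p) (snd p))" "continuous_on R (\<lambda>p. flux (\<phi> (fst p)) (snd p))"
    using cp sub by (auto simp: R case_prod_unfold intro: continuous_on_subset)
  have trig: "((\<lambda>(t, x). \<phi> t x * (deriv (deriv \<theta>) t * w x) - \<mu> * \<phi> t x * (\<theta> t * w2 x) + flux (\<phi> t) x * (\<theta> t * w1 x)) has_integral 0) R"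
    if w: "\<And>n. Ck n w" and w1: "\<And>x. (w has_real_derivative w1 x) (at x)" and w2: "\<And>x. (w1 has_real_derivative w2 x) (at x)"
      and per: "\<And>x. w (x + 2 * pi) = w x" and cw2: "continuous_on UNIV w2" for w w1 w2
  proof -
    define \<eta> where "\<eta> = (\<lambda>t x. \<theta> t * w x)"
    have px: "partial_x \<eta> = (\<lambda>t x. \<theta> t * w1 x)" "partial_x (\<lambda>t x. \<theta> t * w1 x) = (\<lambda>t x. \<theta> t * w2 x)"
      by (auto simp: partial_x_def \<eta>_def fun_eq_iff intro!: DERIV_imp_deriv DERIV_cmult w1 w2)
    have pt: "partial_t \<eta> = (\<lambda>t x. deriv \<theta> t * w x)" "partial_t (\<lambda>t x. deriv \<theta> t * w x) = (\<lambda>t x. deriv (deriv \<theta>) t * w x)"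
      by (auto simp: partial_t_def \<eta>_def fun_eq_iff intro!: DERIV_imp_deriv DERIV_cmult_right D1 D2)
    have "test_function I \<eta>"
      unfolding test_function_def
    proof (intro conjI)
      show "smooth2 \<eta>" unfolding \<eta>_def by (rule smooth2_product[OF \<theta> w])
      show "\<forall>t x. \<eta> t (x + 2 * pi) = \<eta> t x" by (simp add: \<eta>_def per)
      show "\<exists>a b. 0 < a \<and> {a..b} \<subseteq> I \<and> (\<forall>t x. t \<notin> {a..b} \<longrightarrow> \<eta> t x = 0)"
        using c sub z by (intro exI[of _ c] exI[of _ d]) (auto simp: \<eta>_def)
    qed
    then have lint: "(LINT (t, x):I \<times> {0..2*pi}|lborel. \<phi> t x * (deriv (deriv \<theta>) t * w x) - \<mu> * \<phi> t x * (\<theta> t * w2 x) + flux (\<phi> t) x * (\<theta> t * w1 x)) = 0"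
      using sol unfolding distributional_solution_def by (auto simp: px pt)
    have cw: "continuous_on UNIV w" "continuous_on UNIV w1"
      using DERIV_isCont[OF w1] DERIV_isCont[OF w2] by (auto intro!: continuous_at_imp_continuous_on)
    have cwR: "continuous_on A (\<lambda>p. w (snd p))" "continuous_on A (\<lambda>p. w1 (snd p))" "continuous_on A (\<lambda>p. w2 (snd p))" for A :: "(real \<times> real) set"
      by (intro continuous_on_compose2[OF cw(1)] continuous_on_compose2[OF cw(2)] continuous_on_compose2[OF cw2] continuous_intros; simp)+
    have cont: "continuous_on R (\<lambda>(t, x). \<phi> t x * (deriv (deriv \<theta>) t * w x) - \<mu> * \<phi> t x * (\<theta> t * w2 x) + flux (\<phi> t) x * (\<theta> t * w1 x))"
      unfolding case_prod_unfold by (intro continuous_intros c\<theta>R cpR cwR)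
    have i0: "integral R (\<lambda>(t, x). \<phi> t x * (deriv (deriv \<theta>) t * w x) - \<mu> * \<phi> t x * (\<theta> t * w2 x) + flux (\<phi> t) x * (\<theta> t * w1 x)) = 0"
      using lint_eq_box_integral[OF sub cont[unfolded R]] z z2 lint unfolding R_def by simp
    have iR: "(\<lambda>(t, x). \<phi> t x * (deriv (deriv \<theta>) t * w x) - \<mu> * \<phi> t x * (\<theta> t * w2 x) + flux (\<phi> t) x * (\<theta> t * w1 x)) integrable_on R"
      using cont unfolding R_def by (rule integrable_continuous)
    show ?thesis using integrable_integral[OF iR] unfolding i0 .
  qed
  define K where "K = real_of_int k"
  have per: "cos (K * (x + 2 * pi)) = cos (K * x)" "sin (K * (x + 2 * pi)) = sin (K * x)" for x
    using expi_periodic[of k x] by (simp_all add: expi_def exp_eq_polar cis.ctr K_def complex_eq_iff mult.commute)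
  have tc: "((\<lambda>(t, x). \<phi> t x * (deriv (deriv \<theta>) t * cos (K * x)) - \<mu> * \<phi> t x * (\<theta> t * (- K\<^sup>2 * cos (K * x)))
      + flux (\<phi> t) x * (\<theta> t * (- K * sin (K * x)))) has_integral 0) R"
    using Ck_trig[of _ 1 K] by (intro trig) (auto intro!: derivative_eq_intros continuous_intros simp: per power2_eq_square)
  have ts: "((\<lambda>(t, x). \<phi> t x * (deriv (deriv \<theta>) t * sin (K * x)) - \<mu> * \<phi> t x * (\<theta> t * (- K\<^sup>2 * sin (K * x)))
      + flux (\<phi> t) x * (\<theta> t * (K * cos (K * x)))) has_integral 0) R"
    using Ck_trig[of _ 1 K] by (intro trig) (auto intro!: derivative_eq_intros continuous_intros simp: per power2_eq_square)
  define H where "H t x = of_real (deriv (deriv \<theta>) t + \<mu> * K\<^sup>2 * \<theta> t) * (of_real (\<phi> t x) * expi (- k) x)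
     - \<i> * of_real (K * \<theta> t) * (of_real (flux (\<phi> t) x) * expi (- k) x)" for t x
  have expi: "expi (- k) x = of_real (cos (K * x)) - \<i> * of_real (sin (K * x))" for x
    by (simp add: expi_def exp_eq_polar cis.ctr K_def complex_eq_iff)
  have "((\<lambda>(t, x). H t x) has_integral (of_real 0 - \<i> * of_real 0)) R"
  proof -
    have l: "((\<lambda>p. complex_of_real (F p)) has_integral of_real i) R" if "(F has_integral i) R" for F i
      using has_integral_linear[OF that bounded_linear_of_real[where 'a = complex]] by (simp add: o_def)
    show ?thesis
      by (rule has_integral_eq[OF _ has_integral_diff[OF l[OF tc] has_integral_mult_right[OF l[OF ts], of \<i>]]])
         (auto simp: H_def expi algebra_simps)
  qed
  then have "integral R (\<lambda>(t, x). H t x) = 0" by (simp add: integral_unique)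
  moreover have cH: "continuous_on R (\<lambda>(t, x). H t x)"
  proof -
    have "continuous_on R (\<lambda>p. expi (- k) (snd p))"
      by (intro continuous_on_compose2[OF continuous_on_expi[of UNIV]] continuous_intros) auto
    then show ?thesis unfolding H_def case_prod_unfold by (intro continuous_intros c\<theta>R cpR)
  qed
  ultimately have I0: "integral {c..d} (\<lambda>t. integral {0..2*pi} (\<lambda>x. H t x)) = 0"
    using integral_prod_continuous[of c 0 d "2 * pi" "\<lambda>(t, x). H t x"] by (simp add: R_def)
  have inner: "integral {0..2*pi} (\<lambda>x. H t x) = 2 * pi * (of_real (deriv (deriv \<theta>) t) * fourier_coeff (\<phi> t) k
      - of_real (\<theta> t) * (- of_real (\<mu> * (of_int k)\<^sup>2) * fourier_coeff (\<phi> t) k + of_int \<bar>k\<bar> * bilin (fourier_coeff (\<phi> t)) k))"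
    if "t \<in> {c..d}" for t
  proof -
    have tI: "t \<in> I" using that sub by auto
    have s\<phi>: "\<phi> t \<in> sobolev 3" using \<phi> tI by (auto simp: C0_sobolev_def)
    have c1: "continuous_on {0..2*pi} (\<phi> t)" by (rule sobolevD(2)[OF s\<phi>])
    have sF: "(\<lambda>k. cmod (flux_coeff (fourier_coeff (\<phi> t)) k)) summable_on UNIV" by (rule l1_cont_summable[OF f(3) tI])
    have c2: "continuous_on {0..2*pi} (flux (\<phi> t))" unfolding f(5)[OF tI] by (rule continuous_on_synth[OF sF])
    have fF: "fourier_coeff (flux (\<phi> t)) k = flux_coeff (fourier_coeff (\<phi> t)) k"
      unfolding f(5)[OF tI] by (rule fourier_coeff_synth[OF sF hermitian_flux_coeff[OF hermitian_fourier_coeff]])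
    have i: "(\<lambda>x. of_real (q x) * expi (- k) x) integrable_on {0..2*pi}" "integral {0..2*pi} (\<lambda>x. of_real (q x) * expi (- k) x) = 2 * pi * fourier_coeff q k"
      if "continuous_on {0..2*pi} q" for q
      by (intro integrable_continuous_real continuous_intros that) (simp add: fourier_coeff_integral[OF that])
    have im: "(\<lambda>x. a * (of_real (q x) * expi (- k) x)) integrable_on {0..2*pi}" if "continuous_on {0..2*pi} q" for q a
      by (intro integrable_continuous_real continuous_intros that)
    have "integral {0..2*pi} (\<lambda>x. H t x) = of_real (deriv (deriv \<theta>) t + \<mu> * K\<^sup>2 * \<theta> t) * (2 * pi * fourier_coeff (\<phi> t) k)
       - \<i> * of_real (K * \<theta> t) * (2 * pi * flux_coeff (fourier_coeff (\<phi> t)) k)"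
      unfolding H_def Henstock_Kurzweil_Integration.integral_diff[OF im[OF c1] im[OF c2]]
      by (simp add: i(2)[OF c1] i(2)[OF c2] fF)
    then show ?thesis unfolding flux_coeff_deriv[symmetric] by (simp add: K_def algebra_simps)
  qed
  have "integral {c..d} (\<lambda>t. 2 * pi * (of_real (deriv (deriv \<theta>) t) * fourier_coeff (\<phi> t) k
      - of_real (\<theta> t) * (- of_real (\<mu> * (of_int k)\<^sup>2) * fourier_coeff (\<phi> t) k + of_int \<bar>k\<bar> * bilin (fourier_coeff (\<phi> t)) k)))
     = integral {c..d} (\<lambda>t. integral {0..2*pi} (\<lambda>x. H t x))"
    by (intro Henstock_Kurzweil_Integration.integral_cong inner[symmetric])
  also note I0
  finally show "integral {c..d} (\<lambda>t. of_real (deriv (deriv \<theta>) t) * fourier_coeff (\<phi> t) k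
      - of_real (\<theta> t) * (- of_real (\<mu> * (of_int k)\<^sup>2) * fourier_coeff (\<phi> t) k + of_int \<bar>k\<bar> * bilin (fourier_coeff (\<phi> t)) k)) = 0"
    unfolding integral_mult_right by simp
qed

section \<open>From the mode equations to distributional solutions\<close>

lemma smooth2D:
  assumes "smooth2 \<eta>"
  shows "continuous_on UNIV (\<lambda>p. \<eta> (fst p) (snd p))"
    "continuous_on UNIV (\<lambda>p. partial_t \<eta> (fst p) (snd p))"
    "continuous_on UNIV (\<lambda>p. partial_t (partial_t \<eta>) (fst p) (snd p))"
    "continuous_on UNIV (\<lambda>p. partial_x \<eta> (fst p) (snd p))"
    "continuous_on UNIV (\<lambda>p. partial_x (partial_x \<eta>) (fst p) (snd p))"
    "((\<lambda>\<tau>. \<eta> \<tau> x) has_real_derivative partial_t \<eta> t x) (at t)"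
    "((\<lambda>\<tau>. partial_t \<eta> \<tau> x) has_real_derivative partial_t (partial_t \<eta>) t x) (at t)"
    "(\<eta> t has_real_derivative partial_x \<eta> t x) (at x)"
    "(partial_x \<eta> t has_real_derivative partial_x (partial_x \<eta>) t x) (at x)"
proof -
  have S: "continuous_on UNIV (\<lambda>p. ((partial_t ^^ i) ((partial_x ^^ j) \<eta>)) (fst p) (snd p))"
    "((\<lambda>\<tau>. ((partial_t ^^ i) ((partial_x ^^ j) \<eta>)) \<tau> x) has_real_derivative partial_t ((partial_t ^^ i) ((partial_x ^^ j) \<eta>)) t x) (at t)"
    "(((partial_t ^^ i) ((partial_x ^^ j) \<eta>)) t has_real_derivative partial_x ((partial_t ^^ i) ((partial_x ^^ j) \<eta>)) t x) (at x)" for i j t x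
    using assms unfolding smooth2_def Let_def partial_t_def[of _ t x] partial_x_def[of _ t x] DERIV_deriv_iff_real_differentiable case_prod_unfold
    by blast+
  show "continuous_on UNIV (\<lambda>p. \<eta> (fst p) (snd p))" using S(1)[of 0 0] by simp
  show "continuous_on UNIV (\<lambda>p. partial_t \<eta> (fst p) (snd p))" using S(1)[of 1 0] by simp
  show "continuous_on UNIV (\<lambda>p. partial_t (partial_t \<eta>) (fst p) (snd p))" using S(1)[of 2 0] by (simp add: numeral_2_eq_2)
  show "continuous_on UNIV (\<lambda>p. partial_x \<eta> (fst p) (snd p))" using S(1)[of 0 1] by simp
  show "continuous_on UNIV (\<lambda>p. partial_x (partial_x \<eta>) (fst p) (snd p))" using S(1)[of 0 2] by (simp add: numeral_2_eq_2)
  show "((\<lambda>\<tau>. \<eta> \<tau> x) has_real_derivative partial_t \<eta> t x) (at t)" using S(2)[of 0 0] by simp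
  show "((\<lambda>\<tau>. partial_t \<eta> \<tau> x) has_real_derivative partial_t (partial_t \<eta>) t x) (at t)" using S(2)[of 1 0] by simp
  show "(\<eta> t has_real_derivative partial_x \<eta> t x) (at x)" using S(3)[of 0 0] by simp
  show "(partial_x \<eta> t has_real_derivative partial_x (partial_x \<eta>) t x) (at x)" using S(3)[of 0 1] by simp
qed

lemma partial_zero_outside:
  assumes "\<And>t x. t \<notin> {c..d} \<Longrightarrow> \<eta> t x = 0" "t \<notin> {c..d}"
  shows "partial_t \<eta> t x = 0" "partial_x \<eta> t x = 0"
proof -
  show "partial_t \<eta> t x = 0"
    unfolding partial_t_def by (rule deriv_zero_outside[where f = "\<lambda>\<tau>. \<eta> \<tau> x", OF assms])
  have "\<eta> t = (\<lambda>_. 0)" using assms by blast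
  then show "partial_x \<eta> t x = 0" by (simp add: partial_x_def)
qed

lemma partial_x_periodic:
  assumes per: "\<And>x. \<eta> t (x + 2 * pi) = \<eta> t x" and d: "\<And>x. (\<eta> t has_real_derivative partial_x \<eta> t x) (at x)"
  shows "partial_x \<eta> t (x + 2 * pi) = partial_x \<eta> t x"
proof -
  have "((\<lambda>x. \<eta> t (x + 2 * pi)) has_real_derivative partial_x \<eta> t (x + 2 * pi)) (at x)"
    using d[of "x + 2 * pi"] DERIV_shift by blast
  then have "(\<eta> t has_real_derivative partial_x \<eta> t (x + 2 * pi)) (at x)" by (simp add: per)
  then show ?thesis using d DERIV_unique by blast
qed

lemma of_real_has_vector_derivative:
  assumes "(f has_real_derivative f') (at t)"
  shows "((\<lambda>t. complex_of_real (f t)) has_vector_derivative of_real f') (at t within A)"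
proof -
  have "(f has_vector_derivative f') (at t within A)"
    using has_field_derivative_at_within[OF assms] by (simp add: has_real_derivative_iff_has_vector_derivative)
  then show ?thesis by (rule bounded_linear.has_vector_derivative[OF bounded_linear_of_real])
qed

text \<open>
  The integrand is a sum of a pure time derivative \<open>P\<close> and a pure space derivative \<open>Q\<close>, obtained by
  adding and subtracting \<open>g \<eta> expi k\<close>. The first integrates to zero because \<open>\<eta>\<close> vanishes at both
  times, the second by periodicity.
\<close>

lemma mode_weak_identity:
  fixes U V F g :: "real \<Rightarrow> complex"
  assumes ab: "a \<le> b" and sm: "smooth2 \<eta>" and per: "\<And>t x. \<eta> t (x + 2 * pi) = \<eta> t x"
    and U: "\<And>t. t \<in> {a..b} \<Longrightarrow> (U has_vector_derivative V t) (at t within {a..b})"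
    and V: "\<And>t. t \<in> {a..b} \<Longrightarrow> (V has_vector_derivative g t) (at t within {a..b})"
    and F: "continuous_on {a..b} F"
    and g: "\<And>t. t \<in> {a..b} \<Longrightarrow> g t = - of_real (\<mu> * (of_int k)\<^sup>2) * U t + \<i> * of_int k * F t"
    and end_zero: "\<And>x. \<eta> a x = 0" "\<And>x. \<eta> b x = 0" "\<And>x. partial_t \<eta> a x = 0" "\<And>x. partial_t \<eta> b x = 0"
  shows "((\<lambda>(t, x). (U t * of_real (partial_t (partial_t \<eta>) t x) - of_real \<mu> * U t * of_real (partial_x (partial_x \<eta>) t x)
      + F t * of_real (partial_x \<eta> t x)) * expi k x) has_integral 0) (cbox (a, 0) (b, 2 * pi))"
proof -
  define R where "R = cbox (a, 0::real) (b, 2 * pi)"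
  have R: "R = {a..b} \<times> {0..2*pi}" by (simp add: R_def cbox_Pair_eq)
  note D = smooth2D[OF sm]
  have cU: "continuous_on {a..b} U" by (rule continuous_on_vector_derivative[OF U])
  have cg: "continuous_on {a..b} g"
  proof -
    have "continuous_on {a..b} (\<lambda>t. - of_real (\<mu> * (of_int k)\<^sup>2) * U t + \<i> * of_int k * F t)" by (intro continuous_intros cU F)
    then show ?thesis using continuous_on_cong[OF refl, of "{a..b}" g] g by auto
  qed
  have fst_in: "fst ` R \<subseteq> {a..b}" by (auto simp: R)
  have cR: "continuous_on R (\<lambda>p. U (fst p))" "continuous_on R (\<lambda>p. g (fst p))" "continuous_on R (\<lambda>p. F (fst p))"
    by (intro continuous_on_compose2[OF cU] continuous_on_compose2[OF cg] continuous_on_compose2[OF F] continuous_intros fst_in)+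
  have ceR: "continuous_on R (\<lambda>p. expi k (snd p))"
    by (intro continuous_on_compose2[OF continuous_on_expi[of UNIV]] continuous_intros) auto
  have DR: "continuous_on R (\<lambda>p. \<eta> (fst p) (snd p))"
    "continuous_on R (\<lambda>p. partial_t (partial_t \<eta>) (fst p) (snd p))"
    "continuous_on R (\<lambda>p. partial_x \<eta> (fst p) (snd p))"
    "continuous_on R (\<lambda>p. partial_x (partial_x \<eta>) (fst p) (snd p))"
    using D(1,3,4,5) by (auto intro: continuous_on_subset)
  define P where "P t x = (U t * of_real (partial_t (partial_t \<eta>) t x) - g t * of_real (\<eta> t x)) * expi k x" for t x
  define Q where "Q t x = (F t * of_real (partial_x \<eta> t x) + \<i> * of_int k * F t * of_real (\<eta> t x)
      - of_real \<mu> * U t * of_real (partial_x (partial_x \<eta>) t x) - of_real (\<mu> * (of_int k)\<^sup>2) * U t * of_real (\<eta> t x)) * expi k x" for t x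
  have cP: "continuous_on R (\<lambda>(t, x). P t x)" and cQ: "continuous_on R (\<lambda>(t, x). Q t x)"
    unfolding P_def Q_def case_prod_unfold by (intro continuous_intros cR ceR DR)+
  have Pt: "integral {a..b} (\<lambda>t. P t x) = 0" for x
  proof (rule integral_unique)
    have "((\<lambda>t. P t x) has_integral
        ((U b * of_real (partial_t \<eta> b x) - V b * of_real (\<eta> b x)) * expi k x - (U a * of_real (partial_t \<eta> a x) - V a * of_real (\<eta> a x)) * expi k x)) {a..b}"
    proof (rule fundamental_theorem_of_calculus[OF ab])
      fix t assume t: "t \<in> {a..b}"
      have "((\<lambda>t. (U t * of_real (partial_t \<eta> t x) - V t * of_real (\<eta> t x)) * expi k x) has_vector_derivative
         ((U t * of_real (partial_t (partial_t \<eta>) t x) + V t * of_real (partial_t \<eta> t x)) - (V t * of_real (partial_t \<eta> t x) + g t * of_real (\<eta> t x))) * expi k x)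
         (at t within {a..b})"
        by (intro has_vector_derivative_mult_left has_vector_derivative_diff has_vector_derivative_mult of_real_has_vector_derivative D U[OF t] V[OF t])
      then show "((\<lambda>t. (U t * of_real (partial_t \<eta> t x) - V t * of_real (\<eta> t x)) * expi k x) has_vector_derivative P t x) (at t within {a..b})"
        by (simp add: P_def)
    qed
    then show "((\<lambda>t. P t x) has_integral 0) {a..b}" by (simp add: end_zero)
  qed
  have Qx: "integral {0..2*pi} (\<lambda>x. Q t x) = 0" for t
  proof (rule integral_unique)
    define B where "B x = (F t * of_real (\<eta> t x) - of_real \<mu> * U t * of_real (partial_x \<eta> t x) + of_real \<mu> * (\<i> * of_int k) * U t * of_real (\<eta> t x)) * expi k x" for x
    have "(Q t has_integral (B (2 * pi) - B 0)) {0..2*pi}"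
    proof (rule fundamental_theorem_of_calculus)
      fix x :: real
      have "(B has_vector_derivative
         ((F t * of_real (\<eta> t x) - of_real \<mu> * U t * of_real (partial_x \<eta> t x) + of_real \<mu> * (\<i> * of_int k) * U t * of_real (\<eta> t x)) * (\<i> * of_int k * expi k x)
         + (F t * of_real (partial_x \<eta> t x) - of_real \<mu> * U t * of_real (partial_x (partial_x \<eta>) t x) + of_real \<mu> * (\<i> * of_int k) * U t * of_real (partial_x \<eta> t x)) * expi k x))
         (at x within {0..2*pi})"
        unfolding B_def
        by (intro has_vector_derivative_mult has_vector_derivative_mult_right has_vector_derivative_diff has_vector_derivative_add
            of_real_has_vector_derivative D expi_has_vector_derivative)
      also have "((F t * of_real (\<eta> t x) - of_real \<mu> * U t * of_real (partial_x \<eta> t x) + of_real \<mu> * (\<i> * of_int k) * U t * of_real (\<eta> t x)) * (\<i> * of_int k * expi k x)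
         + (F t * of_real (partial_x \<eta> t x) - of_real \<mu> * U t * of_real (partial_x (partial_x \<eta>) t x) + of_real \<mu> * (\<i> * of_int k) * U t * of_real (partial_x \<eta> t x)) * expi k x)
         = (F t * of_real (partial_x \<eta> t x) + \<i> * of_int k * F t * of_real (\<eta> t x)
          - of_real \<mu> * U t * of_real (partial_x (partial_x \<eta>) t x) + (\<i> * \<i>) * (of_real (\<mu> * (of_int k)\<^sup>2) * U t * of_real (\<eta> t x))) * expi k x"
        by (simp only: of_real_mult of_real_power of_real_of_int_eq power2_eq_square) (simp only: algebra_simps)
      also have "\<dots> = Q t x" by (simp add: Q_def)
      finally show "(B has_vector_derivative Q t x) (at x within {0..2*pi})" .
    qed simp
    moreover have "B (2 * pi) = B 0"
      using per[of t 0] partial_x_periodic[of \<eta> t 0, OF per D(8)] expi_periodic[of k 0] by (simp add: B_def)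
    ultimately show "((\<lambda>x. Q t x) has_integral 0) {0..2*pi}" by simp
  qed
  have "integral R (\<lambda>(t, x). P t x) = integral {a..b} (\<lambda>t. integral {0..2*pi} (P t))"
    using integral_prod_continuous[of a 0 b "2 * pi" "\<lambda>(t, x). P t x"] cP by (simp add: R_def)
  also have "\<dots> = integral {0..2*pi} (\<lambda>x. integral {a..b} (\<lambda>t. P t x))"
    using integral_swap_continuous[of a 0 b "2 * pi" P] cP by (simp add: R_def)
  finally have IP: "integral R (\<lambda>(t, x). P t x) = 0" by (simp add: Pt)
  have "integral R (\<lambda>(t, x). Q t x) = integral {a..b} (\<lambda>t. integral {0..2*pi} (Q t))"
    using integral_prod_continuous[of a 0 b "2 * pi" "\<lambda>(t, x). Q t x"] cQ by (simp add: R_def)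
  then have IQ: "integral R (\<lambda>(t, x). Q t x) = 0" by (simp add: Qx)
  have "((\<lambda>(t, x). P t x) has_integral 0) R" "((\<lambda>(t, x). Q t x) has_integral 0) R"
    using integrable_integral[OF integrable_continuous[OF cP[unfolded R_def]]] IP
      integrable_integral[OF integrable_continuous[OF cQ[unfolded R_def]]] IQ by (simp_all add: R_def)
  from has_integral_add[OF this]
  have "((\<lambda>p. (case p of (t, x) \<Rightarrow> P t x) + (case p of (t, x) \<Rightarrow> Q t x)) has_integral 0) R" by simp
  then show ?thesis
    unfolding R_def[symmetric]
  proof (rule has_integral_eq[rotated])
    fix p assume "p \<in> R"
    then obtain t x where p: "p = (t, x)" "t \<in> {a..b}" by (auto simp: R)
    show "(case p of (t, x) \<Rightarrow> P t x) + (case p of (t, x) \<Rightarrow> Q t x) = (case p of (t, x) \<Rightarrow>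
       (U t * of_real (partial_t (partial_t \<eta>) t x) - of_real \<mu> * U t * of_real (partial_x (partial_x \<eta>) t x) + F t * of_real (partial_x \<eta> t x)) * expi k x)"
      unfolding p(1) prod.case P_def Q_def g[OF p(2)] by (simp only: algebra_simps) simp
  qed
qed

text \<open>
  The identities of the single modes are summed symmetrically. The partial sums of the integrand are
  dominated because the coefficients of \<open>\<phi>\<close> and of its flux are bounded in \<open>l\<^sup>1\<close> on compact time intervals.
\<close>

lemma modes_imp_distributional:
  assumes I: "I = time_interval T"
    and \<phi>: "\<phi> \<in> C0_sobolev I 3" and zm: "\<forall>t\<in>I. zero_mean (\<phi> t)"
    and U: "\<And>t k. t \<in> I \<Longrightarrow> ((\<lambda>t. fourier_coeff (\<phi> t) k) has_vector_derivative v t k) (at t within I)"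
    and V: "\<And>t k. t \<in> I \<Longrightarrow> ((\<lambda>t. v t k) has_vector_derivative
      - of_real (\<mu> * (of_int k)\<^sup>2) * fourier_coeff (\<phi> t) k + of_int \<bar>k\<bar> * bilin (fourier_coeff (\<phi> t)) k) (at t within I)"
  shows "distributional_solution \<mu> I \<phi>"
  unfolding distributional_solution_def
proof (intro allI impI)
  fix \<eta> assume "test_function I \<eta>"
  then obtain a0 b0 where sm: "smooth2 \<eta>" and per: "\<And>t x. \<eta> t (x + 2 * pi) = \<eta> t x" and a0: "0 < a0" and sub0: "{a0..b0} \<subseteq> I"
    and z: "\<And>t x. t \<notin> {a0..b0} \<Longrightarrow> \<eta> t x = 0" unfolding test_function_def by blast
  define f where "f t x = \<phi> t x * partial_t (partial_t \<eta>) t x - \<mu> * \<phi> t x * partial_x (partial_x \<eta>) t x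
      + flux (\<phi> t) x * partial_x \<eta> t x" for t x
  have zt: "partial_t \<eta> t x = 0" if "t \<notin> {a0..b0}" for t x
    by (rule partial_zero_outside(1)[OF z that])
  have zx: "partial_x \<eta> t x = 0" if "t \<notin> {a0..b0}" for t x
    by (rule partial_zero_outside(2)[OF z that])
  have ztt: "partial_t (partial_t \<eta>) t x = 0" if "t \<notin> {a0..b0}" for t x
    by (rule partial_zero_outside(1)[OF zt that])
  have zxx: "partial_x (partial_x \<eta>) t x = 0" if "t \<notin> {a0..b0}" for t x
    by (rule partial_zero_outside(2)[OF zx that])
  have fz: "f t x = 0" if "t \<notin> {a0..b0}" for t x by (simp add: f_def ztt[OF that] zx[OF that] zxx[OF that])
  show "(LINT (t, x):I \<times> {0..2*pi}|lborel. \<phi> t x * partial_t (partial_t \<eta>) t x - \<mu> * \<phi> t x * partial_x (partial_x \<eta>) t x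
      + flux (\<phi> t) x * partial_x \<eta> t x) = 0"
    unfolding f_def[symmetric]
  proof (cases "a0 \<le> b0")
    case False
    then have "f t x = 0" for t x by (intro fz) auto
    then show "(LINT (t, x):I \<times> {0..2*pi}|lborel. f t x) = 0" by (simp add: set_lebesgue_integral_def case_prod_unfold)
  next
    case True
    then have "b0 \<in> time_interval T" using sub0 I by auto
    then obtain b where b: "b0 < b" "b \<in> time_interval T" by (rule time_interval_larger)
    \<comment> \<open>The time interval is enlarged on both sides, so that \<open>\<eta>\<close> and its time derivative vanish at its ends.\<close>
    define a where "a = a0 / 2"
    have ab: "0 < a" "a < a0" "a \<le> b" using a0 True b by (auto simp: a_def)
    have sub: "{a..b} \<subseteq> I" using time_interval_Icc[OF b(2)] ab I by auto
    note facts = C0_sobolev_fourier[OF \<phi> zm] and cp = continuous_on_pair_C0_sobolev[OF \<phi> zm]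
    define R where "R = cbox (a, 0::real) (b, 2 * pi)"
    have R: "R = {a..b} \<times> {0..2*pi}" by (simp add: R_def cbox_Pair_eq)
    have cpR: "continuous_on R (\<lambda>p. \<phi> (fst p) (snd p))" "continuous_on R (\<lambda>p. flux (\<phi> (fst p)) (snd p))"
      using cp sub by (auto simp: R case_prod_unfold intro: continuous_on_subset)
    note D = smooth2D[OF sm]
    have DR: "continuous_on R (\<lambda>p. partial_t (partial_t \<eta>) (fst p) (snd p))"
      "continuous_on R (\<lambda>p. partial_x \<eta> (fst p) (snd p))"
      "continuous_on R (\<lambda>p. partial_x (partial_x \<eta>) (fst p) (snd p))"
      using D(3,4,5) by (auto intro: continuous_on_subset)
    have cf: "continuous_on R (\<lambda>(t, x). f t x)"
      unfolding f_def case_prod_unfold by (intro continuous_intros cpR DR)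
    have lint: "(LINT (t, x):I \<times> {0..2*pi}|lborel. f t x) = integral R (\<lambda>(t, x). f t x)"
      unfolding R_def by (rule lint_eq_box_integral[OF sub cf[unfolded R]]) (use fz ab b in auto)
    define h where "h k t x = (fourier_coeff (\<phi> t) k * of_real (partial_t (partial_t \<eta>) t x)
       - of_real \<mu> * fourier_coeff (\<phi> t) k * of_real (partial_x (partial_x \<eta>) t x)
       + flux_coeff (fourier_coeff (\<phi> t)) k * of_real (partial_x \<eta> t x)) * expi k x" for k t x
    have h: "((\<lambda>(t, x). h k t x) has_integral 0) R" for k
      unfolding h_def R_def
    proof (rule mode_weak_identity[OF ab(3) sm per])
      show "((\<lambda>t. fourier_coeff (\<phi> t) k) has_vector_derivative v t k) (at t within {a..b})" if "t \<in> {a..b}" for t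
        using U[of t k] that sub by (blast intro: has_vector_derivative_within_subset)
      show "((\<lambda>t. v t k) has_vector_derivative
        - of_real (\<mu> * (of_int k)\<^sup>2) * fourier_coeff (\<phi> t) k + of_int \<bar>k\<bar> * bilin (fourier_coeff (\<phi> t)) k) (at t within {a..b})" if "t \<in> {a..b}" for t
        using V[of t k] that sub by (blast intro: has_vector_derivative_within_subset)
      show "continuous_on {a..b} (\<lambda>t. flux_coeff (fourier_coeff (\<phi> t)) k)"
        using l1_cont_mode[OF facts(3)] sub by (rule continuous_on_subset)
      show "- of_real (\<mu> * (of_int k)\<^sup>2) * fourier_coeff (\<phi> t) k + of_int \<bar>k\<bar> * bilin (fourier_coeff (\<phi> t)) k
        = - of_real (\<mu> * (of_int k)\<^sup>2) * fourier_coeff (\<phi> t) k + \<i> * of_int k * flux_coeff (fourier_coeff (\<phi> t)) k" for t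
        by (simp only: flux_coeff_deriv)
      show "\<eta> a x = 0" "\<eta> b x = 0" "partial_t \<eta> a x = 0" "partial_t \<eta> b x = 0" for x
        using z zt ab b by auto
    qed
    define fn where "fn n p = Re (\<Sum>k\<in>{- int n..int n}. h k (fst p) (snd p))" for n p
    have fn: "(fn n has_integral 0) R" for n
    proof -
      have "((\<lambda>p. \<Sum>k\<in>{- int n..int n}. (case p of (t, x) \<Rightarrow> h k t x)) has_integral (\<Sum>k\<in>{- int n..int n}. 0)) R"
        by (intro has_integral_sum h) auto
      from has_integral_linear[OF this bounded_linear_Re] show ?thesis
        by (simp add: fn_def[abs_def] o_def case_prod_unfold)
    qed
    obtain A where A: "\<And>t. t \<in> {a..b} \<Longrightarrow> sums_below (\<lambda>k. cmod (fourier_coeff (\<phi> t) k)) A"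
      using l1_cont_bounded[OF facts(1) sub] by blast
    obtain A' where A': "\<And>t. t \<in> {a..b} \<Longrightarrow> sums_below (\<lambda>k. cmod (flux_coeff (fourier_coeff (\<phi> t)) k)) A'"
      using l1_cont_bounded[OF facts(3) sub] by blast
    have A0: "0 \<le> A" "0 \<le> A'" using sums_below_nonneg[OF A[of a]] sums_below_nonneg[OF A'[of a]] ab by auto
    \<comment> \<open>A continuous dominating function, from the \<open>l\<^sup>1\<close> bounds of the coefficients.\<close>
    define C where "C p = A * \<bar>partial_t (partial_t \<eta>) (fst p) (snd p)\<bar> + \<bar>\<mu>\<bar> * A * \<bar>partial_x (partial_x \<eta>) (fst p) (snd p)\<bar>
      + A' * \<bar>partial_x \<eta> (fst p) (snd p)\<bar>" for p
    have split: "fn n (t, x) = Re (\<Sum>k\<in>{- int n..int n}. fourier_coeff (\<phi> t) k * expi k x) * partial_t (partial_t \<eta>) t x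
       - \<mu> * Re (\<Sum>k\<in>{- int n..int n}. fourier_coeff (\<phi> t) k * expi k x) * partial_x (partial_x \<eta>) t x
       + Re (\<Sum>k\<in>{- int n..int n}. flux_coeff (fourier_coeff (\<phi> t)) k * expi k x) * partial_x \<eta> t x" for n t x
    proof -
      have "(\<Sum>k\<in>{- int n..int n}. h k t x) = (\<Sum>k\<in>{- int n..int n}. fourier_coeff (\<phi> t) k * expi k x) * of_real (partial_t (partial_t \<eta>) t x)
       - of_real \<mu> * (\<Sum>k\<in>{- int n..int n}. fourier_coeff (\<phi> t) k * expi k x) * of_real (partial_x (partial_x \<eta>) t x)
       + (\<Sum>k\<in>{- int n..int n}. flux_coeff (fourier_coeff (\<phi> t)) k * expi k x) * of_real (partial_x \<eta> t x)"
        unfolding h_def sum_distrib_left sum_distrib_right sum_subtractf[symmetric] sum.distrib[symmetric]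
        by (intro sum.cong refl) (simp only: algebra_simps)
      then show ?thesis by (simp add: fn_def)
    qed
    have partial_le: "\<bar>Re (\<Sum>k\<in>{- int n..int n}. c k * expi k x)\<bar> \<le> B" if "sums_below (\<lambda>k. cmod (c k)) B" for c B n x
    proof -
      have "\<bar>Re (\<Sum>k\<in>{- int n..int n}. c k * expi k x)\<bar> \<le> (\<Sum>k\<in>{- int n..int n}. cmod (c k * expi k x))"
        by (rule order_trans[OF abs_Re_le_cmod norm_sum])
      also have "\<dots> \<le> B" using sums_belowD[OF that, of "{- int n..int n}"] by (simp add: norm_mult)
      finally show ?thesis .
    qed
    have "(\<lambda>n. integral R (fn n)) \<longlonglongrightarrow> integral R (\<lambda>(t, x). f t x)"
    proof (rule dominated_convergence(2))
      show "fn n integrable_on R" for n using fn by blast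
      show "C integrable_on R"
        unfolding C_def[abs_def] R_def by (intro integrable_continuous continuous_intros DR[unfolded R_def])
      show "norm (fn n p) \<le> C p" if pR: "p \<in> R" for n p
      proof -
        obtain t x where p: "p = (t, x)" "t \<in> {a..b}" using pR by (auto simp: R)
        have "norm (fn n p) \<le> \<bar>Re (\<Sum>k\<in>{- int n..int n}. fourier_coeff (\<phi> t) k * expi k x) * partial_t (partial_t \<eta>) t x\<bar>
         + \<bar>\<mu> * Re (\<Sum>k\<in>{- int n..int n}. fourier_coeff (\<phi> t) k * expi k x) * partial_x (partial_x \<eta>) t x\<bar>
         + \<bar>Re (\<Sum>k\<in>{- int n..int n}. flux_coeff (fourier_coeff (\<phi> t)) k * expi k x) * partial_x \<eta> t x\<bar>"
          unfolding p split real_norm_def by linarith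
        also have "\<dots> \<le> C p"
          unfolding C_def p abs_mult fst_conv snd_conv
          by (intro add_mono mult_right_mono mult_left_mono partial_le A A' p) auto
        finally show ?thesis .
      qed
      show "(\<lambda>n. fn n p) \<longlonglongrightarrow> (case p of (t, x) \<Rightarrow> f t x)" if pR: "p \<in> R" for p
      proof -
        obtain t x where p: "p = (t, x)" "t \<in> {a..b}" using pR by (auto simp: R)
        then have tI: "t \<in> I" using sub by blast
        have lim: "(\<lambda>n. Re (\<Sum>k\<in>{- int n..int n}. c k * expi k x)) \<longlonglongrightarrow> synth c x" if "(\<lambda>k. cmod (c k)) summable_on UNIV" for c
          unfolding synth_def by (intro tendsto_Re tendsto_uniform_limitI[OF uniform_limit_synth[OF that]]) simp
        have "f t x = synth (fourier_coeff (\<phi> t)) x * partial_t (partial_t \<eta>) t x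
          - \<mu> * synth (fourier_coeff (\<phi> t)) x * partial_x (partial_x \<eta>) t x
          + synth (flux_coeff (fourier_coeff (\<phi> t))) x * partial_x \<eta> t x"
          using facts(4)[OF tI] facts(5)[OF tI] by (simp add: f_def)
        then show ?thesis unfolding p prod.case split
          by (simp only:) (intro tendsto_intros lim l1_cont_summable[OF facts(1) tI] l1_cont_summable[OF facts(3) tI])
      qed
    qed
    moreover have "integral R (fn n) = 0" for n using fn by (rule integral_unique)
    ultimately have "(\<lambda>n::nat. 0) \<longlonglongrightarrow> integral R (\<lambda>(t, x). f t x)" by simp
    then have "integral R (\<lambda>(t, x). f t x) = 0" by (simp add: LIMSEQ_const_iff)
    then show "(LINT (t, x):I \<times> {0..2*pi}|lborel. f t x) = 0" using lint by simp
  qed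
qed

section \<open>Uniqueness\<close>

lemma C0_sobolev_cong:
  assumes "\<And>t. t \<in> I \<Longrightarrow> \<phi> t = \<psi> t"
  shows "\<phi> \<in> C0_sobolev I s \<longleftrightarrow> \<psi> \<in> C0_sobolev I s"
proof -
  have "\<forall>\<^sub>F \<tau> in at t within I. sobolev_norm s (\<lambda>x. \<phi> \<tau> x - \<phi> t x) = sobolev_norm s (\<lambda>x. \<psi> \<tau> x - \<psi> t x)" if "t \<in> I" for t
    unfolding eventually_at_filter by (rule always_eventually) (simp add: assms that)
  then have "((\<lambda>\<tau>. sobolev_norm s (\<lambda>x. \<phi> \<tau> x - \<phi> t x)) \<longlongrightarrow> 0) (at t within I) \<longleftrightarrow>
      ((\<lambda>\<tau>. sobolev_norm s (\<lambda>x. \<psi> \<tau> x - \<psi> t x)) \<longlongrightarrow> 0) (at t within I)" if "t \<in> I" for t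
    using that by (intro tendsto_cong)
  then show ?thesis unfolding C0_sobolev_def using assms by auto
qed

lemma time_deriv_cong:
  assumes "\<And>t. t \<in> I \<Longrightarrow> \<phi> t = \<psi> t" and t: "t \<in> I"
  shows "time_deriv I \<phi> t = time_deriv I \<psi> t"
proof -
  have "((\<lambda>\<tau>. \<phi> \<tau> x) has_vector_derivative d) (at t within I) \<longleftrightarrow> ((\<lambda>\<tau>. \<psi> \<tau> x) has_vector_derivative d) (at t within I)" for x d
    using has_vector_derivative_transform[OF t, of "\<lambda>\<tau>. \<phi> \<tau> x" "\<lambda>\<tau>. \<psi> \<tau> x"]
      has_vector_derivative_transform[OF t, of "\<lambda>\<tau>. \<psi> \<tau> x" "\<lambda>\<tau>. \<phi> \<tau> x"] assms(1) by metis
  then show ?thesis unfolding time_deriv_def vector_derivative_def by presburger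
qed

lemma C1_sobolev_cong:
  assumes eq: "\<And>t. t \<in> I \<Longrightarrow> \<phi> t = \<psi> t"
  shows "\<phi> \<in> C1_sobolev I s \<longleftrightarrow> \<psi> \<in> C1_sobolev I s"
proof -
  note td = time_deriv_cong[where I = I and \<phi> = \<phi> and \<psi> = \<psi>, OF eq]
  have "\<forall>\<^sub>F \<tau> in at t within I. sobolev_norm s (\<lambda>x. (\<phi> \<tau> x - \<phi> t x) / (\<tau> - t) - time_deriv I \<phi> t x)
     = sobolev_norm s (\<lambda>x. (\<psi> \<tau> x - \<psi> t x) / (\<tau> - t) - time_deriv I \<psi> t x)" if "t \<in> I" for t
    unfolding eventually_at_filter by (rule always_eventually) (simp add: eq td that)
  then have "((\<lambda>\<tau>. sobolev_norm s (\<lambda>x. (\<phi> \<tau> x - \<phi> t x) / (\<tau> - t) - time_deriv I \<phi> t x)) \<longlongrightarrow> 0) (at t within I) \<longleftrightarrow>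
      ((\<lambda>\<tau>. sobolev_norm s (\<lambda>x. (\<psi> \<tau> x - \<psi> t x) / (\<tau> - t) - time_deriv I \<psi> t x)) \<longlongrightarrow> 0) (at t within I)" if "t \<in> I" for t
    using that by (intro tendsto_cong)
  moreover have "\<phi> \<in> C0_sobolev I s \<longleftrightarrow> \<psi> \<in> C0_sobolev I s" by (rule C0_sobolev_cong) (rule eq)
  moreover have "time_deriv I \<phi> \<in> C0_sobolev I s \<longleftrightarrow> time_deriv I \<psi> \<in> C0_sobolev I s" by (rule C0_sobolev_cong) (rule td)
  ultimately show ?thesis unfolding C1_sobolev_def by blast
qed

lemma cauchy_solution_modes:
  assumes I: "I = time_interval T" and sol: "cauchy_solution \<mu> I \<phi>0 \<phi>1 \<phi>" and t: "t \<in> I"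
  shows "modes_upto \<mu> N {0..t} (\<lambda>\<tau>. fourier_coeff (\<phi> \<tau>)) (\<lambda>\<tau>. fourier_coeff (time_deriv I \<phi> \<tau>))"
    and "\<exists>M. \<forall>\<tau>\<in>{0..t}. sums_below (en (\<lambda>k. sq k) (fourier_coeff (\<phi> \<tau>)) (fourier_coeff (time_deriv I \<phi> \<tau>))) M"
proof -
  have \<phi>: "\<phi> \<in> C0_sobolev I 3" "\<phi> \<in> C1_sobolev I 2" "distributional_solution \<mu> I \<phi>" "\<forall>t\<in>I. zero_mean (\<phi> t)"
    using sol unfolding cauchy_solution_def by blast+
  have sub: "{0..t} \<subseteq> I" using time_interval_Icc t I by blast
  show "modes_upto \<mu> N {0..t} (\<lambda>\<tau>. fourier_coeff (\<phi> \<tau>)) (\<lambda>\<tau>. fourier_coeff (time_deriv I \<phi> \<tau>))"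
    unfolding modes_upto_def
  proof (intro ballI conjI allI impI)
    fix \<tau> k assume "\<tau> \<in> {0..t}"
    then have \<tau>: "\<tau> \<in> I" using sub by blast
    show "fourier_coeff (\<phi> \<tau>) (- k) = cnj (fourier_coeff (\<phi> \<tau>) k)" by (simp add: cnj_fourier_coeff)
    show "((\<lambda>t. fourier_coeff (\<phi> t) k) has_vector_derivative fourier_coeff (time_deriv I \<phi> \<tau>) k) (at \<tau> within {0..t})"
      by (rule has_vector_derivative_within_subset[OF C1_sobolev_mode[OF \<phi>(2) _ \<tau>] sub]) simp
    show "((\<lambda>t. fourier_coeff (time_deriv I \<phi> t) k) has_vector_derivative
        - of_real (\<mu> * (of_int k)\<^sup>2) * fourier_coeff (\<phi> \<tau>) k + of_int \<bar>k\<bar> * bilin (fourier_coeff (\<phi> \<tau>)) k) (at \<tau> within {0..t})"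
      by (rule has_vector_derivative_within_subset[OF distributional_imp_modes[OF I \<phi>(1,2,4,3) \<tau>] sub])
  qed
  have td: "time_deriv I \<phi> \<in> C0_sobolev I 2" using \<phi>(2) unfolding C1_sobolev_def by blast
  obtain M where M: "\<And>\<tau>. \<tau> \<in> {0..t} \<Longrightarrow> sums_below (\<lambda>k. japanese k powr (2 * 3) * (cmod (fourier_coeff (\<phi> \<tau>) k))\<^sup>2) M"
    using C0_sobolev_bounded[OF \<phi>(1) sub] by blast
  obtain M' where M': "\<And>\<tau>. \<tau> \<in> {0..t} \<Longrightarrow> sums_below (\<lambda>k. japanese k powr (2 * 2) * (cmod (fourier_coeff (time_deriv I \<phi> \<tau>) k))\<^sup>2) M'"
    using C0_sobolev_bounded[OF td sub] by blast
  have "en (\<lambda>k. sq k) x y k \<le> japanese k powr (2 * 3) * (cmod (x k))\<^sup>2 + japanese k powr (2 * 2) * (cmod (y k))\<^sup>2" for x y k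
  proof -
    have "(of_int k ^ 3 * cmod (x k))\<^sup>2 = of_int \<bar>k\<bar> ^ (2 * 3) * (cmod (x k))\<^sup>2"
      by (simp add: power_mult_distrib flip: power_mult)
    also have "\<dots> \<le> japanese k powr (2 * 3) * (cmod (x k))\<^sup>2"
      using japanese_powr_ge[of k 3] by (intro mult_right_mono) simp_all
    finally have 1: "(of_int k ^ 3 * cmod (x k))\<^sup>2 \<le> japanese k powr (2 * 3) * (cmod (x k))\<^sup>2" .
    have "(of_int k ^ 2 * cmod (y k))\<^sup>2 = of_int \<bar>k\<bar> ^ (2 * 2) * (cmod (y k))\<^sup>2"
      by (simp add: power_mult_distrib flip: power_mult)
    also have "\<dots> \<le> japanese k powr (2 * 2) * (cmod (y k))\<^sup>2"
      using japanese_powr_ge[of k 2] by (intro mult_right_mono) simp_all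
    finally show ?thesis unfolding en_sq using 1 by linarith
  qed
  note le = this
  have "sums_below (en (\<lambda>k. sq k) (fourier_coeff (\<phi> \<tau>)) (fourier_coeff (time_deriv I \<phi> \<tau>))) (M + M')" if "\<tau> \<in> {0..t}" for \<tau>
    by (rule sums_below_mono[OF sums_below_add[OF M[OF that] M'[OF that]]]) (rule le, simp)
  then show "\<exists>M. \<forall>\<tau>\<in>{0..t}. sums_below (en (\<lambda>k. sq k) (fourier_coeff (\<phi> \<tau>)) (fourier_coeff (time_deriv I \<phi> \<tau>))) M"
    by blast
qed

text \<open>
  Both solutions satisfy the mode equations for every \<open>N\<close>, with a bound \<open>M\<close> that does not depend on
  \<open>N\<close>. Smallness is required of one of them only: it is the coefficient of the energy for the
  difference.
\<close>

lemma cauchy_solution_unique: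
  assumes \<mu>: "0 < \<mu>" and I: "I = time_interval T"
    and \<phi>: "cauchy_solution \<mu> I \<phi>0 \<phi>1 \<phi>" and \<psi>: "cauchy_solution \<mu> I \<phi>0 \<phi>1 \<psi>"
    and small: "\<And>t. t \<in> I \<Longrightarrow> sums_below (\<lambda>n. of_int \<bar>n\<bar> * cmod (fourier_coeff (\<phi> t) n)) (\<mu> / 4)"
    and t: "t \<in> I"
  shows "\<psi> t = \<phi> t"
proof -
  have sub: "{0..t} \<subseteq> I" using time_interval_Icc t I by blast
  have t0: "0 \<le> t" using t I by (simp add: time_interval_def)
  obtain M1 where M1: "\<And>\<tau>. \<tau> \<in> {0..t} \<Longrightarrow> sums_below (en (\<lambda>k. sq k) (fourier_coeff (\<phi> \<tau>)) (fourier_coeff (time_deriv I \<phi> \<tau>))) M1"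
    using cauchy_solution_modes(2)[OF I \<phi> t] by blast
  obtain M2 where M2: "\<And>\<tau>. \<tau> \<in> {0..t} \<Longrightarrow> sums_below (en (\<lambda>k. sq k) (fourier_coeff (\<psi> \<tau>)) (fourier_coeff (time_deriv I \<psi> \<tau>))) M2"
    using cauchy_solution_modes(2)[OF I \<psi> t] by blast
  define M where "M = max M1 M2"
  define A where "A = sqrt_zeta * sqrt M"
  define K where "K = 16 / min 1 \<mu> * A * M * t * exp (52 / min 1 \<mu> * A * t)"
  have bound: "(\<Sum>k\<in>{-N..N}. en (\<lambda>_. 1) (\<lambda>k. fourier_coeff (\<phi> t) k - fourier_coeff (\<psi> t) k)
      (\<lambda>k. fourier_coeff (time_deriv I \<phi> t) k - fourier_coeff (time_deriv I \<psi> t) k) k) \<le> K / of_int N" if N: "1 \<le> N" for N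
    unfolding K_def
  proof (rule difference_bound[OF \<mu> N cauchy_solution_modes(1)[OF I \<phi> t] cauchy_solution_modes(1)[OF I \<psi> t]])
    show "sums_below (en (\<lambda>k. sq k) (fourier_coeff (\<phi> \<tau>)) (fourier_coeff (time_deriv I \<phi> \<tau>))) M" if "\<tau> \<in> {0..t}" for \<tau>
      by (rule sums_below_mono[OF M1[OF that]]) (simp_all add: M_def)
    show "sums_below (en (\<lambda>k. sq k) (fourier_coeff (\<psi> \<tau>)) (fourier_coeff (time_deriv I \<psi> \<tau>))) M" if "\<tau> \<in> {0..t}" for \<tau>
      by (rule sums_below_mono[OF M2[OF that]]) (simp_all add: M_def)
    show "sums_below (\<lambda>n. of_int \<bar>n\<bar> * cmod (fourier_coeff (\<phi> \<tau>) n)) (\<mu> / 4)" if "\<tau> \<in> {0..t}" for \<tau>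
      by (rule small) (use that sub in blast)
    show "fourier_coeff (\<phi> 0) k = fourier_coeff (\<psi> 0) k \<and>
      fourier_coeff (time_deriv I \<phi> 0) k = fourier_coeff (time_deriv I \<psi> 0) k" for k
      using \<phi> \<psi> by (simp add: cauchy_solution_def)
    show "t \<in> {0..t}" using t0 by simp
    show "A = sqrt_zeta * sqrt M" by (rule A_def)
  qed
  have eq: "fourier_coeff (\<psi> t) k = fourier_coeff (\<phi> t) k" for k
  proof (cases "k = 0")
    case True
    have "zero_mean (\<phi> t)" "zero_mean (\<psi> t)" using \<phi> \<psi> t by (auto simp: cauchy_solution_def)
    then show ?thesis using True by (simp add: zero_mean_iff)
  next
    case False
    define d where "d = (of_int k * cmod (fourier_coeff (\<phi> t) k - fourier_coeff (\<psi> t) k))\<^sup>2"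
    have "d \<le> K / real n" if n: "nat \<bar>k\<bar> \<le> n" for n
    proof -
      have n1: "1 \<le> int n" "\<bar>k\<bar> \<le> int n" using n False by linarith+
      have "d \<le> en (\<lambda>_. 1) (\<lambda>k. fourier_coeff (\<phi> t) k - fourier_coeff (\<psi> t) k)
        (\<lambda>k. fourier_coeff (time_deriv I \<phi> t) k - fourier_coeff (time_deriv I \<psi> t) k) k"
        by (simp add: d_def en_def)
      also have "\<dots> \<le> (\<Sum>k\<in>{-int n..int n}. en (\<lambda>_. 1) (\<lambda>k. fourier_coeff (\<phi> t) k - fourier_coeff (\<psi> t) k)
        (\<lambda>k. fourier_coeff (time_deriv I \<phi> t) k - fourier_coeff (time_deriv I \<psi> t) k) k)"
        using n1 by (intro member_le_sum) (auto simp: en_nonneg)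
      also have "\<dots> \<le> K / real n" using bound[OF n1(1)] by simp
      finally show ?thesis .
    qed
    moreover have "(\<lambda>n. K / real n) \<longlonglongrightarrow> 0" by (rule lim_const_over_n)
    ultimately have "d \<le> 0" by (intro LIMSEQ_le_const) auto
    then have "d = 0" by (simp add: d_def)
    then show ?thesis using False by (simp add: d_def)
  qed
  have sob: "\<phi> t \<in> sobolev 3" "\<psi> t \<in> sobolev 3" using \<phi> \<psi> t by (auto simp: cauchy_solution_def C0_sobolev_def)
  have "\<psi> t = synth (fourier_coeff (\<psi> t))" by (rule synth_fourier_coeff[symmetric, OF sob(2)]) simp
  also have "fourier_coeff (\<psi> t) = fourier_coeff (\<phi> t)" using eq by blast
  also have "synth \<dots> = \<phi> t" by (rule synth_fourier_coeff[OF sob(1)]) simp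
  finally show ?thesis .
qed

section \<open>Sobolev continuity from uniform tails\<close>

lemma sums_below_except:
  assumes "finite S" "\<And>k. 0 \<le> f k" and e: "sums_below (\<lambda>k. if k \<in> S then 0 else f k) e"
  shows "sums_below f (sum f S + e)"
  unfolding sums_below_def
proof (intro allI impI)
  fix G :: "'a set" assume G: "finite G"
  have "sum f G = sum f (G \<inter> S) + sum f (G - S)" using G by (rule sum.Int_Diff)
  also have "sum f (G - S) = sum (\<lambda>k. if k \<in> S then 0 else f k) (G - S)" by (intro sum.cong) auto
  also have "sum f (G \<inter> S) + \<dots> \<le> sum f S + e"
    using G assms by (intro add_mono sum_mono2 sums_belowD[OF e]) auto
  finally show "sum f G \<le> sum f S + e" .
qed

lemma infsum_tendsto_zero:
  fixes f :: "'t \<Rightarrow> 'a \<Rightarrow> real"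
  assumes nonneg: "\<And>\<tau> k. 0 \<le> f \<tau> k" and lim: "\<And>k. ((\<lambda>\<tau>. f \<tau> k) \<longlongrightarrow> 0) F"
    and tail: "\<And>e. 0 < e \<Longrightarrow> \<exists>S. finite S \<and> (\<forall>\<^sub>F \<tau> in F. sums_below (\<lambda>k. if k \<in> S then 0 else f \<tau> k) e)"
  shows "((\<lambda>\<tau>. infsum (f \<tau>) UNIV) \<longlongrightarrow> 0) F"
proof (rule tendstoI)
  fix e :: real assume e: "0 < e"
  then obtain S where S: "finite S" "\<forall>\<^sub>F \<tau> in F. sums_below (\<lambda>k. if k \<in> S then 0 else f \<tau> k) (e / 2)"
    using tail[of "e / 2"] by auto
  have "((\<lambda>\<tau>. \<Sum>k\<in>S. f \<tau> k) \<longlongrightarrow> (\<Sum>k\<in>S. 0)) F" by (intro tendsto_sum lim)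
  then have "((\<lambda>\<tau>. \<Sum>k\<in>S. f \<tau> k) \<longlongrightarrow> 0) F" by simp
  then have "\<forall>\<^sub>F \<tau> in F. (\<Sum>k\<in>S. f \<tau> k) < e / 2" using e by (intro order_tendstoD(2)) auto
  with S(2) show "\<forall>\<^sub>F \<tau> in F. dist (infsum (f \<tau>) UNIV) 0 < e"
  proof eventually_elim
    case (elim \<tau>)
    have "infsum (f \<tau>) UNIV \<le> (\<Sum>k\<in>S. f \<tau> k) + e / 2"
      by (rule sums_below_imp_summable(2)[OF sums_below_except[OF S(1) nonneg elim(1)] nonneg])
    moreover have "0 \<le> infsum (f \<tau>) UNIV" by (rule infsum_nonneg) (rule nonneg)
    ultimately show ?case using elim(2) by simp
  qed
qed

definition uniform_tails :: "real set \<Rightarrow> (int \<Rightarrow> real) \<Rightarrow> (real \<Rightarrow> int \<Rightarrow> complex) \<Rightarrow> bool" where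
  "uniform_tails I w c \<longleftrightarrow> (\<forall>e>0. \<exists>S. finite S \<and> (\<forall>t\<in>I. sums_below (\<lambda>k. if k \<in> S then 0 else w k * (cmod (c t k))\<^sup>2) e))"

lemma uniform_tailsD:
  assumes "uniform_tails I w c" "0 < e"
  shows "\<exists>S. finite S \<and> (\<forall>t\<in>I. sums_below (\<lambda>k. if k \<in> S then 0 else w k * (cmod (c t k))\<^sup>2) e)"
  using assms unfolding uniform_tails_def by simp

lemma uniform_tails_summable:
  assumes "uniform_tails I w c" "t \<in> I" and w: "\<And>k. 0 \<le> w k"
  shows "(\<lambda>k. w k * (cmod (c t k))\<^sup>2) summable_on UNIV"
proof -
  obtain S where S: "finite S \<and> (\<forall>t\<in>I. sums_below (\<lambda>k. if k \<in> S then 0 else w k * (cmod (c t k))\<^sup>2) 1)"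
    using uniform_tailsD[OF assms(1) zero_less_one] ..
  note S = conjunct1[OF S] bspec[OF conjunct2[OF S]]
  show ?thesis by (rule sums_below_imp_summable(1)[OF sums_below_except[OF S(1) _ S(2)[OF assms(2)]]]) (simp_all add: w)
qed

text \<open>
  Uniform tails reduce continuity in \<open>H\<^sup>s\<close> to continuity of finitely many modes.
\<close>

lemma C0_sobolev_synth:
  assumes s: "1/2 < s" and tails: "uniform_tails I (\<lambda>k. japanese k powr (2 * s)) c"
    and herm: "\<forall>t\<in>I. hermitian (c t)" and cont: "\<And>k. continuous_on I (\<lambda>t. c t k)"
  shows "(\<lambda>t. synth (c t)) \<in> C0_sobolev I s"
    and "\<And>t. t \<in> I \<Longrightarrow> synth (c t) \<in> sobolev s" "\<And>t. t \<in> I \<Longrightarrow> fourier_coeff (synth (c t)) = c t"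
proof -
  have sob: "synth (c t) \<in> sobolev s" and fc: "fourier_coeff (synth (c t)) = c t" if "t \<in> I" for t
    using synth_in_sobolev[OF uniform_tails_summable[OF tails that] bspec[OF herm that] s] by simp_all
  show "\<And>t. t \<in> I \<Longrightarrow> synth (c t) \<in> sobolev s" "\<And>t. t \<in> I \<Longrightarrow> fourier_coeff (synth (c t)) = c t" by fact+
  show "(\<lambda>t. synth (c t)) \<in> C0_sobolev I s"
    unfolding C0_sobolev_def mem_Collect_eq
  proof (intro ballI conjI)
    fix t assume t: "t \<in> I"
    show "synth (c t) \<in> sobolev s" by (rule sob[OF t])
    define f where "f \<tau> k = japanese k powr (2 * s) * (cmod (c \<tau> k - c t k))\<^sup>2" for \<tau> k
    have "((\<lambda>\<tau>. infsum (f \<tau>) UNIV) \<longlongrightarrow> 0) (at t within I)"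
    proof (rule infsum_tendsto_zero)
      show "0 \<le> f \<tau> k" for \<tau> k by (simp add: f_def)
      show "((\<lambda>\<tau>. f \<tau> k) \<longlongrightarrow> 0) (at t within I)" for k
      proof -
        have "((\<lambda>\<tau>. c \<tau> k) \<longlongrightarrow> c t k) (at t within I)" using cont[of k] t by (simp add: continuous_on)
        then have "((\<lambda>\<tau>. f \<tau> k) \<longlongrightarrow> japanese k powr (2 * s) * (cmod (c t k - c t k))\<^sup>2) (at t within I)"
          unfolding f_def by (intro tendsto_intros)
        then show ?thesis by simp
      qed
      fix e :: real assume "0 < e"
    then have e4: "0 < e / 4" by simp
      obtain S where S: "finite S \<and> (\<forall>t\<in>I. sums_below (\<lambda>k. if k \<in> S then 0 else japanese k powr (2 * s) * (cmod (c t k))\<^sup>2) (e / 4))"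
        using uniform_tailsD[OF tails e4] ..
      note S = conjunct1[OF S] bspec[OF conjunct2[OF S]]
      have "sums_below (\<lambda>k. if k \<in> S then 0 else f \<tau> k) e" if \<tau>: "\<tau> \<in> I" for \<tau>
      proof (rule sums_below_mono[OF sums_below_cmult[OF sums_below_add[OF S(2)[OF \<tau>] S(2)[OF t]], of 2]])
        show "(if k \<in> S then 0 else f \<tau> k) \<le> 2 * ((if k \<in> S then 0 else japanese k powr (2 * s) * (cmod (c \<tau> k))\<^sup>2)
          + (if k \<in> S then 0 else japanese k powr (2 * s) * (cmod (c t k))\<^sup>2))" for k
          using mult_left_mono[OF cmod_diff_power2_le[of "c \<tau> k" "c t k"], of "japanese k powr (2 * s)"]
          by (simp add: f_def algebra_simps)
      qed auto
      then show "\<exists>S. finite S \<and> (\<forall>\<^sub>F \<tau> in at t within I. sums_below (\<lambda>k. if k \<in> S then 0 else f \<tau> k) e)"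
        using S(1) by (intro exI[of _ S]) (simp add: eventually_at_filter)
    qed
    then have "((\<lambda>\<tau>. sqrt (2 * pi * infsum (f \<tau>) UNIV)) \<longlongrightarrow> sqrt (2 * pi * 0)) (at t within I)" by (intro tendsto_intros)
    moreover have "\<forall>\<^sub>F \<tau> in at t within I. sobolev_norm s (\<lambda>x. synth (c \<tau>) x - synth (c t) x) = sqrt (2 * pi * infsum (f \<tau>) UNIV)"
      unfolding eventually_at_filter
      by (rule always_eventually) (simp add: sobolev_norm_def f_def[abs_def] sobolev_diff(2)[OF sob sob] t fc)
    ultimately show "((\<lambda>\<tau>. sobolev_norm s (\<lambda>x. synth (c \<tau>) x - synth (c t) x)) \<longlongrightarrow> 0) (at t within I)"
      by (simp add: tendsto_cong)
  qed
qed

text \<open>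
  Testing against the quotient itself reduces the mean value inequality in a weighted
  \<open>l\<^sup>2\<close>-norm to the mean value theorem for a real function.
\<close>

lemma quotient_weighted_sum_le:
  assumes u: "\<And>\<tau> k. \<tau> \<in> {a..b} \<Longrightarrow> ((\<lambda>t. u t k) has_vector_derivative v \<tau> k) (at \<tau> within {a..b})"
    and ab: "a < b" and w: "\<And>k. 0 \<le> w k"
    and e: "\<And>\<tau>. \<tau> \<in> {a..b} \<Longrightarrow> (\<Sum>k\<in>F. w k * (cmod (v \<tau> k))\<^sup>2) \<le> e"
  shows "(\<Sum>k\<in>F. w k * (cmod (of_real (1 / (b - a)) * (u b k - u a k)))\<^sup>2) \<le> e"
proof -
  define q where "q k = of_real (1 / (b - a)) * (u b k - u a k)" for k
  define g where "g \<tau> = (\<Sum>k\<in>F. w k * Re (cnj (q k) * u \<tau> k))" for \<tau>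
  have g: "(g has_vector_derivative (\<Sum>k\<in>F. w k * Re (cnj (q k) * v \<tau> k))) (at \<tau> within {a..b})" if "\<tau> \<in> {a..b}" for \<tau>
    unfolding g_def
    by (intro has_vector_derivative_sum has_vector_derivative_mult_right
        bounded_linear.has_vector_derivative[OF bounded_linear_Re] has_vector_derivative_mult_right u that)
  have "\<exists>\<xi>\<in>{a..b}. g b - g a = (b - a) *\<^sub>R (\<Sum>k\<in>F. w k * Re (cnj (q k) * v \<xi> k))"
    using ab g unfolding has_vector_derivative_def by (intro mvt_very_simple) auto
  then obtain \<xi> where \<xi>: "\<xi> \<in> {a..b}" "g b - g a = (b - a) * (\<Sum>k\<in>F. w k * Re (cnj (q k) * v \<xi> k))" by auto
  have "g b - g a = (\<Sum>k\<in>F. w k * Re (cnj (q k) * (u b k - u a k)))"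
    by (simp add: g_def algebra_simps flip: sum_subtractf)
  also have "\<dots> = (\<Sum>k\<in>F. (b - a) * (w k * (cmod (q k))\<^sup>2))"
  proof (rule sum.cong[OF refl])
    fix k
    have "u b k - u a k = of_real (b - a) * q k" using ab by (simp add: q_def)
    then have "cnj (q k) * (u b k - u a k) = of_real (b - a) * (q k * cnj (q k))" by (simp only: ac_simps)
    also have "\<dots> = of_real ((b - a) * (cmod (q k))\<^sup>2)" by (simp only: complex_norm_square[symmetric] of_real_mult)
    finally show "w k * Re (cnj (q k) * (u b k - u a k)) = (b - a) * (w k * (cmod (q k))\<^sup>2)"
      by (simp only: Re_complex_of_real) simp
  qed
  finally have "(b - a) * (\<Sum>k\<in>F. w k * (cmod (q k))\<^sup>2) = (b - a) * (\<Sum>k\<in>F. w k * Re (cnj (q k) * v \<xi> k))"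
    using \<xi>(2) by (simp only: sum_distrib_left)
  then have "(\<Sum>k\<in>F. w k * (cmod (q k))\<^sup>2) = (\<Sum>k\<in>F. w k * Re (cnj (q k) * v \<xi> k))" using ab by simp
  also have "\<dots> \<le> (\<Sum>k\<in>F. w k * ((cmod (q k))\<^sup>2 / 2 + (cmod (v \<xi> k))\<^sup>2 / 2))"
  proof (intro sum_mono mult_left_mono w)
    fix k
    have "Re (cnj (q k) * v \<xi> k) \<le> cmod (q k) * cmod (v \<xi> k)"
      by (rule order_trans[OF complex_Re_le_cmod]) (simp add: norm_mult)
    then show "Re (cnj (q k) * v \<xi> k) \<le> (cmod (q k))\<^sup>2 / 2 + (cmod (v \<xi> k))\<^sup>2 / 2"
      using sum_squares_bound[of "cmod (q k)" "cmod (v \<xi> k)"] by simp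
  qed
  also have "\<dots> = (\<Sum>k\<in>F. w k * (cmod (q k))\<^sup>2) / 2 + (\<Sum>k\<in>F. w k * (cmod (v \<xi> k))\<^sup>2) / 2"
    by (simp add: distrib_left sum.distrib sum_divide_distrib)
  finally have "(\<Sum>k\<in>F. w k * (cmod (q k))\<^sup>2) \<le> (\<Sum>k\<in>F. w k * (cmod (v \<xi> k))\<^sup>2)" by simp
  also have "\<dots> \<le> e" by (rule e[OF \<xi>(1)])
  finally show ?thesis by (simp only: q_def)
qed

text \<open>
  The tails of the difference quotients are controlled by those of \<open>v\<close> through the mean value
  inequality \<open>quotient_weighted_sum_le\<close>. The convergence in \<open>H\<^sup>s\<close> implies pointwise convergence, which
  identifies the time derivative.
\<close>

lemma C1_sobolev_synth:
  assumes I: "I = time_interval T" and s: "1 \<le> s"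
    and U: "\<forall>t\<in>I. \<forall>k. ((\<lambda>t. u t k) has_vector_derivative v t k) (at t within I)"
    and V: "\<And>k. continuous_on I (\<lambda>t. v t k)"
    and tails: "uniform_tails I (\<lambda>k. japanese k powr (2 * s)) u" "uniform_tails I (\<lambda>k. japanese k powr (2 * s)) v"
    and herm: "\<forall>t\<in>I. hermitian (u t)" "\<forall>t\<in>I. hermitian (v t)"
    and zero: "\<forall>t\<in>I. u t 0 = 0 \<and> v t 0 = 0"
  shows "(\<lambda>t. synth (u t)) \<in> C1_sobolev I s"
    and "\<And>t. t \<in> I \<Longrightarrow> time_deriv I (\<lambda>t. synth (u t)) t = synth (v t)"
proof -
  note U = U[rule_format] and zero = zero[rule_format]
  have s': "1/2 < s" using s by simp
  have Uc: "continuous_on I (\<lambda>t. u t k)" for k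
    unfolding continuous_on_eq_continuous_within using U has_vector_derivative_continuous by blast
  note CU = C0_sobolev_synth[OF s' tails(1) herm(1) Uc]
  note CV = C0_sobolev_synth[OF s' tails(2) herm(2) V]
  define q where "q t \<tau> k = of_real (1 / (\<tau> - t)) * (u \<tau> k - u t k) - v t k" for t \<tau> k
  define f where "f t \<tau> k = japanese k powr (2 * s) * (cmod (q t \<tau> k))\<^sup>2" for t \<tau> k
  have "((\<lambda>\<tau>. infsum (f t \<tau>) UNIV) \<longlongrightarrow> 0) (at t within I)" if t: "t \<in> I" for t
  proof (rule infsum_tendsto_zero)
    show "0 \<le> f t \<tau> k" for \<tau> k by (simp add: f_def)
    show "((\<lambda>\<tau>. f t \<tau> k) \<longlongrightarrow> 0) (at t within I)" for k
    proof -
      have "((\<lambda>\<tau>. of_real (1 / (\<tau> - t)) * (u \<tau> k - u t k)) \<longlongrightarrow> v t k) (at t within I)"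
        using U[OF t, of k] by (simp only: has_vector_derivative_iff_quotient)
      then have "((\<lambda>\<tau>. f t \<tau> k) \<longlongrightarrow> japanese k powr (2 * s) * (cmod (v t k - v t k))\<^sup>2) (at t within I)"
        unfolding f_def q_def by (intro tendsto_mult tendsto_const tendsto_power tendsto_norm tendsto_diff)
      then show ?thesis by simp
    qed
    fix e :: real assume "0 < e"
    then have e4: "0 < e / 4" by simp
    obtain S where S: "finite S \<and> (\<forall>t\<in>I. sums_below (\<lambda>k. if k \<in> S then 0 else japanese k powr (2 * s) * (cmod (v t k))\<^sup>2) (e / 4))"
      using uniform_tailsD[OF tails(2) e4] ..
    note S = conjunct1[OF S] bspec[OF conjunct2[OF S]]
    define w where "w k = (if k \<in> S then 0 else japanese k powr (2 * s))" for k
    have w: "0 \<le> w k" for k by (simp add: w_def)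
    have Sw: "(\<Sum>k\<in>F. w k * (cmod (v t k))\<^sup>2) \<le> e / 4" if "t \<in> I" "finite F" for t F
    proof -
      have "(\<Sum>k\<in>F. w k * (cmod (v t k))\<^sup>2) = (\<Sum>k\<in>F. if k \<in> S then 0 else japanese k powr (2 * s) * (cmod (v t k))\<^sup>2)"
        by (intro sum.cong) (simp_all add: w_def)
      then show ?thesis using sums_belowD[OF S(2)[OF that(1)] that(2)] by simp
    qed
    have quot: "sums_below (\<lambda>k. w k * (cmod (of_real (1 / (b - a)) * (u b k - u a k)))\<^sup>2) (e / 4)"
      if "a \<in> I" "b \<in> I" "a < b" for a b
      unfolding sums_below_def
    proof (intro allI impI)
      fix F :: "int set" assume F: "finite F"
      have sub: "{a..b} \<subseteq> I" using that I by (auto simp: time_interval_def) (meson ereal_less_eq(3) le_less_trans)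
      show "(\<Sum>k\<in>F. w k * (cmod (of_real (1 / (b - a)) * (u b k - u a k)))\<^sup>2) \<le> e / 4"
      proof (rule quotient_weighted_sum_le[OF _ that(3) w])
        show "((\<lambda>t. u t k) has_vector_derivative v \<tau> k) (at \<tau> within {a..b})" if "\<tau> \<in> {a..b}" for \<tau> k
          using has_vector_derivative_within_subset[OF U sub] that sub by blast
        show "(\<Sum>k\<in>F. w k * (cmod (v \<tau> k))\<^sup>2) \<le> e / 4" if "\<tau> \<in> {a..b}" for \<tau>
          by (rule Sw[OF _ F]) (use that sub in blast)
      qed
    qed
    have Q: "sums_below (\<lambda>k. w k * (cmod (of_real (1 / (\<tau> - t)) * (u \<tau> k - u t k)))\<^sup>2) (e / 4)" if \<tau>: "\<tau> \<in> I" "\<tau> \<noteq> t" for \<tau>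
    proof (cases "t < \<tau>")
      case True
      then show ?thesis by (rule quot[OF t \<tau>(1)])
    next
      case False
      then have "\<tau> < t" using \<tau>(2) by simp
      from quot[OF \<tau>(1) t this] show ?thesis
        by (simp add: norm_mult norm_divide norm_minus_commute abs_minus_commute)
    qed
    have "sums_below (\<lambda>k. if k \<in> S then 0 else f t \<tau> k) e" if \<tau>: "\<tau> \<in> I" "\<tau> \<noteq> t" for \<tau>
    proof -
      have "sums_below (\<lambda>k. w k * (cmod (v t k))\<^sup>2) (e / 4)" unfolding sums_below_def using Sw[OF t] by blast
      from sums_below_cmult[OF sums_below_add[OF Q[OF \<tau>] this], of 2] show ?thesis
      proof (rule sums_below_mono)
        show "(if k \<in> S then 0 else f t \<tau> k) \<le> 2 * (w k * (cmod (of_real (1 / (\<tau> - t)) * (u \<tau> k - u t k)))\<^sup>2 + w k * (cmod (v t k))\<^sup>2)" for k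
          using mult_left_mono[OF cmod_diff_power2_le[of "of_real (1 / (\<tau> - t)) * (u \<tau> k - u t k)" "v t k"], of "japanese k powr (2 * s)"]
          by (simp add: f_def q_def w_def distrib_left)
      qed auto
    qed
    then show "\<exists>S. finite S \<and> (\<forall>\<^sub>F \<tau> in at t within I. sums_below (\<lambda>k. if k \<in> S then 0 else f t \<tau> k) e)"
      using S(1) by (intro exI[of _ S]) (simp add: eventually_at_filter)
  qed
  note lim = this
  have quot_sob: "(\<lambda>x. (synth (u \<tau>) x - synth (u t) x) / (\<tau> - t) - synth (v t) x) \<in> sobolev s"
    and fcq: "fourier_coeff (\<lambda>x. (synth (u \<tau>) x - synth (u t) x) / (\<tau> - t) - synth (v t) x) k = q t \<tau> k"
    if t: "t \<in> I" and \<tau>: "\<tau> \<in> I" for t \<tau> k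
  proof -
    have eq: "(\<lambda>x. (synth (u \<tau>) x - synth (u t) x) / (\<tau> - t) - synth (v t) x)
      = (\<lambda>x. 1 / (\<tau> - t) * (synth (u \<tau>) x - synth (u t) x) - synth (v t) x)" by simp
    note d = sobolev_diff[OF CU(2)[OF \<tau>] CU(2)[OF t]]
    note d2 = sobolev_diff[OF sobolev_cmult[OF d(1), of "1 / (\<tau> - t)"] CV(2)[OF t]]
    show "(\<lambda>x. (synth (u \<tau>) x - synth (u t) x) / (\<tau> - t) - synth (v t) x) \<in> sobolev s"
      unfolding eq by (rule d2(1))
    show "fourier_coeff (\<lambda>x. (synth (u \<tau>) x - synth (u t) x) / (\<tau> - t) - synth (v t) x) k = q t \<tau> k"
      unfolding eq d2(2) fourier_coeff_cmult d(2) CU(3)[OF \<tau>] CU(3)[OF t] CV(3)[OF t] q_def ..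
  qed
  have summ: "f t \<tau> summable_on UNIV" if t: "t \<in> I" and \<tau>: "\<tau> \<in> I" for t \<tau>
    using sobolevD(3)[OF quot_sob[OF t \<tau>]] fcq[OF t \<tau>] by (simp add: f_def[abs_def])
  have point: "\<bar>(synth (u \<tau>) x - synth (u t) x) / (\<tau> - t) - synth (v t) x\<bar> \<le> sqrt_zeta * sqrt (infsum (f t \<tau>) UNIV)"
    if t: "t \<in> I" and \<tau>: "\<tau> \<in> I" for t \<tau> x
  proof -
    note sob = quot_sob[OF t \<tau>]
    have below: "sums_below (\<lambda>k. cmod (q t \<tau> k)) (sqrt_zeta * sqrt (infsum (f t \<tau>) UNIV))"
    proof (rule sums_below_l2_l1)
      show "cmod (q t \<tau> 0) = 0" using zero[OF t] zero[OF \<tau>] by (simp add: q_def)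
      show "sums_below (\<lambda>n. (of_int n * cmod (q t \<tau> n))\<^sup>2) (infsum (f t \<tau>) UNIV)"
      proof (rule sums_below_mono[OF sums_below_infsum[OF summ[OF t \<tau>]]])
        fix k
        have "of_int \<bar>k\<bar> ^ (2 * 1) \<le> japanese k powr (2 * 1)" using japanese_powr_ge[of k 1] by simp
        also have "\<dots> \<le> japanese k powr (2 * s)" using s japanese_ge(2)[of k] by (intro powr_mono) auto
        finally show "(of_int k * cmod (q t \<tau> k))\<^sup>2 \<le> f t \<tau> k"
          by (simp add: f_def power_mult_distrib mult_right_mono)
      qed (auto simp: f_def)
    qed
    have sm: "(\<lambda>k. cmod (q t \<tau> k)) summable_on UNIV" by (rule sums_below_imp_summable(1)[OF below]) simp
    have "fourier_coeff (\<lambda>x. (synth (u \<tau>) x - synth (u t) x) / (\<tau> - t) - synth (v t) x) = q t \<tau>"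
      by (rule ext) (rule fcq[OF t \<tau>])
    then have "(\<lambda>x. (synth (u \<tau>) x - synth (u t) x) / (\<tau> - t) - synth (v t) x) = synth (q t \<tau>)"
      using synth_fourier_coeff[OF sob s'] by simp
    then have "(synth (u \<tau>) x - synth (u t) x) / (\<tau> - t) - synth (v t) x = synth (q t \<tau>) x" unfolding fun_eq_iff by blast
    moreover have "\<bar>synth (q t \<tau>) x\<bar> \<le> sqrt_zeta * sqrt (infsum (f t \<tau>) UNIV)"
      by (rule order_trans[OF abs_synth_le[OF sm] sums_below_imp_summable(2)[OF below]]) simp
    ultimately show ?thesis by simp
  qed
  have td: "time_deriv I (\<lambda>t. synth (u t)) t = synth (v t)" if t: "t \<in> I" for t
  proof
    fix x
    have "((\<lambda>\<tau>. sqrt_zeta * sqrt (infsum (f t \<tau>) UNIV)) \<longlongrightarrow> sqrt_zeta * sqrt 0) (at t within I)"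
      by (intro tendsto_intros lim[OF t])
    then have l0: "((\<lambda>\<tau>. sqrt_zeta * sqrt (infsum (f t \<tau>) UNIV)) \<longlongrightarrow> 0) (at t within I)" by simp
    have "((\<lambda>\<tau>. (synth (u \<tau>) x - synth (u t) x) / (\<tau> - t) - synth (v t) x) \<longlongrightarrow> 0) (at t within I)"
      by (rule Lim_null_comparison[OF _ l0]) (use point[OF t] in \<open>simp add: eventually_at_filter\<close>)
    then have "((\<lambda>\<tau>. (synth (u \<tau>) x - synth (u t) x) / (\<tau> - t)) \<longlongrightarrow> synth (v t) x) (at t within I)"
      by (simp only: LIM_zero_iff)
    then have "((\<lambda>\<tau>. synth (u \<tau>) x) has_real_derivative synth (v t) x) (at t within I)"
      by (simp only: has_field_derivative_iff)
    then have hv: "((\<lambda>\<tau>. synth (u \<tau>) x) has_vector_derivative synth (v t) x) (at t within I)"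
      by (simp only: has_real_derivative_iff_has_vector_derivative)
    obtain b where b: "t < b" "b \<in> time_interval T" using time_interval_larger t I by blast
    have t0: "0 \<le> t" using t I by (simp add: time_interval_def)
    have at: "at t within I = at t within {0..b}" using at_within_time_interval[of t b T] b t0 I by simp
    show "time_deriv I (\<lambda>t. synth (u t)) t x = synth (v t) x"
      unfolding time_deriv_def at
      by (rule vector_derivative_within_cbox[of 0 b, simplified]) (use hv b t0 at in auto)
  qed
  show "\<And>t. t \<in> I \<Longrightarrow> time_deriv I (\<lambda>t. synth (u t)) t = synth (v t)" by (rule td)
  show "(\<lambda>t. synth (u t)) \<in> C1_sobolev I s"
    unfolding C1_sobolev_def mem_Collect_eq
  proof (intro conjI ballI)
    show "(\<lambda>t. synth (u t)) \<in> C0_sobolev I s" by (rule CU(1))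
    show "time_deriv I (\<lambda>t. synth (u t)) \<in> C0_sobolev I s"
      using CV(1) C0_sobolev_cong[where I = I and \<phi> = "time_deriv I (\<lambda>t. synth (u t))" and \<psi> = "\<lambda>t. synth (v t)"] td by blast
    fix t assume t: "t \<in> I"
    have "((\<lambda>\<tau>. sqrt (2 * pi * infsum (f t \<tau>) UNIV)) \<longlongrightarrow> sqrt (2 * pi * 0)) (at t within I)" by (intro tendsto_intros lim[OF t])
    moreover have "\<forall>\<^sub>F \<tau> in at t within I. sobolev_norm s (\<lambda>x. (synth (u \<tau>) x - synth (u t) x) / (\<tau> - t) - synth (v t) x)
        = sqrt (2 * pi * infsum (f t \<tau>) UNIV)"
      unfolding eventually_at_filter
      by (rule always_eventually) (simp add: sobolev_norm_def f_def[abs_def] t fcq)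
    ultimately show "((\<lambda>\<tau>. sobolev_norm s (\<lambda>x. (synth (u \<tau>) x - synth (u t) x) / (\<tau> - t) - time_deriv I (\<lambda>t. synth (u t)) t x)) \<longlongrightarrow> 0) (at t within I)"
      by (simp add: tendsto_cong td[OF t])
  qed
qed

section \<open>Propagation of Sobolev regularity\<close>

text \<open>
  For \<open>\<bar>k\<bar> \<ge> J\<close> this is the Sobolev weight \<open>\<bar>k\<bar> powr (s - 1)\<close>; below \<open>J\<close> it is reduced by a factor that
  tends to zero as \<open>J\<close> grows, but is still an admissible weight.
\<close>

definition tail_weight :: "real \<Rightarrow> real \<Rightarrow> int \<Rightarrow> real" where
  "tail_weight s J k = of_int \<bar>k\<bar> powr (s - 1) * min 1 (of_int \<bar>k\<bar> / J)"

lemma weight_tail_weight: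
  assumes s: "1 \<le> s" and J: "0 < J" and q: "s \<le> real q"
  shows "weight q (tail_weight s J)"
  unfolding weight_def
proof (intro conjI allI impI)
  show "0 \<le> tail_weight s J k" for k using J by (simp add: tail_weight_def)
  fix k l :: int assume kl: "\<bar>k\<bar> \<le> \<bar>l\<bar>"
  define x y :: real where "x = of_int \<bar>k\<bar>" and "y = of_int \<bar>l\<bar>"
  have xy: "0 \<le> x" "x \<le> y" using kl by (auto simp: x_def y_def)
  show "tail_weight s J k \<le> tail_weight s J l"
    unfolding tail_weight_def x_def[symmetric] y_def[symmetric]
    using xy J s by (intro mult_mono powr_mono2 min.mono divide_right_mono) auto
  show "of_int \<bar>k\<bar> ^ q * tail_weight s J l \<le> of_int \<bar>l\<bar> ^ q * tail_weight s J k"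
    unfolding tail_weight_def x_def[symmetric] y_def[symmetric]
  proof (cases "x = 0")
    case True
    have "q \<noteq> 0" using s q by (intro notI) simp
    then show "x ^ q * (y powr (s - 1) * min 1 (y / J)) \<le> y ^ q * (x powr (s - 1) * min 1 (x / J))" using True by (simp add: power_0_left)
  next
    case False
    then have pos: "0 < x" "0 < y" using xy by auto
    have pow: "z ^ q = z powr (s - 1) * (z * z powr (real q - s))" if "0 < z" for z :: real
    proof -
      have "z powr (s - 1) * (z * z powr (real q - s)) = z powr (s - 1) * (z powr 1 * z powr (real q - s))" using that by simp
      also have "\<dots> = z powr real q" unfolding powr_add[symmetric] by simp
      finally show ?thesis using that by (simp add: powr_realpow)
    qed
    have "x * min 1 (y / J) \<le> y * min 1 (x / J)"
      using xy J mult_left_mono[of J y x] by (auto simp: min_def field_simps)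
    moreover have "x powr (real q - s) \<le> y powr (real q - s)" using xy q by (intro powr_mono2) auto
    ultimately have "(x * min 1 (y / J)) * x powr (real q - s) \<le> (y * min 1 (x / J)) * y powr (real q - s)"
      by (rule mult_mono) (use xy J in auto)
    then have "(x powr (s - 1) * y powr (s - 1)) * ((x * min 1 (y / J)) * x powr (real q - s))
        \<le> (x powr (s - 1) * y powr (s - 1)) * ((y * min 1 (x / J)) * y powr (real q - s))"
      by (intro mult_left_mono) auto
    then show "x ^ q * (y powr (s - 1) * min 1 (y / J)) \<le> y ^ q * (x powr (s - 1) * min 1 (x / J))"
      unfolding pow[OF pos(1)] pow[OF pos(2)] by (simp only: ac_simps)
  qed
qed

text \<open>
  The exponent is \<open>s - 1\<close> because \<open>en\<close> contains one more derivative of the position.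
\<close>

definition sobolev_weight :: "real \<Rightarrow> int \<Rightarrow> real" where
  "sobolev_weight s k = of_int \<bar>k\<bar> powr (s - 1)"

lemma tail_weight_eq: "0 < J \<Longrightarrow> J \<le> of_int \<bar>k\<bar> \<Longrightarrow> tail_weight s J k = sobolev_weight s k"
  by (simp add: tail_weight_def sobolev_weight_def)

lemma tail_weight_one: "tail_weight s 1 = sobolev_weight s"
proof
  fix k :: int
  show "tail_weight s 1 k = sobolev_weight s k"
  proof (cases "k = 0")
    case False
    then show ?thesis by (intro tail_weight_eq) auto
  qed (simp add: tail_weight_def sobolev_weight_def)
qed

lemma japanese_powr: "japanese k powr (2 * s) = (1 + (of_int k)\<^sup>2) powr s"
proof -
  have "japanese k powr 2 = (japanese k)\<^sup>2" using japanese_pos[of k] by simp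
  then have "japanese k powr 2 = 1 + (of_int k)\<^sup>2" by (simp add: japanese_def)
  then show ?thesis by (simp flip: powr_powr)
qed

lemma abs_powr_square: "(\<bar>x\<bar> powr s)\<^sup>2 = (x\<^sup>2) powr s" for x :: real
  using powr_mult[of "\<bar>x\<bar>" "\<bar>x\<bar>" s] by (simp add: power2_eq_square)

lemma en_sobolev_weight:
  assumes "k \<noteq> 0"
  shows "en (sobolev_weight s) z z' k = ((of_int k)\<^sup>2) powr s * (cmod (z k))\<^sup>2 + ((of_int k)\<^sup>2) powr (s - 1) * (cmod (z' k))\<^sup>2"
proof -
  have "(real_of_int k)\<^sup>2 powr (s - 1) * (of_int k)\<^sup>2 = (of_int k)\<^sup>2 powr (s - 1) * (of_int k)\<^sup>2 powr 1" using assms by simp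
  also have "\<dots> = (of_int k)\<^sup>2 powr s" by (simp only: powr_add[symmetric]) simp
  finally have "(real_of_int k)\<^sup>2 powr s = (real_of_int k)\<^sup>2 powr (s - 1) * (of_int k)\<^sup>2" ..
  then show ?thesis
    by (simp add: en_def sobolev_weight_def abs_powr_square power_mult_distrib algebra_simps)
qed

lemma en_sobolev_weight_le:
  assumes s: "1 \<le> s"
  shows "en (sobolev_weight s) z z' k
    \<le> japanese k powr (2 * s) * (cmod (z k))\<^sup>2 + japanese k powr (2 * (s - 1)) * (cmod (z' k))\<^sup>2"
proof (cases "k = 0")
  case True
  then show ?thesis by (simp add: en_def sobolev_weight_def)
next
  case False
  then show ?thesis unfolding en_sobolev_weight[OF False] japanese_powr
    using s by (intro add_mono mult_right_mono powr_mono2) auto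
qed

lemma le_en_sobolev_weight:
  assumes s: "1 \<le> s" and z: "z 0 = 0" "z' 0 = 0"
  shows "japanese k powr (2 * s) * (cmod (z k))\<^sup>2 + japanese k powr (2 * (s - 1)) * (cmod (z' k))\<^sup>2
    \<le> 2 powr s * en (sobolev_weight s) z z' k"
proof (cases "k = 0")
  case True
  then show ?thesis using z by (simp add: en_def)
next
  case False
  then have k: "1 \<le> (real_of_int k)\<^sup>2" using int_one_le_iff_zero_less[of "k\<^sup>2"] by (simp flip: of_int_power)
  have 1: "(1 + (of_int k)\<^sup>2) powr r \<le> 2 powr s * (of_int k)\<^sup>2 powr r" if "0 \<le> r" "r \<le> s" for r
  proof -
    have "(1 + (of_int k)\<^sup>2) powr r \<le> (2 * (of_int k)\<^sup>2) powr r" using k that by (intro powr_mono2) auto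
    also have "\<dots> = 2 powr r * (of_int k)\<^sup>2 powr r" by (simp add: powr_mult)
    also have "\<dots> \<le> 2 powr s * (of_int k)\<^sup>2 powr r" using that by (intro mult_right_mono powr_mono) auto
    finally show ?thesis .
  qed
  show ?thesis unfolding en_sobolev_weight[OF False] japanese_powr distrib_left mult.assoc[symmetric]
    using s by (intro add_mono mult_right_mono 1) auto
qed

lemma summable_on_tail:
  fixes f :: "'a \<Rightarrow> real"
  assumes f: "f summable_on UNIV" "\<And>k. 0 \<le> f k" and e: "0 < e"
  shows "\<exists>S. finite S \<and> sums_below (\<lambda>k. if k \<in> S then 0 else f k) e"
proof -
  have "(sum f \<longlongrightarrow> infsum f UNIV) (finite_subsets_at_top UNIV)" using has_sum_infsum[OF f(1)] by (simp add: has_sum_def)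
  from order_tendstoD(1)[OF this, of "infsum f UNIV - e"] e obtain S where S: "finite S" "infsum f UNIV - e < sum f S"
    unfolding eventually_finite_subsets_at_top by auto
  have "sums_below (\<lambda>k. if k \<in> S then 0 else f k) e"
    unfolding sums_below_def
  proof (intro allI impI)
    fix F :: "'a set" assume F: "finite F"
    have "(\<Sum>k\<in>F. if k \<in> S then 0 else f k) = sum f (F - S)" using F by (intro sum.mono_neutral_cong_right) auto
    moreover have "sum f (F - S) + sum f S = sum f (F \<union> S)"
      using F S(1) by (subst sum.union_disjoint[symmetric]) auto
    moreover have "sum f (F \<union> S) \<le> infsum f UNIV"
      using F S(1) f by (intro finite_sum_le_infsum) auto
    ultimately show "(\<Sum>k\<in>F. if k \<in> S then 0 else f k) \<le> e" using S(2) by linarith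
  qed
  then show ?thesis using S(1) by blast
qed

lemma en_le_tail_weight: "0 < J \<Longrightarrow> en (tail_weight s J) a b k \<le> en (sobolev_weight s) a b k"
  unfolding en_def by (intro mult_right_mono power_mono) (auto simp: tail_weight_def sobolev_weight_def intro: mult_right_le_one_le)

text \<open>
  Each frequency is eventually below \<open>J\<close>, and the energies are dominated by the one for the Sobolev
  weight.
\<close>

lemma tail_energy_tendsto:
  assumes summ: "en (sobolev_weight s) a b summable_on UNIV"
  shows "(\<lambda>n. infsum (en (tail_weight s (real n + 1)) a b) UNIV) \<longlonglongrightarrow> 0"
proof (rule infsum_tendsto_zero)
  show "0 \<le> en (tail_weight s (real n + 1)) a b k" for n k by (rule en_nonneg)
  show "(\<lambda>n. en (tail_weight s (real n + 1)) a b k) \<longlonglongrightarrow> 0" for k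
  proof -
    have "(\<lambda>n. of_int \<bar>k\<bar> / (real n + 1)) \<longlonglongrightarrow> 0" by real_asymp
    then have "(\<lambda>n. en (tail_weight s (real n + 1)) a b k) \<longlonglongrightarrow>
        (of_int \<bar>k\<bar> powr (s - 1) * min 1 0)\<^sup>2 * ((cmod (b k))\<^sup>2 + (of_int k * cmod (a k))\<^sup>2)"
      unfolding en_def tail_weight_def by (intro tendsto_mult tendsto_power tendsto_min tendsto_const)
    then show ?thesis by simp
  qed
  fix e :: real assume "0 < e"
  from summable_on_tail[OF summ en_nonneg this] obtain S where
    S: "finite S" "sums_below (\<lambda>k. if k \<in> S then 0 else en (sobolev_weight s) a b k) e" by blast
  have "sums_below (\<lambda>k. if k \<in> S then 0 else en (tail_weight s (real n + 1)) a b k) e" for n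
    by (rule sums_below_mono[OF S(2)]) (auto intro: en_le_tail_weight)
  then show "\<exists>S. finite S \<and> (\<forall>\<^sub>F n in sequentially. sums_below (\<lambda>k. if k \<in> S then 0 else en (tail_weight s (real n + 1)) a b k) e)"
    using S(1) by (intro exI[of _ S]) simp
qed

text \<open>
  The energy of the data for \<open>tail_weight s J\<close> tends to zero as \<open>J\<close> grows. It is propagated with a
  constant that does not depend on \<open>J\<close>, and it dominates the part of the Sobolev norm beyond \<open>J\<close>.
\<close>

lemma uniform_tails_en:
  assumes s: "1 \<le> s" and summ: "en (sobolev_weight s) a b summable_on UNIV"
    and K: "\<And>q. 0 \<le> K q"
    and grow: "\<And>t m q c. t \<in> I \<Longrightarrow> weight q m \<Longrightarrow> sums_below (en m a b) c \<Longrightarrow> sums_below (en m (u t) (v t)) (K q * c)"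
    and zero: "\<And>t. t \<in> I \<Longrightarrow> u t 0 = 0 \<and> v t 0 = 0"
  shows "uniform_tails I (\<lambda>k. japanese k powr (2 * s)) u" "uniform_tails I (\<lambda>k. japanese k powr (2 * (s - 1))) v"
proof -
  have main: "\<exists>S. finite S \<and> (\<forall>t\<in>I. sums_below (\<lambda>k. if k \<in> S then 0 else
      japanese k powr (2 * s) * (cmod (u t k))\<^sup>2 + japanese k powr (2 * (s - 1)) * (cmod (v t k))\<^sup>2) e)" if e: "0 < e" for e
  proof -
    define q where "q = nat \<lceil>s\<rceil>"
    have q: "s \<le> real q" unfolding q_def by linarith
    have "(\<lambda>n. 2 powr s * (K q * infsum (en (tail_weight s (real n + 1)) a b) UNIV)) \<longlonglongrightarrow> 2 powr s * (K q * 0)"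
      by (intro tendsto_intros tail_energy_tendsto[OF summ])
    then have "(\<lambda>n. 2 powr s * (K q * infsum (en (tail_weight s (real n + 1)) a b) UNIV)) \<longlonglongrightarrow> 0" by simp
    from order_tendstoD(2)[OF this e] obtain n where
      n: "2 powr s * (K q * infsum (en (tail_weight s (real n + 1)) a b) UNIV) < e"
      unfolding eventually_sequentially by blast
    define J where "J = real n + 1"
    have J: "0 < J" by (simp add: J_def)
    have "en (tail_weight s J) a b summable_on UNIV"
      by (rule summable_on_comparison_test[OF summ]) (auto intro: en_le_tail_weight[OF J] en_nonneg)
    from sums_below_infsum[OF this en_nonneg]
    have below: "sums_below (en (tail_weight s J) (u t) (v t)) (K q * infsum (en (tail_weight s J) a b) UNIV)" if "t \<in> I" for t
      by (rule grow[OF that weight_tail_weight[OF s J q]])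
    define S where "S = {- int n - 1..int n + 1}"
    have "sums_below (\<lambda>k. if k \<in> S then 0 else
      japanese k powr (2 * s) * (cmod (u t k))\<^sup>2 + japanese k powr (2 * (s - 1)) * (cmod (v t k))\<^sup>2) e" if t: "t \<in> I" for t
    proof (rule sums_below_mono[OF sums_below_cmult[OF below[OF t], of "2 powr s"]])
      fix k
      show "(if k \<in> S then 0 else japanese k powr (2 * s) * (cmod (u t k))\<^sup>2 + japanese k powr (2 * (s - 1)) * (cmod (v t k))\<^sup>2)
        \<le> 2 powr s * en (tail_weight s J) (u t) (v t) k"
      proof (cases "k \<in> S")
        case True
        then show ?thesis by (simp add: en_nonneg)
      next
        case False
        then have "int n + 1 \<le> \<bar>k\<bar>" by (auto simp: S_def)
        then have "J \<le> of_int \<bar>k\<bar>" unfolding J_def by linarith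
        then have "en (tail_weight s J) (u t) (v t) k = en (sobolev_weight s) (u t) (v t) k"
          by (simp add: en_def tail_weight_eq[OF J])
        then show ?thesis using False le_en_sobolev_weight[OF s, of "u t" "v t" k] zero[OF t] by simp
      qed
    qed (use n J_def in auto)
    then show ?thesis by (intro exI[of _ S]) (simp add: S_def)
  qed
  have part: "uniform_tails I w c"
    if le: "\<And>t k. w k * (cmod (c t k))\<^sup>2
      \<le> japanese k powr (2 * s) * (cmod (u t k))\<^sup>2 + japanese k powr (2 * (s - 1)) * (cmod (v t k))\<^sup>2" for w c
    unfolding uniform_tails_def
  proof (intro allI impI)
    fix e :: real assume "0 < e"
    from main[OF this] obtain S where S: "finite S" "\<forall>t\<in>I. sums_below (\<lambda>k. if k \<in> S then 0 else
      japanese k powr (2 * s) * (cmod (u t k))\<^sup>2 + japanese k powr (2 * (s - 1)) * (cmod (v t k))\<^sup>2) e" by (elim exE conjE)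
    have "sums_below (\<lambda>k. if k \<in> S then 0 else w k * (cmod (c t k))\<^sup>2) e" if "t \<in> I" for t
      by (rule sums_below_mono[OF bspec[OF S(2) that]]) (use le in auto)
    then show "\<exists>S. finite S \<and> (\<forall>t\<in>I. sums_below (\<lambda>k. if k \<in> S then 0 else w k * (cmod (c t k))\<^sup>2) e)"
      using S(1) by (intro exI[of _ S]) simp
  qed
  show "uniform_tails I (\<lambda>k. japanese k powr (2 * s)) u" "uniform_tails I (\<lambda>k. japanese k powr (2 * (s - 1))) v"
    by (rule part, simp)+
qed

lemma uniform_tails_mono:
  assumes "uniform_tails I w c" "\<And>k. w' k \<le> w k"
  shows "uniform_tails I w' c"
  unfolding uniform_tails_def
proof (intro allI impI)
  fix e :: real assume "0 < e"
  from uniform_tailsD[OF assms(1) this] obtain S where S: "finite S" "\<forall>t\<in>I. sums_below (\<lambda>k. if k \<in> S then 0 else w k * (cmod (c t k))\<^sup>2) e"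
    by (elim exE conjE)
  have "sums_below (\<lambda>k. if k \<in> S then 0 else w' k * (cmod (c t k))\<^sup>2) e" if "t \<in> I" for t
    by (rule sums_below_mono[OF bspec[OF S(2) that]]) (auto intro: mult_right_mono assms(2))
  then show "\<exists>S. finite S \<and> (\<forall>t\<in>I. sums_below (\<lambda>k. if k \<in> S then 0 else w' k * (cmod (c t k))\<^sup>2) e)"
    using S(1) by (intro exI[of _ S]) simp
qed

lemma japanese_powr_mono: "r \<le> s \<Longrightarrow> japanese k powr (2 * r) \<le> japanese k powr (2 * s)"
  using japanese_ge(2)[of k] by (intro powr_mono) auto

lemma sobolev_mono:
  assumes "f \<in> sobolev s" "r \<le> s"
  shows "f \<in> sobolev r"
proof -
  have "(\<lambda>k. japanese k powr (2 * r) * (cmod (fourier_coeff f k))\<^sup>2) summable_on UNIV"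
    by (rule summable_on_comparison_test[OF sobolevD(3)[OF assms(1)]])
      (auto intro!: mult_right_mono japanese_powr_mono assms(2))
  then show ?thesis using assms(1) by (simp add: sobolev_def)
qed

text \<open>
  The hypotheses are about coefficients only, so that the interval may be bounded or, for zero data,
  the half-line. Everything is proved for the regularity \<open>s\<close> of the data, and the requirements of a
  Cauchy solution follow from \<open>s \<ge> 3\<close>.
\<close>

lemma synth_cauchy_solution:
  assumes I: "I = time_interval T" and I0: "0 \<in> I" and s: "3 \<le> s"
    and \<phi>0: "\<phi>0 \<in> sobolev s" and \<phi>1: "\<phi>1 \<in> sobolev (s - 1)"
    and sol: "\<And>N. modes_upto \<mu> N I u v" and init: "u 0 = fourier_coeff \<phi>0" "v 0 = fourier_coeff \<phi>1"
    and zero: "\<forall>t\<in>I. u t 0 = 0 \<and> v t 0 = 0"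
    and K: "\<And>q. 0 \<le> K q"
    and grow: "\<forall>t\<in>I. \<forall>m q c. weight q m \<longrightarrow> sums_below (en m (fourier_coeff \<phi>0) (fourier_coeff \<phi>1)) c \<longrightarrow>
      sums_below (en m (u t) (v t)) (K q * c)"
  shows "cauchy_solution \<mu> I \<phi>0 \<phi>1 (\<lambda>t. synth (u t))"
    and "\<And>t. t \<in> I \<Longrightarrow> fourier_coeff (synth (u t)) = u t"
    and "(\<lambda>t. synth (u t)) \<in> C0_sobolev I s" "(\<lambda>t. synth (u t)) \<in> C1_sobolev I (s - 1)"
    and "\<And>t. t \<in> I \<Longrightarrow> (sobolev_norm s (synth (u t)))\<^sup>2 + (sobolev_norm (s - 1) (time_deriv I (\<lambda>t. synth (u t)) t))\<^sup>2
      \<le> 2 powr s * K (nat \<lceil>s\<rceil>) * ((sobolev_norm s \<phi>0)\<^sup>2 + (sobolev_norm (s - 1) \<phi>1)\<^sup>2)"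
proof -
  define a where "a = fourier_coeff \<phi>0"
  define b where "b = fourier_coeff \<phi>1"
  have s1: "1 \<le> s" using s by simp
  note grow' = grow[folded a_def b_def, rule_format]
  note zero' = zero and zero = zero[rule_format]
  have U: "((\<lambda>t. u t k) has_vector_derivative v t k) (at t within I)" if "t \<in> I" for t k
    using sol[of 0] that unfolding modes_upto_def by blast
  have V: "((\<lambda>t. v t k) has_vector_derivative
        - of_real (\<mu> * (of_int k)\<^sup>2) * u t k + of_int \<bar>k\<bar> * bilin (u t) k) (at t within I)" if "t \<in> I" for t k
    using sol[of "\<bar>k\<bar>"] that unfolding modes_upto_def by blast
  have hu: "\<forall>t\<in>I. hermitian (u t)" using sol[of 0] unfolding modes_upto_def hermitian_def by blast
  have unique: "x = y" if t: "t \<in> I" and x: "(f has_vector_derivative x) (at t within I)" and y: "(f has_vector_derivative y) (at t within I)"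
    for t and f :: "real \<Rightarrow> complex" and x y
  proof -
    obtain b where b: "t < b" "b \<in> time_interval T" using time_interval_larger t I by blast
    have t0: "0 \<le> t" using t I by (simp add: time_interval_def)
    have at: "at t within I = at t within cbox 0 b" using at_within_time_interval[of t b T] b t0 I by simp
    have "t \<in> cbox 0 b" "0 < b" using b t0 by auto
    from vector_derivative_within_cbox[OF this(2,1) x[unfolded at]] vector_derivative_within_cbox[OF this(2,1) y[unfolded at]]
    show ?thesis by simp
  qed
  have hv: "\<forall>t\<in>I. hermitian (v t)"
    unfolding hermitian_def
  proof (intro ballI allI)
    fix t k assume t: "t \<in> I"
    have "((\<lambda>t. cnj (u t k)) has_vector_derivative cnj (v t k)) (at t within I)"
      by (rule bounded_linear.has_vector_derivative[OF bounded_linear_cnj U[OF t]])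
    then have "((\<lambda>t. u t (- k)) has_vector_derivative cnj (v t k)) (at t within I)"
      by (rule has_vector_derivative_transform[OF t, rotated]) (use hu in \<open>simp add: hermitian_def\<close>)
    then show "v t (- k) = cnj (v t k)"
      by (rule unique[OF t U[OF t]])
  qed
  have Uc: "continuous_on I (\<lambda>t. u t k)" for k
    unfolding continuous_on_eq_continuous_within using U has_vector_derivative_continuous by blast
  have Vc: "continuous_on I (\<lambda>t. v t k)" for k
    unfolding continuous_on_eq_continuous_within using V has_vector_derivative_continuous by blast
  have sumf: "(\<lambda>k. japanese k powr (2 * s) * (cmod (a k))\<^sup>2) summable_on UNIV"
    "(\<lambda>k. japanese k powr (2 * (s - 1)) * (cmod (b k))\<^sup>2) summable_on UNIV"
    using sobolevD(3)[OF \<phi>0] sobolevD(3)[OF \<phi>1] by (simp_all add: a_def b_def)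
  have summ: "en (sobolev_weight s) a b summable_on UNIV"
    by (rule summable_on_comparison_test[OF summable_on_add[OF sumf]]) (rule en_sobolev_weight_le[OF s1], rule en_nonneg)
  note tails = uniform_tails_en[OF s1 summ K grow' zero]
  have tu: "uniform_tails I (\<lambda>k. japanese k powr (2 * r)) u" if "r \<le> s" for r
    by (rule uniform_tails_mono[OF tails(1) japanese_powr_mono[OF that]])
  have tv: "uniform_tails I (\<lambda>k. japanese k powr (2 * r)) v" if "r \<le> s - 1" for r
    by (rule uniform_tails_mono[OF tails(2) japanese_powr_mono[OF that]])
  have U': "\<forall>t\<in>I. \<forall>k. ((\<lambda>t. u t k) has_vector_derivative v t k) (at t within I)" using U by blast
  have r: "1/2 < s" "(1::real)/2 < 3" "1 \<le> s - 1" "(1::real) \<le> 2" "3 \<le> s" "s - 1 \<le> s" "2 \<le> s" "2 \<le> s - 1" using s by auto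
  note C0 = C0_sobolev_synth[OF r(1) tu[OF order_refl] hu Uc]
  note C1 = C1_sobolev_synth[OF I r(3) U' Vc tu[OF r(6)] tv[OF order_refl] hu hv zero']
  show fc: "\<And>t. t \<in> I \<Longrightarrow> fourier_coeff (synth (u t)) = u t" by (rule C0(3))
  show "(\<lambda>t. synth (u t)) \<in> C0_sobolev I s" "(\<lambda>t. synth (u t)) \<in> C1_sobolev I (s - 1)" by (rule C0(1), rule C1(1))
  have td: "time_deriv I (\<lambda>t. synth (u t)) t = synth (v t)" if "t \<in> I" for t by (rule C1(2)[OF that])
  have c3: "(\<lambda>t. synth (u t)) \<in> C0_sobolev I 3" by (rule C0_sobolev_synth(1)[OF r(2) tu[OF r(5)] hu Uc])
  have c2: "(\<lambda>t. synth (u t)) \<in> C1_sobolev I 2"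
    by (rule C1_sobolev_synth(1)[OF I r(4) U' Vc tu[OF r(7)] tv[OF r(8)] hu hv zero'])
  have zm: "\<forall>t\<in>I. zero_mean (synth (u t))" using fc zero by (simp add: zero_mean_iff)
  have dist: "distributional_solution \<mu> I (\<lambda>t. synth (u t))"
  proof (rule modes_imp_distributional[OF I c3 zm])
    fix t k assume t: "t \<in> I"
    show "((\<lambda>t. fourier_coeff (synth (u t)) k) has_vector_derivative v t k) (at t within I)"
      by (rule has_vector_derivative_transform[OF t _ U[OF t]]) (simp add: fc)
    show "((\<lambda>t. v t k) has_vector_derivative - of_real (\<mu> * (of_int k)\<^sup>2) * fourier_coeff (synth (u t)) k
        + of_int \<bar>k\<bar> * bilin (fourier_coeff (synth (u t))) k) (at t within I)"
      unfolding fc[OF t] by (rule V[OF t])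
  qed
  have half: "1/2 < s - 1" using s by simp
  show "cauchy_solution \<mu> I \<phi>0 \<phi>1 (\<lambda>t. synth (u t))"
    unfolding cauchy_solution_def
    using c3 c2 dist zm td[OF I0] init synth_fourier_coeff[OF \<phi>0 r(1)] synth_fourier_coeff[OF \<phi>1 half] by simp
  fix t assume t: "t \<in> I"
  have cv: "fourier_coeff (synth (v t)) = v t"
    using C0_sobolev_synth(3)[OF half tv[OF order_refl] hv Vc t] .
  have q: "s \<le> real (nat \<lceil>s\<rceil>)" by linarith
  have wt: "weight (nat \<lceil>s\<rceil>) (sobolev_weight s)"
    using weight_tail_weight[OF s1 zero_less_one q] by (simp only: tail_weight_one)
  define X where "X = infsum (\<lambda>k. japanese k powr (2 * s) * (cmod (a k))\<^sup>2) UNIV + infsum (\<lambda>k. japanese k powr (2 * (s - 1)) * (cmod (b k))\<^sup>2) UNIV"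
  have "sums_below (en (sobolev_weight s) a b) X"
    unfolding X_def
    by (rule sums_below_mono[OF sums_below_add[OF sums_below_infsum[OF sumf(1)] sums_below_infsum[OF sumf(2)]]])
      (simp_all only: en_sobolev_weight_le[OF s1] order_refl, simp_all)
  from sums_below_cmult[OF grow'[OF t wt this], of "2 powr s"]
  have below: "sums_below (\<lambda>k. japanese k powr (2 * s) * (cmod (u t k))\<^sup>2 + japanese k powr (2 * (s - 1)) * (cmod (v t k))\<^sup>2)
    (2 powr s * (K (nat \<lceil>s\<rceil>) * X))"
    by (rule sums_below_mono) (use le_en_sobolev_weight[OF s1, of "u t" "v t"] zero[OF t] in auto)
  have su: "(\<lambda>k. japanese k powr (2 * s) * (cmod (u t k))\<^sup>2) summable_on UNIV"
    by (rule uniform_tails_summable[OF tu[OF order_refl] t]) simp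
  have sv: "(\<lambda>k. japanese k powr (2 * (s - 1)) * (cmod (v t k))\<^sup>2) summable_on UNIV"
    by (rule uniform_tails_summable[OF tv[OF order_refl] t]) simp
  have "infsum (\<lambda>k. japanese k powr (2 * s) * (cmod (u t k))\<^sup>2 + japanese k powr (2 * (s - 1)) * (cmod (v t k))\<^sup>2) UNIV
      \<le> 2 powr s * (K (nat \<lceil>s\<rceil>) * X)"
    by (rule sums_below_imp_summable(2)[OF below]) simp
  then have le: "infsum (\<lambda>k. japanese k powr (2 * s) * (cmod (u t k))\<^sup>2) UNIV + infsum (\<lambda>k. japanese k powr (2 * (s - 1)) * (cmod (v t k))\<^sup>2) UNIV
      \<le> 2 powr s * (K (nat \<lceil>s\<rceil>) * X)"
    by (simp only: infsum_add[OF su sv])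
  have "(sobolev_norm s (synth (u t)))\<^sup>2 + (sobolev_norm (s - 1) (time_deriv I (\<lambda>t. synth (u t)) t))\<^sup>2
     = 2 * pi * (infsum (\<lambda>k. japanese k powr (2 * s) * (cmod (u t k))\<^sup>2) UNIV + infsum (\<lambda>k. japanese k powr (2 * (s - 1)) * (cmod (v t k))\<^sup>2) UNIV)"
    by (simp only: sobolev_norm_power2 td[OF t] fc[OF t] cv distrib_left)
  also have "\<dots> \<le> 2 * pi * (2 powr s * (K (nat \<lceil>s\<rceil>) * X))" by (intro mult_left_mono le) simp
  also have "\<dots> = 2 powr s * K (nat \<lceil>s\<rceil>) * ((sobolev_norm s \<phi>0)\<^sup>2 + (sobolev_norm (s - 1) \<phi>1)\<^sup>2)"
    by (simp add: sobolev_norm_power2 X_def a_def b_def algebra_simps)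
  finally show "(sobolev_norm s (synth (u t)))\<^sup>2 + (sobolev_norm (s - 1) (time_deriv I (\<lambda>t. synth (u t)) t))\<^sup>2
      \<le> 2 powr s * K (nat \<lceil>s\<rceil>) * ((sobolev_norm s \<phi>0)\<^sup>2 + (sobolev_norm (s - 1) \<phi>1)\<^sup>2)" .
qed

section \<open>Small data\<close>

lemma sobolev_deriv:
  assumes f: "f \<in> sobolev 3"
  shows "deriv f \<in> sobolev 2" and "fourier_coeff (deriv f) k = \<i> * of_int k * fourier_coeff f k"
proof -
  define a where "a = (\<lambda>k. \<i> * of_int k * fourier_coeff f k)"
  have summ: "(\<lambda>k. japanese k powr (2 * 2) * (cmod (a k))\<^sup>2) summable_on UNIV"
  proof (rule summable_on_comparison_test[OF sobolevD(3)[OF f]])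
    fix k
    have "(of_int k)\<^sup>2 \<le> (japanese k)\<^sup>2" by (simp add: japanese_def)
    also have "\<dots> = japanese k powr 2" using japanese_pos[of k] by simp
    finally have "japanese k powr 4 * (of_int k)\<^sup>2 \<le> japanese k powr 4 * japanese k powr 2" by (rule mult_left_mono) simp
    also have "\<dots> = japanese k powr 6" by (simp flip: powr_add)
    finally show "japanese k powr (2 * 2) * (cmod (a k))\<^sup>2 \<le> japanese k powr (2 * 3) * (cmod (fourier_coeff f k))\<^sup>2"
      using mult_right_mono[of "japanese k powr 4 * (of_int k)\<^sup>2" "japanese k powr 6" "(cmod (fourier_coeff f k))\<^sup>2"]
      by (simp add: a_def norm_mult power_mult_distrib mult.assoc)
  qed auto
  have "synth (fourier_coeff f) = f" by (rule synth_fourier_coeff[OF f]) simp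
  then have eq: "deriv f = synth a"
    using deriv_synth[OF sobolev_summable(1,2)[OF f]] by (simp add: a_def)
  have h: "hermitian a" unfolding a_def by (rule hermitian_deriv[OF hermitian_fourier_coeff])
  have "(1::real) / 2 < 2" by simp
  note S = synth_in_sobolev[OF summ h this]
  show "deriv f \<in> sobolev 2" unfolding eq by (rule S(1))
  show "fourier_coeff (deriv f) k = \<i> * of_int k * fourier_coeff f k" unfolding eq S(2) by (simp add: a_def)
qed

text \<open>
  The size of the data bounds their energy for the weight \<open>k\<^sup>2\<close> since \<open>\<bar>k\<bar> \<le> japanese k\<close> and the factor
  \<open>2\<pi>\<close> in the norm exceeds one.
\<close>

lemma sums_below_data_size:
  assumes \<phi>0: "\<phi>0 \<in> sobolev 3" and \<phi>1: "\<phi>1 \<in> sobolev 2"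
  shows "sums_below (en (\<lambda>k. sq k) (fourier_coeff \<phi>0) (fourier_coeff \<phi>1)) (data_size \<phi>0 \<phi>1)"
  unfolding data_size_def
proof (rule sums_below_mono[OF sums_below_add[OF sums_below_sobolev[OF sobolev_deriv(1)[OF \<phi>0]] sums_below_sobolev[OF \<phi>1]]])
  fix k
  have j: "(real_of_int k) ^ 4 \<le> japanese k powr 4" using japanese_powr_ge[of k 2] by simp
  have "en (\<lambda>k. sq k) (fourier_coeff \<phi>0) (fourier_coeff \<phi>1) k
    = (of_int k) ^ 4 * (cmod (fourier_coeff (deriv \<phi>0) k))\<^sup>2 + (of_int k) ^ 4 * (cmod (fourier_coeff \<phi>1 k))\<^sup>2"
    by (simp add: en_def sobolev_deriv(2)[OF \<phi>0] norm_mult power_mult_distrib algebra_simps flip: power_mult)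
  also have "\<dots> \<le> japanese k powr (2 * 2) * (cmod (fourier_coeff (deriv \<phi>0) k))\<^sup>2 + japanese k powr (2 * 2) * (cmod (fourier_coeff \<phi>1 k))\<^sup>2"
    using j by (intro add_mono mult_right_mono) auto
  finally show "en (\<lambda>k. sq k) (fourier_coeff \<phi>0) (fourier_coeff \<phi>1) k
    \<le> japanese k powr (2 * 2) * (cmod (fourier_coeff (deriv \<phi>0) k))\<^sup>2 + japanese k powr (2 * 2) * (cmod (fourier_coeff \<phi>1 k))\<^sup>2" .
qed simp

lemma data_size_pos:
  assumes \<phi>0: "\<phi>0 \<in> sobolev 3" "zero_mean \<phi>0" and \<phi>1: "\<phi>1 \<in> sobolev 2" "zero_mean \<phi>1"
    and nz: "\<not> (\<phi>0 = (\<lambda>_. 0) \<and> \<phi>1 = (\<lambda>_. 0))"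
  shows "0 < data_size \<phi>0 \<phi>1"
proof (rule ccontr)
  assume "\<not> 0 < data_size \<phi>0 \<phi>1"
  then have le: "data_size \<phi>0 \<phi>1 \<le> 0" by simp
  have "fourier_coeff \<phi>0 k = 0 \<and> fourier_coeff \<phi>1 k = 0" for k
  proof (cases "k = 0")
    case True
    then show ?thesis using \<phi>0(2) \<phi>1(2) by (simp add: zero_mean_iff)
  next
    case False
    have "en (\<lambda>k. sq k) (fourier_coeff \<phi>0) (fourier_coeff \<phi>1) k \<le> 0"
      using sums_below_point[OF sums_below_data_size[OF \<phi>0(1) \<phi>1(1)], of k] le by linarith
    then have "en (\<lambda>k. sq k) (fourier_coeff \<phi>0) (fourier_coeff \<phi>1) k = 0"
      using en_nonneg[of "\<lambda>k. sq k" "fourier_coeff \<phi>0" "fourier_coeff \<phi>1" k] by linarith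
    then show ?thesis using False unfolding en_def by (simp add: add_nonneg_eq_0_iff)
  qed
  then have "fourier_coeff \<phi>0 = (\<lambda>_. 0)" "fourier_coeff \<phi>1 = (\<lambda>_. 0)" by auto
  moreover have "synth (\<lambda>_. 0) = (\<lambda>_. 0)" by (simp add: synth_def fun_eq_iff)
  moreover have "synth (fourier_coeff \<phi>0) = \<phi>0" by (rule synth_fourier_coeff[OF \<phi>0(1)]) simp
  moreover have "synth (fourier_coeff \<phi>1) = \<phi>1" by (rule synth_fourier_coeff[OF \<phi>1(1)]) simp
  ultimately show False using nz by simp
qed

text \<open>
  The coefficients of \<open>H[f]\<^sub>x\<close> are \<open>\<bar>k\<bar> u k\<close>.
\<close>

lemma hyperbolicity_synth:
  assumes below: "sums_below (\<lambda>n. of_int \<bar>n\<bar> * cmod (u n)) X" and u0: "u 0 = 0" and fc: "fourier_coeff f = u"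
  shows "\<bar>deriv (hilbert f) x\<bar> \<le> X"
proof -
  define a where "a = (\<lambda>k. - \<i> * of_int (sgn k) * u k)"
  have le: "cmod (a k) \<le> of_int \<bar>k\<bar> * cmod (u k)" for k
  proof (cases "k = 0")
    case False
    then have "1 * cmod (u k) \<le> of_int \<bar>k\<bar> * cmod (u k)" by (intro mult_right_mono) auto
    then show ?thesis using cmod_sgn_mult_le[of k "u k"] unfolding a_def by linarith
  qed (simp add: a_def)
  have s1: "(\<lambda>k. cmod (a k)) summable_on UNIV"
    by (rule sums_below_imp_summable(1)[OF sums_below_mono[OF below le order_refl]]) simp
  have ka: "of_int \<bar>k\<bar> * cmod (a k) = of_int \<bar>k\<bar> * cmod (u k)" for k
    by (simp add: a_def norm_mult sgn_if)
  have b2: "sums_below (\<lambda>k. cmod (\<i> * of_int k * a k)) X"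
  proof (rule sums_below_mono[OF below])
    show "cmod (\<i> * of_int k * a k) \<le> of_int \<bar>k\<bar> * cmod (u k)" for k
      using ka[of k] by (auto simp: norm_mult)
  qed simp
  have s2: "(\<lambda>k. of_int \<bar>k\<bar> * cmod (a k)) summable_on UNIV"
    unfolding ka by (rule sums_below_imp_summable(1)[OF below]) simp
  have "deriv (hilbert f) x = synth (\<lambda>k. \<i> * of_int k * a k) x"
    unfolding hilbert_eq_synth fc a_def[symmetric] deriv_synth[OF s1 s2] ..
  also have "\<bar>\<dots>\<bar> \<le> X"
    by (rule order_trans[OF abs_synth_le sums_below_imp_summable(2)[OF b2]])
      (use sums_below_imp_summable(1)[OF b2] in auto)
  finally show ?thesis .
qed

definition energy_const :: "real \<Rightarrow> real \<Rightarrow> real" where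
  "energy_const \<mu> s = 2 powr s * growth_const \<mu> (nat \<lceil>s\<rceil>)"

lemma growth_const_pos: "0 < \<mu> \<Longrightarrow> 0 < growth_const \<mu> q"
  by (simp add: growth_const_def)

text \<open>
  For nonzero data the lifespan is finite and \<open>modes_exist\<close> applies on its closure with the bound
  \<open>D = data_size \<phi>0 \<phi>1\<close>. For zero data the lifespan is infinite and the solution is zero.
\<close>

lemma small_data_solution:
  assumes \<mu>: "0 < \<mu>" and s: "3 \<le> s"
    and \<phi>0: "\<phi>0 \<in> sobolev s" "zero_mean \<phi>0" and \<phi>1: "\<phi>1 \<in> sobolev (s - 1)" "zero_mean \<phi>1"
    and B: "B = 4 / min 1 \<mu> * (1 + 2 * \<mu>) * exp 1"
    and X: "X = sqrt_zeta * sqrt (B * data_size \<phi>0 \<phi>1)"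
    and small: "B * data_size \<phi>0 \<phi>1 \<le> 1" "X \<le> \<mu> / 4" and C: "0 < C"
    and time: "44 / min 1 \<mu> * X * (C * data_size \<phi>0 \<phi>1 powr (- 1/2)) \<le> 1"
    and I: "I = time_interval (lifespan C \<phi>0 \<phi>1)"
  shows "\<exists>\<phi>. cauchy_solution \<mu> I \<phi>0 \<phi>1 \<phi> \<and> \<phi> \<in> C0_sobolev I s \<and> \<phi> \<in> C1_sobolev I (s - 1) \<and>
    (\<forall>t\<in>I. sums_below (\<lambda>n. of_int \<bar>n\<bar> * cmod (fourier_coeff (\<phi> t) n)) X) \<and>
    (\<forall>t\<in>I. \<forall>x. \<bar>deriv (hilbert (\<phi> t)) x\<bar> \<le> X) \<and>
    (\<forall>t\<in>I. (sobolev_norm s (\<phi> t))\<^sup>2 + (sobolev_norm (s - 1) (time_deriv I \<phi> t))\<^sup>2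
      \<le> energy_const \<mu> s * ((sobolev_norm s \<phi>0)\<^sup>2 + (sobolev_norm (s - 1) \<phi>1)\<^sup>2))"
proof -
  have sob: "\<phi>0 \<in> sobolev 3" "\<phi>1 \<in> sobolev 2"
    using sobolev_mono[OF \<phi>0(1), of 3] sobolev_mono[OF \<phi>1(1), of 2] s by auto
  define a where "a = fourier_coeff \<phi>0"
  define b where "b = fourier_coeff \<phi>1"
  have ab0: "a 0 = 0" "b 0 = 0" using \<phi>0(2) \<phi>1(2) by (simp_all add: a_def b_def zero_mean_iff)
  have D: "sums_below (en (\<lambda>k. sq k) a b) (data_size \<phi>0 \<phi>1)"
    unfolding a_def b_def by (rule sums_below_data_size[OF sob])
  have K: "0 \<le> growth_const \<mu> q" for q using growth_const_pos[OF \<mu>, of q] by simp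
  have B0: "0 < B" using \<mu> by (simp add: B)
  have X0: "0 \<le> X" unfolding X by (intro mult_nonneg_nonneg sqrt_zeta_nonneg real_sqrt_ge_zero)
      (use sums_below_nonneg[OF D] B0 in auto)
  have "\<exists>u v. (\<forall>N. modes_upto \<mu> N I u v) \<and> u 0 = a \<and> v 0 = b \<and> (\<forall>t\<in>I. u t 0 = 0 \<and> v t 0 = 0) \<and>
    (\<forall>t\<in>I. sums_below (\<lambda>n. of_int \<bar>n\<bar> * cmod (u t n)) X) \<and>
    (\<forall>t\<in>I. \<forall>m q c. weight q m \<longrightarrow> sums_below (en m a b) c \<longrightarrow> sums_below (en m (u t) (v t)) (growth_const \<mu> q * c))"
  proof (cases "\<phi>0 = (\<lambda>_. 0) \<and> \<phi>1 = (\<lambda>_. 0)")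
    case True
    have "fourier_coeff (\<lambda>_. 0) = (\<lambda>_. 0)" by (simp add: fourier_coeff_def fun_eq_iff)
    then have z: "a = (\<lambda>_. 0)" "b = (\<lambda>_. 0)" using True by (simp_all add: a_def b_def)
    have bz: "bilin (\<lambda>_. 0) k = 0" for k by (simp add: bilin_def)
    have "modes_upto \<mu> N I (\<lambda>_ _. 0) (\<lambda>_ _. 0)" for N
      unfolding modes_upto_def by (simp add: bz)
    moreover have "sums_below (en m (\<lambda>_. 0) (\<lambda>_. 0)) (growth_const \<mu> q * c)" if "sums_below (en m a b) c" for m q c
      using sums_below_nonneg[OF that] K[of q] by (simp add: sums_below_def en_def)
    moreover have "sums_below (\<lambda>n. of_int \<bar>n\<bar> * cmod 0) X" using X0 by (simp add: sums_below_def)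
    ultimately show ?thesis by (intro exI[of _ "\<lambda>_ _. 0"]) (simp add: z)
  next
    case False
    define \<tau> where "\<tau> = C * data_size \<phi>0 \<phi>1 powr (- 1/2)"
    have \<tau>: "0 \<le> \<tau>" using C by (simp add: \<tau>_def)
    have sub: "I \<subseteq> {0..\<tau>}" using False by (auto simp: I lifespan_def time_interval_def \<tau>_def)
    have pos: "0 < data_size \<phi>0 \<phi>1" by (rule data_size_pos[OF sob(1) \<phi>0(2) sob(2) \<phi>1(2) False])
    obtain u v where uv: "\<And>N. modes_upto \<mu> N {0..\<tau>} u v" "\<And>t. t \<in> {0..\<tau>} \<Longrightarrow> u t 0 = 0 \<and> v t 0 = 0"
      "u 0 = a" "v 0 = b" "\<And>t. t \<in> {0..\<tau>} \<Longrightarrow> sums_below (en (\<lambda>k. sq k) (u t) (v t)) (B * data_size \<phi>0 \<phi>1)"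
      "\<And>t m q c. t \<in> {0..\<tau>} \<Longrightarrow> weight q m \<Longrightarrow> sums_below (en m a b) c \<Longrightarrow>
        sums_below (en m (u t) (v t)) (growth_const \<mu> q * c)"
    proof (rule modes_exist[OF \<mu> \<tau> _ _ ab0 D pos B small(1)])
      show "a (- k) = cnj (a k)" "b (- k) = cnj (b k)" for k by (simp_all add: a_def b_def cnj_fourier_coeff)
      show "sqrt_zeta * sqrt (B * data_size \<phi>0 \<phi>1) \<le> \<mu> / 4" using small(2) X by simp
      show "44 / min 1 \<mu> * (sqrt_zeta * sqrt (B * data_size \<phi>0 \<phi>1)) * \<tau> \<le> 1" using time X by (simp only: \<tau>_def)
    qed blast
    have "modes_upto \<mu> N I u v" for N
      using uv(1)[of N] sub unfolding modes_upto_def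
      by (meson has_vector_derivative_within_subset subsetD)
    moreover have "sums_below (\<lambda>n. of_int \<bar>n\<bar> * cmod (u t n)) X" if "t \<in> I" for t
      unfolding X by (rule en_sq_bounds(3)[OF uv(5)]) (use that sub in blast)
    ultimately show ?thesis using uv(2,3,4,6) sub by (intro exI[of _ u] exI[of _ v]) (simp add: subset_iff)
  qed
  then obtain u v where uv: "\<forall>N. modes_upto \<mu> N I u v" "u 0 = a" "v 0 = b" "\<forall>t\<in>I. u t 0 = 0 \<and> v t 0 = 0"
    "\<forall>t\<in>I. sums_below (\<lambda>n. of_int \<bar>n\<bar> * cmod (u t n)) X"
    "\<forall>t\<in>I. \<forall>m q c. weight q m \<longrightarrow> sums_below (en m a b) c \<longrightarrow> sums_below (en m (u t) (v t)) (growth_const \<mu> q * c)"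
    by (elim exE conjE)
  have I0: "0 \<in> I"
    using data_size_pos[OF sob(1) \<phi>0(2) sob(2) \<phi>1(2)] C by (auto simp: I time_interval_def lifespan_def)
  note S = synth_cauchy_solution[OF I I0 s \<phi>0(1) \<phi>1(1) uv(1)[rule_format] uv(2,3)[unfolded a_def b_def] uv(4) K
    uv(6)[unfolded a_def b_def]]
  have "\<bar>deriv (hilbert (synth (u t))) x\<bar> \<le> X" if t: "t \<in> I" for t x
    by (rule hyperbolicity_synth[OF _ _ S(2)[OF t]]) (use uv(4,5) t in auto)
  then show ?thesis
    using S(1,3,4,5) uv(5) by (intro exI[of _ "\<lambda>t. synth (u t)"]) (simp add: S(2) energy_const_def)
qed

theorem theorem2:
  fixes \<delta> \<mu> :: real
  assumes "0 < \<delta>" and "\<delta> < \<mu>"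
  shows "\<exists>R0 C1 C2 :: real. 0 < R0 \<and> R0 \<le> 1 \<and> 0 < C1 \<and> 0 < C2 \<and>
    (\<forall>\<phi>0 \<phi>1. \<phi>0 \<in> sobolev 3 \<longrightarrow> \<phi>1 \<in> sobolev 2 \<longrightarrow> zero_mean \<phi>0 \<longrightarrow> zero_mean \<phi>1 \<longrightarrow>
       data_size \<phi>0 \<phi>1 < R0\<^sup>2 \<longrightarrow>
       (let I = time_interval (lifespan C1 \<phi>0 \<phi>1) in
        \<exists>\<phi>. cauchy_solution \<mu> I \<phi>0 \<phi>1 \<phi> \<and>
          (\<forall>t\<in>I. \<forall>x. \<mu> - 2 * deriv (hilbert (\<phi> t)) x \<ge> \<delta>) \<and>
          (\<forall>t\<in>I. (sobolev_norm 3 (\<phi> t))\<^sup>2 + (sobolev_norm 2 (time_deriv I \<phi> t))\<^sup>2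
             \<le> C2 * ((sobolev_norm 3 \<phi>0)\<^sup>2 + (sobolev_norm 2 \<phi>1)\<^sup>2)) \<and>
          (\<forall>\<psi>. cauchy_solution \<mu> I \<phi>0 \<phi>1 \<psi> \<longrightarrow> (\<forall>t\<in>I. \<psi> t = \<phi> t)))) \<and>
    (\<forall>s\<ge>3. \<exists>Cs>0. \<forall>\<phi>0 \<phi>1. \<phi>0 \<in> sobolev s \<longrightarrow> \<phi>1 \<in> sobolev (s - 1) \<longrightarrow>
       zero_mean \<phi>0 \<longrightarrow> zero_mean \<phi>1 \<longrightarrow> data_size \<phi>0 \<phi>1 < R0\<^sup>2 \<longrightarrow>
       (let I = time_interval (lifespan C1 \<phi>0 \<phi>1) in
        \<forall>\<phi>. cauchy_solution \<mu> I \<phi>0 \<phi>1 \<phi> \<longrightarrow>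
          \<phi> \<in> C0_sobolev I s \<and> \<phi> \<in> C1_sobolev I (s - 1) \<and>
          (\<forall>t\<in>I. (sobolev_norm s (\<phi> t))\<^sup>2 + (sobolev_norm (s - 1) (time_deriv I \<phi> t))\<^sup>2
             \<le> Cs * ((sobolev_norm s \<phi>0)\<^sup>2 + (sobolev_norm (s - 1) \<phi>1)\<^sup>2))))"
proof -
  have \<mu>: "0 < \<mu>" using assms by simp
  define B where "B = 4 / min 1 \<mu> * (1 + 2 * \<mu>) * exp 1"
  \<comment> \<open>Apart from \<open>B * data_size \<phi>0 \<phi>1 \<le> 1\<close>, smallness concerns \<open>Z\<close> times the square root of the data
    size, which bounds the sum of \<open>\<bar>n\<bar>\<bar>u\<^sub>n\<bar>\<close>: at most \<open>\<mu>/4\<close> for the coercivity of the energy, at most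
    \<open>(\<mu> - \<delta>)/2\<close> for the lower bound on the wave speed. The term \<open>+ 1\<close> avoids a division by zero.\<close>
  define Z where "Z = sqrt_zeta * sqrt B"
  define \<kappa> where "\<kappa> = min (\<mu> / 4) ((\<mu> - \<delta>) / 2)"
  define R0 where "R0 = min 1 (min (1 / sqrt B) (\<kappa> / (Z + 1)))"
  define C1 where "C1 = min 1 \<mu> / (44 * (Z + 1))"
  have B: "0 < B" using \<mu> by (simp add: B_def)
  have Z: "0 \<le> Z" using B sqrt_zeta_nonneg by (simp add: Z_def)
  have \<kappa>: "0 < \<kappa>" using assms by (simp add: \<kappa>_def)
  have R0: "0 < R0" "R0 \<le> 1" using B Z \<kappa> by (simp_all add: R0_def)
  have C1: "0 < C1" using \<mu> Z by (simp add: C1_def)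
  have solution: "\<exists>\<phi>. cauchy_solution \<mu> I \<phi>0 \<phi>1 \<phi> \<and> \<phi> \<in> C0_sobolev I s \<and> \<phi> \<in> C1_sobolev I (s - 1) \<and>
      (\<forall>t\<in>I. \<forall>x. \<mu> - 2 * deriv (hilbert (\<phi> t)) x \<ge> \<delta>) \<and>
      (\<forall>t\<in>I. (sobolev_norm s (\<phi> t))\<^sup>2 + (sobolev_norm (s - 1) (time_deriv I \<phi> t))\<^sup>2
        \<le> energy_const \<mu> s * ((sobolev_norm s \<phi>0)\<^sup>2 + (sobolev_norm (s - 1) \<phi>1)\<^sup>2)) \<and>
      (\<forall>\<psi>. cauchy_solution \<mu> I \<phi>0 \<phi>1 \<psi> \<longrightarrow> (\<forall>t\<in>I. \<psi> t = \<phi> t))"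
    if s: "3 \<le> s" and \<phi>0: "\<phi>0 \<in> sobolev s" and \<phi>1: "\<phi>1 \<in> sobolev (s - 1)"
      and zm: "zero_mean \<phi>0" "zero_mean \<phi>1" and size: "data_size \<phi>0 \<phi>1 < R0\<^sup>2"
      and I: "I = time_interval (lifespan C1 \<phi>0 \<phi>1)" for s \<phi>0 \<phi>1 I
  proof -
    define d where "d = sqrt (data_size \<phi>0 \<phi>1)"
    define X where "X = sqrt_zeta * sqrt (B * data_size \<phi>0 \<phi>1)"
    have d2: "d\<^sup>2 = data_size \<phi>0 \<phi>1" and d0: "0 \<le> d" by (simp_all add: d_def data_size_def)
    have X: "X = Z * d" by (simp add: X_def Z_def d_def real_sqrt_mult)
    have "d < R0" using size R0 by (intro power2_less_imp_less[of d R0]) (simp_all add: d2)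
    then have d: "d \<le> 1 / sqrt B" "d \<le> \<kappa> / (Z + 1)" by (simp_all add: R0_def)
    have "(sqrt B * d)\<^sup>2 \<le> 1\<^sup>2" using d(1) d0 B by (intro power_mono) (simp_all add: field_simps)
    then have BD: "B * data_size \<phi>0 \<phi>1 \<le> 1" using B by (simp add: power_mult_distrib d2)
    have "X \<le> (Z + 1) * d" unfolding X using d0 by (simp add: algebra_simps)
    also have "\<dots> \<le> \<kappa>" using d(2) Z by (simp add: field_simps)
    finally have X\<kappa>: "X \<le> \<kappa>" .
    have time: "44 / min 1 \<mu> * X * (C1 * data_size \<phi>0 \<phi>1 powr (- 1/2)) \<le> 1"
    proof (cases "d = 0")
      case True
      then show ?thesis by (simp add: X)
    next
      case False
      then have pos: "0 < d" using d0 by simp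
      have p: "data_size \<phi>0 \<phi>1 powr (- 1/2) = 1 / d"
        using pos by (simp add: d_def powr_minus powr_half_sqrt divide_simps)
      have cancel: "44 / m * (Z * d) * (m / (44 * w) * (1 / d)) = Z / w" if "0 < m" "0 < w" for m w :: real
        using pos that by (simp add: field_simps)
      have "44 / min 1 \<mu> * X * (C1 * data_size \<phi>0 \<phi>1 powr (- 1/2)) = Z / (Z + 1)"
        unfolding X C1_def p by (rule cancel) (use \<mu> Z in auto)
      also have "\<dots> \<le> 1" using Z by simp
      finally show ?thesis .
    qed
    have X4: "X \<le> \<mu> / 4" using X\<kappa> by (simp add: \<kappa>_def)
    obtain \<phi> where \<phi>: "cauchy_solution \<mu> I \<phi>0 \<phi>1 \<phi>" "\<phi> \<in> C0_sobolev I s" "\<phi> \<in> C1_sobolev I (s - 1)"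
      "\<forall>t\<in>I. sums_below (\<lambda>n. of_int \<bar>n\<bar> * cmod (fourier_coeff (\<phi> t) n)) X"
      "\<forall>t\<in>I. \<forall>x. \<bar>deriv (hilbert (\<phi> t)) x\<bar> \<le> X"
      "\<forall>t\<in>I. (sobolev_norm s (\<phi> t))\<^sup>2 + (sobolev_norm (s - 1) (time_deriv I \<phi> t))\<^sup>2
        \<le> energy_const \<mu> s * ((sobolev_norm s \<phi>0)\<^sup>2 + (sobolev_norm (s - 1) \<phi>1)\<^sup>2)"
      using small_data_solution[OF \<mu> s \<phi>0 zm(1) \<phi>1 zm(2) B_def X_def BD X4 C1 time I] by (elim exE conjE)
    have h1: "\<mu> - 2 * deriv (hilbert (\<phi> t)) x \<ge> \<delta>" if "t \<in> I" for t x
    proof -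
      have "deriv (hilbert (\<phi> t)) x \<le> X" using \<phi>(5) that by (meson abs_le_D1)
      then show ?thesis using X\<kappa> by (simp add: \<kappa>_def)
    qed
    have h2: "\<psi> t = \<phi> t" if "cauchy_solution \<mu> I \<phi>0 \<phi>1 \<psi>" "t \<in> I" for \<psi> t
    proof (rule cauchy_solution_unique[OF \<mu> I \<phi>(1) that(1) _ that(2)])
      show "sums_below (\<lambda>n. of_int \<bar>n\<bar> * cmod (fourier_coeff (\<phi> t) n)) (\<mu> / 4)" if "t \<in> I" for t
        by (rule sums_below_mono[OF bspec[OF \<phi>(4) that] order_refl X4])
    qed
    show ?thesis by (intro exI[of _ \<phi>] conjI \<phi>(1,2,3,6)) (intro ballI allI impI h1 h2; assumption)+
  qed
  have energy_pos: "0 < energy_const \<mu> s" for s using growth_const_pos[OF \<mu>] by (simp add: energy_const_def)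
  show ?thesis
  proof (rule exI[of _ R0], rule exI[of _ C1], rule exI[of _ "energy_const \<mu> 3"], intro conjI allI impI R0 C1 energy_pos)
    fix \<phi>0 \<phi>1 assume data: "\<phi>0 \<in> sobolev 3" "\<phi>1 \<in> sobolev 2" "zero_mean \<phi>0" "zero_mean \<phi>1" "data_size \<phi>0 \<phi>1 < R0\<^sup>2"
    have two: "(3::real) - 1 = 2" by simp
    show "let I = time_interval (lifespan C1 \<phi>0 \<phi>1) in
        \<exists>\<phi>. cauchy_solution \<mu> I \<phi>0 \<phi>1 \<phi> \<and>
          (\<forall>t\<in>I. \<forall>x. \<mu> - 2 * deriv (hilbert (\<phi> t)) x \<ge> \<delta>) \<and>
          (\<forall>t\<in>I. (sobolev_norm 3 (\<phi> t))\<^sup>2 + (sobolev_norm 2 (time_deriv I \<phi> t))\<^sup>2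
             \<le> energy_const \<mu> 3 * ((sobolev_norm 3 \<phi>0)\<^sup>2 + (sobolev_norm 2 \<phi>1)\<^sup>2)) \<and>
          (\<forall>\<psi>. cauchy_solution \<mu> I \<phi>0 \<phi>1 \<psi> \<longrightarrow> (\<forall>t\<in>I. \<psi> t = \<phi> t))"
      unfolding Let_def using solution[of 3, unfolded two, OF order_refl data refl] by (elim exE conjE) (intro exI conjI)
  next
    fix s :: real assume s: "3 \<le> s"
    have "\<phi> \<in> C0_sobolev I s \<and> \<phi> \<in> C1_sobolev I (s - 1) \<and>
        (\<forall>t\<in>I. (sobolev_norm s (\<phi> t))\<^sup>2 + (sobolev_norm (s - 1) (time_deriv I \<phi> t))\<^sup>2
          \<le> energy_const \<mu> s * ((sobolev_norm s \<phi>0)\<^sup>2 + (sobolev_norm (s - 1) \<phi>1)\<^sup>2))"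
      if data: "\<phi>0 \<in> sobolev s" "\<phi>1 \<in> sobolev (s - 1)" "zero_mean \<phi>0" "zero_mean \<phi>1" "data_size \<phi>0 \<phi>1 < R0\<^sup>2"
        and I: "I = time_interval (lifespan C1 \<phi>0 \<phi>1)" and \<phi>: "cauchy_solution \<mu> I \<phi>0 \<phi>1 \<phi>" for \<phi>0 \<phi>1 \<phi> I
    proof -
      obtain \<psi> where \<psi>: "\<psi> \<in> C0_sobolev I s" "\<psi> \<in> C1_sobolev I (s - 1)"
        "\<forall>t\<in>I. (sobolev_norm s (\<psi> t))\<^sup>2 + (sobolev_norm (s - 1) (time_deriv I \<psi> t))\<^sup>2
          \<le> energy_const \<mu> s * ((sobolev_norm s \<phi>0)\<^sup>2 + (sobolev_norm (s - 1) \<phi>1)\<^sup>2)"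
        "\<forall>\<phi>. cauchy_solution \<mu> I \<phi>0 \<phi>1 \<phi> \<longrightarrow> (\<forall>t\<in>I. \<phi> t = \<psi> t)"
        using solution[OF s data I] by (elim exE conjE)
      have eq: "\<phi> t = \<psi> t" if "t \<in> I" for t using \<psi>(4) \<phi> that by blast
      have td: "time_deriv I \<phi> t = time_deriv I \<psi> t" if "t \<in> I" for t by (rule time_deriv_cong[OF eq that])
      show ?thesis
        using \<psi>(1-3) C0_sobolev_cong[OF eq] C1_sobolev_cong[OF eq] eq td by simp
    qed
    then show "\<exists>Cs>0. \<forall>\<phi>0 \<phi>1. \<phi>0 \<in> sobolev s \<longrightarrow> \<phi>1 \<in> sobolev (s - 1) \<longrightarrow>
       zero_mean \<phi>0 \<longrightarrow> zero_mean \<phi>1 \<longrightarrow> data_size \<phi>0 \<phi>1 < R0\<^sup>2 \<longrightarrow>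
       (let I = time_interval (lifespan C1 \<phi>0 \<phi>1) in
        \<forall>\<phi>. cauchy_solution \<mu> I \<phi>0 \<phi>1 \<phi> \<longrightarrow>
          \<phi> \<in> C0_sobolev I s \<and> \<phi> \<in> C1_sobolev I (s - 1) \<and>
          (\<forall>t\<in>I. (sobolev_norm s (\<phi> t))\<^sup>2 + (sobolev_norm (s - 1) (time_deriv I \<phi> t))\<^sup>2
             \<le> Cs * ((sobolev_norm s \<phi>0)\<^sup>2 + (sobolev_norm (s - 1) \<phi>1)\<^sup>2)))"
      unfolding Let_def using energy_pos[of s] by (intro exI[of _ "energy_const \<mu> s"]) simp
  qed
qed

end
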